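(* Let $\Lambda$ be a commutative local uniserial ring of length $n\ge 7$ and let $k$ be its radical factor field. Then the category $\mathcal{S}(\Lambda)$ is controlled $k$-wild.
   Context: Uniserial means that the ideals of $\Lambda$ form a chain; the length of $\Lambda$ is its length as a $\Lambda$-module. The radical factor field is $k=\Lambda/\operatorname{rad}\Lambda$. The submodule category $\mathcal{S}(\Lambda)$: objects are pairs $M=(M_0,M_1)$, also written $(M_1\subseteq M_0)$, where $M_0$ is a finitely generated $\Lambda$-module and $M_1$ is a $\Lambda$-submodule of $M_0$; a morphism $f\colon M\to N$ is a $\Lambda$-linear map $f\colon M_0\to N_0$ with $f(M_1)\subseteq N_1$. This is an additive category. For an additive category $\mathcal{A}$ and a class of objects (or a full subcategory) $\mathcal{C}$ of $\mathcal{A}$, let $\operatorname{Hom}(A,A')_{\mathcal{C}}$ denote the set of maps $A\to A'$ which factor through a finite direct sum of objects in $\mathcal{C}$; $\langle\mathcal{C}\rangle$ denotes the ideal of $\mathcal{A}$ generated by the identity morphisms of the objects in $\mathcal{C}$ (so that it consists of these maps). The factor category $\mathcal{A}/\langle\mathcal{C}\rangle$ has the same objects as $\mathcal{A}$ and morphism groups $\operatorname{Hom}_{\mathcal{A}}(A,A')/\operatorname{Hom}(A,A')_{\mathcal{C}}$. An additive category $\mathcal{A}$ is called controlled $k$-wild if there are full subcategories $\mathcal{C}\subseteq\mathcal{B}\subseteq\mathcal{A}$ such that $\mathcal{B}/\langle\mathcal{C}\rangle$ is equivalent to $\operatorname{mod} k\langle X,Y\rangle$, where $k\langle X,Y\rangle$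 is the free $k$-algebra in two generators and $\operatorname{mod} k\langle X,Y\rangle$ is the category of its finite-dimensional modules. *)

theory Defs
  imports "HOL-Algebra.Module" "HOL-Algebra.QuotRing"
begin

section \<open>Additive categories\<close>

text \<open>
  Morphism sets are indexed by their source and target, so a morphism value need not determine
  its source and target. \<open>Hom A X Y\<close> is the abelian group of morphisms
  from \<open>X\<close> to \<open>Y\<close>, written multiplicatively as a HOL-Algebra group: the group
  operation is the addition of morphisms and the unit is the zero morphism.
  \<open>Comp A X Y Z g f\<close> is the composite of \<open>f : X \<rightarrow> Y\<close> and \<open>g : Y \<rightarrow> Z\<close>.
\<close>

record ('o, 'm) category =
  Obj :: "'o set"
  Hom :: "'o \<Rightarrow> 'o \<Rightarrow> 'm monoid"
  Ident :: "'o \<Rightarrow> 'm"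
  Comp :: "'o \<Rightarrow> 'o \<Rightarrow> 'o \<Rightarrow> 'm \<Rightarrow> 'm \<Rightarrow> 'm"

abbreviation Mor :: "('o, 'm) category \<Rightarrow> 'o \<Rightarrow> 'o \<Rightarrow> 'm set" where
  "Mor A X Y \<equiv> carrier (Hom A X Y)"

text \<open>
  \<open>D\<close> is the direct sum of \<open>Z 0, \<dots>, Z (n - 1)\<close>, with injections \<open>\<iota>\<close> and
  projections \<open>\<pi>\<close>. For \<open>n = 0\<close> this says that \<open>D\<close> is a zero object.
\<close>

definition direct_sum :: "('o, 'm) category \<Rightarrow> nat \<Rightarrow> (nat \<Rightarrow> 'o) \<Rightarrow> 'o \<Rightarrow> bool" where
  "direct_sum A n Z D \<longleftrightarrow> D \<in> Obj A \<and>
     (\<exists>\<iota> \<pi>. (\<forall>i<n. \<iota> i \<in> Mor A (Z i) D \<and> \<pi> i \<in> Mor A D (Z i)) \<and>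
        (\<forall>i<n. \<forall>j<n. Comp A (Z i) D (Z j) (\<pi> j) (\<iota> i)
            = (if i = j then Ident A (Z i) else \<one>\<^bsub>Hom A (Z i) (Z j)\<^esub>)) \<and>
        finprod (Hom A D D) (\<lambda>i. Comp A D (Z i) D (\<iota> i) (\<pi> i)) {..<n} = Ident A D)"

locale additive_category =
  fixes A :: "('o, 'm) category"
  assumes Hom_comm_group:
      "\<lbrakk>X \<in> Obj A; Y \<in> Obj A\<rbrakk> \<Longrightarrow> comm_group (Hom A X Y)"
    and Ident_closed: "X \<in> Obj A \<Longrightarrow> Ident A X \<in> Mor A X X"
    and Comp_closed:
      "\<lbrakk>X \<in> Obj A; Y \<in> Obj A; Z \<in> Obj A; f \<in> Mor A X Y; g \<in> Mor A Y Z\<rbrakk>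
        \<Longrightarrow> Comp A X Y Z g f \<in> Mor A X Z"
    and Comp_assoc:
      "\<lbrakk>W \<in> Obj A; X \<in> Obj A; Y \<in> Obj A; Z \<in> Obj A;
        f \<in> Mor A W X; g \<in> Mor A X Y; h \<in> Mor A Y Z\<rbrakk>
        \<Longrightarrow> Comp A W Y Z h (Comp A W X Y g f) = Comp A W X Z (Comp A X Y Z h g) f"
    and Comp_Ident_left:
      "\<lbrakk>X \<in> Obj A; Y \<in> Obj A; f \<in> Mor A X Y\<rbrakk> \<Longrightarrow> Comp A X Y Y (Ident A Y) f = f"
    and Comp_Ident_right:
      "\<lbrakk>X \<in> Obj A; Y \<in> Obj A; f \<in> Mor A X Y\<rbrakk> \<Longrightarrow> Comp A X X Y f (Ident A X) = f"
    and Comp_add_left: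
      "\<lbrakk>X \<in> Obj A; Y \<in> Obj A; Z \<in> Obj A; f \<in> Mor A X Y; g \<in> Mor A Y Z; h \<in> Mor A Y Z\<rbrakk>
        \<Longrightarrow> Comp A X Y Z (g \<otimes>\<^bsub>Hom A Y Z\<^esub> h) f
            = Comp A X Y Z g f \<otimes>\<^bsub>Hom A X Z\<^esub> Comp A X Y Z h f"
    and Comp_add_right:
      "\<lbrakk>X \<in> Obj A; Y \<in> Obj A; Z \<in> Obj A; f \<in> Mor A X Y; g \<in> Mor A X Y; h \<in> Mor A Y Z\<rbrakk>
        \<Longrightarrow> Comp A X Y Z h (f \<otimes>\<^bsub>Hom A X Y\<^esub> g)
            = Comp A X Y Z h f \<otimes>\<^bsub>Hom A X Z\<^esub> Comp A X Y Z h g"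
    and direct_sums_exist:
      "(\<And>i. i < n \<Longrightarrow> F i \<in> Obj A) \<Longrightarrow> \<exists>D. direct_sum A n F D"

definition full_subcategory :: "('o, 'm) category \<Rightarrow> 'o set \<Rightarrow> ('o, 'm) category" where
  "full_subcategory A B = A\<lparr>Obj := B\<rparr>"

text \<open>\<open>Hom_through A C X Y\<close> is \<open>Hom(X, Y)\<^sub>C\<close>; the direct sums are formed in \<open>A\<close>.\<close>

definition Hom_through :: "('o, 'm) category \<Rightarrow> 'o set \<Rightarrow> 'o \<Rightarrow> 'o \<Rightarrow> 'm set" where
  "Hom_through A C X Y =
     {Comp A X D Y g f | n Z D f g. (\<forall>i<n. Z i \<in> C) \<and> direct_sum A n Z D \<and>
        f \<in> Mor A X D \<and> g \<in> Mor A D Y}"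

text \<open>
  The factor category of \<open>A\<close> by the ideal generated by \<open>C\<close>. Its morphisms are cosets; the
  composite of two cosets is the coset of the composite of any representatives.
\<close>

definition factor_category ::
    "('o, 'm) category \<Rightarrow> 'o set \<Rightarrow> ('o, 'm set) category" where
  "factor_category A C =
     \<lparr>Obj = Obj A,
      Hom = (\<lambda>X Y. Hom A X Y Mod Hom_through A C X Y),
      Ident = (\<lambda>X. Hom_through A C X X #>\<^bsub>Hom A X X\<^esub> Ident A X),
      Comp = (\<lambda>X Y Z G F.
        \<Union>g\<in>G. \<Union>f\<in>F. Hom_through A C X Z #>\<^bsub>Hom A X Z\<^esub> Comp A X Y Z g f)\<rparr>"


section \<open>Equivalence of categories\<close>

definition is_functor ::
    "('o, 'm) category \<Rightarrow> ('p, 'l) category \<Rightarrow> ('o \<Rightarrow> 'p) \<Rightarrow> ('o \<Rightarrow> 'o \<Rightarrow> 'm \<Rightarrow> 'l) \<Rightarrow> bool" where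
  "is_functor A B Fo Fm \<longleftrightarrow>
     (\<forall>X\<in>Obj A. Fo X \<in> Obj B) \<and>
     (\<forall>X\<in>Obj A. \<forall>Y\<in>Obj A. \<forall>f\<in>Mor A X Y. Fm X Y f \<in> Mor B (Fo X) (Fo Y)) \<and>
     (\<forall>X\<in>Obj A. Fm X X (Ident A X) = Ident B (Fo X)) \<and>
     (\<forall>X\<in>Obj A. \<forall>Y\<in>Obj A. \<forall>Z\<in>Obj A. \<forall>f\<in>Mor A X Y. \<forall>g\<in>Mor A Y Z.
        Fm X Z (Comp A X Y Z g f) = Comp B (Fo X) (Fo Y) (Fo Z) (Fm Y Z g) (Fm X Y f))"

definition is_iso :: "('o, 'm) category \<Rightarrow> 'o \<Rightarrow> 'o \<Rightarrow> 'm \<Rightarrow> bool" where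
  "is_iso A X Y f \<longleftrightarrow> f \<in> Mor A X Y \<and>
     (\<exists>g\<in>Mor A Y X. Comp A X Y X g f = Ident A X \<and> Comp A Y X Y f g = Ident A Y)"

definition is_natural_iso ::
    "('o, 'm) category \<Rightarrow> ('p, 'l) category \<Rightarrow> ('o \<Rightarrow> 'p) \<Rightarrow> ('o \<Rightarrow> 'o \<Rightarrow> 'm \<Rightarrow> 'l) \<Rightarrow>
      ('o \<Rightarrow> 'p) \<Rightarrow> ('o \<Rightarrow> 'o \<Rightarrow> 'm \<Rightarrow> 'l) \<Rightarrow> ('o \<Rightarrow> 'l) \<Rightarrow> bool" where
  "is_natural_iso A B Fo Fm Go Gm \<eta> \<longleftrightarrow>
     (\<forall>X\<in>Obj A. is_iso B (Fo X) (Go X) (\<eta> X)) \<and>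
     (\<forall>X\<in>Obj A. \<forall>Y\<in>Obj A. \<forall>f\<in>Mor A X Y.
        Comp B (Fo X) (Fo Y) (Go Y) (\<eta> Y) (Fm X Y f)
          = Comp B (Fo X) (Go X) (Go Y) (Gm X Y f) (\<eta> X))"

definition equivalent_categories :: "('o, 'm) category \<Rightarrow> ('p, 'l) category \<Rightarrow> bool" where
  "equivalent_categories A B \<longleftrightarrow>
     (\<exists>Fo Fm Go Gm \<eta> \<epsilon>. is_functor A B Fo Fm \<and> is_functor B A Go Gm \<and>
        is_natural_iso A A (\<lambda>X. X) (\<lambda>X Y f. f)
          (\<lambda>X. Go (Fo X)) (\<lambda>X Y f. Gm (Fo X) (Fo Y) (Fm X Y f)) \<eta> \<and>
        is_natural_iso B B (\<lambda>X. Fo (Go X)) (\<lambda>X Y f. Fm (Go X) (Go Y) (Gm X Y f))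
          (\<lambda>X. X) (\<lambda>X Y f. f) \<epsilon>)"


section \<open>Modules and their homomorphisms\<close>

text \<open>The library's \<^locale>\<open>module\<close> is restricted to commutative rings.\<close>

locale left_module = R?: ring R + M?: abelian_group M
  for R (structure) and M :: "('a, 'b, 'c) module_scheme" (structure) +
  assumes smult_closed:
      "\<lbrakk>a \<in> carrier R; x \<in> carrier M\<rbrakk> \<Longrightarrow> a \<odot>\<^bsub>M\<^esub> x \<in> carrier M"
    and smult_l_distr:
      "\<lbrakk>a \<in> carrier R; b \<in> carrier R; x \<in> carrier M\<rbrakk>
        \<Longrightarrow> (a \<oplus> b) \<odot>\<^bsub>M\<^esub> x = a \<odot>\<^bsub>M\<^esub> x \<oplus>\<^bsub>M\<^esub> b \<odot>\<^bsub>M\<^esub> x"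
    and smult_r_distr:
      "\<lbrakk>a \<in> carrier R; x \<in> carrier M; y \<in> carrier M\<rbrakk>
        \<Longrightarrow> a \<odot>\<^bsub>M\<^esub> (x \<oplus>\<^bsub>M\<^esub> y) = a \<odot>\<^bsub>M\<^esub> x \<oplus>\<^bsub>M\<^esub> a \<odot>\<^bsub>M\<^esub> y"
    and smult_assoc:
      "\<lbrakk>a \<in> carrier R; b \<in> carrier R; x \<in> carrier M\<rbrakk>
        \<Longrightarrow> (a \<otimes> b) \<odot>\<^bsub>M\<^esub> x = a \<odot>\<^bsub>M\<^esub> (b \<odot>\<^bsub>M\<^esub> x)"
    and smult_one: "x \<in> carrier M \<Longrightarrow> \<one> \<odot>\<^bsub>M\<^esub> x = x"

definition fin_gen :: "('a, 'c) ring_scheme \<Rightarrow> ('a, 'b) module \<Rightarrow> bool" where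
  "fin_gen R M \<longleftrightarrow>
     (\<exists>S. finite S \<and> S \<subseteq> carrier M \<and> (\<forall>N. submodule N R M \<longrightarrow> S \<subseteq> N \<longrightarrow> N = carrier M))"

text \<open>Homomorphisms are extensional functions, so that they are determined by their values on the
  carrier.\<close>

definition linear_maps ::
    "('a, 'c) ring_scheme \<Rightarrow> ('a, 'b) module \<Rightarrow> ('a, 'd) module \<Rightarrow> ('b \<Rightarrow> 'd) set" where
  "linear_maps R M N =
     {f \<in> carrier M \<rightarrow>\<^sub>E carrier N.
        (\<forall>x\<in>carrier M. \<forall>y\<in>carrier M. f (x \<oplus>\<^bsub>M\<^esub> y) = f x \<oplus>\<^bsub>N\<^esub> f y) \<and>
        (\<forall>a\<in>carrier R. \<forall>x\<in>carrier M. f (a \<odot>\<^bsub>M\<^esub> x) = a \<odot>\<^bsub>N\<^esub> f x)}"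

definition map_group ::
    "('a, 'b) module \<Rightarrow> ('a, 'd) module \<Rightarrow> ('b \<Rightarrow> 'd) set \<Rightarrow> ('b \<Rightarrow> 'd) monoid" where
  "map_group M N H =
     \<lparr>carrier = H,
      mult = (\<lambda>f g. \<lambda>x\<in>carrier M. f x \<oplus>\<^bsub>N\<^esub> g x),
      one = (\<lambda>x\<in>carrier M. \<zero>\<^bsub>N\<^esub>)\<rparr>"


section \<open>Finite-dimensional modules over the free algebra\<close>

text \<open>
  The free algebra over \<open>K\<close> on a set of generators indexed by the type \<open>'g\<close>: a \<open>K\<close>-linear
  combination of words, i.e. a finitely supported coefficient function on words. Since a word has
  only finitely many factorisations, given by its prefixes, multiplication is a finite sum.
\<close>

definition free_algebra :: "('k, 'c) ring_scheme \<Rightarrow> ('g list \<Rightarrow> 'k) ring" where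
  "free_algebra K =
     \<lparr>carrier = {p. (\<forall>w. p w \<in> carrier K) \<and> finite {w. p w \<noteq> \<zero>\<^bsub>K\<^esub>}},
      mult = (\<lambda>p q w. \<Oplus>\<^bsub>K\<^esub>i\<in>{..length w}. p (take i w) \<otimes>\<^bsub>K\<^esub> q (drop i w)),
      one = (\<lambda>w. if w = [] then \<one>\<^bsub>K\<^esub> else \<zero>\<^bsub>K\<^esub>),
      zero = (\<lambda>w. \<zero>\<^bsub>K\<^esub>),
      add = (\<lambda>p q w. p w \<oplus>\<^bsub>K\<^esub> q w)\<rparr>"

definition free_algebra_const :: "('k, 'c) ring_scheme \<Rightarrow> 'k \<Rightarrow> 'g list \<Rightarrow> 'k" where
  "free_algebra_const K c = (\<lambda>w. if w = [] then c else \<zero>\<^bsub>K\<^esub>)"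

definition underlying_space ::
    "('k, 'c) ring_scheme \<Rightarrow> ('g list \<Rightarrow> 'k, 'v) module \<Rightarrow> ('k, 'v) module" where
  "underlying_space K M =
     \<lparr>carrier = carrier M, mult = mult M, one = one M, zero = zero M, add = add M,
      smult = (\<lambda>c. smult M (free_algebra_const K c))\<rparr>"

text \<open>
  The two generators are indexed by \<open>False\<close> and \<open>True\<close>. A module is finite-dimensional if it
  is finitely generated over the constants.
\<close>

definition fd_free_modules ::
    "('k, 'c) ring_scheme \<Rightarrow> ((bool list \<Rightarrow> 'k, 'v) module, 'v \<Rightarrow> 'v) category" where
  "fd_free_modules K =
     \<lparr>Obj = {M. left_module (free_algebra K) M \<and> fin_gen K (underlying_space K M)},
      Hom = (\<lambda>M N. map_group M N (linear_maps (free_algebra K) M N)),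
      Ident = (\<lambda>M. \<lambda>x\<in>carrier M. x),
      Comp = (\<lambda>L M N g f. compose (carrier L) g f)\<rparr>"

text \<open>
  In HOL, the carriers of the objects of a category must come from one type. Every
  finite-dimensional space over a field with elements in \<open>'k\<close> is isomorphic to some \<open>K\<^sup>m\<close>, whose
  elements can be taken to be sequences \<open>nat \<Rightarrow> 'k\<close> vanishing from \<open>m\<close> on. Hence carriers in
  \<open>nat \<Rightarrow> 'k\<close> represent all isomorphism classes.
\<close>

type_synonym 'k fd_free_module_category =
  "((bool list \<Rightarrow> 'k, nat \<Rightarrow> 'k) module, (nat \<Rightarrow> 'k) \<Rightarrow> (nat \<Rightarrow> 'k)) category"

text \<open>
  For a full subcategory \<open>B\<close> of \<open>A\<close> containing \<open>C\<close>, the factor category of \<open>B\<close> by \<open>C\<close> is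
  the full subcategory of the factor category of \<open>A\<close> given by the objects in \<open>B\<close>.
\<close>

definition controlled_wild :: "('k, 'c) ring_scheme \<Rightarrow> ('o, 'm) category \<Rightarrow> bool" where
  "controlled_wild K A \<longleftrightarrow> additive_category A \<and>
     (\<exists>C B. C \<subseteq> B \<and> B \<subseteq> Obj A \<and>
        equivalent_categories (full_subcategory (factor_category A C) B)
          (fd_free_modules K :: 'k fd_free_module_category))"


section \<open>Uniserial rings and submodule categories\<close>

definition local_ring :: "('a, 'c) ring_scheme \<Rightarrow> bool" where
  "local_ring R \<longleftrightarrow> (\<exists>!I. maximalideal I R)"

definition uniserial :: "('a, 'c) ring_scheme \<Rightarrow> bool" where
  "uniserial R \<longleftrightarrow> (\<forall>I J. ideal I R \<longrightarrow> ideal J R \<longrightarrow> I \<subseteq> J \<or> J \<subseteq> I)"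

text \<open>
  The length is that of a composition series; by the Jordan-Hoelder theorem it does not depend on
  the series.
\<close>

definition has_length :: "('a, 'c) ring_scheme \<Rightarrow> ('a, 'b) module \<Rightarrow> nat \<Rightarrow> bool" where
  "has_length R M n \<longleftrightarrow>
     (\<exists>N. N 0 = {\<zero>\<^bsub>M\<^esub>} \<and> N n = carrier M \<and> (\<forall>i\<le>n. submodule (N i) R M) \<and>
        (\<forall>i<n. N i \<subset> N (Suc i) \<and>
           (\<forall>L. submodule L R M \<longrightarrow> N i \<subseteq> L \<longrightarrow> L \<subseteq> N (Suc i) \<longrightarrow> L = N i \<or> L = N (Suc i))))"

definition regular_module :: "('a, 'c) ring_scheme \<Rightarrow> ('a, 'a) module" where
  "regular_module R =
     \<lparr>carrier = carrier R, mult = mult R, one = one R, zero = zero R, add = add R,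
      smult = mult R\<rparr>"

definition jacobson_radical :: "('a, 'c) ring_scheme \<Rightarrow> 'a set" where
  "jacobson_radical R = carrier R \<inter> \<Inter>{I. maximalideal I R}"

definition radical_factor :: "('a, 'c) ring_scheme \<Rightarrow> 'a set ring" where
  "radical_factor R = R Quot jacobson_radical R"

definition submodule_category ::
    "('a, 'c) ring_scheme \<Rightarrow> (('a, 'v) module \<times> 'v set, 'v \<Rightarrow> 'v) category" where
  "submodule_category R =
     \<lparr>Obj = {(M, U). module R M \<and> fin_gen R M \<and> submodule U R M},
      Hom = (\<lambda>(M, U) (N, V). map_group M N {f \<in> linear_maps R M N. f ` U \<subseteq> V}),
      Ident = (\<lambda>(M, U). \<lambda>x\<in>carrier M. x),
      Comp = (\<lambda>(L, T) (M, U) (N, V) g f. compose (carrier L) g f)\<rparr>"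

text \<open>
  Every finitely generated module is isomorphic to a factor module of some \<open>R\<^sup>m\<close>, whose elements
  are cosets of sequences in \<open>nat \<Rightarrow> 'a\<close> vanishing from \<open>m\<close> on. Hence carriers in
  \<open>(nat \<Rightarrow> 'a) set\<close> represent all isomorphism classes of objects.
\<close>

type_synonym 'a submodule_category =
  "(('a, (nat \<Rightarrow> 'a) set) module \<times> (nat \<Rightarrow> 'a) set set,
    (nat \<Rightarrow> 'a) set \<Rightarrow> (nat \<Rightarrow> 'a) set) category"

end

theory Submission
  imports Defs
begin

text \<open>
  Let \<open>p\<close> generate the radical of \<open>R\<close> and write \<open>P m = R/p\<^sup>m\<close>. A module \<open>V\<close> of dimension \<open>d\<close> over
  \<open>k\<langle>X,Y\<rangle>\<close> is sent to the pair \<open>U \<subseteq> M\<close> with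
  \<open>M = (P 7 \<oplus> P 7 \<oplus> P 5 \<oplus> P 5 \<oplus> P 3 \<oplus> P 2)\<^sup>d\<close> and \<open>U\<close> the set of all \<open>(p\<^sup>2 u, p w, u + w)\<close> with
  \<open>w \<equiv> \<phi> u\<close> modulo \<open>p\<close>, where \<open>\<phi>\<close> is the endomorphism \<open>(s, t) \<mapsto> (t, X s + Y t)\<close> of \<open>V \<oplus> V\<close>.
  A homomorphism between two such modules \<open>M\<close> acts on the multiplicity spaces \<open>V \<oplus> V\<close>, \<open>V \<oplus> V\<close>, \<open>V\<close>, \<open>V\<close> of
  the summands \<open>P 7\<close>, \<open>P 5\<close>, \<open>P 3\<close>, \<open>P 2\<close>. If it respects the submodules, then \<open>U\<close> forces it to act on the
  first, on the second and on the sum of the last two by the same map, which commutes with \<open>\<phi>\<close> and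
  preserves the kernel of the first projection. Such a map is \<open>a \<oplus> a\<close> with \<open>a\<close> linear over \<open>k\<langle>X,Y\<rangle>\<close>,
  and every such \<open>a\<close> lifts. If \<open>a = 0\<close>, then all components of the homomorphism factor through \<open>P 6\<close> and
  \<open>P 4\<close>, which do not contribute to the multiplicity spaces, except for components \<open>P 2 \<rightarrow> P 3\<close> and \<open>P 2 \<rightarrow> P 2\<close>. The
  latter factor through sums of \<open>P 6\<close> and \<open>P 2\<close> with a submodule containing the elements \<open>(p\<^sup>2 u, u)\<close>,
  and this submodule prevents nonzero maps on the multiplicity spaces of \<open>P 2\<close>. The control class
  consists of all objects \<open>Z\<close> such that no composite of two morphisms through \<open>Z\<close> between objects of the form \<open>U \<subseteq> M\<close>
  induces a nonzero \<open>a\<close>.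
\<close>

section \<open>Equivalences and factor categories\<close>

text \<open>The relation between \<open>u\<close> and \<open>w\<close> modulo \<open>p\<close> can
  carry only one endomorphism, whereas two generators must be encoded. Hence the block companion
  form of \<phi> and the flag: a map preserving the kernel of the first projection is a lower
  triangular block matrix, and a lower triangular matrix that intertwines two such companion
  matrices has zero off-diagonal block and two equal diagonal blocks, which intertwine
  \<open>X\<close> and \<open>Y\<close>. The flag is produced by splitting the third block into
  \<open>P 3\<close> and \<open>P 2\<close>: a map from \<open>P 2\<close> to \<open>P 3\<close> is
  never onto, so it cannot contribute to the first component, while a map from \<open>P 3\<close> to
  \<open>P 2\<close> can contribute to the second. The exponents 7, 5, 3 are spaced so that 6 and 4
  fit in between: a map of \<open>P 7\<close> to itself that kills the socle factors through
  \<open>P 6\<close>, one of \<open>P 5\<close> or \<open>P 3\<close> through \<open>P 4\<close>.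
  Between 3 and 2 nothing fits: what goes from \<open>P 2\<close> through \<open>P 4\<close> or
  \<open>P 6\<close> to \<open>P 3\<close> or \<open>P 2\<close> is multiplication by a multiple of
  \<open>p^2\<close>. Defining the control class by its effect makes closure under direct sums a
  consequence of additivity.\<close>

locale category_laws =
  fixes A :: "('o, 'm) category"
  assumes Ident_closed: "X \<in> Obj A \<Longrightarrow> Ident A X \<in> Mor A X X"
    and Comp_closed:
      "\<lbrakk>X \<in> Obj A; Y \<in> Obj A; Z \<in> Obj A; f \<in> Mor A X Y; g \<in> Mor A Y Z\<rbrakk>
        \<Longrightarrow> Comp A X Y Z g f \<in> Mor A X Z"
    and Comp_assoc:
      "\<lbrakk>W \<in> Obj A; X \<in> Obj A; Y \<in> Obj A; Z \<in> Obj A;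
        f \<in> Mor A W X; g \<in> Mor A X Y; h \<in> Mor A Y Z\<rbrakk>
        \<Longrightarrow> Comp A W Y Z h (Comp A W X Y g f) = Comp A W X Z (Comp A X Y Z h g) f"
    and Comp_Ident_left:
      "\<lbrakk>X \<in> Obj A; Y \<in> Obj A; f \<in> Mor A X Y\<rbrakk> \<Longrightarrow> Comp A X Y Y (Ident A Y) f = f"
    and Comp_Ident_right:
      "\<lbrakk>X \<in> Obj A; Y \<in> Obj A; f \<in> Mor A X Y\<rbrakk> \<Longrightarrow> Comp A X X Y f (Ident A X) = f"

text \<open>The existence of direct sums is kept out so that these laws can be stated for submodule
  categories over any carrier type. Direct sums are constructed only for the carrier type of the
  theorem.\<close>

locale preadditive_category = category_laws A for A :: "('o, 'm) category" +
  assumes Hom_comm_group: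
      "\<lbrakk>X \<in> Obj A; Y \<in> Obj A\<rbrakk> \<Longrightarrow> comm_group (Hom A X Y)"
    and Comp_add_left:
      "\<lbrakk>X \<in> Obj A; Y \<in> Obj A; Z \<in> Obj A; f \<in> Mor A X Y; g \<in> Mor A Y Z; h \<in> Mor A Y Z\<rbrakk>
        \<Longrightarrow> Comp A X Y Z (g \<otimes>\<^bsub>Hom A Y Z\<^esub> h) f
            = Comp A X Y Z g f \<otimes>\<^bsub>Hom A X Z\<^esub> Comp A X Y Z h f"
    and Comp_add_right:
      "\<lbrakk>X \<in> Obj A; Y \<in> Obj A; Z \<in> Obj A; f \<in> Mor A X Y; g \<in> Mor A X Y; h \<in> Mor A Y Z\<rbrakk>
        \<Longrightarrow> Comp A X Y Z h (f \<otimes>\<^bsub>Hom A X Y\<^esub> g)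
            = Comp A X Y Z h f \<otimes>\<^bsub>Hom A X Z\<^esub> Comp A X Y Z h g"

lemma additive_category_iff:
  "additive_category A \<longleftrightarrow> preadditive_category A \<and>
     (\<forall>n F. (\<forall>i<n. F i \<in> Obj A) \<longrightarrow> (\<exists>D. direct_sum A n F D))"
  unfolding additive_category_def preadditive_category_def category_laws_def
    preadditive_category_axioms_def
  by (intro iffI conjI; elim conjE; (assumption | blast))

section \<open>Zero morphisms and negatives\<close>

context preadditive_category
begin

lemma Hom_group: "X \<in> Obj A \<Longrightarrow> Y \<in> Obj A \<Longrightarrow> group (Hom A X Y)"
  using Hom_comm_group comm_group.axioms by blast

lemma Hom_monoid: "X \<in> Obj A \<Longrightarrow> Y \<in> Obj A \<Longrightarrow> monoid (Hom A X Y)"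
  using Hom_group group.axioms by blast

lemma zero_closed: "X \<in> Obj A \<Longrightarrow> Y \<in> Obj A \<Longrightarrow> \<one>\<^bsub>Hom A X Y\<^esub> \<in> Mor A X Y"
  by (simp add: Hom_monoid monoid.one_closed)

lemma add_closed:
  "\<lbrakk>X \<in> Obj A; Y \<in> Obj A; f \<in> Mor A X Y; g \<in> Mor A X Y\<rbrakk> \<Longrightarrow> f \<otimes>\<^bsub>Hom A X Y\<^esub> g \<in> Mor A X Y"
  by (simp add: Hom_monoid monoid.m_closed)

lemma Comp_zero_left:
  assumes "X \<in> Obj A" "Y \<in> Obj A" "Z \<in> Obj A" "f \<in> Mor A X Y"
  shows "Comp A X Y Z \<one>\<^bsub>Hom A Y Z\<^esub> f = \<one>\<^bsub>Hom A X Z\<^esub>"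
proof -
  have "Comp A X Y Z (\<one>\<^bsub>Hom A Y Z\<^esub> \<otimes>\<^bsub>Hom A Y Z\<^esub> \<one>\<^bsub>Hom A Y Z\<^esub>) f
      = Comp A X Y Z \<one>\<^bsub>Hom A Y Z\<^esub> f \<otimes>\<^bsub>Hom A X Z\<^esub> Comp A X Y Z \<one>\<^bsub>Hom A Y Z\<^esub> f"
    using assms by (intro Comp_add_left) (auto intro: zero_closed)
  then show ?thesis
    using assms Hom_group[of X Z] Hom_monoid[of Y Z]
    by (simp add: monoid.l_one monoid.one_closed)
      (metis Comp_closed group.r_cancel_one' zero_closed)
qed

lemma Comp_zero_right:
  assumes "X \<in> Obj A" "Y \<in> Obj A" "Z \<in> Obj A" "g \<in> Mor A Y Z"
  shows "Comp A X Y Z g \<one>\<^bsub>Hom A X Y\<^esub> = \<one>\<^bsub>Hom A X Z\<^esub>"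
proof -
  have "Comp A X Y Z g (\<one>\<^bsub>Hom A X Y\<^esub> \<otimes>\<^bsub>Hom A X Y\<^esub> \<one>\<^bsub>Hom A X Y\<^esub>)
      = Comp A X Y Z g \<one>\<^bsub>Hom A X Y\<^esub> \<otimes>\<^bsub>Hom A X Z\<^esub> Comp A X Y Z g \<one>\<^bsub>Hom A X Y\<^esub>"
    using assms by (intro Comp_add_right) (auto intro: zero_closed)
  then show ?thesis
    using assms Hom_group[of X Z] Hom_monoid[of X Y]
    by (simp add: monoid.l_one monoid.one_closed)
      (metis Comp_closed group.r_cancel_one' zero_closed)
qed

lemma Comp_minus_left:
  assumes "X \<in> Obj A" "Y \<in> Obj A" "Z \<in> Obj A" "f \<in> Mor A X Y" "g \<in> Mor A Y Z"
  shows "Comp A X Y Z (inv\<^bsub>Hom A Y Z\<^esub> g) f = inv\<^bsub>Hom A X Z\<^esub> Comp A X Y Z g f"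
proof -
  interpret YZ: comm_group "Hom A Y Z" using assms Hom_comm_group by blast
  interpret XZ: comm_group "Hom A X Z" using assms Hom_comm_group by blast
  have "Comp A X Y Z (inv\<^bsub>Hom A Y Z\<^esub> g) f \<otimes>\<^bsub>Hom A X Z\<^esub> Comp A X Y Z g f = \<one>\<^bsub>Hom A X Z\<^esub>"
    using assms by (simp add: Comp_add_left[symmetric] YZ.l_inv Comp_zero_left)
  then show ?thesis
    using assms by (simp add: XZ.inv_equality Comp_closed)
qed

end

text \<open>A quasi-inverse is built by choice: every object of \<open>Q\<close> gets an isomorphic
  object in the image of \<open>Go\<close>, and morphisms are conjugated by the chosen isomorphisms
  and pulled back along the bijections \<open>Gm\<close>. The functor runs into \<open>Q\<close>
  because in the application \<open>Q\<close> is the factor category, and fibres of a map out of its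
  morphism groups provide it.\<close>

lemma equivalent_categories_if_fully_faithful:
  assumes P: "category_laws P" and Q: "category_laws Q" and F: "is_functor P Q Go Gm"
    and bij: "\<And>V W. V \<in> Obj P \<Longrightarrow> W \<in> Obj P
      \<Longrightarrow> bij_betw (Gm V W) (Mor P V W) (Mor Q (Go V) (Go W))"
    and ess: "\<And>X. X \<in> Obj Q \<Longrightarrow> \<exists>V\<in>Obj P. \<exists>e. is_iso Q X (Go V) e"
  shows "equivalent_categories Q P"
proof -
  interpret P: category_laws P by fact
  interpret Q: category_laws Q by fact
  have Go: "Go V \<in> Obj Q" if "V \<in> Obj P" for V using F that by (auto simp: is_functor_def)
  have Gm: "Gm V W f \<in> Mor Q (Go V) (Go W)" if "V \<in> Obj P" "W \<in> Obj P" "f \<in> Mor P V W" for V W f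
    using F that by (auto simp: is_functor_def)
  have Gi: "Gm V V (Ident P V) = Ident Q (Go V)" if "V \<in> Obj P" for V
    using F that by (auto simp: is_functor_def)
  have Gc: "Gm V Z (Comp P V W Z g f) = Comp Q (Go V) (Go W) (Go Z) (Gm W Z g) (Gm V W f)"
    if "V \<in> Obj P" "W \<in> Obj P" "Z \<in> Obj P" "f \<in> Mor P V W" "g \<in> Mor P W Z" for V W Z f g
    using F that by (auto simp: is_functor_def)
  define H where "H = (\<lambda>V W. inv_into (Mor P V W) (Gm V W))"
  have H: "H V W g \<in> Mor P V W" "Gm V W (H V W g) = g"
    if "V \<in> Obj P" "W \<in> Obj P" "g \<in> Mor Q (Go V) (Go W)" for V W g
    using bij[OF that(1,2)] that(3) unfolding H_def bij_betw_def
    by (auto simp: inv_into_into f_inv_into_f)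
  have inj: "f = g" if "V \<in> Obj P" "W \<in> Obj P" "f \<in> Mor P V W" "g \<in> Mor P V W"
    "Gm V W f = Gm V W g" for V W f g
    using bij[OF that(1,2)] that(3-5) by (auto simp: bij_betw_def inj_on_def)
  obtain Fo where Fo: "\<And>X. X \<in> Obj Q \<Longrightarrow> Fo X \<in> Obj P \<and> (\<exists>e. is_iso Q X (Go (Fo X)) e)"
    using ess by metis
  then obtain e where e': "\<And>X. X \<in> Obj Q \<Longrightarrow> is_iso Q X (Go (Fo X)) (e X)" by metis
  have FoP[simp]: "Fo X \<in> Obj P" if "X \<in> Obj Q" for X using Fo that by blast
  have e: "e X \<in> Mor Q X (Go (Fo X))" if "X \<in> Obj Q" for X
    using e'[OF that] by (auto simp: is_iso_def)
  have "\<exists>d. \<forall>X\<in>Obj Q. d X \<in> Mor Q (Go (Fo X)) X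
    \<and> Comp Q X (Go (Fo X)) X (d X) (e X) = Ident Q X
    \<and> Comp Q (Go (Fo X)) X (Go (Fo X)) (e X) (d X) = Ident Q (Go (Fo X))"
    by (rule bchoice) (use e' in \<open>auto simp: is_iso_def\<close>)
  then obtain d where d: "\<And>X. X \<in> Obj Q \<Longrightarrow> d X \<in> Mor Q (Go (Fo X)) X"
    and de: "\<And>X. X \<in> Obj Q \<Longrightarrow> Comp Q X (Go (Fo X)) X (d X) (e X) = Ident Q X"
    and ed: "\<And>X. X \<in> Obj Q \<Longrightarrow> Comp Q (Go (Fo X)) X (Go (Fo X)) (e X) (d X) = Ident Q (Go (Fo X))"
    by blast
  note cl = Go Gm H e d FoP Q.Comp_closed P.Comp_closed Q.Ident_closed P.Ident_closed
  \<comment> \<open>Conjugation moves \<open>f\<close> to a morphism between objects in the image of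
    \<open>Go\<close>, where \<open>H\<close> can pull it back to \<open>P\<close>.\<close>
  define K where "K X Y f = Comp Q (Go (Fo X)) Y (Go (Fo Y)) (e Y) (Comp Q (Go (Fo X)) X Y f (d X))" for X Y f
  have K: "K X Y f \<in> Mor Q (Go (Fo X)) (Go (Fo Y))"
    if "X \<in> Obj Q" "Y \<in> Obj Q" "f \<in> Mor Q X Y" for X Y f
    unfolding K_def using that by (auto intro!: cl)
  have Ke: "Comp Q X (Go (Fo X)) (Go (Fo Y)) (K X Y f) (e X) = Comp Q X Y (Go (Fo Y)) (e Y) f"
    if "X \<in> Obj Q" "Y \<in> Obj Q" "f \<in> Mor Q X Y" for X Y f
  proof -
    have "Comp Q X (Go (Fo X)) (Go (Fo Y)) (K X Y f) (e X)
       = Comp Q X Y (Go (Fo Y)) (e Y) (Comp Q X (Go (Fo X)) Y (Comp Q (Go (Fo X)) X Y f (d X)) (e X))"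
      unfolding K_def using that by (intro Q.Comp_assoc[symmetric]) (auto intro!: cl)
    also have "Comp Q X (Go (Fo X)) Y (Comp Q (Go (Fo X)) X Y f (d X)) (e X)
        = Comp Q X X Y f (Comp Q X (Go (Fo X)) X (d X) (e X))"
      using that by (intro Q.Comp_assoc[symmetric]) (auto intro!: cl)
    also have "\<dots> = f" using that by (simp add: de Q.Comp_Ident_right)
    finally show ?thesis .
  qed
  have dK: "Comp Q (Go (Fo X)) (Go (Fo Y)) Y (d Y) (K X Y f) = Comp Q (Go (Fo X)) X Y f (d X)"
    if "X \<in> Obj Q" "Y \<in> Obj Q" "f \<in> Mor Q X Y" for X Y f
  proof -
    have "Comp Q (Go (Fo X)) (Go (Fo Y)) Y (d Y) (K X Y f)
      = Comp Q (Go (Fo X)) Y Y (Comp Q Y (Go (Fo Y)) Y (d Y) (e Y)) (Comp Q (Go (Fo X)) X Y f (d X))"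
      unfolding K_def using that by (intro Q.Comp_assoc) (auto intro!: cl)
    also have "\<dots> = Comp Q (Go (Fo X)) X Y f (d X)"
      using that by (simp add: de) (intro Q.Comp_Ident_left; auto intro!: cl)
    finally show ?thesis .
  qed
  have KK: "K X Z (Comp Q X Y Z g f) = Comp Q (Go (Fo X)) (Go (Fo Y)) (Go (Fo Z)) (K Y Z g) (K X Y f)"
    if "X \<in> Obj Q" "Y \<in> Obj Q" "Z \<in> Obj Q" "f \<in> Mor Q X Y" "g \<in> Mor Q Y Z" for X Y Z f g
  proof -
    have "Comp Q (Go (Fo X)) (Go (Fo Y)) (Go (Fo Z)) (K Y Z g) (K X Y f)
      = Comp Q (Go (Fo X)) Z (Go (Fo Z)) (e Z)
          (Comp Q (Go (Fo X)) (Go (Fo Y)) Z (Comp Q (Go (Fo Y)) Y Z g (d Y)) (K X Y f))"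
      unfolding K_def[of Y Z] using that K
      by (intro Q.Comp_assoc[symmetric]) (auto intro!: cl)
    also have "Comp Q (Go (Fo X)) (Go (Fo Y)) Z (Comp Q (Go (Fo Y)) Y Z g (d Y)) (K X Y f)
       = Comp Q (Go (Fo X)) Y Z g (Comp Q (Go (Fo X)) (Go (Fo Y)) Y (d Y) (K X Y f))"
      using that K by (intro Q.Comp_assoc[symmetric]) (auto intro!: cl)
    also have "\<dots> = Comp Q (Go (Fo X)) Y Z g (Comp Q (Go (Fo X)) X Y f (d X))"
      using that by (simp add: dK)
    also have "\<dots> = Comp Q (Go (Fo X)) X Z (Comp Q X Y Z g f) (d X)"
      using that by (intro Q.Comp_assoc) (auto intro!: cl)
    finally show ?thesis by (simp add: K_def)
  qed
  have Ki: "K X X (Ident Q X) = Ident Q (Go (Fo X))" if "X \<in> Obj Q" for X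
    unfolding K_def using that by (simp add: Q.Comp_Ident_left cl ed)
  define Fm where "Fm = (\<lambda>X Y f. H (Fo X) (Fo Y) (K X Y f))"
  have Fm: "Fm X Y f \<in> Mor P (Fo X) (Fo Y)" "Gm (Fo X) (Fo Y) (Fm X Y f) = K X Y f"
    if "X \<in> Obj Q" "Y \<in> Obj Q" "f \<in> Mor Q X Y" for X Y f
    unfolding Fm_def using that by (auto intro!: H K)
  have isF: "is_functor Q P Fo Fm"
    unfolding is_functor_def
  proof (intro conjI ballI)
    fix X assume X: "X \<in> Obj Q"
    then show "Fo X \<in> Obj P" by simp
    show "Fm X X (Ident Q X) = Ident P (Fo X)"
      by (rule inj) (use X in \<open>auto intro!: Fm cl simp: Fm Ki Gi cl\<close>)
  next
    fix X Y f assume "X \<in> Obj Q" "Y \<in> Obj Q" "f \<in> Mor Q X Y"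
    then show "Fm X Y f \<in> Mor P (Fo X) (Fo Y)" by (rule Fm)
  next
    fix X Y Z f g assume *: "X \<in> Obj Q" "Y \<in> Obj Q" "Z \<in> Obj Q" "f \<in> Mor Q X Y" "g \<in> Mor Q Y Z"
    show "Fm X Z (Comp Q X Y Z g f) = Comp P (Fo X) (Fo Y) (Fo Z) (Fm Y Z g) (Fm X Y f)"
      by (rule inj[of "Fo X" "Fo Z"]) (use * in \<open>auto intro!: Fm cl simp: Fm KK Gc cl\<close>)
  qed
  \<comment> \<open>By fullness the inverse \<open>d (Go V)\<close> of the chosen isomorphism comes
    from a morphism of \<open>P\<close>; naturality then reduces to \<open>dK\<close>.\<close>
  define \<epsilon> where "\<epsilon> = (\<lambda>V. H (Fo (Go V)) V (d (Go V)))"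
  have \<epsilon>: "\<epsilon> V \<in> Mor P (Fo (Go V)) V" "Gm (Fo (Go V)) V (\<epsilon> V) = d (Go V)"
    if "V \<in> Obj P" for V
    unfolding \<epsilon>_def using that by (auto intro!: cl)
  have "is_natural_iso Q Q (\<lambda>X. X) (\<lambda>X Y f. f) (\<lambda>X. Go (Fo X)) (\<lambda>X Y f. Gm (Fo X) (Fo Y) (Fm X Y f)) e"
    unfolding is_natural_iso_def using e' Ke Fm by auto
  moreover have "is_natural_iso P P (\<lambda>V. Fo (Go V)) (\<lambda>V W f. Fm (Go V) (Go W) (Gm V W f)) (\<lambda>V. V) (\<lambda>V W f. f) \<epsilon>"
    unfolding is_natural_iso_def
  proof (intro conjI ballI)
    fix V assume V: "V \<in> Obj P"
    define g where "g = H V (Fo (Go V)) (e (Go V))"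
    have g: "g \<in> Mor P V (Fo (Go V))" "Gm V (Fo (Go V)) g = e (Go V)"
      unfolding g_def using V by (auto intro!: cl)
    have "Comp P (Fo (Go V)) V (Fo (Go V)) g (\<epsilon> V) = Ident P (Fo (Go V))"
      by (rule inj[of "Fo (Go V)" "Fo (Go V)"]) (use V g \<epsilon> in \<open>auto intro!: cl simp: cl Gc ed Gi\<close>)
    moreover have "Comp P V (Fo (Go V)) V (\<epsilon> V) g = Ident P V"
      by (rule inj[of V V]) (use V g \<epsilon> in \<open>auto intro!: cl simp: cl Gc de Gi\<close>)
    ultimately show "is_iso P (Fo (Go V)) V (\<epsilon> V)"
      unfolding is_iso_def using g \<epsilon> V by blast
  next
    fix V W f assume *: "V \<in> Obj P" "W \<in> Obj P" "f \<in> Mor P V W"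
    note [simp] = Fm[OF Go Go Gm, OF *(1,2) *] \<epsilon>(2)[OF *(1)] \<epsilon>(2)[OF *(2)]
    show "Comp P (Fo (Go V)) (Fo (Go W)) W (\<epsilon> W) (Fm (Go V) (Go W) (Gm V W f)) =
       Comp P (Fo (Go V)) V W f (\<epsilon> V)"
      by (rule inj[of "Fo (Go V)" W])
        (use * \<epsilon> Fm[OF Go Go Gm, OF *(1,2) *] in \<open>auto intro!: cl simp: cl Gc dK\<close>)
  qed
  ultimately show ?thesis
    unfolding equivalent_categories_def using isF F by blast
qed

text \<open>Closure under finite direct sums, the empty one included, replaces factoring through a
  direct sum of members of \<open>C\<close> by factoring through a single member.\<close>

locale sum_closed_class = preadditive_category A for A :: "('o, 'm) category" +
  fixes C :: "'o set"
  assumes direct_sums_exist: "(\<And>i. i < n \<Longrightarrow> F i \<in> Obj A) \<Longrightarrow> \<exists>D. direct_sum A n F D"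
    and C_subset: "C \<subseteq> Obj A"
    and C_direct_sum: "(\<And>i. i < n \<Longrightarrow> Z i \<in> C) \<Longrightarrow> direct_sum A n Z D \<Longrightarrow> D \<in> C"
begin

section \<open>The ideal generated by a class closed under direct sums\<close>

lemma C_Obj: "Z \<in> C \<Longrightarrow> Z \<in> Obj A"
  using C_subset by blast

lemma direct_sum_single:
  assumes "Z \<in> Obj A"
  shows "direct_sum A (Suc 0) (\<lambda>_. Z) Z"
proof -
  interpret ZZ: comm_group "Hom A Z Z" using assms Hom_comm_group by blast
  show ?thesis
    unfolding direct_sum_def using assms
    by (intro conjI exI[of _ "\<lambda>_. Ident A Z"])
      (auto simp: Ident_closed Comp_Ident_left lessThan_Suc)
qed

lemma Hom_throughI:
  assumes "X \<in> Obj A" "Y \<in> Obj A" "Z \<in> C" "f \<in> Mor A X Z" "g \<in> Mor A Z Y"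
  shows "Comp A X Z Y g f \<in> Hom_through A C X Y"
  unfolding Hom_through_def mem_Collect_eq
  using assms direct_sum_single[OF C_Obj[of Z]]
  by (intro exI[of _ "Suc 0"] exI[of _ "\<lambda>_. Z"] exI[of _ Z] exI[of _ f] exI[of _ g]) auto

lemma Hom_throughE:
  assumes "h \<in> Hom_through A C X Y"
  obtains Z f g where "Z \<in> C" "f \<in> Mor A X Z" "g \<in> Mor A Z Y" "h = Comp A X Z Y g f"
  using assms C_direct_sum unfolding Hom_through_def by blast

lemma Hom_through_closed:
  assumes "X \<in> Obj A" "Y \<in> Obj A" "h \<in> Hom_through A C X Y"
  shows "h \<in> Mor A X Y"
  using assms by (auto elim!: Hom_throughE intro!: Comp_closed C_Obj)

text \<open>With \<open>D\<close> a direct sum of \<open>Z\<close> and \<open>Z'\<close>, compose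
  the column with entries \<open>f\<close>, \<open>f'\<close> with the row with entries
  \<open>g\<close>, \<open>g'\<close>. The four products are \<open>h\<close>, \<open>h'\<close> and
  two cross terms, which vanish because a projection after the other injection is zero.\<close>

lemma Hom_through_add:
  assumes XY: "X \<in> Obj A" "Y \<in> Obj A" and h: "h \<in> Hom_through A C X Y" "h' \<in> Hom_through A C X Y"
  shows "h \<otimes>\<^bsub>Hom A X Y\<^esub> h' \<in> Hom_through A C X Y"
proof -
  obtain Z f g where Z: "Z \<in> C" "f \<in> Mor A X Z" "g \<in> Mor A Z Y" "h = Comp A X Z Y g f"
    using h(1) by (rule Hom_throughE)
  obtain Z' f' g' where Z': "Z' \<in> C" "f' \<in> Mor A X Z'" "g' \<in> Mor A Z' Y" "h' = Comp A X Z' Y g' f'"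
    using h(2) by (rule Hom_throughE)
  note O = XY C_Obj[OF Z(1)] C_Obj[OF Z'(1)]
  define F where "F i = (if i = (0::nat) then Z else Z')" for i
  have F[simp]: "F 0 = Z" "F (Suc 0) = Z'" by (auto simp: F_def)
  have "F i \<in> Obj A" for i using O by (simp add: F_def)
  then obtain D where D: "direct_sum A 2 F D" using direct_sums_exist[of 2 F] by blast
  have DC: "D \<in> C" by (rule C_direct_sum[OF _ D]) (use Z Z' in \<open>auto simp: F_def\<close>)
  note O = O C_Obj[OF DC]
  obtain \<iota> \<pi> where i: "\<forall>i<2. \<iota> i \<in> Mor A (F i) D \<and> \<pi> i \<in> Mor A D (F i)"
    and ip: "\<forall>i<2. \<forall>j<2. Comp A (F i) D (F j) (\<pi> j) (\<iota> i)
            = (if i = j then Ident A (F i) else \<one>\<^bsub>Hom A (F i) (F j)\<^esub>)"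
    using D unfolding direct_sum_def by blast
  have i: "\<iota> 0 \<in> Mor A Z D" "\<iota> (Suc 0) \<in> Mor A Z' D" "\<pi> 0 \<in> Mor A D Z" "\<pi> (Suc 0) \<in> Mor A D Z'"
    using i by (auto simp: numeral_2_eq_2 All_less_Suc)
  have ip: "Comp A Z D Z (\<pi> 0) (\<iota> 0) = Ident A Z" "Comp A Z' D Z' (\<pi> (Suc 0)) (\<iota> (Suc 0)) = Ident A Z'"
    "Comp A Z D Z' (\<pi> (Suc 0)) (\<iota> 0) = \<one>\<^bsub>Hom A Z Z'\<^esub>" "Comp A Z' D Z (\<pi> 0) (\<iota> (Suc 0)) = \<one>\<^bsub>Hom A Z' Z\<^esub>"
    using ip by (auto simp: numeral_2_eq_2 All_less_Suc)
  define a where "a = Comp A X Z D (\<iota> 0) f"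
  define a' where "a' = Comp A X Z' D (\<iota> (Suc 0)) f'"
  define b where "b = Comp A D Z Y g (\<pi> 0)"
  define b' where "b' = Comp A D Z' Y g' (\<pi> (Suc 0))"
  note cl = O i Z(2,3) Z'(2,3)
  have ab: "a \<in> Mor A X D" "a' \<in> Mor A X D" "b \<in> Mor A D Y" "b' \<in> Mor A D Y"
    unfolding a_def a'_def b_def b'_def by (intro Comp_closed cl)+
  have four: "Comp A X D Y (Comp A D U Y p q) (Comp A X W D r s)
      = Comp A X U Y p (Comp A X W U (Comp A W D U q r) s)"
    if "U \<in> Obj A" "W \<in> Obj A" "p \<in> Mor A U Y" "q \<in> Mor A D U" "r \<in> Mor A W D" "s \<in> Mor A X W" for U W p q r s
    using that O by (simp add: Comp_assoc Comp_closed)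
  have "Comp A X D Y b a = h" "Comp A X D Y b' a' = h'"
       "Comp A X D Y b a' = \<one>\<^bsub>Hom A X Y\<^esub>" "Comp A X D Y b' a = \<one>\<^bsub>Hom A X Y\<^esub>"
    unfolding a_def a'_def b_def b'_def using cl Z Z'
    by (simp_all add: four ip Comp_Ident_left Comp_zero_left Comp_zero_right)
  moreover interpret XY: comm_group "Hom A X Y" using XY Hom_comm_group by blast
  have "h \<in> Mor A X Y" "h' \<in> Mor A X Y" using h XY Hom_through_closed by auto
  ultimately have "Comp A X D Y (b \<otimes>\<^bsub>Hom A D Y\<^esub> b') (a \<otimes>\<^bsub>Hom A X D\<^esub> a') = h \<otimes>\<^bsub>Hom A X Y\<^esub> h'"
    using O ab by (simp add: Comp_add_left Comp_add_right add_closed)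
  moreover have "Comp A X D Y (b \<otimes>\<^bsub>Hom A D Y\<^esub> b') (a \<otimes>\<^bsub>Hom A X D\<^esub> a') \<in> Hom_through A C X Y"
    using O ab DC by (intro Hom_throughI add_closed) auto
  ultimately show ?thesis by simp
qed

text \<open>The direct sum of the empty family lies in \<open>C\<close>, so there is always an
  object of \<open>C\<close> through which the zero morphism can pass.\<close>

lemma Hom_through_zero:
  assumes "X \<in> Obj A" "Y \<in> Obj A"
  shows "\<one>\<^bsub>Hom A X Y\<^esub> \<in> Hom_through A C X Y"
proof -
  obtain D where D: "direct_sum A 0 undefined D" using direct_sums_exist[of 0] by blast
  then have DC: "D \<in> C" using C_direct_sum[of 0] by blast
  have "Comp A X D Y \<one>\<^bsub>Hom A D Y\<^esub> \<one>\<^bsub>Hom A X D\<^esub> \<in> Hom_through A C X Y"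
    using assms DC C_Obj by (intro Hom_throughI zero_closed) auto
  then show ?thesis using assms DC C_Obj by (simp add: Comp_zero_left zero_closed)
qed

lemma Hom_through_subgroup:
  assumes "X \<in> Obj A" "Y \<in> Obj A"
  shows "subgroup (Hom_through A C X Y) (Hom A X Y)"
proof (rule group.subgroupI)
  show "group (Hom A X Y)" using assms Hom_group by blast
  show "inv\<^bsub>Hom A X Y\<^esub> h \<in> Hom_through A C X Y" if "h \<in> Hom_through A C X Y" for h
  proof -
    obtain Z f g where Z: "Z \<in> C" "f \<in> Mor A X Z" "g \<in> Mor A Z Y" "h = Comp A X Z Y g f"
      using \<open>h \<in> _\<close> by (rule Hom_throughE)
    have "Comp A X Z Y (inv\<^bsub>Hom A Z Y\<^esub> g) f \<in> Hom_through A C X Y"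
      using assms Z C_Obj Hom_group by (intro Hom_throughI group.inv_closed) auto
    then show ?thesis using assms Z C_Obj by (simp add: Comp_minus_left)
  qed
  show "Hom_through A C X Y \<noteq> {}" using Hom_through_zero[OF assms] by blast
qed (use assms Hom_through_closed Hom_through_add in auto)

lemma Comp_Hom_through_left:
  assumes "X \<in> Obj A" "Y \<in> Obj A" "W \<in> Obj A" "h \<in> Hom_through A C X Y" "k \<in> Mor A Y W"
  shows "Comp A X Y W k h \<in> Hom_through A C X W"
  using assms(4)
proof (rule Hom_throughE)
  fix Z f g assume Z: "Z \<in> C" "f \<in> Mor A X Z" "g \<in> Mor A Z Y" "h = Comp A X Z Y g f"
  have "Comp A X Z W (Comp A Z Y W k g) f \<in> Hom_through A C X W"
    using assms Z C_Obj by (intro Hom_throughI Comp_closed) auto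
  then show ?thesis using assms Z C_Obj by (simp add: Comp_assoc)
qed

lemma Comp_Hom_through_right:
  assumes "X \<in> Obj A" "Y \<in> Obj A" "W \<in> Obj A" "h \<in> Hom_through A C Y W" "k \<in> Mor A X Y"
  shows "Comp A X Y W h k \<in> Hom_through A C X W"
  using assms(4)
proof (rule Hom_throughE)
  fix Z f g assume Z: "Z \<in> C" "f \<in> Mor A Y Z" "g \<in> Mor A Z W" "h = Comp A Y Z W g f"
  have "Comp A X Z W g (Comp A X Y Z f k) \<in> Hom_through A C X W"
    using assms Z C_Obj by (intro Hom_throughI Comp_closed) auto
  then show ?thesis using assms Z C_Obj by (simp add: Comp_assoc)
qed

section \<open>Cosets and their composition\<close>

abbreviation coset :: "'o \<Rightarrow> 'o \<Rightarrow> 'm \<Rightarrow> 'm set" where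
  "coset X Y f \<equiv> Hom_through A C X Y #>\<^bsub>Hom A X Y\<^esub> f"

lemma coset_eqI:
  assumes "X \<in> Obj A" "Y \<in> Obj A" "f \<in> Mor A X Y" "g \<in> coset X Y f"
  shows "coset X Y g = coset X Y f"
  by (rule group.repr_independence[OF Hom_group[OF assms(1,2)] assms(4,3)
        Hom_through_subgroup[OF assms(1,2)], symmetric])

lemma coset_self:
  assumes "X \<in> Obj A" "Y \<in> Obj A" "f \<in> Mor A X Y"
  shows "f \<in> coset X Y f"
  by (rule group.rcos_self[OF Hom_group[OF assms(1,2)] assms(3) Hom_through_subgroup[OF assms(1,2)]])

lemma coset_subset:
  assumes "X \<in> Obj A" "Y \<in> Obj A" "f \<in> Mor A X Y"
  shows "coset X Y f \<subseteq> Mor A X Y"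
  using assms Hom_through_closed by (auto simp: r_coset_def intro!: add_closed)

lemma Mor_factor_category: "Mor (factor_category A C) X Y = coset X Y ` Mor A X Y"
  by (auto simp: factor_category_def FactGroup_def RCOSETS_def)

text \<open>Changing the representatives by \<open>u\<close> and \<open>v\<close> changes the
  composite by \<open>u v + g v + u f\<close>, which lies in the ideal. The union that defines
  composition therefore runs over equal cosets, and over a nonempty index set because a coset
  contains its representative.\<close>

lemma Comp_factor_category:
  assumes XYZ: "X \<in> Obj A" "Y \<in> Obj A" "Z \<in> Obj A" and f: "f \<in> Mor A X Y" and g: "g \<in> Mor A Y Z"
  shows "Comp (factor_category A C) X Y Z (coset Y Z g) (coset X Y f) = coset X Z (Comp A X Y Z g f)"
proof -
  have "coset X Z (Comp A X Y Z g' f') = coset X Z (Comp A X Y Z g f)"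
    if g': "g' \<in> coset Y Z g" and f': "f' \<in> coset X Y f" for f' g'
  proof (rule coset_eqI)
    obtain u where u: "u \<in> Hom_through A C Y Z" "g' = u \<otimes>\<^bsub>Hom A Y Z\<^esub> g"
      using g' by (auto simp: r_coset_def)
    obtain v where v: "v \<in> Hom_through A C X Y" "f' = v \<otimes>\<^bsub>Hom A X Y\<^esub> f"
      using f' by (auto simp: r_coset_def)
    have uv: "u \<in> Mor A Y Z" "v \<in> Mor A X Y" using u v XYZ Hom_through_closed by auto
    interpret XZ: comm_group "Hom A X Z" using XYZ Hom_comm_group by blast
    have mem: "Comp A X Y Z u v \<in> Hom_through A C X Z" "Comp A X Y Z g v \<in> Hom_through A C X Z"
      "Comp A X Y Z u f \<in> Hom_through A C X Z"
      using u v uv XYZ f g by (auto intro: Comp_Hom_through_left Comp_Hom_through_right)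
    have "Comp A X Y Z g' f' = (Comp A X Y Z u v \<otimes>\<^bsub>Hom A X Z\<^esub> Comp A X Y Z g v
        \<otimes>\<^bsub>Hom A X Z\<^esub> Comp A X Y Z u f) \<otimes>\<^bsub>Hom A X Z\<^esub> Comp A X Y Z g f"
      using XYZ f g uv
      by (simp add: u v Comp_add_left Comp_add_right add_closed Comp_closed XZ.m_assoc)
    then show "Comp A X Y Z g' f' \<in> coset X Z (Comp A X Y Z g f)"
      using mem XYZ by (auto simp: r_coset_def intro!: Hom_through_add)
  qed (use XYZ f g Comp_closed in auto)
  then have "Comp (factor_category A C) X Y Z (coset Y Z g) (coset X Y f)
      = (\<Union>g'\<in>coset Y Z g. \<Union>f'\<in>coset X Y f. coset X Z (Comp A X Y Z g f))"
    unfolding factor_category_def category.simps by (intro SUP_cong refl)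
  moreover have "coset Y Z g \<noteq> {}" "coset X Y f \<noteq> {}"
    using coset_self[OF XYZ(1,2) f] coset_self[OF XYZ(2,3) g] by (metis empty_iff)+
  ultimately show ?thesis by simp
qed

lemma factor_category_laws:
  assumes B: "B \<subseteq> Obj A"
  shows "category_laws (full_subcategory (factor_category A C) B)"
proof
  let ?Q = "full_subcategory (factor_category A C) B"
  have sel[simp]: "Obj ?Q = B" "Hom ?Q = Hom (factor_category A C)"
    "Comp ?Q = Comp (factor_category A C)" "Ident ?Q = (\<lambda>X. coset X X (Ident A X))"
    by (simp_all add: full_subcategory_def) (simp add: factor_category_def)
  note [simp] = Mor_factor_category Comp_factor_category Comp_closed Ident_closed
    Comp_Ident_left Comp_Ident_right Comp_assoc
  have [simp]: "X \<in> Obj A" if "X \<in> B" for X using B that by auto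
  {
    fix X assume "X \<in> Obj ?Q"
    then show "Ident ?Q X \<in> Mor ?Q X X" by auto
  next
    fix X Y Z f g assume "X \<in> Obj ?Q" "Y \<in> Obj ?Q" "Z \<in> Obj ?Q" "f \<in> Mor ?Q X Y" "g \<in> Mor ?Q Y Z"
    then show "Comp ?Q X Y Z g f \<in> Mor ?Q X Z" by auto
  next
    fix X Y f assume "X \<in> Obj ?Q" "Y \<in> Obj ?Q" "f \<in> Mor ?Q X Y"
    then show "Comp ?Q X Y Y (Ident ?Q Y) f = f" by auto
  next
    fix X Y f assume "X \<in> Obj ?Q" "Y \<in> Obj ?Q" "f \<in> Mor ?Q X Y"
    then show "Comp ?Q X X Y f (Ident ?Q X) = f" by auto
  next
    fix W X Y Z f g h assume "W \<in> Obj ?Q" "X \<in> Obj ?Q" "Y \<in> Obj ?Q" "Z \<in> Obj ?Q"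
      "f \<in> Mor ?Q W X" "g \<in> Mor ?Q X Y" "h \<in> Mor ?Q Y Z"
    then show "Comp ?Q W Y Z h (Comp ?Q W X Y g f) = Comp ?Q W X Z (Comp ?Q X Y Z h g) f"
      by auto
  }
qed

end

text \<open>These are the objects that are invisible to \<Phi>. No member is listed explicitly: any
  map that factors through a null object is killed by \<Phi> by definition, so only the converse,
  factoring the killed maps, requires work.\<close>

definition null_objects ::
    "('o, 'm) category \<Rightarrow> ('p, 'l) category \<Rightarrow> ('p \<Rightarrow> 'o) \<Rightarrow> ('p \<Rightarrow> 'p \<Rightarrow> 'm \<Rightarrow> 'l) \<Rightarrow> 'o set" where
  "null_objects A P G \<Phi> = {Z \<in> Obj A. \<forall>V\<in>Obj P. \<forall>W\<in>Obj P. \<forall>f\<in>Mor A (G V) Z. \<forall>g\<in>Mor A Z (G W).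
      \<Phi> V W (Comp A (G V) Z (G W) g f) = \<one>\<^bsub>Hom P V W\<^esub>}"

text \<open>\<open>G\<close> acts on objects only, and on morphisms the data run backwards, from
  \<open>A\<close> to \<open>P\<close>. A functor from \<open>P\<close> to \<open>A\<close> is not
  asked for, since the lift of a morphism is determined only up to the kernel of \<Phi>; it becomes
  a functor after passing to the factor category.\<close>

locale controlled_embedding = A: preadditive_category A + P: preadditive_category P
  for A :: "('o, 'm) category" and P :: "('p, 'l) category" +
  fixes G :: "'p \<Rightarrow> 'o" and \<Phi> :: "'p \<Rightarrow> 'p \<Rightarrow> 'm \<Rightarrow> 'l"
  assumes G_closed: "V \<in> Obj P \<Longrightarrow> G V \<in> Obj A"
    and hom: "V \<in> Obj P \<Longrightarrow> W \<in> Obj P \<Longrightarrow> \<Phi> V W \<in> hom (Hom A (G V) (G W)) (Hom P V W)"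
    and surj: "V \<in> Obj P \<Longrightarrow> W \<in> Obj P \<Longrightarrow> Mor P V W \<subseteq> \<Phi> V W ` Mor A (G V) (G W)"
    and Ident: "V \<in> Obj P \<Longrightarrow> \<Phi> V V (Ident A (G V)) = Ident P V"
    and Comp: "\<lbrakk>U \<in> Obj P; V \<in> Obj P; W \<in> Obj P; f \<in> Mor A (G U) (G V); g \<in> Mor A (G V) (G W)\<rbrakk>
      \<Longrightarrow> \<Phi> U W (Comp A (G U) (G V) (G W) g f) = Comp P U V W (\<Phi> V W g) (\<Phi> U V f)"
    and kernel: "\<lbrakk>V \<in> Obj P; W \<in> Obj P; f \<in> Mor A (G V) (G W); \<Phi> V W f = \<one>\<^bsub>Hom P V W\<^esub>\<rbrakk>
      \<Longrightarrow> \<exists>Z\<in>null_objects A P G \<Phi>. \<exists>h\<in>Mor A (G V) Z. \<exists>g\<in>Mor A Z (G W). f = Comp A (G V) Z (G W) g h"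
begin

section \<open>From a controlled embedding to an equivalence\<close>

lemma \<Phi>_closed:
  "\<lbrakk>V \<in> Obj P; W \<in> Obj P; f \<in> Mor A (G V) (G W)\<rbrakk> \<Longrightarrow> \<Phi> V W f \<in> Mor P V W"
  using hom by (auto simp: hom_def)

lemma \<Phi>_add:
  "\<lbrakk>V \<in> Obj P; W \<in> Obj P; f \<in> Mor A (G V) (G W); g \<in> Mor A (G V) (G W)\<rbrakk>
    \<Longrightarrow> \<Phi> V W (f \<otimes>\<^bsub>Hom A (G V) (G W)\<^esub> g) = \<Phi> V W f \<otimes>\<^bsub>Hom P V W\<^esub> \<Phi> V W g"
  using hom by (auto simp: hom_def)

lemma group_hom_\<Phi>:
  "V \<in> Obj P \<Longrightarrow> W \<in> Obj P \<Longrightarrow> group_hom (Hom A (G V) (G W)) (Hom P V W) (\<Phi> V W)"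
  using hom A.Hom_group P.Hom_group G_closed by (simp add: group_hom_def group_hom_axioms_def)

lemma \<Phi>_eq_iff_coset:
  assumes V: "V \<in> Obj P" and W: "W \<in> Obj P"
    and f: "f \<in> Mor A (G V) (G W)" and g: "g \<in> Mor A (G V) (G W)"
  shows "\<Phi> V W g = \<Phi> V W f \<longleftrightarrow> (\<exists>h\<in>Mor A (G V) (G W). \<Phi> V W h = \<one>\<^bsub>Hom P V W\<^esub>
           \<and> g = h \<otimes>\<^bsub>Hom A (G V) (G W)\<^esub> f)"
proof -
  interpret h: group_hom "Hom A (G V) (G W)" "Hom P V W" "\<Phi> V W" using group_hom_\<Phi> V W .
  show ?thesis
  proof
    assume *: "\<Phi> V W g = \<Phi> V W f"
    have "g = (g \<otimes>\<^bsub>Hom A (G V) (G W)\<^esub> inv\<^bsub>Hom A (G V) (G W)\<^esub> f) \<otimes>\<^bsub>Hom A (G V) (G W)\<^esub> f"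
      using f g by (simp add: h.G.m_assoc)
    moreover have "\<Phi> V W (g \<otimes>\<^bsub>Hom A (G V) (G W)\<^esub> inv\<^bsub>Hom A (G V) (G W)\<^esub> f) = \<one>\<^bsub>Hom P V W\<^esub>"
      using f g * by simp
    ultimately show "\<exists>h\<in>Mor A (G V) (G W). \<Phi> V W h = \<one>\<^bsub>Hom P V W\<^esub> \<and> g = h \<otimes>\<^bsub>Hom A (G V) (G W)\<^esub> f"
      using f g by blast
  qed (use f in auto)
qed

text \<open>Insert the identity of \<open>D\<close>, written as the sum of the idempotents of the
  direct sum, between \<open>f\<close> and \<open>g\<close>. Each term passes through one of the
  null objects \<open>Z i\<close>, and \<Phi> is additive.\<close>

lemma null_objects_direct_sum:
  assumes Z: "\<And>i. i < n \<Longrightarrow> Z i \<in> null_objects A P G \<Phi>" and D: "direct_sum A n Z D"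
  shows "D \<in> null_objects A P G \<Phi>"
proof -
  have DO: "D \<in> Obj A" using D by (simp add: direct_sum_def)
  have ZO: "Z i \<in> Obj A" if "i < n" for i using Z[OF that] by (simp add: null_objects_def)
  obtain \<iota> \<pi> where i: "\<And>i. i<n \<Longrightarrow> \<iota> i \<in> Mor A (Z i) D" "\<And>i. i<n \<Longrightarrow> \<pi> i \<in> Mor A D (Z i)"
    and sum: "finprod (Hom A D D) (\<lambda>i. Comp A D (Z i) D (\<iota> i) (\<pi> i)) {..<n} = Ident A D"
    using D unfolding direct_sum_def by blast
  interpret DD: comm_group "Hom A D D" using DO A.Hom_comm_group by blast
  have "\<Phi> V W (Comp A (G V) D (G W) g f) = \<one>\<^bsub>Hom P V W\<^esub>"
    if V: "V \<in> Obj P" "W \<in> Obj P" and f: "f \<in> Mor A (G V) D" and g: "g \<in> Mor A D (G W)" for V W f g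
  proof -
    interpret h: group_hom "Hom A (G V) (G W)" "Hom P V W" "\<Phi> V W" using group_hom_\<Phi> V .
    note O = G_closed[OF V(1)] G_closed[OF V(2)] DO
    let ?t = "\<lambda>i. Comp A D (Z i) D (\<iota> i) (\<pi> i)"
    have t: "?t i \<in> Mor A D D" if "i < n" for i using i ZO DO that by (auto intro: A.Comp_closed)
    have "\<Phi> V W (Comp A (G V) D (G W) g (Comp A (G V) D D (finprod (Hom A D D) ?t {..<m}) f)) = \<one>\<^bsub>Hom P V W\<^esub>"
      if "m \<le> n" for m
      using that
    proof (induction m)
      case 0
      then show ?case using O f g by (simp add: A.Comp_zero_left A.Comp_zero_right)
    next
      case (Suc m)
      have fm: "finprod (Hom A D D) ?t {..<m} \<in> Mor A D D"
        using t Suc by (intro DD.finprod_closed) auto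
      have m: "m < n" using Suc by simp
      have *: "Comp A (G V) D (G W) g (Comp A (G V) D D (?t m) f)
        = Comp A (G V) (Z m) (G W) (Comp A (Z m) D (G W) g (\<iota> m)) (Comp A (G V) D (Z m) (\<pi> m) f)"
        using O f g i[OF m] ZO[OF m] by (simp add: A.Comp_assoc A.Comp_closed)
      have "\<Phi> V W (Comp A (G V) D (G W) g (Comp A (G V) D D (?t m) f)) = \<one>\<^bsub>Hom P V W\<^esub>"
        unfolding * using Z[OF m] V O f g i[OF m] ZO[OF m]
        by (auto simp: null_objects_def A.Comp_closed)
      moreover have "finprod (Hom A D D) ?t {..<Suc m} = ?t m \<otimes>\<^bsub>Hom A D D\<^esub> finprod (Hom A D D) ?t {..<m}"
        unfolding lessThan_Suc using t m by (intro DD.finprod_insert) auto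
      ultimately show ?case
        using O f g t[OF m] fm V Suc
        by (simp add: A.Comp_add_left A.Comp_add_right A.Comp_closed)
    qed
    from this[of n] show ?thesis using O f by (simp add: sum A.Comp_Ident_left)
  qed
  then show ?thesis using DO by (simp add: null_objects_def)
qed

text \<open>Between objects in the image of \<open>G\<close>, the ideal generated by the null
  objects is exactly the kernel of \<Phi>, so the cosets correspond to morphisms of
  \<open>P\<close>. Since the null objects belong to the subcategory too, essential surjectivity
  needs an object of \<open>P\<close> to which they become isomorphic; this is the zero object
  \<open>V0\<close>.\<close>

theorem factor_category_equivalent:
  assumes sums: "\<And>n F. (\<And>i. i < n \<Longrightarrow> F i \<in> Obj A) \<Longrightarrow> \<exists>D. direct_sum A n F D"
    and V0: "V0 \<in> Obj P" "Ident P V0 = \<one>\<^bsub>Hom P V0 V0\<^esub>"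
  shows "\<exists>C B. C \<subseteq> B \<and> B \<subseteq> Obj A \<and> equivalent_categories (full_subcategory (factor_category A C) B) P"
proof -
  define C where "C = null_objects A P G \<Phi>"
  interpret S: sum_closed_class A C
  proof
    show "\<exists>D. direct_sum A n F D" if "\<And>i. i < n \<Longrightarrow> F i \<in> Obj A" for n F using that by (rule sums)
    show "C \<subseteq> Obj A" by (auto simp: C_def null_objects_def)
    show "D \<in> C" if "\<And>i. i < n \<Longrightarrow> Z i \<in> C" "direct_sum A n Z D" for n Z D
      using that unfolding C_def by (rule null_objects_direct_sum)
  qed
  let ?B = "G ` Obj P \<union> C"
  let ?Q = "full_subcategory (factor_category A C) ?B"
  have BO: "?B \<subseteq> Obj A" using G_closed S.C_Obj by auto
  have sel[simp]: "Obj ?Q = ?B" "Hom ?Q = Hom (factor_category A C)"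
    "Comp ?Q = Comp (factor_category A C)" "Ident ?Q = (\<lambda>X. S.coset X X (Ident A X))"
    by (simp_all add: full_subcategory_def) (simp add: factor_category_def)
  have ker: "Hom_through A C (G V) (G W) = {f \<in> Mor A (G V) (G W). \<Phi> V W f = \<one>\<^bsub>Hom P V W\<^esub>}"
    if V: "V \<in> Obj P" "W \<in> Obj P" for V W
  proof (intro equalityI subsetI)
    fix h assume h: "h \<in> Hom_through A C (G V) (G W)"
    then have "h \<in> Mor A (G V) (G W)" using S.Hom_through_closed G_closed V by blast
    moreover have "\<Phi> V W h = \<one>\<^bsub>Hom P V W\<^esub>"
      using h by (rule S.Hom_throughE) (use V in \<open>auto simp: C_def null_objects_def\<close>)
    ultimately show "h \<in> {f \<in> Mor A (G V) (G W). \<Phi> V W f = \<one>\<^bsub>Hom P V W\<^esub>}" by simp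
  next
    fix h assume "h \<in> {f \<in> Mor A (G V) (G W). \<Phi> V W f = \<one>\<^bsub>Hom P V W\<^esub>}"
    then show "h \<in> Hom_through A C (G V) (G W)"
      using kernel[OF V, of h] G_closed V by (auto simp: C_def[symmetric] intro!: S.Hom_throughI)
  qed
  have coset: "S.coset (G V) (G W) f = {g \<in> Mor A (G V) (G W). \<Phi> V W g = \<Phi> V W f}"
    if V: "V \<in> Obj P" "W \<in> Obj P" and f: "f \<in> Mor A (G V) (G W)" for V W f
  proof -
    have sub: "S.coset (G V) (G W) f \<subseteq> Mor A (G V) (G W)"
      using S.coset_subset V f G_closed by blast
    have "g \<in> S.coset (G V) (G W) f \<longleftrightarrow> \<Phi> V W g = \<Phi> V W f" if g: "g \<in> Mor A (G V) (G W)" for g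
      unfolding \<Phi>_eq_iff_coset[OF V f g] by (auto simp: r_coset_def ker[OF V])
    then show ?thesis using sub by auto
  qed
  \<comment> \<open>A fibre of \<Phi> is a coset of its kernel, hence already a morphism of the
    factor category; no choice of a lift enters the functor.\<close>
  define Gm where "Gm V W a = {f \<in> Mor A (G V) (G W). \<Phi> V W f = a}" for V W a
  have Gm: "\<exists>f\<in>Mor A (G V) (G W). \<Phi> V W f = a \<and> Gm V W a = S.coset (G V) (G W) f"
    if V: "V \<in> Obj P" "W \<in> Obj P" "a \<in> Mor P V W" for V W a
  proof -
    obtain f where f: "f \<in> Mor A (G V) (G W)" "\<Phi> V W f = a" using surj[OF V(1,2)] V(3) by auto
    then show ?thesis using coset[OF V(1,2) f(1)] by (auto simp: Gm_def)
  qed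
  have G\<Phi>: "Gm V W (\<Phi> V W f) = S.coset (G V) (G W) f"
    if V: "V \<in> Obj P" "W \<in> Obj P" "f \<in> Mor A (G V) (G W)" for V W f
    by (simp only: coset[OF V] Gm_def)
  have QL: "category_laws ?Q" by (rule S.factor_category_laws[OF BO])
  have "equivalent_categories ?Q P"
  proof (rule equivalent_categories_if_fully_faithful[where Go = G and Gm = Gm])
    show "category_laws P" ..
    show "category_laws ?Q" by (rule QL)
    show "is_functor P ?Q G Gm"
      unfolding is_functor_def
    proof (intro conjI ballI)
      fix V assume V: "V \<in> Obj P"
      then show "G V \<in> Obj ?Q" by auto
      show "Gm V V (Ident P V) = Ident ?Q (G V)"
        using G\<Phi>[OF V V, of "Ident A (G V)"] V G_closed by (simp add: Ident A.Ident_closed)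
    next
      fix V W a assume "V \<in> Obj P" "W \<in> Obj P" "a \<in> Mor P V W"
      then show "Gm V W a \<in> Mor ?Q (G V) (G W)"
        using Gm[of V W a] by (simp add: S.Mor_factor_category) blast
    next
      fix U V W a b
      assume O: "U \<in> Obj P" "V \<in> Obj P" "W \<in> Obj P" and a: "a \<in> Mor P U V" and b: "b \<in> Mor P V W"
      obtain f where f: "f \<in> Mor A (G U) (G V)" "\<Phi> U V f = a" "Gm U V a = S.coset (G U) (G V) f"
        using Gm[OF O(1,2) a] by blast
      obtain g where g: "g \<in> Mor A (G V) (G W)" "\<Phi> V W g = b" "Gm V W b = S.coset (G V) (G W) g"
        using Gm[OF O(2,3) b] by blast
      show "Gm U W (Comp P U V W b a) = Comp ?Q (G U) (G V) (G W) (Gm V W b) (Gm U V a)"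
        using O f g G_closed G\<Phi>[OF O(1,3), of "Comp A (G U) (G V) (G W) g f"]
        by (simp add: S.Comp_factor_category Comp A.Comp_closed)
    qed
  next
    fix V W assume V: "V \<in> Obj P" "W \<in> Obj P"
    show "bij_betw (Gm V W) (Mor P V W) (Mor ?Q (G V) (G W))"
      unfolding bij_betw_def
    proof
      show "inj_on (Gm V W) (Mor P V W)"
        using surj[OF V] by (fastforce simp: inj_on_def Gm_def)
      show "Gm V W ` Mor P V W = Mor ?Q (G V) (G W)"
        using Gm[OF V] G\<Phi>[OF V] \<Phi>_closed[OF V] by (auto simp: S.Mor_factor_category) (metis imageI)
    qed
  next
    fix X assume "X \<in> Obj ?Q"
    then consider V where "V \<in> Obj P" "X = G V" | "X \<in> C" by auto
    then show "\<exists>V\<in>Obj P. \<exists>e. is_iso ?Q X (G V) e"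
    proof cases
      case 1
      then have "is_iso ?Q X (G V) (Ident ?Q X)"
        using category_laws.Ident_closed[OF QL, of X] category_laws.Comp_Ident_left[OF QL, of X X]
        by (auto simp del: sel(2-) simp: is_iso_def)
      then show ?thesis using 1 by blast
    next
      case 2
      have "G V0 \<in> C"
        unfolding C_def null_objects_def mem_Collect_eq
      proof (intro conjI ballI)
        show "G V0 \<in> Obj A" using V0 G_closed by blast
        fix V W f g assume *: "V \<in> Obj P" "W \<in> Obj P" "f \<in> Mor A (G V) (G V0)" "g \<in> Mor A (G V0) (G W)"
        then have f: "\<Phi> V V0 f \<in> Mor P V V0" using V0 \<Phi>_closed by blast
        then have "\<Phi> V V0 f = Comp P V V0 V0 \<one>\<^bsub>Hom P V0 V0\<^esub> (\<Phi> V V0 f)"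
          using P.Comp_Ident_left[OF *(1) V0(1) f] V0(2) by simp
        also have "\<dots> = \<one>\<^bsub>Hom P V V0\<^esub>" using P.Comp_zero_left *(1) V0(1) f by blast
        finally show "\<Phi> V W (Comp A (G V) (G V0) (G W) g f) = \<one>\<^bsub>Hom P V W\<^esub>"
          using * V0 by (simp add: Comp P.Comp_zero_right \<Phi>_closed)
      qed
      \<comment> \<open>The identity of an object of \<open>C\<close> generates part of the ideal,
        so every morphism starting there lies in the ideal and only the zero coset remains.\<close>
      have triv: "Mor ?Q Y Z = {Hom_through A C Y Z}" if "Y \<in> C" "Z \<in> C" for Y Z
      proof -
        have YZ: "Y \<in> Obj A" "Z \<in> Obj A" using that S.C_Obj by auto
        have "f \<in> Hom_through A C Y Z" if f: "f \<in> Mor A Y Z" for f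
          using S.Hom_throughI[OF YZ \<open>Y \<in> C\<close> A.Ident_closed[OF YZ(1)] f] YZ f
          by (simp add: A.Comp_Ident_right)
        then have "S.coset Y Z f = Hom_through A C Y Z" if "f \<in> Mor A Y Z" for f
          using that YZ
          by (intro group.coset_join2[OF A.Hom_group] S.Hom_through_subgroup) auto
        then show ?thesis using A.zero_closed[OF YZ] by (auto simp: S.Mor_factor_category)
      qed
      have *: "X \<in> C" "G V0 \<in> C" "X \<in> ?B" "G V0 \<in> ?B" using 2 \<open>G V0 \<in> C\<close> by auto
      have "is_iso ?Q X (G V0) (Hom_through A C X (G V0))"
        unfolding is_iso_def
      proof (intro conjI bexI)
        show f: "Hom_through A C X (G V0) \<in> Mor ?Q X (G V0)" using triv * by blast
        show g: "Hom_through A C (G V0) X \<in> Mor ?Q (G V0) X" using triv * by blast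
        show "Comp ?Q X (G V0) X (Hom_through A C (G V0) X) (Hom_through A C X (G V0)) = Ident ?Q X"
          using category_laws.Comp_closed[OF QL _ _ _ f g] category_laws.Ident_closed[OF QL, of X]
            triv[OF *(1,1)] * by (simp del: sel(2-))
        show "Comp ?Q (G V0) X (G V0) (Hom_through A C X (G V0)) (Hom_through A C (G V0) X) = Ident ?Q (G V0)"
          using category_laws.Comp_closed[OF QL _ _ _ g f] category_laws.Ident_closed[OF QL, of "G V0"]
            triv[OF *(2,2)] * by (simp del: sel(2-))
      qed
      then show ?thesis using V0 by blast
    qed
  qed
  then show ?thesis using BO by blast
qed

end

text \<open>The embedding is constructed on tuples of vectors, while the theorem prescribes another
  carrier type; this lemma changes the type. Essential surjectivity of \<open>To\<close> is not
  asked for: nullness of \<open>To Z\<close> is tested only against objects \<open>To (N V)\<close>,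
  and all morphisms involved come from \<open>A'\<close> by fullness.\<close>

lemma controlled_embedding_transport:
  assumes ce: "controlled_embedding A' P N \<Phi>" and A: "preadditive_category A"
    and T: "is_functor A' A To Tm"
    and bij: "\<And>X Y. X \<in> Obj A' \<Longrightarrow> Y \<in> Obj A' \<Longrightarrow> bij_betw (Tm X Y) (Mor A' X Y) (Mor A (To X) (To Y))"
    and add: "\<And>X Y. X \<in> Obj A' \<Longrightarrow> Y \<in> Obj A' \<Longrightarrow> Tm X Y \<in> hom (Hom A' X Y) (Hom A (To X) (To Y))"
  shows "controlled_embedding A P (\<lambda>V. To (N V))
     (\<lambda>V W f. \<Phi> V W (inv_into (Mor A' (N V) (N W)) (Tm (N V) (N W)) f))"
proof -
  interpret N: controlled_embedding A' P N \<Phi> by fact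
  interpret A: preadditive_category A by fact
  have To: "To X \<in> Obj A" if "X \<in> Obj A'" for X using T that by (auto simp: is_functor_def)
  have Tm: "Tm X Y f \<in> Mor A (To X) (To Y)" if "X \<in> Obj A'" "Y \<in> Obj A'" "f \<in> Mor A' X Y" for X Y f
    using T that by (auto simp: is_functor_def)
  have Ti: "Tm X X (Ident A' X) = Ident A (To X)" if "X \<in> Obj A'" for X
    using T that by (auto simp: is_functor_def)
  have Tc: "Tm X Z (Comp A' X Y Z g f) = Comp A (To X) (To Y) (To Z) (Tm Y Z g) (Tm X Y f)"
    if "X \<in> Obj A'" "Y \<in> Obj A'" "Z \<in> Obj A'" "f \<in> Mor A' X Y" "g \<in> Mor A' Y Z" for X Y Z f g
    using T that by (auto simp: is_functor_def)
  define S where "S X Y = inv_into (Mor A' X Y) (Tm X Y)" for X Y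
  have ST: "S X Y (Tm X Y f) = f" if "X \<in> Obj A'" "Y \<in> Obj A'" "f \<in> Mor A' X Y" for X Y f
    using bij[OF that(1,2)] that(3) unfolding S_def by (rule bij_betw_inv_into_left)
  have onto: "\<exists>g\<in>Mor A' X Y. f = Tm X Y g" if "X \<in> Obj A'" "Y \<in> Obj A'" "f \<in> Mor A (To X) (To Y)" for X Y f
    using bij[OF that(1,2)] that(3) by (auto simp: bij_betw_def)
  note NO = N.G_closed
  show ?thesis
    unfolding S_def[symmetric]
  proof
    show "To (N V) \<in> Obj A" if "V \<in> Obj P" for V using that NO To by blast
  next
    fix V W assume V: "V \<in> Obj P" "W \<in> Obj P"
    show "(\<lambda>f. \<Phi> V W (S (N V) (N W) f)) \<in> hom (Hom A (To (N V)) (To (N W))) (Hom P V W)"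
    proof (rule homI)
      fix f assume "f \<in> Mor A (To (N V)) (To (N W))"
      then obtain f' where f': "f' \<in> Mor A' (N V) (N W)" "f = Tm (N V) (N W) f'"
        using onto NO V by blast
      show "\<Phi> V W (S (N V) (N W) f) \<in> Mor P V W" using f' V NO by (simp add: ST N.\<Phi>_closed)
      fix g assume "g \<in> Mor A (To (N V)) (To (N W))"
      then obtain g' where g': "g' \<in> Mor A' (N V) (N W)" "g = Tm (N V) (N W) g'"
        using onto NO V by blast
      have "f \<otimes>\<^bsub>Hom A (To (N V)) (To (N W))\<^esub> g = Tm (N V) (N W) (f' \<otimes>\<^bsub>Hom A' (N V) (N W)\<^esub> g')"
        using add[OF NO[OF V(1)] NO[OF V(2)]] f' g' by (simp add: hom_def)
      then show "\<Phi> V W (S (N V) (N W) (f \<otimes>\<^bsub>Hom A (To (N V)) (To (N W))\<^esub> g))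
         = \<Phi> V W (S (N V) (N W) f) \<otimes>\<^bsub>Hom P V W\<^esub> \<Phi> V W (S (N V) (N W) g)"
        using f' g' V NO by (simp add: ST N.\<Phi>_add N.A.add_closed)
    qed
    show "Mor P V W \<subseteq> (\<lambda>f. \<Phi> V W (S (N V) (N W) f)) ` Mor A (To (N V)) (To (N W))"
    proof
      fix a assume "a \<in> Mor P V W"
      then obtain f where "f \<in> Mor A' (N V) (N W)" "\<Phi> V W f = a" using N.surj[OF V] by auto
      then show "a \<in> (\<lambda>f. \<Phi> V W (S (N V) (N W) f)) ` Mor A (To (N V)) (To (N W))"
        using V NO by (intro image_eqI[where x = "Tm (N V) (N W) f"]) (auto simp: ST Tm)
    qed
  next
    fix V assume "V \<in> Obj P"
    then show "\<Phi> V V (S (N V) (N V) (Ident A (To (N V)))) = Ident P V"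
      using ST[OF NO NO N.A.Ident_closed[OF NO]] by (simp add: Ti NO N.Ident)
  next
    fix U V W f g
    assume O: "U \<in> Obj P" "V \<in> Obj P" "W \<in> Obj P"
      and f: "f \<in> Mor A (To (N U)) (To (N V))" and g: "g \<in> Mor A (To (N V)) (To (N W))"
    obtain f' where f': "f' \<in> Mor A' (N U) (N V)" "f = Tm (N U) (N V) f'"
      using onto[OF NO NO, OF O(1,2) f] by blast
    obtain g' where g': "g' \<in> Mor A' (N V) (N W)" "g = Tm (N V) (N W) g'"
      using onto[OF NO NO, OF O(2,3) g] by blast
    have "Comp A (To (N U)) (To (N V)) (To (N W)) g f = Tm (N U) (N W) (Comp A' (N U) (N V) (N W) g' f')"
      using f' g' O NO by (simp add: Tc)
    then show "\<Phi> U W (S (N U) (N W) (Comp A (To (N U)) (To (N V)) (To (N W)) g f))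
       = Comp P U V W (\<Phi> V W (S (N V) (N W) g)) (\<Phi> U V (S (N U) (N V) f))"
      using f' g' O NO by (simp add: ST N.Comp N.A.Comp_closed)
  next
    fix V W f
    assume V: "V \<in> Obj P" "W \<in> Obj P" and f: "f \<in> Mor A (To (N V)) (To (N W))"
      and z: "\<Phi> V W (S (N V) (N W) f) = \<one>\<^bsub>Hom P V W\<^esub>"
    obtain f' where f': "f' \<in> Mor A' (N V) (N W)" "f = Tm (N V) (N W) f'"
      using onto[OF NO NO, OF V f] by blast
    then have "\<Phi> V W f' = \<one>\<^bsub>Hom P V W\<^esub>" using z V NO by (simp add: ST)
    then obtain Z h g where Z: "Z \<in> null_objects A' P N \<Phi>"
      and h: "h \<in> Mor A' (N V) Z" and g: "g \<in> Mor A' Z (N W)" and fgh: "f' = Comp A' (N V) Z (N W) g h"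
      using N.kernel[OF V f'(1)] by blast
    have ZO: "Z \<in> Obj A'" using Z by (simp add: null_objects_def)
    have "To Z \<in> null_objects A P (\<lambda>V. To (N V)) (\<lambda>V W f. \<Phi> V W (S (N V) (N W) f))"
      unfolding null_objects_def mem_Collect_eq
    proof (intro conjI ballI)
      show "To Z \<in> Obj A" using ZO To by blast
      fix V W f g
      assume V: "V \<in> Obj P" "W \<in> Obj P"
        and f: "f \<in> Mor A (To (N V)) (To Z)" and g: "g \<in> Mor A (To Z) (To (N W))"
      obtain f' where f': "f' \<in> Mor A' (N V) Z" "f = Tm (N V) Z f'"
        using onto[OF NO ZO, OF V(1) f] by blast
      obtain g' where g': "g' \<in> Mor A' Z (N W)" "g = Tm Z (N W) g'"
        using onto[OF ZO NO, OF V(2) g] by blast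
      have "Comp A (To (N V)) (To Z) (To (N W)) g f = Tm (N V) (N W) (Comp A' (N V) Z (N W) g' f')"
        using f' g' V ZO NO by (simp add: Tc)
      then show "\<Phi> V W (S (N V) (N W) (Comp A (To (N V)) (To Z) (To (N W)) g f)) = \<one>\<^bsub>Hom P V W\<^esub>"
        using f' g' V NO ZO Z by (simp add: ST N.A.Comp_closed null_objects_def)
    qed
    moreover have "f = Comp A (To (N V)) (To Z) (To (N W)) (Tm Z (N W) g) (Tm (N V) Z h)"
      using f' fgh h g V ZO NO by (simp add: Tc)
    ultimately show "\<exists>Z\<in>null_objects A P (\<lambda>V. To (N V)) (\<lambda>V W f. \<Phi> V W (S (N V) (N W) f)).
       \<exists>h\<in>Mor A (To (N V)) Z. \<exists>g\<in>Mor A Z (To (N W)). f = Comp A (To (N V)) Z (To (N W)) g h"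
      using Tm h g V ZO NO by blast
  qed
qed

section \<open>Linear maps\<close>

lemma module_imp_left_module: "module R M \<Longrightarrow> left_module R M"
  by (intro left_module.intro left_module_axioms.intro)
    (auto simp: module_def module_axioms_def cring.axioms(1))

lemma linear_mapsI:
  assumes "f \<in> extensional (carrier M)" "\<And>x. x \<in> carrier M \<Longrightarrow> f x \<in> carrier N"
    "\<And>x y. x \<in> carrier M \<Longrightarrow> y \<in> carrier M \<Longrightarrow> f (x \<oplus>\<^bsub>M\<^esub> y) = f x \<oplus>\<^bsub>N\<^esub> f y"
    "\<And>a x. a \<in> carrier R \<Longrightarrow> x \<in> carrier M \<Longrightarrow> f (a \<odot>\<^bsub>M\<^esub> x) = a \<odot>\<^bsub>N\<^esub> f x"
  shows "f \<in> linear_maps R M N"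
  using assms by (auto simp: linear_maps_def PiE_iff)

lemma linear_mapsD:
  assumes "f \<in> linear_maps R M N"
  shows "f \<in> extensional (carrier M)" "\<And>x. x \<in> carrier M \<Longrightarrow> f x \<in> carrier N"
    "\<And>x y. x \<in> carrier M \<Longrightarrow> y \<in> carrier M \<Longrightarrow> f (x \<oplus>\<^bsub>M\<^esub> y) = f x \<oplus>\<^bsub>N\<^esub> f y"
    "\<And>a x. a \<in> carrier R \<Longrightarrow> x \<in> carrier M \<Longrightarrow> f (a \<odot>\<^bsub>M\<^esub> x) = a \<odot>\<^bsub>N\<^esub> f x"
  using assms by (auto simp: linear_maps_def PiE_iff)

lemma restrict_linear_mapsI:
  assumes "left_module R M" "\<And>x. x \<in> carrier M \<Longrightarrow> f x \<in> carrier N"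
    "\<And>x y. x \<in> carrier M \<Longrightarrow> y \<in> carrier M \<Longrightarrow> f (x \<oplus>\<^bsub>M\<^esub> y) = f x \<oplus>\<^bsub>N\<^esub> f y"
    "\<And>a x. a \<in> carrier R \<Longrightarrow> x \<in> carrier M \<Longrightarrow> f (a \<odot>\<^bsub>M\<^esub> x) = a \<odot>\<^bsub>N\<^esub> f x"
  shows "(\<lambda>x\<in>carrier M. f x) \<in> linear_maps R M N"
proof -
  interpret left_module R M by fact
  show ?thesis using assms smult_closed by (intro linear_mapsI) auto
qed

lemma linear_map_zero:
  assumes "f \<in> linear_maps R M N" "abelian_group M" "abelian_group N"
  shows "f \<zero>\<^bsub>M\<^esub> = \<zero>\<^bsub>N\<^esub>"
proof -
  interpret M: abelian_group M by fact
  interpret N: abelian_group N by fact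
  have "f \<zero>\<^bsub>M\<^esub> = f \<zero>\<^bsub>M\<^esub> \<oplus>\<^bsub>N\<^esub> f \<zero>\<^bsub>M\<^esub>"
    using linear_mapsD(3)[OF assms(1), of "\<zero>\<^bsub>M\<^esub>" "\<zero>\<^bsub>M\<^esub>"] by simp
  then show ?thesis using linear_mapsD(2)[OF assms(1)] by (simp add: N.add.l_cancel_one')
qed

lemma linear_map_finsum:
  assumes f: "f \<in> linear_maps R M N" and "abelian_group M" "abelian_group N"
    and "finite S" "x \<in> S \<rightarrow> carrier M"
  shows "f (finsum M x S) = finsum N (\<lambda>i. f (x i)) S"
proof -
  interpret M: abelian_group M by fact
  interpret N: abelian_group N by fact
  show ?thesis
    using assms(4,5)
  proof (induction S rule: finite_induct)
    case empty
    then show ?case using linear_map_zero assms by auto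
  next
    case (insert i S)
    have "(\<lambda>i. f (x i)) \<in> S \<rightarrow> carrier N" "f (x i) \<in> carrier N"
      using insert linear_mapsD(2)[OF f] by auto
    then show ?case using insert linear_mapsD(3)[OF f] by (simp add: Pi_iff)
  qed
qed

lemma compose_linear_maps:
  assumes "left_module R L" "f \<in> linear_maps R L M" "g \<in> linear_maps R M N"
  shows "compose (carrier L) g f \<in> linear_maps R L N"
proof -
  interpret left_module R L by fact
  show ?thesis
    using assms(2,3)[THEN linear_mapsD(2)] assms(2,3)[THEN linear_mapsD(3)]
      assms(2,3)[THEN linear_mapsD(4)] smult_closed
    by (intro linear_mapsI) (auto simp: compose_def)
qed

lemma map_group_simps [simp]:
  "carrier (map_group M N H) = H"
  "f \<otimes>\<^bsub>map_group M N H\<^esub> g = (\<lambda>x\<in>carrier M. f x \<oplus>\<^bsub>N\<^esub> g x)"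
  "\<one>\<^bsub>map_group M N H\<^esub> = (\<lambda>x\<in>carrier M. \<zero>\<^bsub>N\<^esub>)"
  by (simp_all add: map_group_def)

lemma comm_group_map_group:
  assumes N: "abelian_group N" and H: "H \<subseteq> carrier M \<rightarrow>\<^sub>E carrier N"
    and zero: "(\<lambda>x\<in>carrier M. \<zero>\<^bsub>N\<^esub>) \<in> H"
    and add: "\<And>f g. f \<in> H \<Longrightarrow> g \<in> H \<Longrightarrow> (\<lambda>x\<in>carrier M. f x \<oplus>\<^bsub>N\<^esub> g x) \<in> H"
    and minus: "\<And>f. f \<in> H \<Longrightarrow> (\<lambda>x\<in>carrier M. \<ominus>\<^bsub>N\<^esub> f x) \<in> H"
  shows "comm_group (map_group M N H)"
proof -
  interpret N: abelian_group N by fact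
  have val: "f x \<in> carrier N" if "f \<in> H" "x \<in> carrier M" for f x using H that by auto
  have ext: "f = (\<lambda>x\<in>carrier M. f x)" if "f \<in> H" for f
    using H that by (auto simp: PiE_iff extensional_restrict)
  show ?thesis
  proof (rule comm_groupI)
    fix f g h assume fgh: "f \<in> carrier (map_group M N H)" "g \<in> carrier (map_group M N H)"
      "h \<in> carrier (map_group M N H)"
    show "f \<otimes>\<^bsub>map_group M N H\<^esub> g \<otimes>\<^bsub>map_group M N H\<^esub> h
        = f \<otimes>\<^bsub>map_group M N H\<^esub> (g \<otimes>\<^bsub>map_group M N H\<^esub> h)"
      using fgh val by (auto intro!: restrict_ext simp: N.a_assoc)
  next
    fix f g assume fg: "f \<in> carrier (map_group M N H)" "g \<in> carrier (map_group M N H)"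
    show "f \<otimes>\<^bsub>map_group M N H\<^esub> g \<in> carrier (map_group M N H)" using fg add by simp
    show "f \<otimes>\<^bsub>map_group M N H\<^esub> g = g \<otimes>\<^bsub>map_group M N H\<^esub> f"
      using fg val by (auto intro!: restrict_ext simp: N.a_comm)
  next
    fix f assume f: "f \<in> carrier (map_group M N H)"
    have "(\<lambda>x\<in>carrier M. \<zero>\<^bsub>N\<^esub> \<oplus>\<^bsub>N\<^esub> f x) = (\<lambda>x\<in>carrier M. f x)"
      using f val by (intro restrict_ext) auto
    then show "\<one>\<^bsub>map_group M N H\<^esub> \<otimes>\<^bsub>map_group M N H\<^esub> f = f"
      using f ext[of f] by (simp cong: restrict_cong)
    show "\<exists>g\<in>carrier (map_group M N H). g \<otimes>\<^bsub>map_group M N H\<^esub> f = \<one>\<^bsub>map_group M N H\<^esub>"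
      using f val minus[of f]
      by (intro bexI[of _ "\<lambda>x\<in>carrier M. \<ominus>\<^bsub>N\<^esub> f x"]) (auto intro!: restrict_ext simp: N.l_neg)
  qed (use zero in auto)
qed

text \<open>\<open>direct_sum\<close> adds up endomorphisms with \<open>finprod\<close>; this makes
  the sum pointwise, so that it can be computed in the module.\<close>

lemma finprod_map_group:
  assumes G: "comm_group (map_group M N H)" and N: "abelian_group N"
    and H: "H \<subseteq> carrier M \<rightarrow>\<^sub>E carrier N" and "finite S" "F \<in> S \<rightarrow> H" and x: "x \<in> carrier M"
  shows "finprod (map_group M N H) F S x = finsum N (\<lambda>i. F i x) S"
proof -
  interpret N: abelian_group N by fact
  interpret G: comm_group "map_group M N H" by fact
  show ?thesis
    using assms(4,5)
  proof (induction S rule: finite_induct)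
    case empty
    then show ?case using x by simp
  next
    case (insert i S)
    have "(\<lambda>i. F i x) \<in> S \<rightarrow> carrier N" "F i x \<in> carrier N" using insert x H by auto
    then show ?case using insert x by (simp add: Pi_iff)
  qed
qed

context left_module
begin

lemma smult_zero_right: "a \<in> carrier R \<Longrightarrow> a \<odot>\<^bsub>M\<^esub> \<zero>\<^bsub>M\<^esub> = \<zero>\<^bsub>M\<^esub>"
  using smult_r_distr[of a "\<zero>\<^bsub>M\<^esub>" "\<zero>\<^bsub>M\<^esub>"] smult_closed[of a "\<zero>\<^bsub>M\<^esub>"]
  by (simp add: M.add.l_cancel_one')

lemma smult_minus_right:
  assumes "a \<in> carrier R" "x \<in> carrier M"
  shows "a \<odot>\<^bsub>M\<^esub> (\<ominus>\<^bsub>M\<^esub> x) = \<ominus>\<^bsub>M\<^esub> (a \<odot>\<^bsub>M\<^esub> x)"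
proof -
  have "a \<odot>\<^bsub>M\<^esub> (\<ominus>\<^bsub>M\<^esub> x) \<oplus>\<^bsub>M\<^esub> a \<odot>\<^bsub>M\<^esub> x = \<zero>\<^bsub>M\<^esub>"
    using assms by (simp add: smult_r_distr[symmetric] M.l_neg smult_zero_right)
  then show ?thesis using assms smult_closed by (metis M.a_inv_closed M.minus_equality)
qed

end

lemma linear_maps_zero:
  assumes "left_module R M" "left_module R N"
  shows "(\<lambda>x\<in>carrier M. \<zero>\<^bsub>N\<^esub>) \<in> linear_maps R M N"
proof -
  interpret M: left_module R M by fact
  interpret N: left_module R N by fact
  show ?thesis using assms N.smult_zero_right by (intro restrict_linear_mapsI) auto
qed

lemma linear_maps_add:
  assumes "left_module R M" "left_module R N" "f \<in> linear_maps R M N" "g \<in> linear_maps R M N"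
  shows "(\<lambda>x\<in>carrier M. f x \<oplus>\<^bsub>N\<^esub> g x) \<in> linear_maps R M N"
proof -
  interpret N: left_module R N by fact
  show ?thesis using assms(1) assms(3,4)[THEN linear_mapsD(2)] assms(3,4)[THEN linear_mapsD(3)]
    assms(3,4)[THEN linear_mapsD(4)]
    by (intro restrict_linear_mapsI) (auto simp: N.M.add.m_ac N.smult_r_distr)
qed

lemma linear_maps_minus:
  assumes "left_module R M" "left_module R N" "f \<in> linear_maps R M N"
  shows "(\<lambda>x\<in>carrier M. \<ominus>\<^bsub>N\<^esub> f x) \<in> linear_maps R M N"
proof -
  interpret N: left_module R N by fact
  show ?thesis using assms(1) assms(3)[THEN linear_mapsD(2)] assms(3)[THEN linear_mapsD(3)]
    assms(3)[THEN linear_mapsD(4)]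
    by (intro restrict_linear_mapsI) (auto simp: N.M.minus_add N.smult_minus_right)
qed

lemma linear_maps_subset: "linear_maps R M N \<subseteq> carrier M \<rightarrow>\<^sub>E carrier N"
  by (auto simp: linear_maps_def)

section \<open>The two categories are preadditive\<close>

lemma fd_free_modules_simps [simp]:
  "Obj (fd_free_modules K) = {M. left_module (free_algebra K) M \<and> fin_gen K (underlying_space K M)}"
  "Hom (fd_free_modules K) M N = map_group M N (linear_maps (free_algebra K) M N)"
  "Ident (fd_free_modules K) M = (\<lambda>x\<in>carrier M. x)"
  "Comp (fd_free_modules K) L M N g f = compose (carrier L) g f"
  by (simp_all add: fd_free_modules_def)

lemma submodule_category_simps [simp]:
  "(M, U) \<in> Obj (submodule_category R) \<longleftrightarrow> module R M \<and> fin_gen R M \<and> submodule U R M"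
  "Hom (submodule_category R) (M, U) (N, V) = map_group M N {f \<in> linear_maps R M N. f ` U \<subseteq> V}"
  "Ident (submodule_category R) (M, U) = (\<lambda>x\<in>carrier M. x)"
  "Comp (submodule_category R) (L, T) (M, U) (N, V) g f = compose (carrier L) g f"
  by (simp_all add: submodule_category_def)

text \<open>In both categories the morphisms form additive groups of linear maps and composition is
  composition of functions. Here \<open>m\<close> extracts the module of an object and
  \<open>H\<close> the admissible linear maps, so one verification serves for both.\<close>

lemma preadditive_category_linear_maps:
  assumes "\<And>X. X \<in> Obj A \<Longrightarrow> left_module R (m X)"
    and Hom: "\<And>X Y. Hom A X Y = map_group (m X) (m Y) (H X Y)"
    and H: "\<And>X Y. H X Y \<subseteq> linear_maps R (m X) (m Y)"
    and zero: "\<And>X Y. X \<in> Obj A \<Longrightarrow> Y \<in> Obj A \<Longrightarrow> (\<lambda>x\<in>carrier (m X). \<zero>\<^bsub>m Y\<^esub>) \<in> H X Y"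
    and add: "\<And>X Y f g. \<lbrakk>X \<in> Obj A; Y \<in> Obj A; f \<in> H X Y; g \<in> H X Y\<rbrakk>
      \<Longrightarrow> (\<lambda>x\<in>carrier (m X). f x \<oplus>\<^bsub>m Y\<^esub> g x) \<in> H X Y"
    and minus: "\<And>X Y f. \<lbrakk>X \<in> Obj A; Y \<in> Obj A; f \<in> H X Y\<rbrakk>
      \<Longrightarrow> (\<lambda>x\<in>carrier (m X). \<ominus>\<^bsub>m Y\<^esub> f x) \<in> H X Y"
    and Ident: "\<And>X. X \<in> Obj A \<Longrightarrow> Ident A X = (\<lambda>x\<in>carrier (m X). x)"
      "\<And>X. X \<in> Obj A \<Longrightarrow> (\<lambda>x\<in>carrier (m X). x) \<in> H X X"
    and Comp: "\<And>X Y Z g f. Comp A X Y Z g f = compose (carrier (m X)) g f"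
      "\<And>X Y Z g f. \<lbrakk>X \<in> Obj A; Y \<in> Obj A; Z \<in> Obj A; f \<in> H X Y; g \<in> H Y Z\<rbrakk>
         \<Longrightarrow> compose (carrier (m X)) g f \<in> H X Z"
  shows "preadditive_category A"
proof (intro preadditive_category.intro category_laws.intro preadditive_category_axioms.intro)
  note [simp] = Hom Ident(1) Comp(1)
  have val: "f x \<in> carrier (m Y)" if "f \<in> H X Y" "x \<in> carrier (m X)" for X Y f x
    using linear_mapsD(2)[OF subsetD[OF H that(1)]] that by simp
  have lin: "f (x \<oplus>\<^bsub>m X\<^esub> y) = f x \<oplus>\<^bsub>m Y\<^esub> f y"
    if "f \<in> H X Y" "x \<in> carrier (m X)" "y \<in> carrier (m X)" for X Y f x y
    using linear_mapsD(3)[OF subsetD[OF H that(1)]] that by simp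
  have ext: "f \<in> extensional (carrier (m X))" if "f \<in> H X Y" for f X Y
    using linear_mapsD(1)[OF subsetD[OF H that]] .
  have ab: "abelian_group (m X)" if "X \<in> Obj A" for X
    using assms(1)[OF that] left_module.axioms(2) by blast
  {
    fix X assume X: "X \<in> Obj A"
    then show "Ident A X \<in> Mor A X X" using Ident(2) by simp
  next
    fix W X Y Z f g h assume "f \<in> Mor A W X"
    then show "Comp A W Y Z h (Comp A W X Y g f) = Comp A W X Z (Comp A X Y Z h g) f"
      using val[of f W X] by (simp add: compose_def cong: restrict_cong)
  next
    fix X Y Z f g assume "X \<in> Obj A" "Y \<in> Obj A" "Z \<in> Obj A" "f \<in> Mor A X Y" "g \<in> Mor A Y Z"
    then show "Comp A X Y Z g f \<in> Mor A X Z" using Comp(2) by simp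
  next
    fix X Y f assume "X \<in> Obj A" "Y \<in> Obj A" "f \<in> Mor A X Y"
    then show "Comp A X Y Y (Ident A Y) f = f" "Comp A X X Y f (Ident A X) = f"
      using ext[of f X Y] val[of f X Y]
      by (auto simp: compose_def intro!: extensionalityI[where A = "carrier (m X)"])
  next
    fix X Y assume O: "X \<in> Obj A" "Y \<in> Obj A"
    show "comm_group (Hom A X Y)"
      unfolding Hom using H[of X Y] linear_maps_subset[of R "m X" "m Y"] O zero add minus ab
      by (intro comm_group_map_group) auto
  next
    fix X Y Z f g h
    assume "X \<in> Obj A" "Y \<in> Obj A" "Z \<in> Obj A" "f \<in> Mor A X Y" "g \<in> Mor A Y Z" "h \<in> Mor A Y Z"
    then show "Comp A X Y Z (g \<otimes>\<^bsub>Hom A Y Z\<^esub> h) f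
            = Comp A X Y Z g f \<otimes>\<^bsub>Hom A X Z\<^esub> Comp A X Y Z h f"
      using val[of f X Y] by (auto simp: compose_def intro!: restrict_ext)
  next
    fix X Y Z f g h
    assume "X \<in> Obj A" "Y \<in> Obj A" "Z \<in> Obj A" "f \<in> Mor A X Y" "g \<in> Mor A X Y" "h \<in> Mor A Y Z"
    then show "Comp A X Y Z h (f \<otimes>\<^bsub>Hom A X Y\<^esub> g)
            = Comp A X Y Z h f \<otimes>\<^bsub>Hom A X Z\<^esub> Comp A X Y Z h g"
      using val[of f X Y] val[of g X Y] lin[of h Y Z] by (auto simp: compose_def intro!: restrict_ext)
  }
qed

lemma identity_linear_maps:
  assumes "left_module R M" shows "(\<lambda>x\<in>carrier M. x) \<in> linear_maps R M M"
  using assms by (intro restrict_linear_mapsI) auto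

lemma preadditive_fd_free_modules: "preadditive_category (fd_free_modules K)"
  by (rule preadditive_category_linear_maps[where R = "free_algebra K" and m = id
        and H = "linear_maps (free_algebra K)"])
    (auto intro: linear_maps_zero linear_maps_add linear_maps_minus identity_linear_maps
      compose_linear_maps)

lemma submodule_closed:
  assumes "submodule U R M"
  shows "U \<subseteq> carrier M" "\<zero>\<^bsub>M\<^esub> \<in> U" "\<And>x y. x \<in> U \<Longrightarrow> y \<in> U \<Longrightarrow> x \<oplus>\<^bsub>M\<^esub> y \<in> U"
    "\<And>x. x \<in> U \<Longrightarrow> \<ominus>\<^bsub>M\<^esub> x \<in> U" "\<And>a x. a \<in> carrier R \<Longrightarrow> x \<in> U \<Longrightarrow> a \<odot>\<^bsub>M\<^esub> x \<in> U"
proof -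
  interpret submodule U R M by fact
  show "U \<subseteq> carrier M" "\<zero>\<^bsub>M\<^esub> \<in> U" "\<And>x y. x \<in> U \<Longrightarrow> y \<in> U \<Longrightarrow> x \<oplus>\<^bsub>M\<^esub> y \<in> U"
    "\<And>x. x \<in> U \<Longrightarrow> \<ominus>\<^bsub>M\<^esub> x \<in> U" "\<And>a x. a \<in> carrier R \<Longrightarrow> x \<in> U \<Longrightarrow> a \<odot>\<^bsub>M\<^esub> x \<in> U"
    using subset one_closed m_closed m_inv_closed smult_closed by (auto simp: a_inv_def)
qed

lemma preadditive_submodule_category: "preadditive_category (submodule_category R)"
proof (rule preadditive_category_linear_maps[where R = R and m = fst
        and H = "\<lambda>X Y. {f \<in> linear_maps R (fst X) (fst Y). f ` snd X \<subseteq> snd Y}"])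
  let ?A = "submodule_category R"
  let ?H = "\<lambda>X Y. {f \<in> linear_maps R (fst X) (fst Y). f ` snd X \<subseteq> snd Y}"
  have O: "left_module R (fst X)" "submodule (snd X) R (fst X)" if "X \<in> Obj ?A" for X
    using that by (cases X; auto simp: module_imp_left_module)+
  have U: "x \<in> carrier (fst X)" if "X \<in> Obj ?A" "x \<in> snd X" for X x
    using submodule_closed(1)[OF O(2)] that by blast
  {
    fix X Y assume *: "X \<in> Obj ?A" "Y \<in> Obj ?A"
    note c = submodule_closed[OF O(2)[OF *(2)]]
    show "(\<lambda>x\<in>carrier (fst X). \<zero>\<^bsub>fst Y\<^esub>) \<in> ?H X Y"
      using linear_maps_zero[OF O(1) O(1), OF *] U[OF *(1)] c by auto
    fix f g assume f: "f \<in> ?H X Y"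
    then show "(\<lambda>x\<in>carrier (fst X). \<ominus>\<^bsub>fst Y\<^esub> f x) \<in> ?H X Y"
      using linear_maps_minus[OF O(1) O(1), OF *] U[OF *(1)] c(4) by auto
    assume "g \<in> ?H X Y"
    then show "(\<lambda>x\<in>carrier (fst X). f x \<oplus>\<^bsub>fst Y\<^esub> g x) \<in> ?H X Y"
      using f linear_maps_add[OF O(1) O(1), OF *] U[OF *(1)] by (auto intro!: c(3))
  next
    fix X Y Z f g assume *: "X \<in> Obj ?A" "Y \<in> Obj ?A" "Z \<in> Obj ?A" "f \<in> ?H X Y" "g \<in> ?H Y Z"
    then show "compose (carrier (fst X)) g f \<in> ?H X Z"
      using compose_linear_maps[OF O(1)[OF *(1)], of f "fst Y" g "fst Z"] U[OF *(1)]
      by (auto simp: compose_def)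
  }
  fix X assume X: "X \<in> Obj ?A"
  show "left_module R (fst X)" by (rule O(1)[OF X])
  show "(\<lambda>x\<in>carrier (fst X). x) \<in> ?H X X"
    using identity_linear_maps[OF O(1)[OF X]] U[OF X] by auto
qed (auto simp: submodule_category_def split: prod.splits)

section \<open>Constructions of modules\<close>

definition direct_product :: "nat set \<Rightarrow> (nat \<Rightarrow> ('a, 'v) module) \<Rightarrow> ('a, nat \<Rightarrow> 'v) module" where
  "direct_product I M =
     \<lparr>carrier = (\<Pi>\<^sub>E i\<in>I. carrier (M i)), mult = undefined, one = undefined,
      zero = (\<lambda>i\<in>I. \<zero>\<^bsub>M i\<^esub>), add = (\<lambda>x y. \<lambda>i\<in>I. x i \<oplus>\<^bsub>M i\<^esub> y i),
      smult = (\<lambda>a x. \<lambda>i\<in>I. a \<odot>\<^bsub>M i\<^esub> x i)\<rparr>"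

lemma direct_product_simps [simp]:
  "carrier (direct_product I M) = (\<Pi>\<^sub>E i\<in>I. carrier (M i))"
  "\<zero>\<^bsub>direct_product I M\<^esub> = (\<lambda>i\<in>I. \<zero>\<^bsub>M i\<^esub>)"
  "x \<oplus>\<^bsub>direct_product I M\<^esub> y = (\<lambda>i\<in>I. x i \<oplus>\<^bsub>M i\<^esub> y i)"
  "a \<odot>\<^bsub>direct_product I M\<^esub> x = (\<lambda>i\<in>I. a \<odot>\<^bsub>M i\<^esub> x i)"
  by (simp_all add: direct_product_def)

lemma module_direct_product:
  assumes R: "cring R" and M: "\<And>i. i \<in> I \<Longrightarrow> module R (M i)"
  shows "module R (direct_product I M)"
proof (rule moduleI)
  note ab = abelian_group.axioms(1)[OF module.axioms(2)[OF M]]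
  note ag = module.axioms(2)[OF M]
  have c: "x i \<in> carrier (M i)" if "x \<in> carrier (direct_product I M)" "i \<in> I" for x i
    using that by auto
  show "abelian_group (direct_product I M)"
  proof (rule abelian_groupI)
    fix x assume x: "x \<in> carrier (direct_product I M)"
    show "\<zero>\<^bsub>direct_product I M\<^esub> \<oplus>\<^bsub>direct_product I M\<^esub> x = x"
      using x c[OF x] by (auto intro!: extensionalityI[where A = I] simp: PiE_iff abelian_monoid.l_zero[OF ab])
    show "\<exists>y\<in>carrier (direct_product I M). y \<oplus>\<^bsub>direct_product I M\<^esub> x = \<zero>\<^bsub>direct_product I M\<^esub>"
      using c[OF x]
      by (intro bexI[of _ "\<lambda>i\<in>I. \<ominus>\<^bsub>M i\<^esub> x i"])
        (auto intro!: restrict_ext simp: abelian_group.l_neg[OF ag] abelian_group.a_inv_closed[OF ag])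
  next
    fix x y z assume *: "x \<in> carrier (direct_product I M)" "y \<in> carrier (direct_product I M)"
      "z \<in> carrier (direct_product I M)"
    show "x \<oplus>\<^bsub>direct_product I M\<^esub> y \<oplus>\<^bsub>direct_product I M\<^esub> z
        = x \<oplus>\<^bsub>direct_product I M\<^esub> (y \<oplus>\<^bsub>direct_product I M\<^esub> z)"
      using *[THEN c] by (auto intro!: restrict_ext simp: abelian_monoid.a_assoc[OF ab])
    show "x \<oplus>\<^bsub>direct_product I M\<^esub> y = y \<oplus>\<^bsub>direct_product I M\<^esub> x"
      using *[THEN c] by (auto intro!: restrict_ext simp: abelian_monoid.a_comm[OF ab])
  qed (use c in \<open>auto simp: abelian_monoid.a_closed[OF ab] abelian_monoid.zero_closed[OF ab]\<close>)
qed (use R in \<open>auto intro!: restrict_ext extensionalityI[where A = I] simp: PiE_iff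
      module.smult_closed[OF M] module.smult_l_distr[OF M] module.smult_r_distr[OF M]
      module.smult_assoc1[OF M] module.smult_one[OF M]\<close>)

definition single :: "nat set \<Rightarrow> (nat \<Rightarrow> ('a, 'v) module) \<Rightarrow> nat \<Rightarrow> 'v \<Rightarrow> nat \<Rightarrow> 'v" where
  "single I M i a = (\<lambda>j\<in>I. if j = i then a else \<zero>\<^bsub>M j\<^esub>)"

lemma single_linear:
  assumes M: "\<And>i. i \<in> I \<Longrightarrow> module R (M i)" and i: "i \<in> I"
  shows "(\<lambda>a\<in>carrier (M i). single I M i a) \<in> linear_maps R (M i) (direct_product I M)"
proof (rule restrict_linear_mapsI)
  note ab = abelian_group.axioms(1)[OF module.axioms(2)[OF M]]
  show "left_module R (M i)" using M i module_imp_left_module by blast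
qed (auto simp: single_def i intro!: restrict_ext
     abelian_monoid.zero_closed[OF abelian_group.axioms(1)[OF module.axioms(2)[OF M]]]
     simp: abelian_monoid.zero_closed[OF abelian_group.axioms(1)[OF module.axioms(2)[OF M]]]
     abelian_monoid.l_zero[OF abelian_group.axioms(1)[OF module.axioms(2)[OF M]]]
     module.smult_r_null[OF M])

lemma component_linear:
  assumes R: "cring R" and M: "\<And>i. i \<in> I \<Longrightarrow> module R (M i)" and i: "i \<in> I"
  shows "(\<lambda>x\<in>carrier (direct_product I M). x i) \<in> linear_maps R (direct_product I M) (M i)"
  using module_imp_left_module[OF module_direct_product[OF R M]] i
  by (intro restrict_linear_mapsI) auto

lemma sum_of_singles_mem:
  assumes R: "cring R" and M: "\<And>i. i \<in> I \<Longrightarrow> module R (M i)" and "finite J" "J \<subseteq> I"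
    and N: "submodule N R (direct_product I M)"
    and x: "x \<in> carrier (direct_product I M)" "\<And>i. i \<in> J \<Longrightarrow> single I M i (x i) \<in> N"
  shows "(\<lambda>j\<in>I. if j \<in> J then x j else \<zero>\<^bsub>M j\<^esub>) \<in> N"
  using assms(3,4) x(2)
proof (induction J rule: finite_induct)
  case empty
  then show ?case using submodule_closed(2)[OF N] by (simp add: restrict_def)
next
  case (insert i J)
  note ab = abelian_group.axioms(1)[OF module.axioms(2)[OF M]]
  have "(\<lambda>j\<in>I. if j \<in> J then x j else \<zero>\<^bsub>M j\<^esub>) \<oplus>\<^bsub>direct_product I M\<^esub> single I M i (x i) \<in> N"
    by (intro submodule_closed(3)[OF N] insert.IH insert.prems) (use insert.prems in blast)+
  moreover have "(\<lambda>j\<in>I. if j \<in> J then x j else \<zero>\<^bsub>M j\<^esub>) \<oplus>\<^bsub>direct_product I M\<^esub> single I M i (x i)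
     = (\<lambda>j\<in>I. if j \<in> insert i J then x j else \<zero>\<^bsub>M j\<^esub>)"
    using x(1) insert
    by (auto simp: single_def intro!: restrict_ext abelian_monoid.l_zero[OF ab] abelian_monoid.r_zero[OF ab]
        abelian_monoid.zero_closed[OF ab])
  ultimately show ?case by (simp only:)
qed

lemma finsum_singles:
  assumes R: "cring R" and I: "finite I" and M: "\<And>i. i \<in> I \<Longrightarrow> module R (M i)"
    and x: "x \<in> carrier (direct_product I M)"
  shows "finsum (direct_product I M) (\<lambda>i. single I M i (x i)) I = x"
proof -
  let ?D = "direct_product I M"
  interpret D: module R ?D by (rule module_direct_product[OF R M])
  have sD: "single I M i (x i) \<in> carrier ?D" if "i \<in> I" for i
    using linear_mapsD(2)[OF single_linear[where M = M and I = I and R = R, OF M that], of "x i"] x that by auto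
  have "finsum ?D (\<lambda>i. single I M i (x i)) I \<in> carrier ?D" using sD by (intro D.M.finsum_closed) auto
  moreover have "finsum ?D (\<lambda>i. single I M i (x i)) I j = x j" if j: "j \<in> I" for j
  proof -
    interpret Mj: module R "M j" by (rule M[OF j])
    have "finsum ?D (\<lambda>i. single I M i (x i)) I \<in> carrier ?D" using sD by (intro D.M.finsum_closed) auto
    then have "finsum ?D (\<lambda>i. single I M i (x i)) I j
       = (\<lambda>x\<in>carrier ?D. x j) (finsum ?D (\<lambda>i. single I M i (x i)) I)" by (simp del: direct_product_simps)
    also have "\<dots> = finsum (M j) (\<lambda>i. (\<lambda>x\<in>carrier ?D. x j) (single I M i (x i))) I"
      using sD D.M.abelian_group_axioms Mj.M.abelian_group_axioms I
      by (intro linear_map_finsum[OF component_linear[OF R M j]]) auto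
    also have "\<dots> = finsum (M j) (\<lambda>i. if j = i then x j else \<zero>\<^bsub>M j\<^esub>) I"
      using sD x j by (intro Mj.M.finsum_cong') (auto simp del: direct_product_simps simp: single_def, auto)
    also have "\<dots> = x j" using x I j by (intro Mj.M.add.finprod_singleton[where f = "\<lambda>_. x j"]) auto
    finally show ?thesis .
  qed
  ultimately show ?thesis using x by (intro extensionalityI[where A = I]) (auto simp: PiE_iff)
qed

section \<open>Images, preimages and finite generation\<close>

lemma submodule_vimage:
  assumes "module R M" "module R N" "f \<in> linear_maps R M N" "submodule L R N"
  shows "submodule {x \<in> carrier M. f x \<in> L} R M"
proof -
  interpret M: module R M by fact
  interpret N: module R N by fact
  note f = linear_mapsD[OF assms(3)] and L = submodule_closed[OF assms(4)]
  have z: "f \<zero>\<^bsub>M\<^esub> = \<zero>\<^bsub>N\<^esub>" using linear_map_zero assms M.abelian_group_axioms N.abelian_group_axioms by blast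
  have "f (\<ominus>\<^bsub>M\<^esub> x) = \<ominus>\<^bsub>N\<^esub> f x" if x: "x \<in> carrier M" for x
  proof -
    have "f (\<ominus>\<^bsub>M\<^esub> x) \<oplus>\<^bsub>N\<^esub> f x = \<zero>\<^bsub>N\<^esub>" using x f(3)[of "\<ominus>\<^bsub>M\<^esub> x" x] z by (simp add: M.M.l_neg)
    then show ?thesis using x f(2) by (simp add: N.M.minus_equality)
  qed
  then show ?thesis using f L z by (intro M.submoduleI) auto
qed

lemma submodule_image:
  assumes "module R M" "module R N" "f \<in> linear_maps R M N" "submodule L R M"
  shows "submodule (f ` L) R N"
proof -
  interpret M: module R M by fact
  interpret N: module R N by fact
  note f = linear_mapsD[OF assms(3)] and L = submodule_closed[OF assms(4)]
  have z: "f \<zero>\<^bsub>M\<^esub> = \<zero>\<^bsub>N\<^esub>" using linear_map_zero assms M.abelian_group_axioms N.abelian_group_axioms by blast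
  have Lc: "x \<in> carrier M" if "x \<in> L" for x using L that by blast
  have minus: "\<ominus>\<^bsub>N\<^esub> f x = f (\<ominus>\<^bsub>M\<^esub> x)" if x: "x \<in> carrier M" for x
  proof -
    have "f (\<ominus>\<^bsub>M\<^esub> x) \<oplus>\<^bsub>N\<^esub> f x = \<zero>\<^bsub>N\<^esub>" using x f(3)[of "\<ominus>\<^bsub>M\<^esub> x" x] z by (simp add: M.M.l_neg)
    then show ?thesis using x f(2) by (simp add: N.M.minus_equality)
  qed
  show ?thesis
    using f L(2-) Lc z
    by (intro N.submoduleI)
      (auto simp: minus f(3)[symmetric] f(4)[symmetric] intro!: imageI intro: rev_image_eqI[of "\<zero>\<^bsub>M\<^esub>"])
qed

text \<open>If a submodule of \<open>N\<close> contains the images of the generators, its preimage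
  contains the generators and so is all of \<open>M\<close>.\<close>

lemma fin_gen_image:
  assumes "module R M" "module R N" "f \<in> linear_maps R M N" "f ` carrier M = carrier N" "fin_gen R M"
  shows "fin_gen R N"
proof -
  obtain S where S: "finite S" "S \<subseteq> carrier M"
    "\<And>L. submodule L R M \<Longrightarrow> S \<subseteq> L \<Longrightarrow> L = carrier M"
    using assms(5) unfolding fin_gen_def by blast
  show ?thesis
    unfolding fin_gen_def
  proof (intro exI[of _ "f ` S"] conjI allI impI)
    fix L assume L: "submodule L R N" "f ` S \<subseteq> L"
    have "{x \<in> carrier M. f x \<in> L} = carrier M"
      by (rule S(3)[OF submodule_vimage]) (use assms L S(2) in auto)
    then have "f ` carrier M \<subseteq> L" by blast
    then have "carrier N \<subseteq> L" using assms(4) by simp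
    then show "L = carrier N" using submodule_closed(1)[OF L(1)] by blast
  qed (use S assms(4) in auto)
qed

text \<open>For a submodule \<open>N\<close> containing the generators in each coordinate, the
  preimage of \<open>N\<close> under every coordinate injection is everything; a tuple is the sum of
  its coordinates.\<close>

lemma fin_gen_direct_product:
  assumes R: "cring R" and I: "finite I" and M: "\<And>i. i \<in> I \<Longrightarrow> module R (M i)"
    and fg: "\<And>i. i \<in> I \<Longrightarrow> fin_gen R (M i)"
  shows "fin_gen R (direct_product I M)"
proof -
  have "\<exists>S. \<forall>i\<in>I. finite (S i) \<and> S i \<subseteq> carrier (M i) \<and>
      (\<forall>N. submodule N R (M i) \<longrightarrow> S i \<subseteq> N \<longrightarrow> N = carrier (M i))"
    by (rule bchoice) (use fg in \<open>simp add: fin_gen_def\<close>)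
  then obtain S where S0: "\<forall>i\<in>I. finite (S i) \<and> S i \<subseteq> carrier (M i) \<and>
      (\<forall>N. submodule N R (M i) \<longrightarrow> S i \<subseteq> N \<longrightarrow> N = carrier (M i))"
    by (rule exE)
  have S: "finite (S i)" "S i \<subseteq> carrier (M i)" if "i \<in> I" for i
    using bspec[OF S0 that] by (simp_all only: conj_assoc)
  have gen: "N = carrier (M i)" if "i \<in> I" "submodule N R (M i)" "S i \<subseteq> N" for i N
    by (rule S0[THEN bspec, THEN conjunct2, THEN conjunct2, THEN spec, THEN mp, THEN mp]) fact+
  note single = single_linear[where I = I and M = M, OF M]
  show ?thesis
    unfolding fin_gen_def
  proof (intro exI[of _ "\<Union>i\<in>I. single I M i ` S i"] conjI allI impI)
    show "(\<Union>i\<in>I. single I M i ` S i) \<subseteq> carrier (direct_product I M)"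
      using linear_mapsD(2)[OF single] S(2) by fastforce
    fix N assume N: "submodule N R (direct_product I M)" and sub: "(\<Union>i\<in>I. single I M i ` S i) \<subseteq> N"
    have sN: "single I M i a \<in> N" if i: "i \<in> I" and a: "a \<in> carrier (M i)" for i a
    proof -
      have "{a \<in> carrier (M i). (\<lambda>a\<in>carrier (M i). single I M i a) a \<in> N} = carrier (M i)"
        by (rule gen[OF i submodule_vimage[OF M[OF i] module_direct_product[OF R M] single[OF _ i] N]])
          (use i sub S(2) in auto)
      then have "a \<in> {a \<in> carrier (M i). (\<lambda>a\<in>carrier (M i). single I M i a) a \<in> N}" using a by blast
      then show ?thesis using a by simp
    qed
    have "x \<in> N" if x: "x \<in> carrier (direct_product I M)" for x
    proof -
      have "(\<lambda>j\<in>I. if j \<in> I then x j else \<zero>\<^bsub>M j\<^esub>) \<in> N"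
        by (rule sum_of_singles_mem[OF R M I _ N x]) (use sN x in auto)
      moreover have "(\<lambda>j\<in>I. if j \<in> I then x j else \<zero>\<^bsub>M j\<^esub>) = x"
        using x by (intro extensionalityI[where A = I]) (auto simp: PiE_iff)
      ultimately show ?thesis by simp
    qed
    then show "N = carrier (direct_product I M)" using submodule_closed(1)[OF N] by blast
  qed (use S I in auto)
qed

text \<open>The linear combinations of the finitely many generators form a submodule containing
  them, so by the definition of \<open>fin_gen\<close> they exhaust \<open>M\<close>. This passes
  from the definition by submodules to coefficients.\<close>

lemma fin_gen_span:
  fixes R (structure)
  assumes "module R M" "fin_gen R M"
  shows "\<exists>(m::nat) v. v \<in> {..<m} \<rightarrow> carrier M \<and>
     (\<forall>x\<in>carrier M. \<exists>r\<in>{..<m} \<rightarrow> carrier R. x = (\<Oplus>\<^bsub>M\<^esub>i\<in>{..<m}. r i \<odot>\<^bsub>M\<^esub> v i))"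
proof -
  interpret module R M by fact
  obtain S where S: "finite S" "S \<subseteq> carrier M" "\<And>L. submodule L R M \<Longrightarrow> S \<subseteq> L \<Longrightarrow> L = carrier M"
    using assms(2) unfolding fin_gen_def by blast
  obtain v where v: "bij_betw v {0..<card S} S" using ex_bij_betw_nat_finite S(1) by blast
  let ?I = "{..<card S}"
  have vS: "v ` ?I = S" using v by (simp add: bij_betw_def lessThan_atLeast0)
  then have vc: "v i \<in> carrier M" if "i \<in> ?I" for i using that S(2) by auto
  define L where "L = {(\<Oplus>\<^bsub>M\<^esub>i\<in>?I. r i \<odot>\<^bsub>M\<^esub> v i) | r. r \<in> ?I \<rightarrow> carrier R}"
  have LI: "(\<Oplus>\<^bsub>M\<^esub>i\<in>?I. r i \<odot>\<^bsub>M\<^esub> v i) \<in> L" if "r \<in> ?I \<rightarrow> carrier R" for r using that by (auto simp: L_def)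
  have sm: "a \<odot>\<^bsub>M\<^esub> x \<in> L" if ax: "a \<in> carrier R" "x \<in> L" for a x
  proof -
    obtain r where r: "r \<in> ?I \<rightarrow> carrier R" "x = (\<Oplus>\<^bsub>M\<^esub>i\<in>?I. r i \<odot>\<^bsub>M\<^esub> v i)" using ax by (auto simp: L_def)
    have "a \<odot>\<^bsub>M\<^esub> x = (\<Oplus>\<^bsub>M\<^esub>i\<in>?I. a \<odot>\<^bsub>M\<^esub> (r i \<odot>\<^bsub>M\<^esub> v i))"
      unfolding r(2) using r vc ax by (intro finsum_smult_ldistr) auto
    also have "\<dots> = (\<Oplus>\<^bsub>M\<^esub>i\<in>?I. (a \<otimes> r i) \<odot>\<^bsub>M\<^esub> v i)"
      using r vc ax by (intro M.finsum_cong') (auto simp: smult_assoc1 Pi_iff)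
    also have "\<dots> \<in> L" using r ax by (intro LI) auto
    finally show ?thesis .
  qed
  have Lc: "L \<subseteq> carrier M" using vc by (auto simp: L_def intro!: M.finsum_closed)
  have "submodule L R M"
  proof (rule submoduleI)
    show "a \<oplus>\<^bsub>M\<^esub> b \<in> L" if ab: "a \<in> L" "b \<in> L" for a b
    proof -
      obtain r where r: "r \<in> ?I \<rightarrow> carrier R" "a = (\<Oplus>\<^bsub>M\<^esub>i\<in>?I. r i \<odot>\<^bsub>M\<^esub> v i)" using ab by (auto simp: L_def)
      obtain s where s: "s \<in> ?I \<rightarrow> carrier R" "b = (\<Oplus>\<^bsub>M\<^esub>i\<in>?I. s i \<odot>\<^bsub>M\<^esub> v i)" using ab by (auto simp: L_def)
      have "a \<oplus>\<^bsub>M\<^esub> b = (\<Oplus>\<^bsub>M\<^esub>i\<in>?I. r i \<odot>\<^bsub>M\<^esub> v i \<oplus>\<^bsub>M\<^esub> s i \<odot>\<^bsub>M\<^esub> v i)"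
        unfolding r(2) s(2) using r(1) s(1) vc by (intro M.finsum_addf[symmetric]) auto
      also have "\<dots> = (\<Oplus>\<^bsub>M\<^esub>i\<in>?I. (r i \<oplus> s i) \<odot>\<^bsub>M\<^esub> v i)"
        using r(1) s(1) vc by (intro M.finsum_cong') (auto simp: smult_l_distr Pi_iff)
      also have "\<dots> \<in> L" using r s by (intro LI) auto
      finally show ?thesis .
    qed
    have "(\<Oplus>\<^bsub>M\<^esub>i\<in>?I. (\<lambda>_. \<zero>) i \<odot>\<^bsub>M\<^esub> v i) \<in> L" by (intro LI) auto
    moreover have "(\<Oplus>\<^bsub>M\<^esub>i\<in>?I. (\<lambda>_. \<zero>) i \<odot>\<^bsub>M\<^esub> v i) = (\<Oplus>\<^bsub>M\<^esub>i\<in>?I. \<zero>\<^bsub>M\<^esub>)"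
      using vc by (intro M.finsum_cong') auto
    ultimately show z: "\<zero>\<^bsub>M\<^esub> \<in> L" by simp
    show "\<ominus>\<^bsub>M\<^esub> a \<in> L" if "a \<in> L" for a
      using sm[of "\<ominus> \<one>" a] that Lc by (auto simp: smult_l_minus)
  qed (use sm Lc in auto)
  moreover have "S \<subseteq> L"
  proof
    fix s assume "s \<in> S"
    then obtain k where k: "k \<in> ?I" "s = v k" using vS by auto
    have "(\<Oplus>\<^bsub>M\<^esub>i\<in>?I. (if i = k then \<one> else \<zero>) \<odot>\<^bsub>M\<^esub> v i) = (\<Oplus>\<^bsub>M\<^esub>i\<in>?I. if k = i then v i else \<zero>\<^bsub>M\<^esub>)"
      using vc by (intro M.finsum_cong') auto
    also have "\<dots> = v k" using k vc by (intro M.add.finprod_singleton) auto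
    finally show "s \<in> L" using LI[of "\<lambda>i. if i = k then \<one> else \<zero>"] k by auto
  qed
  ultimately have "L = carrier M" by (rule S(3))
  then have "x \<in> L" if "x \<in> carrier M" for x using that by blast
  then have "\<exists>r\<in>?I \<rightarrow> carrier R. x = (\<Oplus>\<^bsub>M\<^esub>i\<in>?I. r i \<odot>\<^bsub>M\<^esub> v i)" if "x \<in> carrier M" for x
    using that unfolding L_def by blast
  then show ?thesis using vc by (intro exI[of _ "card S"] exI[of _ v]) auto
qed

section \<open>Transport of structure to another carrier type\<close>

definition transported :: "('v \<Rightarrow> 'w) \<Rightarrow> ('a, 'v) module \<Rightarrow> ('a, 'w) module" where
  "transported h M = (let k = inv_into (carrier M) h in
     \<lparr>carrier = h ` carrier M, mult = undefined, one = undefined,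
      zero = h \<zero>\<^bsub>M\<^esub>, add = (\<lambda>x y. h (k x \<oplus>\<^bsub>M\<^esub> k y)), smult = (\<lambda>a x. h (a \<odot>\<^bsub>M\<^esub> k x))\<rparr>)"

lemma transported_simps [simp]:
  "carrier (transported h M) = h ` carrier M"
  "\<zero>\<^bsub>transported h M\<^esub> = h \<zero>\<^bsub>M\<^esub>"
  "x \<oplus>\<^bsub>transported h M\<^esub> y = h (inv_into (carrier M) h x \<oplus>\<^bsub>M\<^esub> inv_into (carrier M) h y)"
  "a \<odot>\<^bsub>transported h M\<^esub> x = h (a \<odot>\<^bsub>M\<^esub> inv_into (carrier M) h x)"
  by (simp_all add: transported_def Let_def)

lemma module_transported:
  assumes M: "module R M" and h: "inj_on h (carrier M)"
  shows "module R (transported h M)"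
proof -
  interpret M: module R M by fact
  note [simp] = inv_into_f_f[OF h]
  show ?thesis
  proof (rule moduleI)
    show "cring R" by (rule M.R.is_cring)
    show "abelian_group (transported h M)"
    proof (rule abelian_groupI)
      fix x assume "x \<in> carrier (transported h M)"
      then obtain y where y: "y \<in> carrier M" "x = h y" by auto
      show "\<exists>y\<in>carrier (transported h M). y \<oplus>\<^bsub>transported h M\<^esub> x = \<zero>\<^bsub>transported h M\<^esub>"
        using y by (intro bexI[of _ "h (\<ominus>\<^bsub>M\<^esub> y)"]) (auto simp: M.M.l_neg)
    qed (auto simp: M.M.add.m_ac)
  qed (auto simp: M.smult_l_distr M.smult_r_distr M.smult_assoc1)
qed

lemma transport_linear:
  assumes M: "module R M" and h: "inj_on h (carrier M)"
  shows "(\<lambda>x\<in>carrier M. h x) \<in> linear_maps R M (transported h M)"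
    and "(\<lambda>y\<in>h ` carrier M. inv_into (carrier M) h y) \<in> linear_maps R (transported h M) M"
proof -
  interpret M: module R M by fact
  note [simp] = inv_into_f_f[OF h]
  show "(\<lambda>x\<in>carrier M. h x) \<in> linear_maps R M (transported h M)"
    using module_imp_left_module[OF M] by (intro restrict_linear_mapsI) auto
  show "(\<lambda>y\<in>h ` carrier M. inv_into (carrier M) h y) \<in> linear_maps R (transported h M) M"
    by (intro linear_mapsI) (auto simp: inj_on_eq_iff[OF h])
qed

lemma fin_gen_transported:
  assumes "module R M" "inj_on h (carrier M)" "fin_gen R M"
  shows "fin_gen R (transported h M)"
  by (rule fin_gen_image[OF assms(1) module_transported[OF assms(1,2)] transport_linear(1)[OF assms(1,2)] _ assms(3)])
    simp

text \<open>An element of a finitely generated module is encoded by the set of all coefficient sequences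
  that represent it with respect to a fixed finite family of generators.\<close>

lemma fin_gen_embedding:
  fixes R (structure) and M :: "('a, 'v) module"
  assumes "module R M" "fin_gen R M"
  shows "\<exists>h :: 'v \<Rightarrow> (nat \<Rightarrow> 'a) set. inj_on h (carrier M)"
proof -
  obtain m :: nat and v where v:
    "\<forall>x\<in>carrier M. \<exists>r\<in>{..<m} \<rightarrow> carrier R. x = (\<Oplus>\<^bsub>M\<^esub>i\<in>{..<m}. r i \<odot>\<^bsub>M\<^esub> v i)"
    using fin_gen_span[OF assms] by blast
  have "inj_on (\<lambda>x. {r. x = (\<Oplus>\<^bsub>M\<^esub>i\<in>{..<m}. r i \<odot>\<^bsub>M\<^esub> v i)}) (carrier M)"
  proof (rule inj_onI)
    fix x y assume x: "x \<in> carrier M"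
      and eq: "{r. x = (\<Oplus>\<^bsub>M\<^esub>i\<in>{..<m}. r i \<odot>\<^bsub>M\<^esub> v i)} = {r. y = (\<Oplus>\<^bsub>M\<^esub>i\<in>{..<m}. r i \<odot>\<^bsub>M\<^esub> v i)}"
    obtain r where r: "x = (\<Oplus>\<^bsub>M\<^esub>i\<in>{..<m}. r i \<odot>\<^bsub>M\<^esub> v i)" using v x by blast
    then have "r \<in> {r. y = (\<Oplus>\<^bsub>M\<^esub>i\<in>{..<m}. r i \<odot>\<^bsub>M\<^esub> v i)}" using eq by blast
    then show "x = y" using r by simp
  qed
  then show ?thesis by blast
qed

definition encoding :: "('a, 'v) module \<Rightarrow> 'v \<Rightarrow> (nat \<Rightarrow> 'a) set" where
  "encoding M = (SOME h. inj_on h (carrier M))"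

lemma inj_encoding:
  assumes "module R M" "fin_gen R M"
  shows "inj_on (encoding M) (carrier M)"
  unfolding encoding_def by (rule someI_ex[OF fin_gen_embedding[OF assms]])

definition encode_obj ::
  "('a, 'v) module \<times> 'v set \<Rightarrow> ('a, (nat \<Rightarrow> 'a) set) module \<times> (nat \<Rightarrow> 'a) set set" where
  "encode_obj X = (transported (encoding (fst X)) (fst X), encoding (fst X) ` snd X)"

definition encode_mor ::
  "('a, 'v) module \<times> 'v set \<Rightarrow> ('a, 'v) module \<times> 'v set \<Rightarrow> ('v \<Rightarrow> 'v)
    \<Rightarrow> (nat \<Rightarrow> 'a) set \<Rightarrow> (nat \<Rightarrow> 'a) set" where
  "encode_mor X Y f = (\<lambda>y\<in>encoding (fst X) ` carrier (fst X).
      encoding (fst Y) (f (inv_into (carrier (fst X)) (encoding (fst X)) y)))"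

lemma encode_obj_closed:
  assumes "X \<in> Obj (submodule_category R)"
  shows "encode_obj X \<in> Obj (submodule_category R)"
proof -
  obtain M U where X[simp]: "X = (M, U)" by (cases X)
  have M: "module R M" "fin_gen R M" "submodule U R M" using assms by auto
  note h = inj_encoding[OF M(1,2)]
  have "submodule ((\<lambda>x\<in>carrier M. encoding M x) ` U) R (transported (encoding M) M)"
    by (rule submodule_image[OF M(1) module_transported[OF M(1) h] transport_linear(1)[OF M(1) h] M(3)])
  moreover have "(\<lambda>x\<in>carrier M. encoding M x) ` U = encoding M ` U"
    using submodule_closed(1)[OF M(3)] by (intro image_cong) auto
  ultimately show ?thesis
    using module_transported[OF M(1) h] fin_gen_transported[OF M(1) h M(2)] by (simp add: encode_obj_def)
qed

text \<open>Transport of structure is an isomorphism on each pair, so conjugation by it is bijective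
  and additive on morphisms. The three facts are the hypotheses of
  \<open>controlled_embedding_transport\<close>.\<close>

lemma encode_functor:
  fixes R :: "('a, 'c) ring_scheme"
  defines "A' \<equiv> submodule_category R :: (('a, 'v) module \<times> 'v set, 'v \<Rightarrow> 'v) category"
    and "A \<equiv> submodule_category R :: 'a submodule_category"
  shows "is_functor A' A encode_obj encode_mor"
    and "\<And>X Y. X \<in> Obj A' \<Longrightarrow> Y \<in> Obj A' \<Longrightarrow>
      bij_betw (encode_mor X Y) (Mor A' X Y) (Mor A (encode_obj X) (encode_obj Y))"
    and "\<And>X Y. X \<in> Obj A' \<Longrightarrow> Y \<in> Obj A' \<Longrightarrow>
      encode_mor X Y \<in> hom (Hom A' X Y) (Hom A (encode_obj X) (encode_obj Y))"
proof -
  have mem: "encode_mor (M, U) (N, V) f \<in> Mor A (encode_obj (M, U)) (encode_obj (N, V))"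
    and dec: "\<And>x. x \<in> carrier M \<Longrightarrow> encode_mor (M, U) (N, V) f (encoding M x) = encoding N (f x)"
    if M: "module R M" "fin_gen R M" "submodule U R M" and N: "module R N" "fin_gen R N" "submodule V R N"
      and f: "f \<in> linear_maps R M N" "f ` U \<subseteq> V"
    for M N :: "('a, 'v) module" and U V f
  proof -
    note hM = inj_encoding[OF M(1,2)] and hN = inj_encoding[OF N(1,2)]
    have fN: "f x \<in> carrier N" if "x \<in> carrier M" for x using linear_mapsD(2)[OF f(1)] that .
    show dec: "encode_mor (M, U) (N, V) f (encoding M x) = encoding N (f x)" if "x \<in> carrier M" for x
      using that by (simp add: encode_mor_def inv_into_f_f[OF hM])
    have "encode_mor (M, U) (N, V) f \<in> linear_maps R (transported (encoding M) M) (transported (encoding N) N)"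
    proof (rule linear_mapsI)
      show "encode_mor (M, U) (N, V) f \<in> extensional (carrier (transported (encoding M) M))"
        by (simp add: encode_mor_def)
    qed (use dec fN module.smult_closed[OF M(1)] abelian_monoid.a_closed[OF abelian_group.axioms(1), OF module.axioms(2)[OF M(1)]]
          linear_mapsD(3,4)[OF f(1)] in \<open>auto simp: inv_into_f_f[OF hM] inv_into_f_f[OF hN]\<close>)
    moreover have "x \<in> carrier M" if "x \<in> U" for x using submodule_closed(1)[OF M(3)] that by blast
    ultimately show "encode_mor (M, U) (N, V) f \<in> Mor A (encode_obj (M, U)) (encode_obj (N, V))"
      using f(2) dec by (auto simp: A_def encode_obj_def)
  qed
  show "is_functor A' A encode_obj encode_mor"
    unfolding is_functor_def
  proof (intro conjI ballI)
    fix X assume X: "X \<in> Obj A'"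
    then show "encode_obj X \<in> Obj A" unfolding A'_def A_def by (rule encode_obj_closed)
    obtain M U where [simp]: "X = (M, U)" by (cases X)
    have M: "module R M" "fin_gen R M" "submodule U R M" using X by (auto simp: A'_def)
    show "encode_mor X X (Ident A' X) = Ident A (encode_obj X)"
      using inv_into_f_f[OF inj_encoding[OF M(1,2)]]
      by (auto simp: A'_def A_def encode_obj_def encode_mor_def intro!: restrict_ext)
  next
    fix X Y f assume "X \<in> Obj A'" "Y \<in> Obj A'" "f \<in> Mor A' X Y"
    then show "encode_mor X Y f \<in> Mor A (encode_obj X) (encode_obj Y)"
      by (cases X; cases Y) (auto simp: A'_def intro!: mem)
  next
    fix X Y Z f g
    assume *: "X \<in> Obj A'" "Y \<in> Obj A'" "Z \<in> Obj A'" "f \<in> Mor A' X Y" "g \<in> Mor A' Y Z"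
    obtain M U N V P W where [simp]: "X = (M, U)" "Y = (N, V)" "Z = (P, W)"
      by (cases X; cases Y; cases Z)
    have M: "module R M" "fin_gen R M" "submodule U R M" and N: "module R N" "fin_gen R N" "submodule V R N"
      and P: "module R P" "fin_gen R P" "submodule W R P"
      and f: "f \<in> linear_maps R M N" "f ` U \<subseteq> V" and g: "g \<in> linear_maps R N P" "g ` V \<subseteq> W"
      using * by (auto simp: A'_def)
    show "encode_mor X Z (Comp A' X Y Z g f) =
        Comp A (encode_obj X) (encode_obj Y) (encode_obj Z) (encode_mor Y Z g) (encode_mor X Y f)"
      using inv_into_f_f[OF inj_encoding[OF M(1,2)]] linear_mapsD(2)[OF f(1)]
        dec[OF M N f] dec[OF N P g]
      by (auto simp: A'_def A_def encode_obj_def compose_def intro!: extensionalityI[where A = "encoding M ` carrier M"])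
        (auto simp: encode_mor_def)
  qed
  fix X Y assume XY: "X \<in> Obj A'" "Y \<in> Obj A'"
  obtain M U N V where [simp]: "X = (M, U)" "Y = (N, V)" by (cases X; cases Y)
  have M: "module R M" "fin_gen R M" "submodule U R M" and N: "module R N" "fin_gen R N" "submodule V R N"
    using XY by (auto simp: A'_def)
  note hM = inj_encoding[OF M(1,2)] and hN = inj_encoding[OF N(1,2)]
  note iM = inv_into_f_f[OF hM] and iN = inv_into_f_f[OF hN]
  show "bij_betw (encode_mor X Y) (Mor A' X Y) (Mor A (encode_obj X) (encode_obj Y))"
  proof (rule bij_betwI[where g = "\<lambda>g. \<lambda>x\<in>carrier M. inv_into (carrier N) (encoding N) (g (encoding M x))"])
    show "encode_mor X Y \<in> Mor A' X Y \<rightarrow> Mor A (encode_obj X) (encode_obj Y)"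
      using mem[OF M N] by (auto simp: A'_def)
    show "(\<lambda>g. \<lambda>x\<in>carrier M. inv_into (carrier N) (encoding N) (g (encoding M x)))
       \<in> Mor A (encode_obj X) (encode_obj Y) \<rightarrow> Mor A' X Y"
    proof
      fix g assume "g \<in> Mor A (encode_obj X) (encode_obj Y)"
      then have g: "g \<in> linear_maps R (transported (encoding M) M) (transported (encoding N) N)"
        and gU: "g ` encoding M ` U \<subseteq> encoding N ` V" by (auto simp: A_def encode_obj_def)
      have gN: "\<exists>y\<in>carrier N. g (encoding M x) = encoding N y" if "x \<in> carrier M" for x
        using linear_mapsD(2)[OF g, of "encoding M x"] that by auto
      have "(\<lambda>x\<in>carrier M. inv_into (carrier N) (encoding N) (g (encoding M x))) \<in> linear_maps R M N"
      proof (rule restrict_linear_mapsI)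
        show "left_module R M" using M(1) module_imp_left_module by blast
        show "inv_into (carrier N) (encoding N) (g (encoding M x)) \<in> carrier N" if "x \<in> carrier M" for x
          using gN[OF that] by (auto simp: iN)
        show "inv_into (carrier N) (encoding N) (g (encoding M (x \<oplus>\<^bsub>M\<^esub> y)))
           = inv_into (carrier N) (encoding N) (g (encoding M x)) \<oplus>\<^bsub>N\<^esub> inv_into (carrier N) (encoding N) (g (encoding M y))"
          if "x \<in> carrier M" "y \<in> carrier M" for x y
          using linear_mapsD(3)[OF g, of "encoding M x" "encoding M y"] gN[OF that(1)] gN[OF that(2)] that
            abelian_monoid.a_closed[OF abelian_group.axioms(1), OF module.axioms(2)[OF N(1)]]
          by (auto simp: iM iN)
        show "inv_into (carrier N) (encoding N) (g (encoding M (a \<odot>\<^bsub>M\<^esub> x)))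
           = a \<odot>\<^bsub>N\<^esub> inv_into (carrier N) (encoding N) (g (encoding M x))"
          if "a \<in> carrier R" "x \<in> carrier M" for a x
          using linear_mapsD(4)[OF g that(1), of "encoding M x"] gN[OF that(2)] that
            module.smult_closed[OF N(1)]
          by (auto simp: iM iN)
      qed
      moreover have "inv_into (carrier N) (encoding N) (g (encoding M x)) \<in> V" if "x \<in> U" for x
      proof -
        have "g (encoding M x) \<in> encoding N ` V" using that by (intro subsetD[OF gU] imageI)
        then obtain y where "y \<in> V" "g (encoding M x) = encoding N y" by (elim imageE)
        moreover have "y \<in> carrier N" using submodule_closed(1)[OF N(3)] \<open>y \<in> V\<close> by blast
        ultimately show ?thesis by (simp add: iN)
      qed
      moreover have "x \<in> carrier M" if "x \<in> U" for x using submodule_closed(1)[OF M(3)] that by blast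
      ultimately show "(\<lambda>x\<in>carrier M. inv_into (carrier N) (encoding N) (g (encoding M x))) \<in> Mor A' X Y"
        by (auto simp: A'_def)
    qed
    fix f assume "f \<in> Mor A' X Y"
    then have f: "f \<in> linear_maps R M N" "f ` U \<subseteq> V" by (auto simp: A'_def)
    show "(\<lambda>x\<in>carrier M. inv_into (carrier N) (encoding N) (encode_mor X Y f (encoding M x))) = f"
      using dec[OF M N f] linear_mapsD(1,2)[OF f(1)] iN
      by (intro extensionalityI[where A = "carrier M"]) auto
  next
    fix g assume "g \<in> Mor A (encode_obj X) (encode_obj Y)"
    then have g: "g \<in> linear_maps R (transported (encoding M) M) (transported (encoding N) N)"
      by (auto simp: A_def encode_obj_def)
    have "encoding N (inv_into (carrier N) (encoding N) (g (encoding M x))) = g (encoding M x)"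
      if "x \<in> carrier M" for x
      using linear_mapsD(2)[OF g, of "encoding M x"] that by (intro f_inv_into_f) auto
    then show "encode_mor X Y (\<lambda>x\<in>carrier M. inv_into (carrier N) (encoding N) (g (encoding M x))) = g"
      using linear_mapsD(1)[OF g] iM
      by (intro extensionalityI[where A = "encoding M ` carrier M"]) (auto simp: encode_mor_def)
  qed
  show "encode_mor X Y \<in> hom (Hom A' X Y) (Hom A (encode_obj X) (encode_obj Y))"
  proof (rule homI)
    fix f assume "f \<in> Mor A' X Y"
    then have f: "f \<in> linear_maps R M N" "f ` U \<subseteq> V" by (auto simp: A'_def)
    then show "encode_mor X Y f \<in> Mor A (encode_obj X) (encode_obj Y)" using mem[OF M N] by simp
    fix g assume "g \<in> Mor A' X Y"
    then have g: "g \<in> linear_maps R M N" "g ` U \<subseteq> V" by (auto simp: A'_def)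
    show "encode_mor X Y (f \<otimes>\<^bsub>Hom A' X Y\<^esub> g)
       = encode_mor X Y f \<otimes>\<^bsub>Hom A (encode_obj X) (encode_obj Y)\<^esub> encode_mor X Y g"
      using linear_mapsD(2)[OF f(1)] linear_mapsD(2)[OF g(1)] iM iN
      by (auto simp: A'_def A_def encode_obj_def encode_mor_def intro!: restrict_ext)
  qed
qed

text \<open>The direct product of the modules, with the product of the submodules, is a direct sum,
  but its elements are tuples of sets and leave the carrier type. It is finitely generated, hence
  can be encoded back; the injections and projections are composed with the encoding and its
  inverse.\<close>

lemma submodule_category_direct_sums:
  fixes R :: "('a, 'c) ring_scheme"
  assumes R: "cring R"
    and F: "\<And>i. i < n \<Longrightarrow> F i \<in> Obj (submodule_category R :: 'a submodule_category)"
  shows "\<exists>D. direct_sum (submodule_category R :: 'a submodule_category) n F D"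
proof -
  let ?A = "submodule_category R :: 'a submodule_category"
  interpret A: preadditive_category ?A by (rule preadditive_submodule_category)
  define M where "M i = fst (F i)" for i
  define U where "U i = snd (F i)" for i
  have FMU: "F i = (M i, U i)" for i by (simp add: M_def U_def)
  have M: "module R (M i)" "fin_gen R (M i)" "submodule (U i) R (M i)" if "i < n" for i
    using F[OF that] by (auto simp: FMU)
  let ?I = "{..<n}"
  define D where "D = direct_product ?I M"
  define W where "W = {x \<in> carrier D. \<forall>i<n. x i \<in> U i}"
  have D: "module R D" unfolding D_def using M(1) by (intro module_direct_product[OF R]) auto
  have Dfg: "fin_gen R D" unfolding D_def using M(1,2) by (intro fin_gen_direct_product[OF R]) auto
  interpret D: module R D by (rule D)
  have ag: "abelian_group (M i)" if "i < n" for i using module.axioms(2)[OF M(1)[OF that]] .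
  note U = submodule_closed[OF M(3)]
  have minusD: "\<ominus>\<^bsub>D\<^esub> x = (\<lambda>i\<in>?I. \<ominus>\<^bsub>M i\<^esub> x i)" if x: "x \<in> carrier D" for x
  proof (rule D.M.minus_equality)
    have xc: "x i \<in> carrier (M i)" if "i < n" for i using x that by (auto simp: D_def)
    show "x \<in> carrier D" by fact
    show "(\<lambda>i\<in>?I. \<ominus>\<^bsub>M i\<^esub> x i) \<in> carrier D" "(\<lambda>i\<in>?I. \<ominus>\<^bsub>M i\<^esub> x i) \<oplus>\<^bsub>D\<^esub> x = \<zero>\<^bsub>D\<^esub>"
      using xc abelian_group.l_neg[OF ag] abelian_group.a_inv_closed[OF ag]
      by (auto simp: D_def intro!: restrict_ext)
  qed
  have W: "submodule W R D"
  proof (rule D.submoduleI)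
    show "\<ominus>\<^bsub>D\<^esub> x \<in> W" if "x \<in> W" for x
      using that U(4) minusD[of x] D.M.a_inv_closed[of x] by (auto simp: W_def)
    show "x \<oplus>\<^bsub>D\<^esub> y \<in> W" if "x \<in> W" "y \<in> W" for x y
      using that U(3) D.M.a_closed[of x y] by (auto simp: W_def) (auto simp: D_def)
    show "a \<odot>\<^bsub>D\<^esub> x \<in> W" if "a \<in> carrier R" "x \<in> W" for a x
      using that U(5) D.smult_closed[of a x] by (auto simp: W_def) (auto simp: D_def)
    show "\<zero>\<^bsub>D\<^esub> \<in> W" using U(2) D.M.zero_closed by (auto simp: W_def) (auto simp: D_def)
  qed (auto simp: W_def)
  define h where "h = encoding D"
  have h: "inj_on h (carrier D)" unfolding h_def by (rule inj_encoding[OF D Dfg])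
  define E where "E = transported h D"
  have E: "module R E" unfolding E_def by (rule module_transported[OF D h])
  interpret E: module R E by (rule E)
  have EO: "(E, h ` W) \<in> Obj ?A"
    using encode_obj_closed[of "(D, W)" R] D Dfg W by (simp add: encode_obj_def E_def h_def)
  note hl = transport_linear(1)[OF D h, folded E_def] and kl = transport_linear(2)[OF D h, folded E_def]
  have sl: "(\<lambda>a\<in>carrier (M i). single ?I M i a) \<in> linear_maps R (M i) D" if "i < n" for i
    unfolding D_def using that M(1) by (intro single_linear) auto
  have cl: "(\<lambda>x\<in>carrier D. x i) \<in> linear_maps R D (M i)" if "i < n" for i
    unfolding D_def using that M(1) by (intro component_linear[OF R]) auto
  have sD: "single ?I M i a \<in> carrier D" if "i < n" "a \<in> carrier (M i)" for i a
    using linear_mapsD(2)[OF sl[OF that(1)] that(2)] that by simp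
  define \<iota> where "\<iota> i = compose (carrier (M i)) (\<lambda>x\<in>carrier D. h x) (\<lambda>a\<in>carrier (M i). single ?I M i a)" for i
  define \<pi> where "\<pi> i = compose (carrier E) (\<lambda>x\<in>carrier D. x i) (\<lambda>y\<in>h ` carrier D. inv_into (carrier D) h y)" for i
  have \<iota>: "\<iota> i a = h (single ?I M i a)" if "i < n" "a \<in> carrier (M i)" for i a
    using that sD by (simp add: \<iota>_def compose_def)
  have \<pi>: "\<pi> i (h x) = x i" if "x \<in> carrier D" for i x
    using that by (simp add: \<pi>_def E_def compose_def inv_into_f_f[OF h])
  have \<iota>l: "\<iota> i \<in> linear_maps R (M i) E" if "i < n" for i
    unfolding \<iota>_def using M(1) that by (intro compose_linear_maps[OF _ sl hl] module_imp_left_module)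
  have \<pi>l: "\<pi> i \<in> linear_maps R E (M i)" if "i < n" for i
    unfolding \<pi>_def using that by (intro compose_linear_maps[OF _ kl cl] module_imp_left_module E)
  have Uc: "x \<in> carrier (M i)" if "i < n" "x \<in> U i" for i x using U(1) that by blast
  have \<iota>A: "\<iota> i \<in> Mor ?A (F i) (E, h ` W)" and \<pi>A: "\<pi> i \<in> Mor ?A (E, h ` W) (F i)" if i: "i < n" for i
  proof -
    have "single ?I M i x \<in> W" if "x \<in> U i" for x
      using sD[OF i Uc[OF i that]] that U(2) i by (auto simp: W_def) (auto simp: single_def)
    then show "\<iota> i \<in> Mor ?A (F i) (E, h ` W)" using \<iota>l[OF i] \<iota>[OF i] Uc[OF i] by (auto simp: FMU)
    show "\<pi> i \<in> Mor ?A (E, h ` W) (F i)" using \<pi>l[OF i] i by (auto simp: FMU W_def \<pi>)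
  qed
  have MorE: "Mor ?A (E, h ` W) (E, h ` W) \<subseteq> carrier E \<rightarrow>\<^sub>E carrier E"
    using linear_maps_subset[of R E E] by auto
  have "direct_sum ?A n F (E, h ` W)"
    unfolding direct_sum_def
  proof (intro conjI exI allI impI)
    fix i j assume i: "i < n" and j: "j < n"
    have "compose (carrier (M i)) (\<pi> j) (\<iota> i) = (if i = j then (\<lambda>x\<in>carrier (M i). x) else (\<lambda>x\<in>carrier (M i). \<zero>\<^bsub>M j\<^esub>))"
      using i j sD by (auto simp: compose_def \<iota> \<pi> single_def intro!: restrict_ext)
    then show "Comp ?A (F i) (E, h ` W) (F j) (\<pi> j) (\<iota> i)
        = (if i = j then Ident ?A (F i) else \<one>\<^bsub>Hom ?A (F i) (F j)\<^esub>)"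
      by (simp add: FMU)
  next
    let ?G = "Hom ?A (E, h ` W) (E, h ` W)"
    let ?t = "\<lambda>i. Comp ?A (E, h ` W) (F i) (E, h ` W) (\<iota> i) (\<pi> i)"
    have G: "comm_group ?G" using A.Hom_comm_group EO by blast
    have t: "?t i \<in> carrier ?G" if "i < n" for i
      using \<iota>A \<pi>A that EO F by (intro A.Comp_closed) auto
    have fp: "finprod ?G ?t ?I \<in> carrier ?G"
      using G t by (intro comm_monoid.finprod_closed comm_group.axioms) auto
    show "finprod ?G ?t ?I = Ident ?A (E, h ` W)"
    proof (rule extensionalityI[where A = "carrier E"])
      show "finprod ?G ?t ?I \<in> extensional (carrier E)" using fp MorE by (auto simp: PiE_iff)
      show "Ident ?A (E, h ` W) \<in> extensional (carrier E)" by simp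
      fix y assume y: "y \<in> carrier E"
      then obtain x where x: "x \<in> carrier D" "y = h x" by (auto simp: E_def)
      have xs: "single ?I M i (x i) \<in> carrier D" if "i < n" for i
        using x(1) that by (intro sD) (auto simp: D_def)
      have "finprod ?G ?t ?I y = finsum E (\<lambda>i. ?t i y) ?I"
        using G t y E.M.abelian_group_axioms MorE unfolding submodule_category_simps
        by (intro finprod_map_group) (auto simp: FMU)
      also have "\<dots> = finsum E (\<lambda>i. (\<lambda>x\<in>carrier D. h x) (single ?I M i (x i))) ?I"
      proof (rule E.M.finsum_cong')
        show "(\<lambda>i. (\<lambda>x\<in>carrier D. h x) (single ?I M i (x i))) \<in> ?I \<rightarrow> carrier E"
          using xs by (auto simp: E_def)
        fix i assume i: "i \<in> ?I"
        have "x i \<in> carrier (M i)" using x i by (auto simp: D_def)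
        then show "?t i y = (\<lambda>x\<in>carrier D. h x) (single ?I M i (x i))"
          using i x y by (simp add: FMU compose_def \<pi> \<iota> sD)
      qed simp
      also have "\<dots> = (\<lambda>x\<in>carrier D. h x) (finsum D (\<lambda>i. single ?I M i (x i)) ?I)"
        by (rule linear_map_finsum[OF hl, symmetric])
          (use D.M.abelian_group_axioms E.M.abelian_group_axioms xs in auto)
      also have "finsum D (\<lambda>i. single ?I M i (x i)) ?I = x"
        unfolding D_def using x(1) M(1) by (intro finsum_singles[OF R]) (auto simp: D_def)
      finally show "finprod ?G ?t ?I y = Ident ?A (E, h ` W) y" using x y by simp
    qed
  qed (use EO \<iota>A \<pi>A in auto)
  then show ?thesis by blast
qed

section \<open>Uniserial rings of finite length\<close>

lemma regular_module_simps [simp]: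
  "carrier (regular_module R) = carrier R" "\<zero>\<^bsub>regular_module R\<^esub> = \<zero>\<^bsub>R\<^esub>"
  "x \<oplus>\<^bsub>regular_module R\<^esub> y = x \<oplus>\<^bsub>R\<^esub> y" "a \<odot>\<^bsub>regular_module R\<^esub> x = a \<otimes>\<^bsub>R\<^esub> x"
  by (simp_all add: regular_module_def)

lemma module_regular_module:
  assumes "cring R" shows "module R (regular_module R)"
proof -
  interpret cring R by fact
  show ?thesis
    by (rule moduleI)
      (auto intro!: abelian_groupI intro: add.l_inv_ex simp: a_ac l_distr r_distr m_assoc assms)
qed

lemma submodule_regular_module_iff:
  fixes R (structure)
  assumes "cring R"
  shows "submodule I R (regular_module R) \<longleftrightarrow> ideal I R"
proof
  interpret cring R by fact
  interpret M: module R "regular_module R" by (rule module_regular_module[OF assms])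
  {
    assume I: "submodule I R (regular_module R)"
    note c = submodule_closed[OF I, simplified]
    have "\<ominus> x \<in> I" if "x \<in> I" for x
      using c(5)[of "\<ominus> \<one>" x] that c(1) by (auto simp: l_minus)
    moreover have "a \<otimes> x \<in> I" if "a \<in> I" "x \<in> carrier R" for a x
      using c(5)[of x a] that c(1) m_comm[of x a] by auto
    ultimately show "ideal I R"
      using c by (intro idealI) (auto simp: ring_axioms subgroup_def m_comm a_inv_def[symmetric])
  next
    assume "ideal I R"
    then interpret ideal I R .
    have "\<ominus>\<^bsub>regular_module R\<^esub> x = \<ominus> x" if "x \<in> carrier R" for x
      using that by (intro M.M.minus_equality) (auto simp: l_neg)
    then show "submodule I R (regular_module R)"
      using a_Hcarr a_inv_closed I_l_closed by (intro M.submoduleI) auto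
  }
qed

text \<open>These are the consequences of uniseriality on which the rest is built. The central one
  is \<open>annihilator\<close>: it is the elementwise form of self-injectivity and makes it
  possible to extend linear maps from torsion submodules.\<close>

locale uniserial_ring = cring R for R (structure) +
  fixes p :: 'a and n :: nat
  assumes p_closed [simp, intro]: "p \<in> carrier R"
    and p_pow_n: "p [^] n = \<zero>"
    and annihilator: "\<lbrakk>m \<le> n; x \<in> carrier R; p [^] m \<otimes> x = \<zero>\<rbrakk> \<Longrightarrow> \<exists>z\<in>carrier R. x = p [^] (n - m) \<otimes> z"
    and Units_or_dvd: "x \<in> carrier R \<Longrightarrow> x \<in> Units R \<or> (\<exists>z\<in>carrier R. x = p \<otimes> z)"
    and radical: "jacobson_radical R = {p \<otimes> z | z. z \<in> carrier R}"
    and not_unit: "p \<notin> Units R"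

text \<open>By uniseriality the composition series contains every ideal. An element \<open>p\<close>
  of the maximal ideal outside the next smaller member multiplies each member of the series onto the
  one below. Hence \<open>N (n - m)\<close> is generated by \<open>p^m\<close>, and the annihilators
  of the powers can be read off from the series.\<close>

lemma uniserial_ring_exists:
  fixes R (structure)
  assumes R: "cring R" and loc: "local_ring R" and uni: "uniserial R"
    and len: "has_length R (regular_module R) n" and n: "2 \<le> n"
  shows "\<exists>p. uniserial_ring R p n"
proof -
  interpret cring R by fact
  obtain N where N0: "N 0 = {\<zero>}" and Nn: "N n = carrier R"
    and Nid: "\<And>i. i \<le> n \<Longrightarrow> ideal (N i) R" and Nlt: "\<And>i. i < n \<Longrightarrow> N i \<subset> N (Suc i)"
    and Ncov: "\<And>i L. i < n \<Longrightarrow> ideal L R \<Longrightarrow> N i \<subseteq> L \<Longrightarrow> L \<subseteq> N (Suc i) \<Longrightarrow> L = N i \<or> L = N (Suc i)"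
    using len unfolding has_length_def submodule_regular_module_iff[OF R] by auto
  have le: "N i \<subseteq> N j" if "i \<le> j" "j \<le> n" for i j
    using that
  proof (induction j)
    case (Suc j)
    then show ?case using Nlt[of j] by (cases "i = Suc j") auto
  qed simp
  have lt: "i \<le> j" if "N i \<subseteq> N j" "i \<le> n" "j \<le> n" for i j
  proof (rule ccontr)
    assume "\<not> i \<le> j"
    then have "N (Suc j) \<subseteq> N i" "N j \<subset> N (Suc j)" using le[of "Suc j" i] Nlt[of j] that by auto
    then show False using that by blast
  qed
  \<comment> \<open>Take the largest \<open>N i\<close> inside \<open>L\<close>. The next member is
    not inside \<open>L\<close>, so by uniseriality it contains \<open>L\<close>, and there is
    nothing strictly between the two.\<close>
  have all: "\<exists>i\<le>n. L = N i" if L: "ideal L R" for L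
  proof -
    define i where "i = (GREATEST i. i \<le> n \<and> N i \<subseteq> L)"
    have "\<zero> \<in> L" using L by (simp add: additive_subgroup.zero_closed ideal.axioms(1))
    then have ex: "0 \<le> n \<and> N 0 \<subseteq> L" using N0 by simp
    have i: "i \<le> n \<and> N i \<subseteq> L" unfolding i_def
      using ex by (intro GreatestI_nat[where P = "\<lambda>i. i \<le> n \<and> N i \<subseteq> L" and k = 0 and b = n]) auto
    have Lc: "L \<subseteq> carrier R" using L by (simp add: additive_subgroup.a_subset ideal.axioms(1))
    show ?thesis
    proof (cases "i = n")
      case True
      then show ?thesis using i Nn Lc by auto
    next
      case False
      then have "i < n" using i by simp
      have "\<not> N (Suc i) \<subseteq> L"
      proof
        assume "N (Suc i) \<subseteq> L"
        then have "Suc i \<le> i"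
          unfolding i_def using \<open>i < n\<close> by (intro Greatest_le_nat[where b = n]) (auto simp: i_def)
        then show False by simp
      qed
      then have "L \<subseteq> N (Suc i)" using uni L Nid[of "Suc i"] \<open>i < n\<close> unfolding uniserial_def by auto
      then show ?thesis using Ncov[OF \<open>i < n\<close> L] i \<open>\<not> N (Suc i) \<subseteq> L\<close> by blast
    qed
  qed
  have Nc: "N i \<subseteq> carrier R" if "i \<le> n" for i
    using Nid[OF that] by (simp add: additive_subgroup.a_subset ideal.axioms(1))
  have NI: "r \<otimes> x \<in> N i" if "i \<le> n" "r \<in> carrier R" "x \<in> N i" for i r x
    using ideal.I_l_closed[OF Nid[OF that(1)]] that by blast
  have Nadd: "x \<oplus> y \<in> N i" if "i \<le> n" "x \<in> N i" "y \<in> N i" for i x y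
    using additive_subgroup.a_closed[OF ideal.axioms(1)[OF Nid[OF that(1)]]] that by blast
  have Nz: "\<zero> \<in> N i" if "i \<le> n" for i
    using additive_subgroup.zero_closed[OF ideal.axioms(1)[OF Nid[OF that(1)]]] .
  have gen: "N (Suc i) = {r \<otimes> a | r. r \<in> carrier R}"
    if i: "i < n" and a: "a \<in> N (Suc i)" "a \<notin> N i" for i a
  proof -
    have ac: "a \<in> carrier R" using Nc[of "Suc i"] i a by auto
    obtain j where j: "j \<le> n" "PIdl a = N j" using all[OF cgenideal_ideal[OF ac]] by blast
    have "PIdl a \<subseteq> N (Suc i)" using NI i a by (auto simp: cgenideal_def)
    then have "j \<le> Suc i" using lt j i by auto
    moreover have "\<not> j \<le> i"
    proof
      assume "j \<le> i"
      then have "a \<in> N i" using cgenideal_self[OF ac] j le[of j i] i by auto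
      then show False using a by blast
    qed
    ultimately have "j = Suc i" by simp
    then show ?thesis using j by (simp add: cgenideal_def)
  qed
  \<comment> \<open>The shift by two names both members used next: \<open>N (Suc n')\<close> is the
    maximal ideal, and \<open>p\<close> will be taken in it but outside \<open>N n'\<close>.\<close>
  obtain n' where n': "n = Suc (Suc n')" using n by (metis Suc_le_D numeral_2_eq_2 Suc_le_mono)
  let ?m = "N (Suc n')"
  have nonunit: "x \<in> ?m" if x: "x \<in> carrier R" "x \<notin> Units R" for x
  proof -
    obtain j where j: "j \<le> n" "PIdl x = N j" using all[OF cgenideal_ideal[OF x(1)]] by blast
    have "j \<noteq> n"
    proof
      assume "j = n"
      then have "\<one> \<in> PIdl x" using j Nn by simp
      then obtain r where "r \<in> carrier R" "\<one> = r \<otimes> x" by (auto simp: cgenideal_def)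
      then show False using x by (auto simp: Units_def m_comm)
    qed
    then have "N j \<subseteq> ?m" using j n' by (intro le) auto
    then show ?thesis using cgenideal_self[OF x(1)] j by blast
  qed
  have one: "\<one> \<notin> ?m"
  proof
    assume "\<one> \<in> ?m"
    then have "x \<in> ?m" if "x \<in> carrier R" for x using NI[of "Suc n'" x "\<one>"] that n' by auto
    then show False using Nlt[of "Suc n'"] Nn n' by auto
  qed
  have unit_not: "x \<notin> ?m" if "x \<in> Units R" for x
    using NI[of "Suc n'" "inv x" x] that one n' by auto
  have max: "maximalideal ?m R"
  proof (rule maximalidealI)
    show "ideal ?m R" using Nid n' by simp
    show "carrier R \<noteq> ?m" using one by auto
    show "J = ?m \<or> J = carrier R" if "ideal J R" "?m \<subseteq> J" "J \<subseteq> carrier R" for J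
      using Ncov[of "Suc n'" J] that Nn n' by auto
  qed
  have "{I. maximalideal I R} = {?m}" using loc max unfolding local_ring_def by blast
  then have jac: "jacobson_radical R = ?m"
    unfolding jacobson_radical_def using Nc[of "Suc n'"] n' by auto
  obtain p where p: "p \<in> ?m" "p \<notin> N n'" using Nlt[of n'] n' by auto
  then have pc: "p \<in> carrier R" using Nc[of "Suc n'"] n' by auto
  have m: "?m = {r \<otimes> p | r. r \<in> carrier R}" using gen[of n' p] p n' by auto
  have step: "N i = {p \<otimes> x | x. x \<in> N (Suc i)}" if i: "i < n" for i
  proof -
    obtain a where a: "a \<in> N (Suc i)" "a \<notin> N i" using Nlt[OF i] by blast
    then have ac: "a \<in> carrier R" using Nc[of "Suc i"] i by auto
    \<comment> \<open>The argument of Nakayama: otherwise \<open>p a\<close> would also generate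
      \<open>N (Suc i)\<close>, so \<open>a = s p a\<close>; but \<open>1 - s p\<close> is a unit
      because \<open>s p\<close> is in the maximal ideal, which forces \<open>a = 0\<close>.\<close>
    have pa: "p \<otimes> a \<in> N i"
    proof (rule ccontr)
      assume neg: "p \<otimes> a \<notin> N i"
      have "p \<otimes> a \<in> N (Suc i)" using NI a i pc by auto
      then have "a \<in> {r \<otimes> (p \<otimes> a) | r. r \<in> carrier R}" using gen[OF i _ neg] a by auto
      then obtain s where s: "s \<in> carrier R" "a = s \<otimes> (p \<otimes> a)" by auto
      have "(\<one> \<ominus> s \<otimes> p) \<otimes> a = a \<ominus> s \<otimes> (p \<otimes> a)"
        using s(1) ac pc by algebra
      also have "\<dots> = \<zero>" using s ac by (simp add: minus_eq r_neg)
      finally have z: "(\<one> \<ominus> s \<otimes> p) \<otimes> a = \<zero>" .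
      have "\<one> \<ominus> s \<otimes> p \<in> Units R"
      proof (rule ccontr)
        assume "\<one> \<ominus> s \<otimes> p \<notin> Units R"
        then have "\<one> \<ominus> s \<otimes> p \<in> ?m" using nonunit s pc by auto
        moreover have "s \<otimes> p \<in> ?m" using s m by auto
        ultimately have "(\<one> \<ominus> s \<otimes> p) \<oplus> s \<otimes> p \<in> ?m" using Nadd n' by auto
        moreover have "(\<one> \<ominus> s \<otimes> p) \<oplus> s \<otimes> p = \<one>" using s pc by algebra
        ultimately show False using one by simp
      qed
      then have "a = \<zero>" using z ac by (metis Units_closed Units_l_cancel r_null zero_closed)
      then show False using a Nz[of i] i by auto
    qed
    show ?thesis
    proof (intro equalityI subsetI)
      fix b assume b: "b \<in> N i"
      then have "b \<in> N (Suc i)" using le[of i "Suc i"] i by auto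
      then obtain r where r: "r \<in> carrier R" "b = r \<otimes> a" using gen[OF i a] by auto
      have "r \<notin> Units R"
      proof
        assume "r \<in> Units R"
        then have "a = inv r \<otimes> b" using r ac by (simp add: m_assoc[symmetric])
        then show False using NI[of i "inv r" b] b a i \<open>r \<in> Units R\<close> by auto
      qed
      then obtain s where s: "s \<in> carrier R" "r = s \<otimes> p" using nonunit[OF r(1)] m by auto
      then have "b = p \<otimes> (s \<otimes> a)" using r ac pc by (simp add: m_ac)
      then show "b \<in> {p \<otimes> x | x. x \<in> N (Suc i)}" using NI[of "Suc i" s a] a i s by auto
    next
      fix b assume "b \<in> {p \<otimes> x | x. x \<in> N (Suc i)}"
      then obtain x where x: "x \<in> N (Suc i)" "b = p \<otimes> x" by auto
      then obtain r where r: "r \<in> carrier R" "x = r \<otimes> a" using gen[OF i a] by auto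
      then have "b = r \<otimes> (p \<otimes> a)" using x ac pc by (simp add: m_ac)
      then show "b \<in> N i" using NI[of i r "p \<otimes> a"] pa r i by auto
    qed
  qed
  have pow: "N (n - m) = {p [^] m \<otimes> x | x. x \<in> carrier R}" if "m \<le> n" for m
    using that
  proof (induction m)
    case 0
    then show ?case using Nn by auto (metis l_one)
  next
    case (Suc m)
    have eq: "p \<otimes> (p [^] m \<otimes> x) = p [^] Suc m \<otimes> x" if "x \<in> carrier R" for x
      using that pc by (simp add: m_ac)
    have "N (n - Suc m) = {p \<otimes> x | x. x \<in> N (n - m)}"
      using step[of "n - Suc m"] Suc.prems by (simp add: Suc_diff_Suc)
    also have "\<dots> = {p \<otimes> (p [^] m \<otimes> x) | x. x \<in> carrier R}"
      using Suc by auto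
    also have "\<dots> = {p [^] Suc m \<otimes> x | x. x \<in> carrier R}"
      using eq by (intro Collect_cong) (metis eq)
    finally show ?case .
  qed
  have pn: "p [^] n = \<zero>"
  proof -
    have "p [^] n \<otimes> \<one> \<in> N (n - n)" unfolding pow[OF order_refl] by blast
    then show ?thesis using N0 pc by simp
  qed
  \<comment> \<open>If \<open>x\<close> generated \<open>N j\<close> with \<open>j\<close> at least
    2, then \<open>p N j\<close>, which is the nonzero ideal \<open>N (j - 1)\<close>, would vanish
    together with \<open>p x\<close>.\<close>
  have ann1: "x \<in> N 1" if x: "x \<in> carrier R" "p \<otimes> x = \<zero>" for x
  proof -
    obtain j where j: "j \<le> n" "PIdl x = N j" using all[OF cgenideal_ideal[OF x(1)]] by blast
    have "j \<le> 1"
    proof (rule ccontr)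
      assume "\<not> j \<le> 1"
      then obtain i where i: "j = Suc (Suc i)" by (metis One_nat_def Suc_le_D not_less_eq_eq)
      have "N (Suc i) \<subseteq> {\<zero>}"
      proof
        fix b assume "b \<in> N (Suc i)"
        then obtain y where y: "y \<in> PIdl x" "b = p \<otimes> y" using step[of "Suc i"] i j by auto
        then obtain r where r: "r \<in> carrier R" "y = r \<otimes> x" by (auto simp: cgenideal_def)
        then have "b = r \<otimes> (p \<otimes> x)" using y x(1) pc by (simp add: m_ac)
        then show "b \<in> {\<zero>}" using r x by simp
      qed
      then have "N (Suc i) \<subseteq> N 0" using N0 by simp
      then show False using lt[of "Suc i" 0] i j by auto
    qed
    then show ?thesis using cgenideal_self[OF x(1)] j le[of j 1] n by auto
  qed
  have div: "x \<in> N (Suc i)" if x: "x \<in> carrier R" "p \<otimes> x \<in> N i" "i < n" for x i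
  proof -
    obtain y where y: "y \<in> N (Suc i)" "p \<otimes> x = p \<otimes> y" using step[OF x(3)] x(2) by auto
    have yc: "y \<in> carrier R" using y Nc[of "Suc i"] x by auto
    have "p \<otimes> (x \<ominus> y) = p \<otimes> x \<ominus> p \<otimes> y" using x(1) yc pc by algebra
    also have "\<dots> = \<zero>" using y x pc yc by (simp add: minus_eq r_neg)
    finally have "p \<otimes> (x \<ominus> y) = \<zero>" .
    then have "x \<ominus> y \<in> N (Suc i)" using ann1[of "x \<ominus> y"] x yc le[of 1 "Suc i"] by auto
    then have "(x \<ominus> y) \<oplus> y \<in> N (Suc i)" using Nadd[of "Suc i"] y x by auto
    moreover have "(x \<ominus> y) \<oplus> y = x" using x(1) yc by algebra
    ultimately show ?thesis by simp
  qed
  have ann: "x \<in> N m" if "m \<le> n" "x \<in> carrier R" "p [^] m \<otimes> x = \<zero>" for m x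
    using that
  proof (induction m arbitrary: x)
    case 0
    then show ?case using N0 by simp
  next
    case (Suc m)
    have "p [^] m \<otimes> (p \<otimes> x) = \<zero>" using Suc.prems pc by (simp add: m_assoc)
    then have "p \<otimes> x \<in> N m" using Suc pc by auto
    then show ?case using div[of x m] Suc.prems by simp
  qed
  have "uniserial_ring R p n"
  proof (intro uniserial_ring.intro uniserial_ring_axioms.intro)
    show "\<exists>z\<in>carrier R. x = p [^] (n - m) \<otimes> z" if "m \<le> n" "x \<in> carrier R" "p [^] m \<otimes> x = \<zero>" for m x
      using ann[OF that] pow[of "n - m"] that by auto
    show "x \<in> Units R \<or> (\<exists>z\<in>carrier R. x = p \<otimes> z)" if "x \<in> carrier R" for x
      using nonunit[of x] m that pc m_comm by auto
    show "jacobson_radical R = {p \<otimes> z | z. z \<in> carrier R}"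
      unfolding jac m using pc m_comm by (auto; metis)
    show "p \<notin> Units R" using unit_not p by blast
  qed (use R pc pn in auto)
  then show ?thesis by blast
qed

section \<open>Torsion in free modules\<close>

lemma finsum_lessThan_singleton:
  assumes "abelian_monoid M" "k < (d::nat)" "y \<in> carrier M"
  shows "finsum M (\<lambda>j. if j = k then y else \<zero>\<^bsub>M\<^esub>) {..<d} = y"
proof -
  interpret abelian_monoid M by fact
  have "finsum M (\<lambda>j. if k = j then y else \<zero>\<^bsub>M\<^esub>) {..<d} = y"
    using assms by (intro add.finprod_singleton[where f = "\<lambda>_. y"]) auto
  then show ?thesis by (simp add: eq_commute[of k] cong: if_cong)
qed

context uniserial_ring
begin

definition F :: "nat \<Rightarrow> ('a, nat \<Rightarrow> 'a) module" where
  "F d = direct_product {..<d} (\<lambda>_. regular_module R)"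

text \<open>The \<open>p\<^sup>m\<close>-torsion of a free module is a direct sum of copies of \<open>R/p\<^sup>m\<close>; representing
  these modules as torsion submodules avoids cosets.\<close>

definition T :: "nat \<Rightarrow> nat \<Rightarrow> ('a, nat \<Rightarrow> 'a) module" where
  "T d m = F d \<lparr>carrier := {x \<in> carrier (F d). p [^] m \<odot>\<^bsub>F d\<^esub> x = \<zero>\<^bsub>F d\<^esub>}\<rparr>"

lemma T_simps [simp]:
  "x \<in> carrier (T d m) \<longleftrightarrow> x \<in> carrier (F d) \<and> p [^] m \<odot>\<^bsub>F d\<^esub> x = \<zero>\<^bsub>F d\<^esub>"
  "\<zero>\<^bsub>T d m\<^esub> = \<zero>\<^bsub>F d\<^esub>" "x \<oplus>\<^bsub>T d m\<^esub> y = x \<oplus>\<^bsub>F d\<^esub> y" "a \<odot>\<^bsub>T d m\<^esub> x = a \<odot>\<^bsub>F d\<^esub> x"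
  by (simp_all add: T_def)

lemma ring_cring: "cring R" ..

lemma module_F: "module R (F d)"
  unfolding F_def using ring_cring by (intro module_direct_product module_regular_module)

sublocale F: module R "F d" for d by (rule module_F)

lemma pow_closed [simp]: "p [^] (k::nat) \<in> carrier R" by simp

lemma pow_pow [simp]:
  "x \<in> carrier (F d) \<Longrightarrow> p [^] j \<odot>\<^bsub>F d\<^esub> (p [^] k \<odot>\<^bsub>F d\<^esub> x) = p [^] (j + k :: nat) \<odot>\<^bsub>F d\<^esub> x"
  by (simp add: F.smult_assoc1[symmetric] nat_pow_mult)

lemma pow_ge_n [simp]: "n \<le> k \<Longrightarrow> x \<in> carrier (F d) \<Longrightarrow> p [^] k \<odot>\<^bsub>F d\<^esub> x = \<zero>\<^bsub>F d\<^esub>"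
proof -
  assume "n \<le> k" "x \<in> carrier (F d)"
  then have "p [^] k = p [^] (k - n) \<otimes> p [^] n" by (simp add: nat_pow_mult)
  then show ?thesis using p_pow_n \<open>x \<in> _\<close> by simp
qed

lemma pow_mono:
  "p [^] k \<odot>\<^bsub>F d\<^esub> x = \<zero>\<^bsub>F d\<^esub> \<Longrightarrow> x \<in> carrier (F d) \<Longrightarrow> k \<le> (l::nat) \<Longrightarrow> p [^] l \<odot>\<^bsub>F d\<^esub> x = \<zero>\<^bsub>F d\<^esub>"
  using pow_pow[of x d "l - k" k] by simp

lemma pow_commute:
  "a \<in> carrier R \<Longrightarrow> x \<in> carrier (F d) \<Longrightarrow>
    p [^] (k::nat) \<odot>\<^bsub>F d\<^esub> (a \<odot>\<^bsub>F d\<^esub> x) = a \<odot>\<^bsub>F d\<^esub> (p [^] k \<odot>\<^bsub>F d\<^esub> x)"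
  by (simp add: F.smult_assoc1[symmetric] m_comm)

lemma submodule_torsion: "submodule {x \<in> carrier (F d). p [^] (m::nat) \<odot>\<^bsub>F d\<^esub> x = \<zero>\<^bsub>F d\<^esub>} R (F d)"
  by (rule F.submoduleI) (auto simp: F.smult_r_minus F.smult_r_distr pow_commute)

lemma module_T: "module R (T d m)"
  unfolding T_def by (rule submodule.submodule_is_module[OF submodule_torsion module_F])

lemma left_module_T: "left_module R (T d m)" using module_T module_imp_left_module by blast
lemma left_module_F: "left_module R (F d)" using module_F module_imp_left_module by blast

text \<open>This is \<open>annihilator\<close> in each coordinate. Together with
  \<open>p^n = 0\<close> it identifies the \<open>p^m\<close>-torsion of \<open>F d\<close> with
  \<open>p^(n - m) F d\<close>, which is a copy of \<open>(R/p^m)^d\<close>.\<close>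

lemma torsion_dvd:
  assumes "m \<le> n" "x \<in> carrier (T d m)"
  shows "\<exists>r\<in>carrier (F d). x = p [^] (n - m) \<odot>\<^bsub>F d\<^esub> r"
proof -
  have x: "\<And>i. i < d \<Longrightarrow> x i \<in> carrier R" "x \<in> extensional {..<d}" using assms(2) by (auto simp: F_def PiE_iff)
  have eq: "p [^] m \<odot>\<^bsub>F d\<^esub> x = \<zero>\<^bsub>F d\<^esub>" using assms by simp
  have "p [^] m \<otimes> x i = \<zero>" if "i < d" for i using fun_cong[OF eq, of i] that by (simp add: F_def)
  then have "\<forall>i\<in>{..<d}. \<exists>z. z \<in> carrier R \<and> x i = p [^] (n - m) \<otimes> z"
    using annihilator[OF assms(1)] x(1) by (metis lessThan_iff)
  then obtain z where z: "\<And>i. i < d \<Longrightarrow> z i \<in> carrier R \<and> x i = p [^] (n - m) \<otimes> z i"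
    using bchoice[of "{..<d}" "\<lambda>i z. z \<in> carrier R \<and> x i = p [^] (n - m) \<otimes> z"] by auto
  show ?thesis
    using z x(2) by (intro bexI[of _ "\<lambda>i\<in>{..<d}. z i"])
      (auto simp: F_def intro!: extensionalityI[where A = "{..<d}"])
qed

lemma torsion_dvd_torsion:
  assumes "x \<in> carrier (T d l)" "l \<le> m" "m \<le> n"
  shows "\<exists>y\<in>carrier (T d m). x = p [^] (m - l) \<odot>\<^bsub>F d\<^esub> y"
proof -
  obtain r where r: "r \<in> carrier (F d)" "x = p [^] (n - l) \<odot>\<^bsub>F d\<^esub> r"
    using torsion_dvd[of l x d] assms by auto
  have "p [^] (n - m) \<odot>\<^bsub>F d\<^esub> r \<in> carrier (T d m)" using r assms by simp
  moreover have "x = p [^] (m - l) \<odot>\<^bsub>F d\<^esub> (p [^] (n - m) \<odot>\<^bsub>F d\<^esub> r)" using r assms by simp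
  ultimately show ?thesis by blast
qed

section \<open>Linear maps on free modules and on their torsion\<close>

definition unit_vec :: "nat \<Rightarrow> nat \<Rightarrow> nat \<Rightarrow> 'a" where
  "unit_vec d i = (\<lambda>j\<in>{..<d}. if j = i then \<one> else \<zero>)"

lemma unit_vec_closed [simp]: "unit_vec d i \<in> carrier (F d)"
  by (auto simp: unit_vec_def F_def)

lemma F_component [simp]: "x \<in> carrier (F d) \<Longrightarrow> j < d \<Longrightarrow> x j \<in> carrier R"
  by (auto simp: F_def)

lemma F_expansion:
  assumes "x \<in> carrier (F d)"
  shows "(\<Oplus>\<^bsub>F d\<^esub>j\<in>{..<d}. x j \<odot>\<^bsub>F d\<^esub> unit_vec d j) = x"
proof -
  have "(\<Oplus>\<^bsub>F d\<^esub>j\<in>{..<d}. x j \<odot>\<^bsub>F d\<^esub> unit_vec d j)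
    = (\<Oplus>\<^bsub>F d\<^esub>j\<in>{..<d}. single {..<d} (\<lambda>_. regular_module R) j (x j))"
  proof (rule F.M.finsum_cong')
    have *: "x j \<odot>\<^bsub>F d\<^esub> unit_vec d j = single {..<d} (\<lambda>_. regular_module R) j (x j)" if "j < d" for j
      using F_component[OF assms that]
      by (auto simp: F_def single_def unit_vec_def intro!: restrict_ext)
    then show "x j \<odot>\<^bsub>F d\<^esub> unit_vec d j = single {..<d} (\<lambda>_. regular_module R) j (x j)" if "j \<in> {..<d}" for j
      using that by simp
    show "(\<lambda>j. single {..<d} (\<lambda>_. regular_module R) j (x j)) \<in> {..<d} \<rightarrow> carrier (F d)"
      using assms by (auto simp: *[symmetric])
  qed simp
  also have "\<dots> = x"
    using finsum_singles[OF ring_cring _ module_regular_module[OF ring_cring], of "{..<d}" x] assms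
    by (simp add: F_def)
  finally show ?thesis .
qed

lemma linear_map_F_expansion:
  assumes M: "module R M" and g: "g \<in> linear_maps R (F d) M" and x: "x \<in> carrier (F d)"
  shows "g x = (\<Oplus>\<^bsub>M\<^esub>j\<in>{..<d}. x j \<odot>\<^bsub>M\<^esub> g (unit_vec d j))"
proof -
  interpret M: module R M by fact
  have "g x = g (\<Oplus>\<^bsub>F d\<^esub>j\<in>{..<d}. x j \<odot>\<^bsub>F d\<^esub> unit_vec d j)" by (simp only: F_expansion[OF x])
  also have "\<dots> = (\<Oplus>\<^bsub>M\<^esub>j\<in>{..<d}. g (x j \<odot>\<^bsub>F d\<^esub> unit_vec d j))"
    using x by (intro linear_map_finsum[OF g] F.M.abelian_group_axioms M.M.abelian_group_axioms) auto
  also have "\<dots> = (\<Oplus>\<^bsub>M\<^esub>j\<in>{..<d}. x j \<odot>\<^bsub>M\<^esub> g (unit_vec d j))"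
    using x linear_mapsD(2,4)[OF g] by (intro M.M.finsum_cong') auto
  finally show ?thesis .
qed

lemma free_linear_map:
  assumes M: "module R M" and v: "v \<in> {..<d} \<rightarrow> carrier M"
  shows "(\<lambda>x\<in>carrier (F d). \<Oplus>\<^bsub>M\<^esub>j\<in>{..<d}. x j \<odot>\<^bsub>M\<^esub> v j) \<in> linear_maps R (F d) M"
    and "\<And>k. k < d \<Longrightarrow> (\<lambda>x\<in>carrier (F d). \<Oplus>\<^bsub>M\<^esub>j\<in>{..<d}. x j \<odot>\<^bsub>M\<^esub> v j) (unit_vec d k) = v k"
proof -
  let ?g = "\<lambda>x\<in>carrier (F d). \<Oplus>\<^bsub>M\<^esub>j\<in>{..<d}. x j \<odot>\<^bsub>M\<^esub> v j"
  interpret M: module R M by fact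
  have vc: "v j \<in> carrier M" if "j < d" for j using v that by auto
  show "?g \<in> linear_maps R (F d) M"
  proof (rule restrict_linear_mapsI[OF left_module_F])
    fix x y assume x: "x \<in> carrier (F d)" and y: "y \<in> carrier (F d)"
    have "(\<Oplus>\<^bsub>M\<^esub>j\<in>{..<d}. (x \<oplus>\<^bsub>F d\<^esub> y) j \<odot>\<^bsub>M\<^esub> v j) = (\<Oplus>\<^bsub>M\<^esub>j\<in>{..<d}. x j \<odot>\<^bsub>M\<^esub> v j \<oplus>\<^bsub>M\<^esub> y j \<odot>\<^bsub>M\<^esub> v j)"
    proof (rule M.M.finsum_cong')
      show "(x \<oplus>\<^bsub>F d\<^esub> y) j \<odot>\<^bsub>M\<^esub> v j = x j \<odot>\<^bsub>M\<^esub> v j \<oplus>\<^bsub>M\<^esub> y j \<odot>\<^bsub>M\<^esub> v j" if "j \<in> {..<d}" for j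
      proof -
        have "(x \<oplus>\<^bsub>F d\<^esub> y) j = x j \<oplus> y j" using that by (simp add: F_def)
        then show ?thesis using x y vc that by (simp add: M.smult_l_distr)
      qed
    qed (use x y vc in auto)
    also have "\<dots> = (\<Oplus>\<^bsub>M\<^esub>j\<in>{..<d}. x j \<odot>\<^bsub>M\<^esub> v j) \<oplus>\<^bsub>M\<^esub> (\<Oplus>\<^bsub>M\<^esub>j\<in>{..<d}. y j \<odot>\<^bsub>M\<^esub> v j)"
      using x y vc by (intro M.M.finsum_addf) auto
    finally show "(\<Oplus>\<^bsub>M\<^esub>j\<in>{..<d}. (x \<oplus>\<^bsub>F d\<^esub> y) j \<odot>\<^bsub>M\<^esub> v j)
      = (\<Oplus>\<^bsub>M\<^esub>j\<in>{..<d}. x j \<odot>\<^bsub>M\<^esub> v j) \<oplus>\<^bsub>M\<^esub> (\<Oplus>\<^bsub>M\<^esub>j\<in>{..<d}. y j \<odot>\<^bsub>M\<^esub> v j)" .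
  next
    fix a x assume a: "a \<in> carrier R" and x: "x \<in> carrier (F d)"
    have "(\<Oplus>\<^bsub>M\<^esub>j\<in>{..<d}. (a \<odot>\<^bsub>F d\<^esub> x) j \<odot>\<^bsub>M\<^esub> v j) = (\<Oplus>\<^bsub>M\<^esub>j\<in>{..<d}. a \<odot>\<^bsub>M\<^esub> (x j \<odot>\<^bsub>M\<^esub> v j))"
    proof (rule M.M.finsum_cong')
      show "(a \<odot>\<^bsub>F d\<^esub> x) j \<odot>\<^bsub>M\<^esub> v j = a \<odot>\<^bsub>M\<^esub> (x j \<odot>\<^bsub>M\<^esub> v j)" if "j \<in> {..<d}" for j
      proof -
        have "(a \<odot>\<^bsub>F d\<^esub> x) j = a \<otimes> x j" using that by (simp add: F_def)
        then show ?thesis using x a vc that by (simp add: M.smult_assoc1)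
      qed
    qed (use a x vc in auto)
    also have "\<dots> = a \<odot>\<^bsub>M\<^esub> (\<Oplus>\<^bsub>M\<^esub>j\<in>{..<d}. x j \<odot>\<^bsub>M\<^esub> v j)"
      using a x vc by (intro M.finsum_smult_ldistr[symmetric]) auto
    finally show "(\<Oplus>\<^bsub>M\<^esub>j\<in>{..<d}. (a \<odot>\<^bsub>F d\<^esub> x) j \<odot>\<^bsub>M\<^esub> v j) = a \<odot>\<^bsub>M\<^esub> (\<Oplus>\<^bsub>M\<^esub>j\<in>{..<d}. x j \<odot>\<^bsub>M\<^esub> v j)" .
  qed (use vc in \<open>auto intro!: M.M.finsum_closed\<close>)
  fix k assume k: "k < d"
  have "?g (unit_vec d k) = (\<Oplus>\<^bsub>M\<^esub>j\<in>{..<d}. unit_vec d k j \<odot>\<^bsub>M\<^esub> v j)" by simp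
  also have "\<dots> = (\<Oplus>\<^bsub>M\<^esub>j\<in>{..<d}. if j = k then v k else \<zero>\<^bsub>M\<^esub>)"
    using vc k by (intro M.M.finsum_cong') (auto simp: unit_vec_def)
  also have "\<dots> = v k" using k vc by (intro finsum_lessThan_singleton M.M.abelian_monoid_axioms) auto
  finally show "?g (unit_vec d k) = v k" .
qed

lemma linear_maps_F_eqI:
  assumes "module R M" "f \<in> linear_maps R (F d) M" "g \<in> linear_maps R (F d) M"
    "\<And>j. j < d \<Longrightarrow> f (unit_vec d j) = g (unit_vec d j)" "x \<in> carrier (F d)"
  shows "f x = g x"
proof -
  interpret M: module R M by fact
  show ?thesis
    unfolding linear_map_F_expansion[OF assms(1,2,5)] linear_map_F_expansion[OF assms(1,3,5)]
    using assms(4,5) linear_mapsD(2)[OF assms(3)] by (intro M.M.finsum_cong') auto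
qed

lemma smult_pow_linear: "(\<lambda>x\<in>carrier (F d). p [^] (k::nat) \<odot>\<^bsub>F d\<^esub> x) \<in> linear_maps R (F d) (F d)"
  by (rule restrict_linear_mapsI[OF left_module_F]) (auto simp: F.smult_r_distr pow_commute)

text \<open>Self-injectivity made explicit: \<open>T d m\<close> is generated by the vectors
  \<open>p^(n - m) e_j\<close>. The value of \<open>h\<close> on such a vector is killed by
  \<open>p^m\<close>, hence divisible by \<open>p^(n - m)\<close>, and any quotient may serve as the
  value of \<open>H\<close> at \<open>e_j\<close>.\<close>

lemma linear_map_extends:
  assumes m: "m \<le> n" and h: "h \<in> linear_maps R (T d m) (T d' m')"
  shows "\<exists>H\<in>linear_maps R (F d) (F d'). \<forall>x\<in>carrier (T d m). h x = H x"
proof -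
  have hD: "h x \<in> carrier (T d' m')" if "x \<in> carrier (T d m)" for x using linear_mapsD(2)[OF h] that .
  have hm: "h (a \<odot>\<^bsub>F d\<^esub> x) = a \<odot>\<^bsub>F d'\<^esub> h x" if "a \<in> carrier R" "x \<in> carrier (T d m)" for a x
    using linear_mapsD(4)[OF h that] by simp
  have ha: "h (x \<oplus>\<^bsub>F d\<^esub> y) = h x \<oplus>\<^bsub>F d'\<^esub> h y" if "x \<in> carrier (T d m)" "y \<in> carrier (T d m)" for x y
    using linear_mapsD(3)[OF h that] by simp
  let ?k = "\<lambda>x. p [^] (n - m) \<odot>\<^bsub>F d\<^esub> x"
  have kT: "?k x \<in> carrier (T d m)" if "x \<in> carrier (F d)" for x using that m by simp
  have "\<forall>j\<in>{..<d}. \<exists>z. z \<in> carrier (F d') \<and> h (?k (unit_vec d j)) = p [^] (n - m) \<odot>\<^bsub>F d'\<^esub> z"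
  proof
    fix j
    have "p [^] m \<odot>\<^bsub>F d'\<^esub> h (?k (unit_vec d j)) = h (p [^] m \<odot>\<^bsub>F d\<^esub> ?k (unit_vec d j))"
      by (rule hm[OF pow_closed kT[OF unit_vec_closed], symmetric])
    also have "\<dots> = h (\<zero> \<odot>\<^bsub>F d\<^esub> \<zero>\<^bsub>F d\<^esub>)" using m by simp
    also have "\<dots> = \<zero>\<^bsub>F d'\<^esub>" using hD[of "\<zero>\<^bsub>F d\<^esub>"] by (subst hm) auto
    finally have "h (?k (unit_vec d j)) \<in> carrier (T d' m)" using hD kT by simp
    then show "\<exists>z. z \<in> carrier (F d') \<and> h (?k (unit_vec d j)) = p [^] (n - m) \<odot>\<^bsub>F d'\<^esub> z"
      using torsion_dvd[OF m] by blast
  qed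
  then obtain z where z: "\<And>j. j < d \<Longrightarrow> z j \<in> carrier (F d')"
    "\<And>j. j < d \<Longrightarrow> h (?k (unit_vec d j)) = p [^] (n - m) \<odot>\<^bsub>F d'\<^esub> z j"
    using bchoice[of "{..<d}" "\<lambda>j z. z \<in> carrier (F d') \<and> h (?k (unit_vec d j)) = p [^] (n - m) \<odot>\<^bsub>F d'\<^esub> z"] by auto
  define H where "H = (\<lambda>x\<in>carrier (F d). \<Oplus>\<^bsub>F d'\<^esub>j\<in>{..<d}. x j \<odot>\<^bsub>F d'\<^esub> z j)"
  have zP: "z \<in> {..<d} \<rightarrow> carrier (F d')" using z by auto
  have H: "H \<in> linear_maps R (F d) (F d')" "\<And>j. j < d \<Longrightarrow> H (unit_vec d j) = z j"
    using free_linear_map[OF module_F zP] unfolding H_def by auto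
  have "h x = H x" if x: "x \<in> carrier (T d m)" for x
  proof -
    obtain r where r: "r \<in> carrier (F d)" "x = ?k r" using torsion_dvd[OF m x] by blast
    have "(\<lambda>r\<in>carrier (F d). h (?k r)) \<in> linear_maps R (F d) (F d')"
    proof (rule restrict_linear_mapsI[OF left_module_F])
      show "h (?k r) \<in> carrier (F d')" if "r \<in> carrier (F d)" for r using hD[OF kT[OF that]] by simp
      show "h (?k (r \<oplus>\<^bsub>F d\<^esub> s)) = h (?k r) \<oplus>\<^bsub>F d'\<^esub> h (?k s)"
        if "r \<in> carrier (F d)" "s \<in> carrier (F d)" for r s
        using ha[OF kT[OF that(1)] kT[OF that(2)]] that by (simp add: F.smult_r_distr)
      show "h (?k (a \<odot>\<^bsub>F d\<^esub> r)) = a \<odot>\<^bsub>F d'\<^esub> h (?k r)" if "a \<in> carrier R" "r \<in> carrier (F d)" for a r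
        using hm[OF that(1) kT[OF that(2)]] that by (simp add: pow_commute)
    qed
    moreover have "compose (carrier (F d)) H (\<lambda>r\<in>carrier (F d). ?k r) \<in> linear_maps R (F d) (F d')"
      by (intro compose_linear_maps[OF left_module_F smult_pow_linear H(1)])
    moreover have "(\<lambda>r\<in>carrier (F d). h (?k r)) (unit_vec d j)
        = compose (carrier (F d)) H (\<lambda>r\<in>carrier (F d). ?k r) (unit_vec d j)" if "j < d" for j
      using z[OF that] H(2)[OF that] linear_mapsD(4)[OF H(1)] by (simp add: compose_def)
    ultimately have "(\<lambda>r\<in>carrier (F d). h (?k r)) r = compose (carrier (F d)) H (\<lambda>r\<in>carrier (F d). ?k r) r"
      using linear_maps_F_eqI[OF module_F] r(1) by blast
    then show ?thesis using r by (simp add: compose_def)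
  qed
  then show ?thesis using H(1) by blast
qed

text \<open>An extension of \<open>h\<close> sends \<open>p^(n - j) e_i\<close>, which lies in
  \<open>T d j\<close>, to zero. So its values on the unit vectors are killed by
  \<open>p^(n - j)\<close> and are divisible by \<open>p^j\<close>.\<close>

lemma linear_map_extends_dvd:
  assumes m: "m \<le> n" and h: "h \<in> linear_maps R (T d m) (T d' m')"
    and j: "j \<le> m" and kill: "\<And>x. x \<in> carrier (T d j) \<Longrightarrow> h x = \<zero>\<^bsub>F d'\<^esub>"
  shows "\<exists>H\<in>linear_maps R (F d) (F d'). \<forall>x\<in>carrier (T d m). h x = p [^] j \<odot>\<^bsub>F d'\<^esub> H x"
proof -
  obtain H0 where H0: "H0 \<in> linear_maps R (F d) (F d')" "\<And>x. x \<in> carrier (T d m) \<Longrightarrow> h x = H0 x"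
    using linear_map_extends[OF m h] by blast
  have "\<forall>i\<in>{..<d}. \<exists>z. z \<in> carrier (F d') \<and> H0 (unit_vec d i) = p [^] j \<odot>\<^bsub>F d'\<^esub> z"
  proof
    fix i
    have "p [^] (n - j) \<odot>\<^bsub>F d\<^esub> unit_vec d i \<in> carrier (T d j)" using j m by simp
    moreover from this have "p [^] (n - j) \<odot>\<^bsub>F d\<^esub> unit_vec d i \<in> carrier (T d m)"
      using pow_mono j by auto
    ultimately have "H0 (p [^] (n - j) \<odot>\<^bsub>F d\<^esub> unit_vec d i) = \<zero>\<^bsub>F d'\<^esub>"
      using kill H0(2) by metis
    then have "H0 (unit_vec d i) \<in> carrier (T d' (n - j))"
      using linear_mapsD(2,4)[OF H0(1)] by simp
    then show "\<exists>z. z \<in> carrier (F d') \<and> H0 (unit_vec d i) = p [^] j \<odot>\<^bsub>F d'\<^esub> z"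
      using torsion_dvd[of "n - j" _ d'] j m by fastforce
  qed
  then obtain z where z: "\<And>i. i < d \<Longrightarrow> z i \<in> carrier (F d')"
    "\<And>i. i < d \<Longrightarrow> H0 (unit_vec d i) = p [^] j \<odot>\<^bsub>F d'\<^esub> z i"
    using bchoice[of "{..<d}" "\<lambda>i z. z \<in> carrier (F d') \<and> H0 (unit_vec d i) = p [^] j \<odot>\<^bsub>F d'\<^esub> z"] by auto
  define H where "H = (\<lambda>x\<in>carrier (F d). \<Oplus>\<^bsub>F d'\<^esub>j\<in>{..<d}. x j \<odot>\<^bsub>F d'\<^esub> z j)"
  have zP: "z \<in> {..<d} \<rightarrow> carrier (F d')" using z by auto
  have H: "H \<in> linear_maps R (F d) (F d')" "\<And>j. j < d \<Longrightarrow> H (unit_vec d j) = z j"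
    using free_linear_map[OF module_F zP] unfolding H_def by auto
  have "compose (carrier (F d)) (\<lambda>x\<in>carrier (F d'). p [^] j \<odot>\<^bsub>F d'\<^esub> x) H \<in> linear_maps R (F d) (F d')"
    by (intro compose_linear_maps[OF left_module_F H(1) smult_pow_linear])
  from linear_maps_F_eqI[OF module_F H0(1) this]
  have "H0 x = compose (carrier (F d)) (\<lambda>x\<in>carrier (F d'). p [^] j \<odot>\<^bsub>F d'\<^esub> x) H x"
    if "x \<in> carrier (F d)" for x
    using that z H(2) by (simp add: compose_def)
  then show ?thesis
    using H(1) H0(2) linear_mapsD(2)[OF H(1)] by (intro bexI[of _ H]) (auto simp: compose_def)
qed

text \<open>Write \<open>h\<close> as \<open>p^j H\<close> and split the power:
  \<open>p^(a - m)\<close> is spent on the map from \<open>T d a\<close> to \<open>T d m\<close>,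
  the remaining \<open>p^(j - (a - m))\<close> on \<open>h'\<close>. The first inequality in
  \<open>m\<close> makes the splitting possible, the second makes \<open>h'\<close> land in
  \<open>T d' b\<close>. If \<open>a < m\<close>, truncated subtraction gives exponent 0 and the
  first map is the inclusion.\<close>

lemma linear_map_factors:
  assumes a: "a \<le> n" and h: "h \<in> linear_maps R (T d a) (T d' b)"
    and j: "j \<le> a" and kill: "\<And>x. x \<in> carrier (T d j) \<Longrightarrow> h x = \<zero>\<^bsub>F d'\<^esub>"
    and m: "a - m \<le> j" "m \<le> b + (j - (a - m))"
  shows "\<exists>h'\<in>linear_maps R (T d m) (T d' b). \<forall>x\<in>carrier (T d a). h x = h' (p [^] (a - m) \<odot>\<^bsub>F d\<^esub> x)"
proof -
  obtain H where H: "H \<in> linear_maps R (F d) (F d')" "\<And>x. x \<in> carrier (T d a) \<Longrightarrow> h x = p [^] j \<odot>\<^bsub>F d'\<^esub> H x"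
    using linear_map_extends_dvd[OF a h j kill] by blast
  note HD = linear_mapsD[OF H(1)]
  let ?e = "j - (a - m)"
  have Hz: "H \<zero>\<^bsub>F d\<^esub> = \<zero>\<^bsub>F d'\<^esub>" by (rule linear_map_zero[OF H(1) F.M.abelian_group_axioms F.M.abelian_group_axioms])
  have "(\<lambda>x\<in>carrier (T d m). p [^] ?e \<odot>\<^bsub>F d'\<^esub> H x) \<in> linear_maps R (T d m) (T d' b)"
  proof (rule restrict_linear_mapsI[OF left_module_T])
    fix x assume x: "x \<in> carrier (T d m)"
    have "p [^] (b + ?e) \<odot>\<^bsub>F d'\<^esub> H x = H (p [^] (b + ?e) \<odot>\<^bsub>F d\<^esub> x)" using x HD(4) by simp
    also have "\<dots> = \<zero>\<^bsub>F d'\<^esub>" using x pow_mono[where k = m and d = d and x = x and l = "b + ?e"] m Hz by simp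
    finally show "p [^] ?e \<odot>\<^bsub>F d'\<^esub> H x \<in> carrier (T d' b)" using x HD(2) by simp
  qed (use HD in \<open>auto simp: F.smult_r_distr pow_commute\<close>)
  moreover have "h x = (\<lambda>x\<in>carrier (T d m). p [^] ?e \<odot>\<^bsub>F d'\<^esub> H x) (p [^] (a - m) \<odot>\<^bsub>F d\<^esub> x)"
    if x: "x \<in> carrier (T d a)" for x
  proof -
    have "p [^] (a - m) \<odot>\<^bsub>F d\<^esub> x \<in> carrier (T d m)" using x pow_mono[where k = a and d = d and x = x and l = "m + (a - m)"] by simp
    then show ?thesis using x H(2)[OF x] HD(2,4) m by simp
  qed
  ultimately show ?thesis by blast
qed

lemma fin_gen_F: "fin_gen R (F d)"
proof -
  have "fin_gen R (regular_module R)"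
    unfolding fin_gen_def
  proof (intro exI[of _ "{\<one>}"] conjI allI impI)
    fix L assume L: "submodule L R (regular_module R)" "{\<one>} \<subseteq> L"
    have "x \<in> L" if "x \<in> carrier R" for x
      using submodule_closed(5)[OF L(1) that, of \<one>] L(2) that by simp
    then show "L = carrier (regular_module R)" using submodule_closed(1)[OF L(1)] by auto
  qed auto
  then show ?thesis
    unfolding F_def using ring_cring by (intro fin_gen_direct_product module_regular_module) auto
qed

text \<open>Multiplication by \<open>p^(n - m)\<close> maps the free module onto its
  \<open>p^m\<close>-torsion.\<close>

lemma fin_gen_T:
  assumes m: "m \<le> n" shows "fin_gen R (T d m)"
proof -
  let ?k = "\<lambda>x\<in>carrier (F d). p [^] (n - m) \<odot>\<^bsub>F d\<^esub> x"
  have k: "?k \<in> linear_maps R (F d) (T d m)"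
  proof (rule restrict_linear_mapsI[OF left_module_F])
    show "p [^] (n - m) \<odot>\<^bsub>F d\<^esub> x \<in> carrier (T d m)" if "x \<in> carrier (F d)" for x using m that by simp
  qed (simp_all add: F.smult_r_distr pow_commute)
  have "carrier (T d m) \<subseteq> ?k ` carrier (F d)"
  proof
    fix x assume "x \<in> carrier (T d m)"
    then obtain r where "r \<in> carrier (F d)" "x = p [^] (n - m) \<odot>\<^bsub>F d\<^esub> r" by (rule torsion_dvd[OF m, THEN bexE])
    then show "x \<in> ?k ` carrier (F d)" by (intro image_eqI[of _ _ r]) simp_all
  qed
  then have "?k ` carrier (F d) = carrier (T d m)" using linear_mapsD(2)[OF k] by blast
  then show ?thesis by (rule fin_gen_image[OF module_F module_T k _ fin_gen_F])
qed

section \<open>Vector spaces over the residue field\<close>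

text \<open>Take a spanning subfamily of least size: a relation with a unit coefficient would allow
  the corresponding vector to be dropped. Since the residue field acts through \<open>R\<close>,
  independence says that coefficients of a relation are nonunits instead of zero.\<close>

lemma basis_exists:
  assumes V: "module R V" "fin_gen R V" and kill: "\<And>v. v \<in> carrier V \<Longrightarrow> p \<odot>\<^bsub>V\<^esub> v = \<zero>\<^bsub>V\<^esub>"
  shows "\<exists>(d::nat) v. v \<in> {..<d} \<rightarrow> carrier V \<and>
     (\<forall>x\<in>carrier V. \<exists>r\<in>{..<d} \<rightarrow> carrier R. x = (\<Oplus>\<^bsub>V\<^esub>i\<in>{..<d}. r i \<odot>\<^bsub>V\<^esub> v i)) \<and>
     (\<forall>r\<in>{..<d} \<rightarrow> carrier R. (\<Oplus>\<^bsub>V\<^esub>i\<in>{..<d}. r i \<odot>\<^bsub>V\<^esub> v i) = \<zero>\<^bsub>V\<^esub> \<longrightarrow> (\<forall>i<d. r i \<notin> Units R))"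
proof -
  interpret V: module R V by fact
  obtain m :: nat and w where w: "w \<in> {..<m} \<rightarrow> carrier V"
    "\<forall>x\<in>carrier V. \<exists>r\<in>{..<m} \<rightarrow> carrier R. x = (\<Oplus>\<^bsub>V\<^esub>i\<in>{..<m}. r i \<odot>\<^bsub>V\<^esub> w i)"
    using fin_gen_span[OF V] by blast
  define spans where "spans J \<longleftrightarrow> J \<subseteq> {..<m} \<and>
     (\<forall>x\<in>carrier V. \<exists>r\<in>J \<rightarrow> carrier R. x = (\<Oplus>\<^bsub>V\<^esub>i\<in>J. r i \<odot>\<^bsub>V\<^esub> w i))" for J
  have "spans {..<m}" using w by (simp add: spans_def)
  then obtain J where J: "spans J" "\<And>J'. spans J' \<Longrightarrow> card J \<le> card J'"
    using ex_has_least_nat[of spans "{..<m}" card] by auto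
  have Jm: "J \<subseteq> {..<m}" using J(1) by (simp add: spans_def)
  have fin: "finite J" using Jm finite_subset by blast
  have wc: "w i \<in> carrier V" if "i \<in> J" for i using w(1) Jm that by auto
  have indep: "r k \<notin> Units R"
    if r: "r \<in> J \<rightarrow> carrier R" "(\<Oplus>\<^bsub>V\<^esub>i\<in>J. r i \<odot>\<^bsub>V\<^esub> w i) = \<zero>\<^bsub>V\<^esub>" and k: "k \<in> J" for r k
  proof
    assume u: "r k \<in> Units R"
    let ?J = "J - {k}"
    have rc: "r i \<in> carrier R" if "i \<in> J" for i using r that by auto
    have split: "(\<Oplus>\<^bsub>V\<^esub>i\<in>J. s i \<odot>\<^bsub>V\<^esub> w i) = s k \<odot>\<^bsub>V\<^esub> w k \<oplus>\<^bsub>V\<^esub> (\<Oplus>\<^bsub>V\<^esub>i\<in>?J. s i \<odot>\<^bsub>V\<^esub> w i)"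
      if "s \<in> J \<rightarrow> carrier R" for s
    proof -
      have "(\<Oplus>\<^bsub>V\<^esub>i\<in>insert k ?J. s i \<odot>\<^bsub>V\<^esub> w i) = s k \<odot>\<^bsub>V\<^esub> w k \<oplus>\<^bsub>V\<^esub> (\<Oplus>\<^bsub>V\<^esub>i\<in>?J. s i \<odot>\<^bsub>V\<^esub> w i)"
        using that k fin wc by (intro V.M.finsum_insert) auto
      then show ?thesis using k by (simp add: insert_absorb)
    qed
    have "spans ?J"
      unfolding spans_def
    proof (intro conjI ballI)
      show "?J \<subseteq> {..<m}" using Jm by blast
      fix x assume "x \<in> carrier V"
      then obtain s where s: "s \<in> J \<rightarrow> carrier R" "x = (\<Oplus>\<^bsub>V\<^esub>i\<in>J. s i \<odot>\<^bsub>V\<^esub> w i)"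
        using J(1) unfolding spans_def by blast
      have sc: "s i \<in> carrier R" if "i \<in> J" for i using s that by auto
      \<comment> \<open>Adding this multiple of the relation \<open>r\<close> does not change
        \<open>x\<close> but clears the coefficient at \<open>k\<close>.\<close>
      let ?c = "\<ominus> (s k \<otimes> inv (r k))"
      have cc: "?c \<in> carrier R" using sc k u by auto
      let ?t = "\<lambda>i. s i \<oplus> ?c \<otimes> r i"
      have tc: "?t \<in> J \<rightarrow> carrier R" using sc rc cc by auto
      have tk: "?t k = \<zero>"
        using sc[OF k] rc[OF k] u by (simp add: l_minus m_assoc r_neg)
      have "(\<Oplus>\<^bsub>V\<^esub>i\<in>J. ?t i \<odot>\<^bsub>V\<^esub> w i) = (\<Oplus>\<^bsub>V\<^esub>i\<in>J. s i \<odot>\<^bsub>V\<^esub> w i \<oplus>\<^bsub>V\<^esub> ?c \<odot>\<^bsub>V\<^esub> (r i \<odot>\<^bsub>V\<^esub> w i))"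
        using sc rc cc wc by (intro V.M.finsum_cong') (auto simp: V.smult_l_distr V.smult_assoc1)
      also have "\<dots> = x \<oplus>\<^bsub>V\<^esub> (\<Oplus>\<^bsub>V\<^esub>i\<in>J. ?c \<odot>\<^bsub>V\<^esub> (r i \<odot>\<^bsub>V\<^esub> w i))"
        unfolding s(2) using sc rc cc wc by (intro V.M.finsum_addf) auto
      also have "(\<Oplus>\<^bsub>V\<^esub>i\<in>J. ?c \<odot>\<^bsub>V\<^esub> (r i \<odot>\<^bsub>V\<^esub> w i)) = ?c \<odot>\<^bsub>V\<^esub> (\<Oplus>\<^bsub>V\<^esub>i\<in>J. r i \<odot>\<^bsub>V\<^esub> w i)"
        using rc cc wc fin by (intro V.finsum_smult_ldistr[symmetric]) auto
      also have "x \<oplus>\<^bsub>V\<^esub> \<dots> = x" using r(2) cc \<open>x \<in> carrier V\<close> by simp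
      finally have x: "x = (\<Oplus>\<^bsub>V\<^esub>i\<in>J. ?t i \<odot>\<^bsub>V\<^esub> w i)" by simp
      have "(\<Oplus>\<^bsub>V\<^esub>i\<in>?J. ?t i \<odot>\<^bsub>V\<^esub> w i) \<in> carrier V"
        using tc wc by (intro V.M.finsum_closed) auto
      then have "x = (\<Oplus>\<^bsub>V\<^esub>i\<in>?J. ?t i \<odot>\<^bsub>V\<^esub> w i)"
        using x split[OF tc] tk wc[OF k] by simp
      then show "\<exists>r\<in>?J \<rightarrow> carrier R. x = (\<Oplus>\<^bsub>V\<^esub>i\<in>?J. r i \<odot>\<^bsub>V\<^esub> w i)"
        using tc by (intro bexI[of _ ?t]) auto
    qed
    then have "card J \<le> card ?J" by (rule J(2))
    then show False using k fin by (metis card_Diff1_less not_less)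
  qed
  obtain e where e: "bij_betw e {0..<card J} J" using ex_bij_betw_nat_finite[OF fin] by blast
  let ?d = "card J"
  have e: "bij_betw e {..<?d} J" using e by (simp add: lessThan_atLeast0)
  have eJ: "e ` {..<?d} = J" "inj_on e {..<?d}" using e by (auto simp: bij_betw_def)
  have ej: "e i \<in> J" if "i < ?d" for i using eJ that by blast
  have re: "(\<Oplus>\<^bsub>V\<^esub>i\<in>{..<?d}. s (e i) \<odot>\<^bsub>V\<^esub> w (e i)) = (\<Oplus>\<^bsub>V\<^esub>i\<in>J. s i \<odot>\<^bsub>V\<^esub> w i)"
    if "s \<in> J \<rightarrow> carrier R" for s
    using V.M.finsum_reindex[of "\<lambda>i. s i \<odot>\<^bsub>V\<^esub> w i" e "{..<?d}"] eJ that wc by (auto simp: Pi_iff)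
  show ?thesis
  proof (intro exI[of _ ?d] exI[of _ "\<lambda>i. w (e i)"] conjI ballI impI allI)
    show "(\<lambda>i. w (e i)) \<in> {..<?d} \<rightarrow> carrier V" using wc ej by auto
  next
    fix x assume "x \<in> carrier V"
    then obtain s where s: "s \<in> J \<rightarrow> carrier R" "x = (\<Oplus>\<^bsub>V\<^esub>i\<in>J. s i \<odot>\<^bsub>V\<^esub> w i)"
      using J(1) unfolding spans_def by blast
    then show "\<exists>r\<in>{..<?d} \<rightarrow> carrier R. x = (\<Oplus>\<^bsub>V\<^esub>i\<in>{..<?d}. r i \<odot>\<^bsub>V\<^esub> w (e i))"
      using re[OF s(1)] ej by (intro bexI[of _ "\<lambda>i. s (e i)"]) auto
  next
    fix r i assume r: "r \<in> {..<?d} \<rightarrow> carrier R" "(\<Oplus>\<^bsub>V\<^esub>i\<in>{..<?d}. r i \<odot>\<^bsub>V\<^esub> w (e i)) = \<zero>\<^bsub>V\<^esub>" and i: "i < ?d"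
    let ?s = "\<lambda>j. r (inv_into {..<?d} e j)"
    have se: "?s (e i) = r i" if "i < ?d" for i using eJ(2) that by (simp add: inv_into_f_f)
    have sc: "?s \<in> J \<rightarrow> carrier R" using r(1) eJ by (auto simp: inv_into_into Pi_iff) (metis eJ(1) inv_into_into lessThan_iff)
    have "(\<Oplus>\<^bsub>V\<^esub>i\<in>J. ?s i \<odot>\<^bsub>V\<^esub> w i) = (\<Oplus>\<^bsub>V\<^esub>i\<in>{..<?d}. r i \<odot>\<^bsub>V\<^esub> w (e i))"
      unfolding re[OF sc, symmetric] using se r(1) wc ej by (intro V.M.finsum_cong') auto
    then show "r i \<notin> Units R" using indep[OF sc _ ej[OF i]] r(2) se[OF i] by simp
  qed
qed

text \<open>A basis of \<open>V\<close> gives a surjection \<open>q\<close> from \<open>F d\<close>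
  with kernel \<open>p F d\<close>. Multiplication by \<open>p^(n - 1)\<close> maps
  \<open>F d\<close> onto \<open>T d 1\<close> and has the same kernel, so \<open>q\<close> descends
  to a bijection from \<open>T d 1\<close> to \<open>V\<close>.\<close>

lemma socle_iso_exists:
  assumes V: "module R V" "fin_gen R V" and kill: "\<And>v. v \<in> carrier V \<Longrightarrow> p \<odot>\<^bsub>V\<^esub> v = \<zero>\<^bsub>V\<^esub>"
    and n: "1 \<le> n"
  shows "\<exists>d \<sigma>. \<sigma> \<in> linear_maps R (T d 1) V \<and> bij_betw \<sigma> (carrier (T d 1)) (carrier V)"
proof -
  interpret V: module R V by fact
  obtain d :: nat and v where v: "v \<in> {..<d} \<rightarrow> carrier V"
    and sp: "\<And>x. x \<in> carrier V \<Longrightarrow> \<exists>r\<in>{..<d} \<rightarrow> carrier R. x = (\<Oplus>\<^bsub>V\<^esub>i\<in>{..<d}. r i \<odot>\<^bsub>V\<^esub> v i)"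
    and ind: "\<And>r i. r \<in> {..<d} \<rightarrow> carrier R \<Longrightarrow> (\<Oplus>\<^bsub>V\<^esub>i\<in>{..<d}. r i \<odot>\<^bsub>V\<^esub> v i) = \<zero>\<^bsub>V\<^esub> \<Longrightarrow> i < d \<Longrightarrow> r i \<notin> Units R"
    using basis_exists[OF V kill] by blast
  define q where "q = (\<lambda>x\<in>carrier (F d). \<Oplus>\<^bsub>V\<^esub>j\<in>{..<d}. x j \<odot>\<^bsub>V\<^esub> v j)"
  have q: "q \<in> linear_maps R (F d) V" using free_linear_map[OF V(1) v] by (simp add: q_def)
  note qD = linear_mapsD[OF q]
  have qsurj: "\<exists>x\<in>carrier (F d). y = q x" if y: "y \<in> carrier V" for y
  proof -
    obtain r where r: "r \<in> {..<d} \<rightarrow> carrier R" "y = (\<Oplus>\<^bsub>V\<^esub>i\<in>{..<d}. r i \<odot>\<^bsub>V\<^esub> v i)" using sp[OF y] by blast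
    let ?x = "\<lambda>i\<in>{..<d}. r i"
    have "?x \<in> carrier (F d)" using r by (auto simp: F_def)
    moreover from this have "q ?x = y"
      unfolding r(2) using r(1) v by (simp add: q_def) (intro V.M.finsum_cong'; auto)
    ultimately show ?thesis by blast
  qed
  have ker: "q x = \<zero>\<^bsub>V\<^esub> \<longleftrightarrow> (\<exists>z\<in>carrier (F d). x = p \<odot>\<^bsub>F d\<^esub> z)" if x: "x \<in> carrier (F d)" for x
  proof
    assume "q x = \<zero>\<^bsub>V\<^esub>"
    then have "x i \<notin> Units R" if "i < d" for i
      using ind[of x i] x that by (auto simp: q_def)
    then have "\<forall>i\<in>{..<d}. \<exists>z. z \<in> carrier R \<and> x i = p \<otimes> z"
      using Units_or_dvd F_component[OF x] by blast
    then obtain z where z: "\<And>i. i < d \<Longrightarrow> z i \<in> carrier R \<and> x i = p \<otimes> z i"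
      using bchoice[of "{..<d}" "\<lambda>i z. z \<in> carrier R \<and> x i = p \<otimes> z"] by auto
    have "x \<in> extensional {..<d}" using x by (auto simp: F_def PiE_iff)
    then show "\<exists>z\<in>carrier (F d). x = p \<odot>\<^bsub>F d\<^esub> z"
      using z by (intro bexI[of _ "\<lambda>i\<in>{..<d}. z i"])
        (auto simp: F_def intro!: extensionalityI[where A = "{..<d}"])
  qed (use qD kill in auto)
  let ?k = "\<lambda>x. p [^] (n - 1) \<odot>\<^bsub>F d\<^esub> x"
  have kz: "?k x = \<zero>\<^bsub>F d\<^esub> \<longleftrightarrow> q x = \<zero>\<^bsub>V\<^esub>" if x: "x \<in> carrier (F d)" for x
  proof
    assume "?k x = \<zero>\<^bsub>F d\<^esub>"
    then have "x \<in> carrier (T d (n - 1))" using x by simp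
    then obtain r where "r \<in> carrier (F d)" "x = p [^] (n - (n - 1)) \<odot>\<^bsub>F d\<^esub> r"
      using torsion_dvd[of "n - 1" x d] by auto
    moreover have "n - (n - 1) = Suc 0" using n by simp
    ultimately show "q x = \<zero>\<^bsub>V\<^esub>" using ker[OF x] by auto
  next
    assume "q x = \<zero>\<^bsub>V\<^esub>"
    then obtain z where z: "z \<in> carrier (F d)" "x = p \<odot>\<^bsub>F d\<^esub> z" using ker[OF x] by auto
    then have "?k x = p [^] (n - 1) \<odot>\<^bsub>F d\<^esub> (p [^] (1::nat) \<odot>\<^bsub>F d\<^esub> z)" by simp
    also have "\<dots> = \<zero>\<^bsub>F d\<^esub>" using z(1) n by (subst pow_pow) auto
    finally show "?k x = \<zero>\<^bsub>F d\<^esub>" .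
  qed
  have keq: "?k x = ?k y \<longleftrightarrow> q x = q y" if x: "x \<in> carrier (F d)" and y: "y \<in> carrier (F d)" for x y
  proof -
    have my: "\<ominus>\<^bsub>F d\<^esub> y = (\<ominus> \<one>) \<odot>\<^bsub>F d\<^esub> y" using y by (simp add: F.smult_l_minus)
    have "?k x = ?k y \<longleftrightarrow> ?k x \<oplus>\<^bsub>F d\<^esub> \<ominus>\<^bsub>F d\<^esub> ?k y = \<zero>\<^bsub>F d\<^esub>"
      using x y by (metis F.M.a_inv_closed F.M.minus_equality F.M.minus_minus F.M.r_neg F.smult_closed pow_closed)
    also have "\<dots> \<longleftrightarrow> ?k (x \<oplus>\<^bsub>F d\<^esub> \<ominus>\<^bsub>F d\<^esub> y) = \<zero>\<^bsub>F d\<^esub>" using x y by (simp add: F.smult_r_distr F.smult_r_minus)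
    also have "\<dots> \<longleftrightarrow> q (x \<oplus>\<^bsub>F d\<^esub> \<ominus>\<^bsub>F d\<^esub> y) = \<zero>\<^bsub>V\<^esub>" using x y by (intro kz) auto
    also have "q (x \<oplus>\<^bsub>F d\<^esub> \<ominus>\<^bsub>F d\<^esub> y) = q x \<oplus>\<^bsub>V\<^esub> \<ominus>\<^bsub>V\<^esub> q y"
      using x y qD my by (simp add: V.smult_l_minus)
    also have "\<dots> = \<zero>\<^bsub>V\<^esub> \<longleftrightarrow> q x = q y"
      using x y qD(2) by (metis V.M.a_inv_closed V.M.minus_equality V.M.minus_minus V.M.r_neg)
    finally show ?thesis .
  qed
  \<comment> \<open>Which preimage is chosen does not matter: by \<open>keq\<close> two preimages of
    \<open>y\<close> have the same image under \<open>q\<close>.\<close>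
  define \<sigma> where "\<sigma> = (\<lambda>y\<in>carrier (T d 1). q (SOME x. x \<in> carrier (F d) \<and> y = ?k x))"
  have kT: "?k x \<in> carrier (T d 1)" if "x \<in> carrier (F d)" for x using that n pow_pow[of x d 1 "n - 1"] by (simp del: pow_pow)
  have onto: "\<exists>x\<in>carrier (F d). y = ?k x" if "y \<in> carrier (T d 1)" for y
    using torsion_dvd[OF n that] .
  have \<sigma>k: "\<sigma> (?k x) = q x" if x: "x \<in> carrier (F d)" for x
  proof -
    define x' where "x' = (SOME x'. x' \<in> carrier (F d) \<and> ?k x = ?k x')"
    have "x' \<in> carrier (F d) \<and> ?k x = ?k x'" unfolding x'_def by (rule someI[of _ x]) (use x in simp)
    moreover have "\<sigma> (?k x) = q x'" using kT[OF x] by (simp add: \<sigma>_def x'_def del: T_simps)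
    ultimately show ?thesis using keq x by metis
  qed
  have "\<sigma> \<in> linear_maps R (T d 1) V"
  proof (rule linear_mapsI)
    show "\<sigma> \<in> extensional (carrier (T d 1))" unfolding \<sigma>_def by (rule restrict_extensional)
    fix y assume y: "y \<in> carrier (T d 1)"
    obtain x where x: "x \<in> carrier (F d)" "y = ?k x" using onto[OF y] by blast
    show "\<sigma> y \<in> carrier V" using x \<sigma>k qD by simp
    show "\<sigma> (a \<odot>\<^bsub>T d 1\<^esub> y) = a \<odot>\<^bsub>V\<^esub> \<sigma> y" if a: "a \<in> carrier R" for a
    proof -
      have "a \<odot>\<^bsub>F d\<^esub> y = ?k (a \<odot>\<^bsub>F d\<^esub> x)" using x a by (simp add: pow_commute)
      then show ?thesis using x a \<sigma>k qD by simp
    qed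
    fix y' assume y': "y' \<in> carrier (T d 1)"
    obtain x' where x': "x' \<in> carrier (F d)" "y' = ?k x'" using onto[OF y'] by blast
    have "y \<oplus>\<^bsub>F d\<^esub> y' = ?k (x \<oplus>\<^bsub>F d\<^esub> x')" using x x' by (simp add: F.smult_r_distr)
    then show "\<sigma> (y \<oplus>\<^bsub>T d 1\<^esub> y') = \<sigma> y \<oplus>\<^bsub>V\<^esub> \<sigma> y'" using x x' \<sigma>k qD by simp
  qed
  moreover have "bij_betw \<sigma> (carrier (T d 1)) (carrier V)"
  proof (rule bij_betw_imageI)
    show "inj_on \<sigma> (carrier (T d 1))"
    proof (rule inj_onI)
      fix y y' assume "y \<in> carrier (T d 1)" "y' \<in> carrier (T d 1)" and eq: "\<sigma> y = \<sigma> y'"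
      then obtain x x' where "x \<in> carrier (F d)" "y = ?k x" "x' \<in> carrier (F d)" "y' = ?k x'" using onto by metis
      then show "y = y'" using eq \<sigma>k keq by auto
    qed
    show "\<sigma> ` carrier (T d 1) = carrier V"
    proof
      show "\<sigma> ` carrier (T d 1) \<subseteq> carrier V"
        using linear_mapsD(2)[OF calculation] by blast
      show "carrier V \<subseteq> \<sigma> ` carrier (T d 1)"
      proof
        fix y assume "y \<in> carrier V"
        then obtain x where "x \<in> carrier (F d)" "y = q x" using qsurj by blast
        then show "y \<in> \<sigma> ` carrier (T d 1)" using \<sigma>k kT by (intro image_eqI[of _ _ "?k x"]) auto
      qed
    qed
  qed
  ultimately show ?thesis by blast
qed

end

section \<open>The embedding\<close>

lemma finsum_lessThan_6:
  assumes "abelian_monoid M" "\<And>c. c < 6 \<Longrightarrow> g c \<in> carrier M"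
  shows "finsum M g {..<6::nat} = g 0 \<oplus>\<^bsub>M\<^esub> (g 1 \<oplus>\<^bsub>M\<^esub> (g 2 \<oplus>\<^bsub>M\<^esub> (g 3 \<oplus>\<^bsub>M\<^esub> (g 4 \<oplus>\<^bsub>M\<^esub> g 5))))"
proof -
  interpret abelian_monoid M by fact
  have *: "{..<6::nat} = {0, 1, 2, 3, 4, 5}" by auto
  show ?thesis unfolding * using assms(2) by (subst finsum_insert; auto)+
qed

lemma tuple_linear:
  assumes M: "left_module R M" and \<phi>: "\<And>i. i \<in> I \<Longrightarrow> \<phi> i \<in> linear_maps R M (N i)"
  shows "(\<lambda>x\<in>carrier M. \<lambda>i\<in>I. \<phi> i x) \<in> linear_maps R M (direct_product I N)"
  using linear_mapsD(2-)[OF \<phi>]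
  by (intro restrict_linear_mapsI[OF M]) (auto intro!: restrict_ext)

lemma linear_maps_finsum:
  assumes M: "left_module R M" and N: "left_module R N"
    and S: "finite S" "\<And>c. c \<in> S \<Longrightarrow> g c \<in> linear_maps R M N"
  shows "(\<lambda>x\<in>carrier M. \<Oplus>\<^bsub>N\<^esub>c\<in>S. g c x) \<in> linear_maps R M N"
  using S
proof (induction S rule: finite_induct)
  case empty
  interpret N: left_module R N by fact
  show ?case using linear_maps_zero[OF M N] by (simp add: restrict_def)
next
  case (insert s S)
  interpret N: left_module R N by fact
  have "(\<lambda>x\<in>carrier M. g s x \<oplus>\<^bsub>N\<^esub> (\<lambda>x\<in>carrier M. \<Oplus>\<^bsub>N\<^esub>c\<in>S. g c x) x) \<in> linear_maps R M N"
    using insert by (intro linear_maps_add[OF M N]) auto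
  moreover have "(\<lambda>x\<in>carrier M. g s x \<oplus>\<^bsub>N\<^esub> (\<lambda>x\<in>carrier M. \<Oplus>\<^bsub>N\<^esub>c\<in>S. g c x) x)
      = (\<lambda>x\<in>carrier M. \<Oplus>\<^bsub>N\<^esub>c\<in>insert s S. g c x)"
  proof (rule restrict_ext)
    fix x assume x: "x \<in> carrier M"
    have g: "g c x \<in> carrier N" if "c \<in> insert s S" for c
      using linear_mapsD(2)[OF insert.prems[OF that] x] .
    then have "(\<lambda>c. g c x) \<in> S \<rightarrow> carrier N" "g s x \<in> carrier N" by auto
    then show "g s x \<oplus>\<^bsub>N\<^esub> (\<lambda>x\<in>carrier M. \<Oplus>\<^bsub>N\<^esub>c\<in>S. g c x) x = (\<Oplus>\<^bsub>N\<^esub>c\<in>insert s S. g c x)"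
      using insert.hyps x by (simp add: N.M.finsum_insert)
  qed
  ultimately show ?case by (simp only:)
qed

context uniserial_ring
begin

text \<open>With the power recorded as a natural number, exponents add up under simplification, and
  the later vanishing statements become inequalities between numerals.\<close>

definition ppow :: "nat \<Rightarrow> nat \<Rightarrow> (nat \<Rightarrow> 'a) \<Rightarrow> nat \<Rightarrow> 'a" where
  "ppow d k x = p [^] k \<odot>\<^bsub>F d\<^esub> x"

lemma ppow_simps [simp]:
  assumes "x \<in> carrier (F d)"
  shows "ppow d k x \<in> carrier (F d)" "ppow d j (ppow d k x) = ppow d (j + k) x" "ppow d 0 x = x"
    "n \<le> k \<Longrightarrow> ppow d k x = \<zero>\<^bsub>F d\<^esub>"
    "y \<in> carrier (F d) \<Longrightarrow> ppow d k (x \<oplus>\<^bsub>F d\<^esub> y) = ppow d k x \<oplus>\<^bsub>F d\<^esub> ppow d k y"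
  using assms by (simp_all add: ppow_def F.smult_r_distr)

lemma ppow_zero [simp]: "ppow d k \<zero>\<^bsub>F d\<^esub> = \<zero>\<^bsub>F d\<^esub>"
  by (simp add: ppow_def)

lemma ppow_smult: "a \<in> carrier R \<Longrightarrow> x \<in> carrier (F d) \<Longrightarrow> ppow d k (a \<odot>\<^bsub>F d\<^esub> x) = a \<odot>\<^bsub>F d\<^esub> ppow d k x"
  by (simp add: ppow_def pow_commute)

lemma ppow_mono: "ppow d k x = \<zero>\<^bsub>F d\<^esub> \<Longrightarrow> x \<in> carrier (F d) \<Longrightarrow> k \<le> l \<Longrightarrow> ppow d l x = \<zero>\<^bsub>F d\<^esub>"
  by (simp add: ppow_def pow_mono)

lemma T_iff: "x \<in> carrier (T d m) \<longleftrightarrow> x \<in> carrier (F d) \<and> ppow d m x = \<zero>\<^bsub>F d\<^esub>"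
  by (simp add: ppow_def)

declare T_simps(1) [simp del]

lemma T_subset: "x \<in> carrier (T d l) \<Longrightarrow> l \<le> m \<Longrightarrow> x \<in> carrier (T d m)"
  using ppow_mono by (auto simp: T_iff)

lemma T_dvd:
  assumes "x \<in> carrier (T d l)" "l \<le> m" "m \<le> n"
  shows "\<exists>y\<in>carrier (T d m). x = ppow d (m - l) y"
  using torsion_dvd_torsion[OF assms] by (simp add: ppow_def)

lemma T_linear:
  assumes "h \<in> linear_maps R (T d m) (T d' b)"
  shows "x \<in> carrier (T d m) \<Longrightarrow> h x \<in> carrier (F d')"
    "x \<in> carrier (T d m) \<Longrightarrow> b \<le> k \<Longrightarrow> ppow d' k (h x) = \<zero>\<^bsub>F d'\<^esub>"
    "x \<in> carrier (T d m) \<Longrightarrow> ppow d' k (h x) = h (ppow d k x)"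
    "h \<zero>\<^bsub>F d\<^esub> = \<zero>\<^bsub>F d'\<^esub>"
    "x \<in> carrier (T d m) \<Longrightarrow> y \<in> carrier (T d m) \<Longrightarrow> h (x \<oplus>\<^bsub>F d\<^esub> y) = h x \<oplus>\<^bsub>F d'\<^esub> h y"
proof -
  note hD = linear_mapsD[OF assms, simplified]
  show "x \<in> carrier (T d m) \<Longrightarrow> h x \<in> carrier (F d')" using hD(2) by (simp add: T_iff)
  show "x \<in> carrier (T d m) \<Longrightarrow> b \<le> k \<Longrightarrow> ppow d' k (h x) = \<zero>\<^bsub>F d'\<^esub>"
    using hD(2)[of x] ppow_mono[where d = d' and k = b and x = "h x"] by (simp add: T_iff)
  show "x \<in> carrier (T d m) \<Longrightarrow> ppow d' k (h x) = h (ppow d k x)"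
    using hD(4)[of "p [^] k" x] by (simp add: ppow_def)
  show "h \<zero>\<^bsub>F d\<^esub> = \<zero>\<^bsub>F d'\<^esub>"
    using linear_map_zero[OF assms] module.axioms(2)[OF module_T] by simp
  show "x \<in> carrier (T d m) \<Longrightarrow> y \<in> carrier (T d m) \<Longrightarrow> h (x \<oplus>\<^bsub>F d\<^esub> y) = h x \<oplus>\<^bsub>F d'\<^esub> h y"
    using hD(3) by simp
qed

text \<open>Write \<open>a\<close> as \<open>p^(m - l) y\<close> with \<open>y\<close> in
  \<open>T d m\<close>. Then \<open>h (p^k a)\<close> is \<open>p^(k + m - l)\<close> times
  \<open>h y\<close>, and \<open>h y\<close> is killed by \<open>p^b\<close>. This is how all
  unwanted matrix entries disappear in the computations with test elements.\<close>

lemma T_linear_vanish: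
  assumes h: "h \<in> linear_maps R (T d m) (T d' b)" and "m \<le> n"
    and a: "a \<in> carrier (T d l)" and "l \<le> m" "b \<le> k + (m - l)"
  shows "h (ppow d k a) = \<zero>\<^bsub>F d'\<^esub>"
proof -
  obtain y where y: "y \<in> carrier (T d m)" "a = ppow d (m - l) y" using T_dvd[OF a] assms by blast
  have "h (ppow d k a) = h (ppow d (k + (m - l)) y)" using y by (simp add: T_iff)
  also have "\<dots> = \<zero>\<^bsub>F d'\<^esub>" using T_linear(2,3)[OF h y(1)] assms(5) by metis
  finally show ?thesis .
qed

section \<open>Sums of torsion modules and matrix entries\<close>

definition TP :: "nat \<Rightarrow> (nat \<Rightarrow> nat) \<Rightarrow> nat \<Rightarrow> ('a, nat \<Rightarrow> nat \<Rightarrow> 'a) module" where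
  "TP N e d = direct_product {..<N} (\<lambda>i. T d (e i))"

lemma TP_simps [simp]:
  "x \<in> carrier (TP N e d) \<longleftrightarrow> x \<in> extensional {..<N} \<and> (\<forall>i<N. x i \<in> carrier (T d (e i)))"
  "\<zero>\<^bsub>TP N e d\<^esub> = (\<lambda>i\<in>{..<N}. \<zero>\<^bsub>F d\<^esub>)"
  "x \<oplus>\<^bsub>TP N e d\<^esub> y = (\<lambda>i\<in>{..<N}. x i \<oplus>\<^bsub>F d\<^esub> y i)"
  "a \<odot>\<^bsub>TP N e d\<^esub> x = (\<lambda>i\<in>{..<N}. a \<odot>\<^bsub>F d\<^esub> x i)"
  by (auto simp: TP_def PiE_iff)

lemma module_TP: "module R (TP N e d)"
  unfolding TP_def using ring_cring module_T by (intro module_direct_product)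

lemma left_module_TP: "left_module R (TP N e d)"
  using module_TP module_imp_left_module by blast

lemma fin_gen_TP: "(\<And>i. i < N \<Longrightarrow> e i \<le> n) \<Longrightarrow> fin_gen R (TP N e d)"
  unfolding TP_def using ring_cring module_T fin_gen_T by (intro fin_gen_direct_product) auto

definition single_TP :: "nat \<Rightarrow> nat \<Rightarrow> nat \<Rightarrow> (nat \<Rightarrow> 'a) \<Rightarrow> nat \<Rightarrow> nat \<Rightarrow> 'a" where
  "single_TP N d c a = (\<lambda>j\<in>{..<N}. if j = c then a else \<zero>\<^bsub>F d\<^esub>)"

text \<open>The entry of the matrix of \<open>f\<close> in row \<open>i\<close> and column
  \<open>c\<close>: the component from the summand \<open>T d (e c)\<close> to the target summand
  with index \<open>i\<close>.\<close>

definition entry ::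
  "nat \<Rightarrow> (nat \<Rightarrow> nat) \<Rightarrow> nat \<Rightarrow> ((nat \<Rightarrow> nat \<Rightarrow> 'a) \<Rightarrow> nat \<Rightarrow> nat \<Rightarrow> 'a) \<Rightarrow> nat \<Rightarrow> nat \<Rightarrow> (nat \<Rightarrow> 'a) \<Rightarrow> nat \<Rightarrow> 'a" where
  "entry N e d f i c = (\<lambda>a\<in>carrier (T d (e c)). f (single_TP N d c a) i)"

lemma zero_T [simp]: "\<zero>\<^bsub>F d\<^esub> \<in> carrier (T d m)"
  by (simp add: T_iff)

lemma single_TP_closed:
  "c < N \<Longrightarrow> a \<in> carrier (T d (e c)) \<Longrightarrow> single_TP N d c a \<in> carrier (TP N e d)"
  by (auto simp: single_TP_def)

lemma entry_linear:
  assumes f: "f \<in> linear_maps R (TP N e d) (TP N' e' d')" and "i < N'" "c < N"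
  shows "entry N e d f i c \<in> linear_maps R (T d (e c)) (T d' (e' i))"
  unfolding entry_def
proof (rule restrict_linear_mapsI[OF left_module_T])
  note fD = linear_mapsD[OF f]
  note sc = single_TP_closed[where e = e and d = d, OF \<open>c < N\<close>]
  fix x assume x: "x \<in> carrier (T d (e c))"
  show "f (single_TP N d c x) i \<in> carrier (T d' (e' i))" using fD(2)[OF sc[OF x]] \<open>i < N'\<close> by simp
  {
    fix y assume y: "y \<in> carrier (T d (e c))"
    have "single_TP N d c (x \<oplus>\<^bsub>F d\<^esub> y) = single_TP N d c x \<oplus>\<^bsub>TP N e d\<^esub> single_TP N d c y"
      by (auto simp: single_TP_def intro!: restrict_ext)
    then show "f (single_TP N d c (x \<oplus>\<^bsub>T d (e c)\<^esub> y)) i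
       = f (single_TP N d c x) i \<oplus>\<^bsub>T d' (e' i)\<^esub> f (single_TP N d c y) i"
      using fD(3)[OF sc[OF x] sc[OF y]] \<open>i < N'\<close> by simp
  next
    fix a assume a: "a \<in> carrier R"
    have "single_TP N d c (a \<odot>\<^bsub>F d\<^esub> x) = a \<odot>\<^bsub>TP N e d\<^esub> single_TP N d c x"
      using a by (auto simp: single_TP_def intro!: restrict_ext)
    then show "f (single_TP N d c (a \<odot>\<^bsub>T d (e c)\<^esub> x)) i = a \<odot>\<^bsub>T d' (e' i)\<^esub> f (single_TP N d c x) i"
      using fD(4)[OF a sc[OF x]] \<open>i < N'\<close> by simp
  }
qed

lemma entry_sum:
  assumes f: "f \<in> linear_maps R (TP N e d) (TP N' e' d')" and i: "i < N'"
    and x: "x \<in> carrier (TP N e d)"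
  shows "f x i = finsum (T d' (e' i)) (\<lambda>c. entry N e d f i c (x c)) {..<N}"
proof -
  interpret S: module R "TP N e d" by (rule module_TP)
  interpret S': module R "TP N' e' d'" by (rule module_TP)
  interpret Ti: module R "T d' (e' i)" by (rule module_T)
  have comp: "(\<lambda>y\<in>carrier (TP N' e' d'). y i) \<in> linear_maps R (TP N' e' d') (T d' (e' i))"
    unfolding TP_def using i module_T by (intro component_linear[OF ring_cring]) auto
  have xs: "single_TP N d c (x c) \<in> carrier (TP N e d)" if "c < N" for c
    using x that by (intro single_TP_closed) auto
  have "finsum (TP N e d) (\<lambda>c. single {..<N} (\<lambda>i. T d (e i)) c (x c)) {..<N} = x"
    unfolding TP_def using x module_T
    by (intro finsum_singles[OF ring_cring]) (auto simp: TP_def PiE_iff)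
  moreover have "single {..<N} (\<lambda>i. T d (e i)) c (x c) = single_TP N d c (x c)" for c
    by (auto simp: single_def single_TP_def intro!: restrict_ext)
  ultimately have s: "finsum (TP N e d) (\<lambda>c. single_TP N d c (x c)) {..<N} = x" by simp
  have fx: "f x = finsum (TP N' e' d') (\<lambda>c. f (single_TP N d c (x c))) {..<N}"
    using linear_map_finsum[OF f S.M.abelian_group_axioms S'.M.abelian_group_axioms, of "{..<N}"
        "\<lambda>c. single_TP N d c (x c)"] xs s by (auto simp del: TP_simps)
  have "f x i = (\<lambda>y\<in>carrier (TP N' e' d'). y i) (f x)" using linear_mapsD(2)[OF f x] by (simp del: TP_simps)
  also have "\<dots> = finsum (T d' (e' i)) (\<lambda>c. (\<lambda>y\<in>carrier (TP N' e' d'). y i) (f (single_TP N d c (x c)))) {..<N}"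
    unfolding fx
    by (rule linear_map_finsum[OF comp S'.M.abelian_group_axioms Ti.M.abelian_group_axioms])
      (use linear_mapsD(2)[OF f xs] in \<open>auto simp del: TP_simps\<close>)
  also have "\<dots> = finsum (T d' (e' i)) (\<lambda>c. entry N e d f i c (x c)) {..<N}"
  proof (rule Ti.M.finsum_cong')
    show "(\<lambda>c. entry N e d f i c (x c)) \<in> {..<N} \<rightarrow> carrier (T d' (e' i))"
      using x linear_mapsD(2)[OF entry_linear[OF f i]] by auto
    show "(\<lambda>y\<in>carrier (TP N' e' d'). y i) (f (single_TP N d c (x c))) = entry N e d f i c (x c)"
      if "c \<in> {..<N}" for c
      using linear_mapsD(2)[OF f xs, of c] x that by (simp add: entry_def del: TP_simps(2-))
  qed simp
  finally show ?thesis .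
qed

section \<open>The pair assigned to a representation\<close>

definition tot_exp :: "nat \<Rightarrow> nat" where
  "tot_exp c = (if c < 2 then 7 else if c < 4 then 5 else if c < 5 then 3 else 2)"

lemma tot_exp_simps [simp]: "tot_exp 0 = 7" "tot_exp (Suc 0) = 7" "tot_exp 1 = 7" "tot_exp 2 = 5" "tot_exp 3 = 5" "tot_exp 4 = 3" "tot_exp 5 = 2"
  by (simp_all add: tot_exp_def)

lemma tot_exp_le: "tot_exp c \<le> 7" by (simp add: tot_exp_def)

text \<open>Even and odd indices distinguish the two copies of \<open>V\<close>: 0 and 1 belong to
  the exponent 7, 2 and 3 to the exponent 5, and in the last block index 4 (exponent 3) is the first
  copy and index 5 (exponent 2) the second.\<close>

abbreviation tot :: "nat \<Rightarrow> ('a, nat \<Rightarrow> nat \<Rightarrow> 'a) module" where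
  "tot \<equiv> TP 6 tot_exp"

abbreviation ent :: "nat \<Rightarrow> ((nat \<Rightarrow> nat \<Rightarrow> 'a) \<Rightarrow> nat \<Rightarrow> nat \<Rightarrow> 'a) \<Rightarrow> nat \<Rightarrow> nat \<Rightarrow> (nat \<Rightarrow> 'a) \<Rightarrow> nat \<Rightarrow> 'a" where
  "ent \<equiv> entry 6 tot_exp"

lemma entry_sum_6:
  assumes f: "f \<in> linear_maps R (tot d) (TP N' e' d')" and i: "i < N'" and x: "x \<in> carrier (tot d)"
  shows "f x i = ent d f i 0 (x 0) \<oplus>\<^bsub>F d'\<^esub> (ent d f i 1 (x 1) \<oplus>\<^bsub>F d'\<^esub> (ent d f i 2 (x 2) \<oplus>\<^bsub>F d'\<^esub>
     (ent d f i 3 (x 3) \<oplus>\<^bsub>F d'\<^esub> (ent d f i 4 (x 4) \<oplus>\<^bsub>F d'\<^esub> ent d f i 5 (x 5)))))"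
  unfolding entry_sum[OF f i x]
  using x linear_mapsD(2)[OF entry_linear[OF f i]]
  by (subst finsum_lessThan_6)
    (auto simp: abelian_group.axioms(1)[OF module.axioms(2)[OF module_T]])

text \<open>A representation of the free algebra in two generators is given by an \<open>R\<close>-module \<open>V\<close>
  killed by \<open>p\<close> and two endomorphisms \<open>X\<close>, \<open>Y\<close>; the isomorphism \<open>\<sigma>\<close> identifies \<open>V\<close> with the
  socle of a free module.\<close>

definition is_rep :: "('a, 'v) module \<Rightarrow> ('v \<Rightarrow> 'v) \<Rightarrow> ('v \<Rightarrow> 'v) \<Rightarrow> nat \<Rightarrow> ((nat \<Rightarrow> 'a) \<Rightarrow> 'v) \<Rightarrow> bool" where
  "is_rep V X Y d \<sigma> \<longleftrightarrow> module R V \<and> X \<in> linear_maps R V V \<and> Y \<in> linear_maps R V V \<and>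
     \<sigma> \<in> linear_maps R (T d 1) V \<and> bij_betw \<sigma> (carrier (T d 1)) (carrier V)"

text \<open>With \<open>P m = R/p\<^sup>m\<close> and \<open>N = R\<^sup>d \<oplus> R\<^sup>d\<close>, this is the submodule of all
  \<open>(p\<^sup>2 u, p w, u + w)\<close> in \<open>N/p\<^sup>7 \<oplus> N/p\<^sup>5 \<oplus> (P 3 \<oplus> P 2)\<^sup>d\<close> such that \<open>u\<close>, \<open>w\<close> are in \<open>N\<close> and
  \<open>w \<equiv> \<phi> u\<close> modulo \<open>p\<close>, where \<open>\<phi> (s, t) = (t, X s + Y t)\<close>. Here \<open>P m\<close> is identified with the
  \<open>p\<^sup>m\<close>-torsion of \<open>R\<close>, and \<open>u\<close>, \<open>w\<close> have been eliminated.\<close>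

definition sub :: "('a, 'v) module \<Rightarrow> ('v \<Rightarrow> 'v) \<Rightarrow> ('v \<Rightarrow> 'v) \<Rightarrow> nat \<Rightarrow> ((nat \<Rightarrow> 'a) \<Rightarrow> 'v)
    \<Rightarrow> (nat \<Rightarrow> nat \<Rightarrow> 'a) set" where
  "sub V X Y d \<sigma> = {m \<in> carrier (tot d).
     ppow d 5 (m 0) = \<zero>\<^bsub>F d\<^esub> \<and> ppow d 5 (m 1) = \<zero>\<^bsub>F d\<^esub> \<and>
     ppow d 4 (m 2) = \<zero>\<^bsub>F d\<^esub> \<and> ppow d 4 (m 3) = \<zero>\<^bsub>F d\<^esub> \<and>
     m 4 = ppow d 2 (m 0) \<oplus>\<^bsub>F d\<^esub> ppow d 1 (m 2) \<and>
     m 5 = ppow d 3 (m 1) \<oplus>\<^bsub>F d\<^esub> ppow d 2 (m 3) \<and>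
     ppow d 3 (m 2) = ppow d 4 (m 1) \<and>
     \<sigma> (ppow d 3 (m 3)) = X (\<sigma> (ppow d 4 (m 0))) \<oplus>\<^bsub>V\<^esub> Y (\<sigma> (ppow d 4 (m 1)))}"

lemma tot_comp: "m \<in> carrier (tot d) \<Longrightarrow> i < 6 \<Longrightarrow> m i \<in> carrier (F d) \<and> ppow d (tot_exp i) (m i) = \<zero>\<^bsub>F d\<^esub>"
  by (simp add: T_iff)

lemma less_6: "(0::nat) < 6" "(1::nat) < 6" "Suc 0 < 6" "(2::nat) < 6" "(3::nat) < 6" "(4::nat) < 6" "(5::nat) < 6"
  by simp_all

definition tup :: "'t \<Rightarrow> 't \<Rightarrow> 't \<Rightarrow> 't \<Rightarrow> 't \<Rightarrow> 't \<Rightarrow> nat \<Rightarrow> 't" where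
  "tup a b c d e f = (\<lambda>i\<in>{..<6}. if i = 0 then a else if i = 1 then b else if i = 2 then c
     else if i = 3 then d else if i = 4 then e else f)"

lemma tup_simps [simp]:
  "tup a b c d e f 0 = a" "tup a b c d e f (Suc 0) = b" "tup a b c d e f 1 = b" "tup a b c d e f 2 = c"
  "tup a b c d e f 3 = d" "tup a b c d e f 4 = e" "tup a b c d e f 5 = f"
  "tup a b c d e f \<in> extensional {..<6}"
  by (simp_all add: tup_def)

lemma all_less_6: "(\<forall>i<6. P i) \<longleftrightarrow> P 0 \<and> P (Suc 0) \<and> P 2 \<and> P 3 \<and> P 4 \<and> P (5::nat)"
  by (auto simp: eval_nat_numeral All_less_Suc)

lemma repD:
  assumes "is_rep V X Y d \<sigma>"
  shows "module R V" "\<And>v. v \<in> carrier V \<Longrightarrow> X v \<in> carrier V" "\<And>v. v \<in> carrier V \<Longrightarrow> Y v \<in> carrier V"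
    "\<And>s. s \<in> carrier (F d) \<Longrightarrow> ppow d 1 s = \<zero>\<^bsub>F d\<^esub> \<Longrightarrow> \<sigma> s \<in> carrier V"
    "\<And>s t. \<lbrakk>s \<in> carrier (F d); ppow d 1 s = \<zero>\<^bsub>F d\<^esub>; t \<in> carrier (F d); ppow d 1 t = \<zero>\<^bsub>F d\<^esub>\<rbrakk>
       \<Longrightarrow> \<sigma> (s \<oplus>\<^bsub>F d\<^esub> t) = \<sigma> s \<oplus>\<^bsub>V\<^esub> \<sigma> t"
    "\<And>a s. \<lbrakk>a \<in> carrier R; s \<in> carrier (F d); ppow d 1 s = \<zero>\<^bsub>F d\<^esub>\<rbrakk> \<Longrightarrow> \<sigma> (a \<odot>\<^bsub>F d\<^esub> s) = a \<odot>\<^bsub>V\<^esub> \<sigma> s"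
    "\<sigma> \<zero>\<^bsub>F d\<^esub> = \<zero>\<^bsub>V\<^esub>" "X \<zero>\<^bsub>V\<^esub> = \<zero>\<^bsub>V\<^esub>" "Y \<zero>\<^bsub>V\<^esub> = \<zero>\<^bsub>V\<^esub>"
    "\<And>v. v \<in> carrier V \<Longrightarrow> \<exists>s\<in>carrier (T d 1). \<sigma> s = v"
    "\<And>s t. s \<in> carrier (T d 1) \<Longrightarrow> t \<in> carrier (T d 1) \<Longrightarrow> \<sigma> s = \<sigma> t \<Longrightarrow> s = t"
proof -
  have V: "module R V" and X: "X \<in> linear_maps R V V" and Y: "Y \<in> linear_maps R V V"
    and \<sigma>: "\<sigma> \<in> linear_maps R (T d 1) V" and b: "bij_betw \<sigma> (carrier (T d 1)) (carrier V)"
    using assms by (auto simp: is_rep_def)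
  show "module R V" by fact
  show "\<And>v. v \<in> carrier V \<Longrightarrow> X v \<in> carrier V" "\<And>v. v \<in> carrier V \<Longrightarrow> Y v \<in> carrier V"
    by (rule linear_mapsD(2)[OF X], assumption) (rule linear_mapsD(2)[OF Y], assumption)
  show "\<And>s. s \<in> carrier (F d) \<Longrightarrow> ppow d 1 s = \<zero>\<^bsub>F d\<^esub> \<Longrightarrow> \<sigma> s \<in> carrier V"
    "\<And>s t. \<lbrakk>s \<in> carrier (F d); ppow d 1 s = \<zero>\<^bsub>F d\<^esub>; t \<in> carrier (F d); ppow d 1 t = \<zero>\<^bsub>F d\<^esub>\<rbrakk>
       \<Longrightarrow> \<sigma> (s \<oplus>\<^bsub>F d\<^esub> t) = \<sigma> s \<oplus>\<^bsub>V\<^esub> \<sigma> t"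
    "\<And>a s. \<lbrakk>a \<in> carrier R; s \<in> carrier (F d); ppow d 1 s = \<zero>\<^bsub>F d\<^esub>\<rbrakk> \<Longrightarrow> \<sigma> (a \<odot>\<^bsub>F d\<^esub> s) = a \<odot>\<^bsub>V\<^esub> \<sigma> s"
    using linear_mapsD(2-)[OF \<sigma>] by (simp_all add: T_iff)
  note ag = module.axioms(2)[OF V] module.axioms(2)[OF module_T]
  show "\<sigma> \<zero>\<^bsub>F d\<^esub> = \<zero>\<^bsub>V\<^esub>" using linear_map_zero[OF \<sigma> ag(2,1)] by simp
  show "X \<zero>\<^bsub>V\<^esub> = \<zero>\<^bsub>V\<^esub>" "Y \<zero>\<^bsub>V\<^esub> = \<zero>\<^bsub>V\<^esub>" using linear_map_zero[OF X ag(1,1)] linear_map_zero[OF Y ag(1,1)] .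
  show "\<And>v. v \<in> carrier V \<Longrightarrow> \<exists>s\<in>carrier (T d 1). \<sigma> s = v"
    using bij_betw_imp_surj_on[OF b] by (metis imageE)
  show "\<And>s t. s \<in> carrier (T d 1) \<Longrightarrow> t \<in> carrier (T d 1) \<Longrightarrow> \<sigma> s = \<sigma> t \<Longrightarrow> s = t"
    using bij_betw_imp_inj_on[OF b] by (meson inj_onD)
qed

lemma submodule_sub:
  assumes rep: "is_rep V X Y d \<sigma>"
  shows "submodule (sub V X Y d \<sigma>) R (tot d)"
proof -
  interpret V: module R V by (rule repD(1)[OF rep])
  interpret M: module R "tot d" by (rule module_TP)
  have XY: "X \<in> linear_maps R V V" "Y \<in> linear_maps R V V" using rep by (auto simp: is_rep_def)
  note rD = repD[OF rep]
  have z: "\<zero>\<^bsub>tot d\<^esub> \<in> sub V X Y d \<sigma>"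
    unfolding sub_def by (simp add: rD)
  have add: "x \<oplus>\<^bsub>tot d\<^esub> y \<in> sub V X Y d \<sigma>" if x: "x \<in> sub V X Y d \<sigma>" and y: "y \<in> sub V X Y d \<sigma>" for x y
  proof -
    have xc: "x \<in> carrier (tot d)" and yc: "y \<in> carrier (tot d)" using x y by (auto simp: sub_def)
    note [simp] = tot_comp[OF xc, THEN conjunct1] tot_comp[OF yc, THEN conjunct1]
    note xe = x[unfolded sub_def mem_Collect_eq] and ye = y[unfolded sub_def mem_Collect_eq]
    have s: "\<sigma> (ppow d 4 (x i \<oplus>\<^bsub>F d\<^esub> y i)) = \<sigma> (ppow d 4 (x i)) \<oplus>\<^bsub>V\<^esub> \<sigma> (ppow d 4 (y i))"
      "\<sigma> (ppow d 4 (x i)) \<in> carrier V" "\<sigma> (ppow d 4 (y i)) \<in> carrier V" if "i < 2" for i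
      using that xe ye by (auto simp: less_2_cases_iff rD)
    have s3: "\<sigma> (ppow d 3 (x 3 \<oplus>\<^bsub>F d\<^esub> y 3)) = \<sigma> (ppow d 3 (x 3)) \<oplus>\<^bsub>V\<^esub> \<sigma> (ppow d 3 (y 3))"
      using xe ye by (simp add: rD)
    show ?thesis
      unfolding sub_def mem_Collect_eq
    proof (intro conjI)
      show "x \<oplus>\<^bsub>tot d\<^esub> y \<in> carrier (tot d)" using xc yc by (rule M.M.a_closed)
      show "\<sigma> (ppow d 3 ((x \<oplus>\<^bsub>tot d\<^esub> y) 3)) = X (\<sigma> (ppow d 4 ((x \<oplus>\<^bsub>tot d\<^esub> y) 0)))
          \<oplus>\<^bsub>V\<^esub> Y (\<sigma> (ppow d 4 ((x \<oplus>\<^bsub>tot d\<^esub> y) 1)))"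
        using xe ye s[of 0] s[of 1] linear_mapsD(3)[OF XY(1)] linear_mapsD(3)[OF XY(2)]
        by (simp add: s3 rD V.M.add.m_ac)
    qed (use xe ye in \<open>simp_all add: F.M.add.m_ac\<close>)
  qed
  have sm: "a \<odot>\<^bsub>tot d\<^esub> x \<in> sub V X Y d \<sigma>" if a: "a \<in> carrier R" and x: "x \<in> sub V X Y d \<sigma>" for a x
  proof -
    have xc: "x \<in> carrier (tot d)" using x by (auto simp: sub_def)
    note [simp] = tot_comp[OF xc, THEN conjunct1]
    note xe = x[unfolded sub_def mem_Collect_eq]
    show ?thesis
      unfolding sub_def mem_Collect_eq
    proof (intro conjI)
      show "a \<odot>\<^bsub>tot d\<^esub> x \<in> carrier (tot d)" using a xc by (rule M.smult_closed)
      have s: "\<sigma> (ppow d 4 (a \<odot>\<^bsub>F d\<^esub> x i)) = a \<odot>\<^bsub>V\<^esub> \<sigma> (ppow d 4 (x i))"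
        "\<sigma> (ppow d 4 (x i)) \<in> carrier V" if "i < 2" for i
        using that xe a by (auto simp: less_2_cases_iff rD ppow_smult)
      have "\<sigma> (ppow d 3 (a \<odot>\<^bsub>F d\<^esub> x 3)) = a \<odot>\<^bsub>V\<^esub> \<sigma> (ppow d 3 (x 3))"
        using xe a by (simp add: rD ppow_smult)
      then show "\<sigma> (ppow d 3 ((a \<odot>\<^bsub>tot d\<^esub> x) 3)) = X (\<sigma> (ppow d 4 ((a \<odot>\<^bsub>tot d\<^esub> x) 0)))
          \<oplus>\<^bsub>V\<^esub> Y (\<sigma> (ppow d 4 ((a \<odot>\<^bsub>tot d\<^esub> x) 1)))"
        using xe a s[of 0] s[of 1] linear_mapsD(4)[OF XY(1)] linear_mapsD(4)[OF XY(2)]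
        by (simp add: rD V.smult_r_distr)
    qed (use xe a in \<open>simp_all add: ppow_smult F.smult_r_distr\<close>)
  qed
  have sub: "sub V X Y d \<sigma> \<subseteq> carrier (tot d)" by (auto simp: sub_def simp del: TP_simps)
  show ?thesis
  proof (rule M.submoduleI)
    show "\<ominus>\<^bsub>tot d\<^esub> x \<in> sub V X Y d \<sigma>" if "x \<in> sub V X Y d \<sigma>" for x
      using sm[of "\<ominus> \<one>" x] that subsetD[OF sub that] by (simp add: M.smult_l_minus del: TP_simps)
  qed (use sub z add sm in \<open>auto simp del: TP_simps\<close>)
qed

text \<open>The functor \<open>p M[p\<^sup>2]/p\<^sup>2 M[p\<^sup>3]\<close> counts the direct summands \<open>R/p\<^sup>2\<close>; on \<open>tot d\<close> it gives back \<open>V\<close>, and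
  a linear map acts on it by its last diagonal entry.\<close>

lemma layer_map:
  assumes n: "7 \<le> n" and f: "f \<in> linear_maps R (tot d) (tot d')"
    and m: "m \<in> carrier (tot d)" "\<And>c. c < 6 \<Longrightarrow> ppow d 2 (m c) = \<zero>\<^bsub>F d\<^esub>"
  shows "ppow d' 1 (f m 5) = ent d f 5 5 (ppow d 1 (m 5))"
proof -
  note L = T_linear[OF entry_linear[OF f]]
  have mT: "m c \<in> carrier (T d 2)" if "c < 6" for c using m that by (simp add: T_iff)
  have mc: "m c \<in> carrier (T d (tot_exp c))" if "c < 6" for c using m(1) that by simp
  \<comment> \<open>A \<open>p^2\<close>-torsion element of a summand with exponent at least 3 is
    divisible by \<open>p\<close>. So \<open>p\<close> times it is divisible by \<open>p^2\<close>,
    which kills its image in the summand of exponent 2.\<close>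
  have z: "ent d f 5 c (ppow d 1 (m c)) = \<zero>\<^bsub>F d'\<^esub>" if "c < 5" for c
    using that n tot_exp_le[of c] by (intro T_linear_vanish[OF entry_linear[OF f] _ mT]) (auto simp: tot_exp_def)
  have P: "ppow d' 1 (ent d f 5 c (m c)) = ent d f 5 c (ppow d 1 (m c))" if "c < 6" for c
    using L(3)[OF _ that mc[OF that]] by simp
  have c: "ent d f 5 c (m c) \<in> carrier (F d')" if "c < 6" for c using L(1)[OF _ that mc[OF that]] by simp
  have c5: "ent d f 5 5 (ppow d 1 (m 5)) \<in> carrier (F d')"
    using P[of 5] c[of 5] ppow_simps(1)[of "ent d f 5 5 (m 5)" d' 1] by simp
  show ?thesis
    unfolding entry_sum_6[OF f less_6(7) m(1)]
    using c P z c5 by (simp del: One_nat_def)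
qed

text \<open>Membership in terms of the parameters: the elements \<open>x\<^sub>1\<close>,
  \<open>x\<^sub>2\<close> of the \<open>p^5\<close>-torsion play the role of \<open>p^2 u\<close>,
  and \<open>y\<^sub>1\<close>, \<open>y\<^sub>2\<close> in the \<open>p^4\<close>-torsion that of
  \<open>p w\<close>. The last two hypotheses express the congruence between \<open>w\<close> and
  \<phi> applied to \<open>u\<close>, multiplied into the socle.\<close>

lemma tup_mem_sub:
  assumes rep: "is_rep V X Y d \<sigma>"
    and c: "x\<^sub>1 \<in> carrier (T d 5)" "x\<^sub>2 \<in> carrier (T d 5)" "y\<^sub>1 \<in> carrier (T d 4)" "y\<^sub>2 \<in> carrier (T d 4)"
    and st: "s = ppow d 2 x\<^sub>1 \<oplus>\<^bsub>F d\<^esub> ppow d 1 y\<^sub>1" "t = ppow d 3 x\<^sub>2 \<oplus>\<^bsub>F d\<^esub> ppow d 2 y\<^sub>2"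
    and w: "ppow d 3 y\<^sub>1 = ppow d 4 x\<^sub>2"
      "\<sigma> (ppow d 3 y\<^sub>2) = X (\<sigma> (ppow d 4 x\<^sub>1)) \<oplus>\<^bsub>V\<^esub> Y (\<sigma> (ppow d 4 x\<^sub>2))"
  shows "tup x\<^sub>1 x\<^sub>2 y\<^sub>1 y\<^sub>2 s t \<in> sub V X Y d \<sigma>"
proof -
  note m = c[unfolded T_iff]
  have z: "ppow d k x\<^sub>1 = \<zero>\<^bsub>F d\<^esub>" "ppow d k x\<^sub>2 = \<zero>\<^bsub>F d\<^esub>" if "5 \<le> k" for k
    using m ppow_mono that by blast+
  have z': "ppow d k y\<^sub>1 = \<zero>\<^bsub>F d\<^esub>" "ppow d k y\<^sub>2 = \<zero>\<^bsub>F d\<^esub>" if "4 \<le> k" for k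
    using m ppow_mono that by blast+
  have "tup x\<^sub>1 x\<^sub>2 y\<^sub>1 y\<^sub>2 s t \<in> carrier (tot d)"
    using m z z' by (simp add: all_less_6 T_iff st)
  then show ?thesis using st w z z' by (simp add: sub_def del: TP_simps)
qed

text \<open>The defining relations in the form in which they are read off from images of test
  elements. The one for coordinate 4 is multiplied by \<open>p\<close>, because only then do the
  remaining entries vanish on the test elements; the one for coordinate 5 is used as it is.\<close>

lemma sub_images:
  assumes m': "m' \<in> sub V X Y d \<sigma>"
  shows "ppow d 1 (m' 4) = ppow d 3 (m' 0) \<oplus>\<^bsub>F d\<^esub> ppow d 2 (m' 2)"
    "m' 5 = ppow d 3 (m' 1) \<oplus>\<^bsub>F d\<^esub> ppow d 2 (m' 3)"
    "ppow d 3 (m' 2) = ppow d 4 (m' 1)"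
    "\<sigma> (ppow d 3 (m' 3)) = X (\<sigma> (ppow d 4 (m' 0))) \<oplus>\<^bsub>V\<^esub> Y (\<sigma> (ppow d 4 (m' 1)))"
    "m' \<in> carrier (tot d)"
proof -
  have mc: "m' \<in> carrier (tot d)" using m' by (auto simp: sub_def)
  note [simp] = tot_comp[OF mc, THEN conjunct1]
  show "ppow d 1 (m' 4) = ppow d 3 (m' 0) \<oplus>\<^bsub>F d\<^esub> ppow d 2 (m' 2)"
    using m' by (simp add: sub_def del: TP_simps One_nat_def)
qed (use m' in \<open>auto simp: sub_def simp del: TP_simps\<close>)

section \<open>Constraints on the entries of a morphism\<close>

lemma ppow_entry_sum:
  fixes d k :: nat
  assumes f: "f \<in> linear_maps R (tot d) (tot d')" and i: "i < 6" and m: "m \<in> carrier (tot d)"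
  shows "ppow d' k (f m i) = ent d f i 0 (ppow d k (m 0)) \<oplus>\<^bsub>F d'\<^esub> (ent d f i 1 (ppow d k (m 1)) \<oplus>\<^bsub>F d'\<^esub>
     (ent d f i 2 (ppow d k (m 2)) \<oplus>\<^bsub>F d'\<^esub> (ent d f i 3 (ppow d k (m 3)) \<oplus>\<^bsub>F d'\<^esub>
     (ent d f i 4 (ppow d k (m 4)) \<oplus>\<^bsub>F d'\<^esub> ent d f i 5 (ppow d k (m 5))))))"
proof -
  note L = T_linear[OF entry_linear[OF f i]]
  have mc: "m c \<in> carrier (T d (tot_exp c))" if "c < 6" for c using m that by simp
  have P: "ent d f i c (ppow d k (m c)) = ppow d' k (ent d f i c (m c))" if "c < 6" for c
    using L(3)[OF that mc[OF that]] by simp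
  have c: "ent d f i c (m c) \<in> carrier (F d')" if "c < 6" for c using L(1)[OF that mc[OF that]] .
  show ?thesis
    unfolding entry_sum_6[OF f i m] using c by (simp add: P del: One_nat_def)
qed

text \<open>Parameters \<open>u\<close>, \<open>w\<close> divisible by \<open>p\<close> escape the
  congruence and compare the diagonal entries within each copy: 0 and 2 with 4, and 1 and 3 with 5.
  The congruence for the first component of \<open>w\<close> then links the copies by identifying
  entries 1 and 2, and that for its second component yields the compatibility with \<open>X\<close>
  and \<open>Y\<close>. The vanishing of the off-diagonal entries has to be gained in the order 0 1
  and 2 3, then 1 0, then 5 4, then 3 2, since each uses earlier ones.\<close>

lemma entries_of_morphism:
  assumes n: "7 \<le> n" and rep: "is_rep V X Y d \<sigma>" and rep': "is_rep V' X' Y' d' \<sigma>'"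
    and f: "f \<in> linear_maps R (tot d) (tot d')" and fU: "f ` sub V X Y d \<sigma> \<subseteq> sub V' X' Y' d' \<sigma>'"
  shows "\<And>s i. s \<in> carrier (T d 1) \<Longrightarrow> i < 6 \<Longrightarrow> ent d f i i s = ent d f 5 5 s"
    "\<And>s. s \<in> carrier (T d 1) \<Longrightarrow> ent d f 0 1 s = \<zero>\<^bsub>F d'\<^esub> \<and> ent d f 1 0 s = \<zero>\<^bsub>F d'\<^esub>
        \<and> ent d f 2 3 s = \<zero>\<^bsub>F d'\<^esub> \<and> ent d f 3 2 s = \<zero>\<^bsub>F d'\<^esub>"
    "\<And>y. y \<in> carrier (T d 2) \<Longrightarrow> ent d f 5 4 y = \<zero>\<^bsub>F d'\<^esub>"
    "\<And>s b. s \<in> carrier (T d 1) \<Longrightarrow> b \<in> carrier (T d 1) \<Longrightarrow> \<sigma> b = X (\<sigma> s)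
        \<Longrightarrow> \<sigma>' (ent d f 5 5 b) = X' (\<sigma>' (ent d f 5 5 s))"
    "\<And>s b. s \<in> carrier (T d 1) \<Longrightarrow> b \<in> carrier (T d 1) \<Longrightarrow> \<sigma> b = Y (\<sigma> s)
        \<Longrightarrow> \<sigma>' (ent d f 5 5 b) = Y' (\<sigma>' (ent d f 5 5 s))"
proof -
  interpret V: module R V by (rule repD(1)[OF rep])
  interpret V': module R V' by (rule repD(1)[OF rep'])
  note rD = repD[OF rep] and rD' = repD[OF rep']
  note el = entry_linear[OF f]
  note L = T_linear[OF el]
  note pick = ppow_entry_sum[OF f]
  have dvd: "\<exists>a\<in>carrier (T d (Suc k)). s = ppow d k a" if "s \<in> carrier (T d 1)" "k < 7" for s k
    using T_dvd[OF that(1), of "Suc k"] that n by simp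
  have vanish: "ent d f i c (ppow d k a) = \<zero>\<^bsub>F d'\<^esub>"
    if "i < 6" "c < 6" "a \<in> carrier (T d l)" "l \<le> tot_exp c" "tot_exp i \<le> k + (tot_exp c - l)" for i c k l a
    using T_linear_vanish[OF el[OF that(1,2)] _ that(3-5)] tot_exp_le[of c] n by simp
  have vanish0: "ent d f i c a = \<zero>\<^bsub>F d'\<^esub>"
    if "i < 6" "c < 6" "a \<in> carrier (T d l)" "l \<le> tot_exp c" "tot_exp i \<le> tot_exp c - l" for i c l a
    using vanish[of i c a l 0] that by (simp add: T_iff)
  have cl0: "ent d f i c a \<in> carrier (F d')" if "i < 6" "c < 6" "a \<in> carrier (T d l)" "l \<le> tot_exp c" for i c l a
    using L(1)[OF that(1,2)] T_subset[OF that(3,4)] by simp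
  have zero: "ent d f i c \<zero>\<^bsub>F d\<^esub> = \<zero>\<^bsub>F d'\<^esub>" if "i < 6" "c < 6" for i c using L(4)[OF that] .
  have cl: "ent d f i c (ppow d k a) \<in> carrier (F d')"
    if "i < 6" "c < 6" "a \<in> carrier (T d l)" "l \<le> k + tot_exp c" for i c k l a
  proof -
    have "ppow d k a \<in> carrier (T d (tot_exp c))" using that(3,4) ppow_mono[of d l a "tot_exp c + k"] by (simp add: T_iff)
    then show ?thesis using L(1)[OF that(1,2)] by simp
  qed
  have kill: "ppow d k a = \<zero>\<^bsub>F d\<^esub>" if "a \<in> carrier (T d l)" "l \<le> k" for k l a
    using that ppow_mono by (auto simp: T_iff)
  have fsub: "f m \<in> sub V' X' Y' d' \<sigma>'" if "m \<in> sub V X Y d \<sigma>" for m using fU that by blast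
  note pick0 = entry_sum_6[OF f _ sub_images(5)]
  \<comment> \<open>Each of the following facts comes from the image under \<open>f\<close> of one test element.\<close>
  have t1: "ent d f 4 4 s = ent d f 0 0 s" "ent d f 5 4 (ppow d 2 a) = ent d f 1 0 s"
    if a: "a \<in> carrier (T d 4)" "s = ppow d 3 a" for a s
  proof -
    \<comment> \<open>Here \<open>u\<close> is divisible by \<open>p\<close> with second component
      zero, and \<open>w = 0\<close>. As \<open>P 3\<close> maps onto \<open>P 2\<close>, the
      relation for coordinate 5 does not make \<open>ent 1 0\<close> vanish but only equates it with
      \<open>ent 5 4\<close>.\<close>
    let ?m = "tup a \<zero>\<^bsub>F d\<^esub> \<zero>\<^bsub>F d\<^esub> \<zero>\<^bsub>F d\<^esub> (ppow d 2 a) \<zero>\<^bsub>F d\<^esub>"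
    have aF[simp]: "a \<in> carrier (F d)" using a by (simp add: T_iff)
    have m: "?m \<in> sub V X Y d \<sigma>"
      using T_subset[OF a(1), of 5] kill[OF a(1)] by (intro tup_mem_sub[OF rep]) (auto simp: rD simp del: One_nat_def)
    note mc = sub_images(5)[OF m]
    note ss = vanish[OF _ _ a(1)] vanish0[OF _ _ a(1)] kill[OF a(1)] cl[OF _ _ a(1)] cl0[OF _ _ a(1)]
    show "ent d f 4 4 s = ent d f 0 0 s"
      using sub_images(1)[OF fsub[OF m]] by (simp add: pick[OF _ mc] zero ss a(2) del: One_nat_def)
    show "ent d f 5 4 (ppow d 2 a) = ent d f 1 0 s"
      using sub_images(2)[OF fsub[OF m]] pick0[OF less_6(7) m]
      by (simp add: pick[OF _ mc] zero ss a(2) del: One_nat_def)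
  qed
  have t2: "ent d f 0 1 s = \<zero>\<^bsub>F d'\<^esub>" "ent d f 5 5 s = ent d f 1 1 s"
    if a: "a \<in> carrier (T d 4)" "s = ppow d 3 a" for a s
  proof -
    \<comment> \<open>Again \<open>w = 0\<close>, now with the first component of \<open>u\<close>
      zero. In the relation for coordinate 4 the entry from \<open>P 2\<close> is applied to
      \<open>p^4 a = 0\<close>; this is where the flag comes from.\<close>
    let ?m = "tup \<zero>\<^bsub>F d\<^esub> a \<zero>\<^bsub>F d\<^esub> \<zero>\<^bsub>F d\<^esub> \<zero>\<^bsub>F d\<^esub> (ppow d 3 a)"
    have aF[simp]: "a \<in> carrier (F d)" using a by (simp add: T_iff)
    have m: "?m \<in> sub V X Y d \<sigma>"
      using T_subset[OF a(1), of 5] kill[OF a(1)] by (intro tup_mem_sub[OF rep]) (auto simp: rD simp del: One_nat_def)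
    note mc = sub_images(5)[OF m]
    note ss = vanish[OF _ _ a(1)] vanish0[OF _ _ a(1)] kill[OF a(1)] cl[OF _ _ a(1)] cl0[OF _ _ a(1)]
    show "ent d f 0 1 s = \<zero>\<^bsub>F d'\<^esub>"
      using sub_images(1)[OF fsub[OF m]] by (simp add: pick[OF _ mc] zero ss a(2) del: One_nat_def)
    show "ent d f 5 5 s = ent d f 1 1 s"
      using sub_images(2)[OF fsub[OF m]] pick0[OF less_6(7) m]
      by (simp add: pick[OF _ mc] zero ss a(2) del: One_nat_def)
  qed
  have t3: "ent d f 4 4 s = ent d f 2 2 s" "ent d f 5 4 (ppow d 1 a) = ent d f 3 2 s"
    if a: "a \<in> carrier (T d 3)" "s = ppow d 2 a" for a s
  proof -
    \<comment> \<open>The same with the roles exchanged: \<open>u = 0\<close> and \<open>w\<close>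
      divisible by \<open>p\<close>, in its first component here and in its second component for
      \<open>t4\<close>.\<close>
    let ?m = "tup \<zero>\<^bsub>F d\<^esub> \<zero>\<^bsub>F d\<^esub> a \<zero>\<^bsub>F d\<^esub> (ppow d 1 a) \<zero>\<^bsub>F d\<^esub>"
    have aF[simp]: "a \<in> carrier (F d)" using a by (simp add: T_iff)
    have m: "?m \<in> sub V X Y d \<sigma>"
      using T_subset[OF a(1), of 4] kill[OF a(1)] by (intro tup_mem_sub[OF rep]) (auto simp: rD simp del: One_nat_def)
    note mc = sub_images(5)[OF m]
    note ss = vanish[OF _ _ a(1)] vanish0[OF _ _ a(1)] kill[OF a(1)] cl[OF _ _ a(1)] cl0[OF _ _ a(1)]
    show "ent d f 4 4 s = ent d f 2 2 s"
      using sub_images(1)[OF fsub[OF m]] by (simp add: pick[OF _ mc] zero ss a(2) del: One_nat_def)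
    show "ent d f 5 4 (ppow d 1 a) = ent d f 3 2 s"
      using sub_images(2)[OF fsub[OF m]] pick0[OF less_6(7) m]
      by (simp add: pick[OF _ mc] zero ss a(2) del: One_nat_def)
  qed
  have t4: "ent d f 2 3 s = \<zero>\<^bsub>F d'\<^esub>" "ent d f 5 5 s = ent d f 3 3 s"
    if a: "a \<in> carrier (T d 3)" "s = ppow d 2 a" for a s
  proof -
    let ?m = "tup \<zero>\<^bsub>F d\<^esub> \<zero>\<^bsub>F d\<^esub> \<zero>\<^bsub>F d\<^esub> a \<zero>\<^bsub>F d\<^esub> (ppow d 2 a)"
    have aF[simp]: "a \<in> carrier (F d)" using a by (simp add: T_iff)
    have m: "?m \<in> sub V X Y d \<sigma>"
      using T_subset[OF a(1), of 4] kill[OF a(1)] by (intro tup_mem_sub[OF rep]) (auto simp: rD simp del: One_nat_def)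
    note mc = sub_images(5)[OF m]
    note ss = vanish[OF _ _ a(1)] vanish0[OF _ _ a(1)] kill[OF a(1)] cl[OF _ _ a(1)] cl0[OF _ _ a(1)]
    show "ent d f 2 3 s = \<zero>\<^bsub>F d'\<^esub>"
      using sub_images(1)[OF fsub[OF m]] by (simp add: pick[OF _ mc] zero ss a(2) del: One_nat_def)
    show "ent d f 5 5 s = ent d f 3 3 s"
      using sub_images(2)[OF fsub[OF m]] pick0[OF less_6(7) m]
      by (simp add: pick[OF _ mc] zero ss a(2) del: One_nat_def)
  qed
  have s23: "ent d f 2 3 s = \<zero>\<^bsub>F d'\<^esub>" "ent d f 5 5 s = ent d f 3 3 s" "ent d f 4 4 s = ent d f 2 2 s"
    if s: "s \<in> carrier (T d 1)" for s
  proof -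
    obtain a where "a \<in> carrier (T d 3)" "s = ppow d 2 a" using dvd[OF s, of 2] by auto
    then show "ent d f 2 3 s = \<zero>\<^bsub>F d'\<^esub>" "ent d f 5 5 s = ent d f 3 3 s" "ent d f 4 4 s = ent d f 2 2 s"
      using t3 t4 by auto
  qed
  have s01: "ent d f 0 1 s = \<zero>\<^bsub>F d'\<^esub>" "ent d f 5 5 s = ent d f 1 1 s" "ent d f 4 4 s = ent d f 0 0 s"
    if s: "s \<in> carrier (T d 1)" for s
  proof -
    obtain a where "a \<in> carrier (T d 4)" "s = ppow d 3 a" using dvd[OF s, of 3] by auto
    then show "ent d f 0 1 s = \<zero>\<^bsub>F d'\<^esub>" "ent d f 5 5 s = ent d f 1 1 s" "ent d f 4 4 s = ent d f 0 0 s"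
      using t1 t2 by auto
  qed
  have t5: "ent d f 1 0 s = \<zero>\<^bsub>F d'\<^esub>" "\<sigma>' (ent d f 3 3 b) = X' (\<sigma>' (ent d f 0 0 s))"
    if s: "s \<in> carrier (T d 1)" and b: "b \<in> carrier (T d 1)" "\<sigma> b = X (\<sigma> s)" for s b
  proof -
    obtain a where a: "a \<in> carrier (T d 5)" "s = ppow d 4 a" using dvd[OF s, of 4] by auto
    obtain c where c: "c \<in> carrier (T d 4)" "b = ppow d 3 c" using dvd[OF b(1), of 3] by auto
    \<comment> \<open>A test element not divisible by \<open>p\<close>: modulo \<open>p\<close> it
      has \<open>u = (s, 0)\<close> and \<open>w = (0, X s)\<close>. The congruence between the
      first component of \<open>w\<close> and the second of \<open>u\<close> forces
      \<open>ent 1 0\<close> to vanish on the socle, the other one relates \<open>X\<close> and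
      \<open>X'\<close>.\<close>
    let ?m = "tup a \<zero>\<^bsub>F d\<^esub> \<zero>\<^bsub>F d\<^esub> c (ppow d 2 a) (ppow d 2 c)"
    have aF[simp]: "a \<in> carrier (F d)" "c \<in> carrier (F d)" using a c by (auto simp: T_iff)
    have \<sigma>b: "\<sigma> b \<in> carrier V" using rD(4)[of b] b(1) by (simp add: T_iff)
    have m: "?m \<in> sub V X Y d \<sigma>"
      using a c b(2) \<sigma>b by (intro tup_mem_sub[OF rep]) (auto simp: rD simp del: One_nat_def)
    note mc = sub_images(5)[OF m]
    note ss = vanish[OF _ _ a(1)] kill[OF a(1)] cl[OF _ _ a(1)] vanish[OF _ _ c(1)] kill[OF c(1)] cl[OF _ _ c(1)]
    have z: "ent d f 2 3 (ppow d 3 c) = \<zero>\<^bsub>F d'\<^esub>" using s23 b(1) c(2) by simp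
    show e10: "ent d f 1 0 s = \<zero>\<^bsub>F d'\<^esub>"
      using sub_images(3)[OF fsub[OF m]] by (simp add: pick[OF _ mc] zero ss z a(2) del: One_nat_def)
    have e00: "ent d f 0 0 s \<in> carrier (F d')" "ppow d' 1 (ent d f 0 0 s) = \<zero>\<^bsub>F d'\<^esub>"
      using cl0[OF _ _ s, of 0 0] L(3)[of 0 0 s 1] T_subset[OF s, of 7] kill[OF s, of 1] zero[of 0 0] by auto
    show "\<sigma>' (ent d f 3 3 b) = X' (\<sigma>' (ent d f 0 0 s))"
      using sub_images(4)[OF fsub[OF m]] e10 e00
      by (simp add: pick[OF _ mc] zero ss a(2) c(2) rD' del: One_nat_def)
  qed
  have e10: "ent d f 1 0 s = \<zero>\<^bsub>F d'\<^esub>" if s: "s \<in> carrier (T d 1)" for s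
  proof -
    have "X (\<sigma> s) \<in> carrier V" using rD(2,4) s by (simp add: T_iff)
    then show ?thesis using t5(1)[OF s] rD(10) by blast
  qed
  \<comment> \<open>With \<open>ent 1 0\<close> known to vanish on the socle, the equation of
    \<open>t1\<close> becomes a vanishing statement, and on all of the \<open>p^2\<close>-torsion,
    one step more than every map from \<open>P 3\<close> to \<open>P 2\<close> satisfies.\<close>
  have e54: "ent d f 5 4 y = \<zero>\<^bsub>F d'\<^esub>" if y: "y \<in> carrier (T d 2)" for y
  proof -
    obtain a where a: "a \<in> carrier (T d 4)" "y = ppow d 2 a" using T_dvd[OF y, of 4] n by auto
    have "ppow d 3 a \<in> carrier (T d 1)" using a by (simp add: T_iff)
    then show ?thesis using t1(2)[OF a(1) refl] e10 a(2) by simp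
  qed
  have e32: "ent d f 3 2 s = \<zero>\<^bsub>F d'\<^esub>" if s: "s \<in> carrier (T d 1)" for s
  proof -
    obtain a where a: "a \<in> carrier (T d 3)" "s = ppow d 2 a" using dvd[OF s, of 2] by auto
    have "ppow d 1 a \<in> carrier (T d 2)" using a by (simp add: T_iff)
    then show ?thesis using t3(2)[OF a] e54 by simp
  qed
  have t6: "ent d f 2 2 s = ent d f 1 1 s" "\<sigma>' (ent d f 3 3 b) = Y' (\<sigma>' (ent d f 1 1 s))"
    if s: "s \<in> carrier (T d 1)" and b: "b \<in> carrier (T d 1)" "\<sigma> b = Y (\<sigma> s)" for s b
  proof -
    obtain a where a: "a \<in> carrier (T d 5)" "s = ppow d 4 a" using dvd[OF s, of 4] by auto
    obtain c where c: "c \<in> carrier (T d 4)" "b = ppow d 3 c" using dvd[OF b(1), of 3] by auto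
    \<comment> \<open>Modulo \<open>p\<close> this has \<open>u = (0, s)\<close> and
      \<open>w = (s, Y s)\<close>. It is the element that ties the two copies of \<open>V\<close>
      together.\<close>
    let ?m = "tup \<zero>\<^bsub>F d\<^esub> a (ppow d 1 a) c (ppow d 2 a) (ppow d 3 a \<oplus>\<^bsub>F d\<^esub> ppow d 2 c)"
    have aF[simp]: "a \<in> carrier (F d)" "c \<in> carrier (F d)" using a c by (auto simp: T_iff)
    have \<sigma>b: "\<sigma> b \<in> carrier V" using rD(4)[of b] b(1) by (simp add: T_iff)
    have pa: "ppow d 1 a \<in> carrier (T d 4)" using a by (simp add: T_iff)
    have m: "?m \<in> sub V X Y d \<sigma>"
      using a c b(2) \<sigma>b pa by (intro tup_mem_sub[OF rep]) (auto simp: rD simp del: One_nat_def)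
    note mc = sub_images(5)[OF m]
    note ss = vanish[OF _ _ a(1)] kill[OF a(1)] cl[OF _ _ a(1)] vanish[OF _ _ c(1)] kill[OF c(1)] cl[OF _ _ c(1)]
    have z: "ent d f 2 3 (ppow d 3 c) = \<zero>\<^bsub>F d'\<^esub>" "ent d f 3 2 (ppow d 4 a) = \<zero>\<^bsub>F d'\<^esub>"
      "ent d f 0 1 (ppow d 4 a) = \<zero>\<^bsub>F d'\<^esub>"
      using s23 e32 s01 s b(1) c(2) a(2) by auto
    show "ent d f 2 2 s = ent d f 1 1 s"
      using sub_images(3)[OF fsub[OF m]] by (simp add: pick[OF _ mc] zero ss z a(2) del: One_nat_def)
    have e11: "ent d f 1 1 s \<in> carrier (F d')" "ppow d' 1 (ent d f 1 1 s) = \<zero>\<^bsub>F d'\<^esub>"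
      using cl0[OF _ _ s, of 1 1] L(3)[of 1 1 s 1] T_subset[OF s, of 7] kill[OF s, of 1] zero[of 1 1] by auto
    show "\<sigma>' (ent d f 3 3 b) = Y' (\<sigma>' (ent d f 1 1 s))"
      using sub_images(4)[OF fsub[OF m]] e11
      by (simp add: pick[OF _ mc] zero ss z a(2) c(2) rD' del: One_nat_def)
  qed
  have e22: "ent d f 2 2 s = ent d f 1 1 s" if s: "s \<in> carrier (T d 1)" for s
  proof -
    have "Y (\<sigma> s) \<in> carrier V" using rD(3,4) s by (simp add: T_iff)
    then show ?thesis using t6(1)[OF s] rD(10) by blast
  qed
  show ii: "ent d f i i s = ent d f 5 5 s" if s: "s \<in> carrier (T d 1)" and i: "i < 6" for s i
  proof -
    have "\<forall>i<6. ent d f i i s = ent d f 5 5 s"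
      unfolding all_less_6 using s01[OF s] s23[OF s] e22[OF s] by simp
    then show ?thesis using i by blast
  qed
  show "ent d f 0 1 s = \<zero>\<^bsub>F d'\<^esub> \<and> ent d f 1 0 s = \<zero>\<^bsub>F d'\<^esub>
        \<and> ent d f 2 3 s = \<zero>\<^bsub>F d'\<^esub> \<and> ent d f 3 2 s = \<zero>\<^bsub>F d'\<^esub>" if "s \<in> carrier (T d 1)" for s
    using s01 s23 e10 e32 that by simp
  show "ent d f 5 4 y = \<zero>\<^bsub>F d'\<^esub>" if "y \<in> carrier (T d 2)" for y using e54 that .
  show "\<sigma>' (ent d f 5 5 b) = X' (\<sigma>' (ent d f 5 5 s))"
    if "s \<in> carrier (T d 1)" "b \<in> carrier (T d 1)" "\<sigma> b = X (\<sigma> s)" for s b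
    using t5(2)[OF that] ii[OF that(2), of 3] ii[OF that(1), of 0] by simp
  show "\<sigma>' (ent d f 5 5 b) = Y' (\<sigma>' (ent d f 5 5 s))"
    if "s \<in> carrier (T d 1)" "b \<in> carrier (T d 1)" "\<sigma> b = Y (\<sigma> s)" for s b
    using t6(2)[OF that] ii[OF that(2), of 3] ii[OF that(1), of 1] by simp
qed

section \<open>Lifting homomorphisms of representations\<close>

lemma F_linear:
  assumes "H \<in> linear_maps R (F d) (F d')"
  shows "x \<in> carrier (F d) \<Longrightarrow> H x \<in> carrier (F d')"
    "x \<in> carrier (F d) \<Longrightarrow> ppow d' k (H x) = H (ppow d k x)"
    "H \<zero>\<^bsub>F d\<^esub> = \<zero>\<^bsub>F d'\<^esub>"
    "x \<in> carrier (F d) \<Longrightarrow> y \<in> carrier (F d) \<Longrightarrow> H (x \<oplus>\<^bsub>F d\<^esub> y) = H x \<oplus>\<^bsub>F d'\<^esub> H y"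
  using linear_mapsD(2-)[OF assms] linear_map_zero[OF assms] module.axioms(2)[OF module_F]
  by (auto simp: ppow_def)

lemma restrict_F_linear:
  assumes H: "H \<in> linear_maps R (F d) (F d')" and m: "m \<le> m'"
  shows "(\<lambda>x\<in>carrier (T d m). H x) \<in> linear_maps R (T d m) (T d' m')"
proof (rule restrict_linear_mapsI[OF left_module_T])
  show "H x \<in> carrier (T d' m')" if "x \<in> carrier (T d m)" for x
    using T_subset[OF that m] F_linear[OF H] by (simp add: T_iff)
qed (use linear_mapsD[OF H] in \<open>auto simp: T_iff\<close>)

text \<open>Carry \<open>a\<close> to the socle by the isomorphisms \<sigma>, extend it to a map
  \<open>H\<close> of free modules by self-injectivity, and apply \<open>H\<close> in all six
  coordinates. The relations of the submodule involve only powers of \<open>p\<close>, sums and, on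
  the socle, \<open>X\<close> and \<open>Y\<close>, so they are preserved.\<close>

lemma morphism_exists:
  assumes n: "7 \<le> n" and rep: "is_rep V X Y d \<sigma>" and rep': "is_rep V' X' Y' d' \<sigma>'"
    and a: "a \<in> linear_maps R V V'"
    and aX: "\<And>v. v \<in> carrier V \<Longrightarrow> a (X v) = X' (a v)" and aY: "\<And>v. v \<in> carrier V \<Longrightarrow> a (Y v) = Y' (a v)"
  shows "\<exists>f\<in>linear_maps R (tot d) (tot d'). f ` sub V X Y d \<sigma> \<subseteq> sub V' X' Y' d' \<sigma>'
     \<and> (\<forall>s\<in>carrier (T d 1). \<sigma>' (ent d f 5 5 s) = a (\<sigma> s))"
proof -
  interpret V: module R V by (rule repD(1)[OF rep])
  note rD = repD[OF rep] and rD' = repD[OF rep'] and aD = linear_mapsD[OF a]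
  define h where "h = (\<lambda>s\<in>carrier (T d 1). inv_into (carrier (T d' 1)) \<sigma>' (a (\<sigma> s)))"
  have \<sigma>V: "\<sigma> s \<in> carrier V" if "s \<in> carrier (T d 1)" for s using that rD(4) by (simp add: T_iff)
  have h: "h s \<in> carrier (T d' 1)" "\<sigma>' (h s) = a (\<sigma> s)" if "s \<in> carrier (T d 1)" for s
  proof -
    have "a (\<sigma> s) \<in> \<sigma>' ` carrier (T d' 1)" using rD'(10)[OF aD(2)[OF \<sigma>V[OF that]]] by (metis imageI)
    then show "h s \<in> carrier (T d' 1)" "\<sigma>' (h s) = a (\<sigma> s)"
      using that by (simp_all add: h_def inv_into_into f_inv_into_f)
  qed
  interpret T1: module R "T d 1" by (rule module_T)
  interpret T1': module R "T d' 1" by (rule module_T)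
  have hlin: "h \<in> linear_maps R (T d 1) (T d' 1)"
  proof (rule linear_mapsI)
    show "h \<in> extensional (carrier (T d 1))" by (simp add: h_def)
    fix x assume x: "x \<in> carrier (T d 1)"
    show "h x \<in> carrier (T d' 1)" using h(1)[OF x] .
    {
      fix y assume y: "y \<in> carrier (T d 1)"
      have xy: "x \<oplus>\<^bsub>T d 1\<^esub> y \<in> carrier (T d 1)" using x y by (rule T1.M.a_closed)
      have "h x \<oplus>\<^bsub>T d' 1\<^esub> h y \<in> carrier (T d' 1)" using h(1)[OF x] h(1)[OF y] by (rule T1'.M.a_closed)
      moreover have "\<sigma>' (h (x \<oplus>\<^bsub>T d 1\<^esub> y)) = \<sigma>' (h x \<oplus>\<^bsub>T d' 1\<^esub> h y)"
        using h(2)[OF xy] h[OF x] h[OF y] x y \<sigma>V by (simp add: rD(5) rD'(5) aD T_iff)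
      ultimately show "h (x \<oplus>\<^bsub>T d 1\<^esub> y) = h x \<oplus>\<^bsub>T d' 1\<^esub> h y" using rD'(11)[OF h(1)[OF xy]] by blast
    next
      fix c assume c: "c \<in> carrier R"
      have cx: "c \<odot>\<^bsub>T d 1\<^esub> x \<in> carrier (T d 1)" using c x by (rule T1.smult_closed)
      have "c \<odot>\<^bsub>T d' 1\<^esub> h x \<in> carrier (T d' 1)" using c h(1)[OF x] by (rule T1'.smult_closed)
      moreover have "\<sigma>' (h (c \<odot>\<^bsub>T d 1\<^esub> x)) = \<sigma>' (c \<odot>\<^bsub>T d' 1\<^esub> h x)"
        using h(2)[OF cx] h[OF x] x c \<sigma>V by (simp add: rD(6) rD'(6) aD T_iff)
      ultimately show "h (c \<odot>\<^bsub>T d 1\<^esub> x) = c \<odot>\<^bsub>T d' 1\<^esub> h x" using rD'(11)[OF h(1)[OF cx]] by blast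
    }
  qed
  obtain H where H: "H \<in> linear_maps R (F d) (F d')" "\<And>s. s \<in> carrier (T d 1) \<Longrightarrow> h s = H s"
    using linear_map_extends[OF _ hlin] n by auto
  note HF = F_linear[OF H(1)]
  define f where "f = (\<lambda>m\<in>carrier (tot d). \<lambda>i\<in>{..<6}. H (m i))"
  have f: "f \<in> linear_maps R (tot d) (tot d')"
    unfolding f_def
  proof (rule restrict_linear_mapsI[OF left_module_TP])
    show "(\<lambda>i\<in>{..<6}. H (m i)) \<in> carrier (tot d')" if "m \<in> carrier (tot d)" for m
      using tot_comp[OF that] HF by (simp add: T_iff)
  qed (use linear_mapsD(3,4)[OF H(1)] in \<open>auto simp: T_iff intro!: restrict_ext\<close>)
  have sH: "\<sigma>' (H s) = a (\<sigma> s)" if "s \<in> carrier (T d 1)" for s using H(2)[OF that] h(2)[OF that] by simp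
  have "f m \<in> sub V' X' Y' d' \<sigma>'" if m: "m \<in> sub V X Y d \<sigma>" for m
  proof -
    have mc: "m \<in> carrier (tot d)" using m by (auto simp: sub_def)
    note [simp] = tot_comp[OF mc, THEN conjunct1]
    note me = m[unfolded sub_def mem_Collect_eq]
    have s: "ppow d 4 (m 0) \<in> carrier (T d 1)" "ppow d 4 (m 1) \<in> carrier (T d 1)" "ppow d 3 (m 3) \<in> carrier (T d 1)"
      using me by (simp_all add: T_iff)
    have fm: "f m i = H (m i)" if "i < 6" for i using mc that by (simp add: f_def)
    have fc: "f m \<in> carrier (tot d')" using linear_mapsD(2)[OF f mc] .
    have "\<sigma>' (H (ppow d 3 (m 3))) = X' (\<sigma>' (H (ppow d 4 (m 0)))) \<oplus>\<^bsub>V'\<^esub> Y' (\<sigma>' (H (ppow d 4 (m 1))))"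
      using s me \<sigma>V rD(2,3) by (simp add: sH aD aX aY del: One_nat_def)
    then show ?thesis
      unfolding sub_def mem_Collect_eq using fc me
      by (simp add: fm HF del: TP_simps One_nat_def)
  qed
  moreover have "\<sigma>' (ent d f 5 5 s) = a (\<sigma> s)" if s: "s \<in> carrier (T d 1)" for s
  proof -
    have s2: "s \<in> carrier (T d (tot_exp 5))" using T_subset[OF s, of 2] by simp
    have "single_TP 6 d 5 s \<in> carrier (tot d)" using s2 by (intro single_TP_closed) auto
    then have "ent d f 5 5 s = H s" using s2 by (simp add: entry_def f_def single_TP_def del: TP_simps)
    then show ?thesis using sH[OF s] by simp
  qed
  ultimately show ?thesis using f by blast
qed

section \<open>Factoring the morphisms that induce zero\<close>

definition null_exp :: "nat \<Rightarrow> nat" where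
  "null_exp j = (if j < 6 then 6 else if j < 12 then 4 else if j = 12 then 6 else 2)"

text \<open>In the torsion picture an element \<open>x\<close> of the \<open>p^4\<close>-torsion of
  \<open>P 6\<close> is a multiple of \<open>p^2\<close>, so this is the element
  \<open>(p^2 u, u)\<close> of \<open>P 6\<close> plus \<open>P 2\<close> with
  \<open>x = p^2 u\<close>.\<close>

definition probe :: "nat \<Rightarrow> (nat \<Rightarrow> 'a) \<Rightarrow> nat \<Rightarrow> nat \<Rightarrow> 'a" where
  "probe d x = (\<lambda>j\<in>{..<14}. if j = 12 then x else if j = 13 then ppow d 2 x else \<zero>\<^bsub>F d\<^esub>)"

text \<open>The last summand of \<open>TP 14 null_exp d\<close> is the only one with exponent \<open>2\<close>, hence the only one through
  which a map can be nonzero on the layer of \<open>T d 2\<close>; the probes in the submodule exclude that.\<close>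

lemma probed_object_null:
  assumes n: "7 \<le> n" and g: "g \<in> linear_maps R (tot d) (TP 14 null_exp d\<^sub>0)" and k: "k \<in> linear_maps R (TP 14 null_exp d\<^sub>0) (tot d')"
    and W: "\<And>x. x \<in> carrier (T d\<^sub>0 4) \<Longrightarrow> k (probe d\<^sub>0 x) \<in> sub V' X' Y' d' \<sigma>'"
    and s: "s \<in> carrier (T d 1)"
  shows "ent d (compose (carrier (tot d)) k g) 5 5 s = \<zero>\<^bsub>F d'\<^esub>"
proof -
  let ?f = "compose (carrier (tot d)) k g"
  have f: "?f \<in> linear_maps R (tot d) (tot d')" by (rule compose_linear_maps[OF left_module_TP g k])
  note kl = entry_linear[OF k]
  obtain t where t: "t \<in> carrier (T d 2)" "s = ppow d 1 t" using T_dvd[OF s, of 2] n by auto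
  let ?m = "single_TP 6 d 5 t"
  have m: "?m \<in> carrier (tot d)" using t by (intro single_TP_closed) auto
  have m2: "ppow d 2 (?m c) = \<zero>\<^bsub>F d\<^esub>" if "c < 6" for c using t that by (simp add: single_TP_def T_iff)
  have "ent d ?f 5 5 s = ppow d' 1 (?f ?m 5)"
  proof -
    have "?m 5 = t" by (simp add: single_TP_def)
    then show ?thesis using layer_map[OF n f m m2] t(2) by simp
  qed
  also have "?f ?m = k (g ?m)" using m by (simp add: compose_def)
  finally have e: "ent d ?f 5 5 s = ppow d' 1 (k (g ?m) 5)" .
  let ?z = "g ?m"
  have z: "?z \<in> carrier (TP 14 null_exp d\<^sub>0)" by (rule linear_mapsD(2)[OF g m])
  have zT: "?z j \<in> carrier (T d\<^sub>0 2)" if j: "j < 14" for j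
  proof -
    have "p [^] (2::nat) \<odot>\<^bsub>tot d\<^esub> ?m = \<zero>\<^bsub>tot d\<^esub>"
      using m2 by (auto simp: ppow_def[symmetric] intro!: restrict_ext)
    then have "p [^] (2::nat) \<odot>\<^bsub>TP 14 null_exp d\<^sub>0\<^esub> ?z = \<zero>\<^bsub>TP 14 null_exp d\<^sub>0\<^esub>"
      using linear_mapsD(4)[OF g pow_closed m, of 2] linear_map_zero[OF g] module.axioms(2)[OF module_TP] by metis
    then have "(p [^] (2::nat) \<odot>\<^bsub>TP 14 null_exp d\<^sub>0\<^esub> ?z) j = \<zero>\<^bsub>TP 14 null_exp d\<^sub>0\<^esub> j" by simp
    then have "ppow d\<^sub>0 2 (?z j) = \<zero>\<^bsub>F d\<^sub>0\<^esub>" using j by (simp add: ppow_def)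
    then show ?thesis using z j by (simp add: T_iff)
  qed
  have v: "entry 14 null_exp d\<^sub>0 k 5 j (ppow d\<^sub>0 1 y) = \<zero>\<^bsub>F d'\<^esub>" if "j < 13" "y \<in> carrier (T d\<^sub>0 2)" for j y
    by (rule T_linear_vanish[OF kl _ that(2)]) (use that n in \<open>auto simp: null_exp_def\<close>)
  have last: "entry 14 null_exp d\<^sub>0 k 5 13 (ppow d\<^sub>0 1 y) = \<zero>\<^bsub>F d'\<^esub>" if y: "y \<in> carrier (T d\<^sub>0 2)" for y
  proof -
    obtain x where x: "x \<in> carrier (T d\<^sub>0 4)" "y = ppow d\<^sub>0 2 x" using T_dvd[OF y, of 4] n by auto
    have xF[simp]: "x \<in> carrier (F d\<^sub>0)" using x by (simp add: T_iff)
    have x6: "x \<in> carrier (T d\<^sub>0 (null_exp 12))" using T_subset[OF x(1), of 6] by (simp add: null_exp_def)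
    have y2: "y \<in> carrier (T d\<^sub>0 (null_exp 13))" using y by (simp add: null_exp_def)
    have s1: "single_TP 14 d\<^sub>0 12 x \<in> carrier (TP 14 null_exp d\<^sub>0)" using x6 by (intro single_TP_closed) auto
    have s2: "single_TP 14 d\<^sub>0 13 y \<in> carrier (TP 14 null_exp d\<^sub>0)" using y2 by (intro single_TP_closed) auto
    have "probe d\<^sub>0 x = single_TP 14 d\<^sub>0 12 x \<oplus>\<^bsub>TP 14 null_exp d\<^sub>0\<^esub> single_TP 14 d\<^sub>0 13 y"
      by (auto simp: probe_def single_TP_def x(2) intro!: restrict_ext)
    then have "k (probe d\<^sub>0 x) = k (single_TP 14 d\<^sub>0 12 x) \<oplus>\<^bsub>tot d'\<^esub> k (single_TP 14 d\<^sub>0 13 y)"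
      using linear_mapsD(3)[OF k s1 s2] by simp
    then have kp: "k (probe d\<^sub>0 x) i = entry 14 null_exp d\<^sub>0 k i 12 x \<oplus>\<^bsub>F d'\<^esub> entry 14 null_exp d\<^sub>0 k i 13 y" if "i < 6" for i
      using that x6 y2 by (simp add: entry_def)
    have c: "entry 14 null_exp d\<^sub>0 k i 12 x \<in> carrier (F d')" "entry 14 null_exp d\<^sub>0 k i 13 y \<in> carrier (F d')"
      "ppow d' q (entry 14 null_exp d\<^sub>0 k i 12 x) = entry 14 null_exp d\<^sub>0 k i 12 (ppow d\<^sub>0 q x)"
      "ppow d' q (entry 14 null_exp d\<^sub>0 k i 13 y) = entry 14 null_exp d\<^sub>0 k i 13 (ppow d\<^sub>0 q y)"
      "entry 14 null_exp d\<^sub>0 k i 13 \<zero>\<^bsub>F d\<^sub>0\<^esub> = \<zero>\<^bsub>F d'\<^esub>" "entry 14 null_exp d\<^sub>0 k i 12 \<zero>\<^bsub>F d\<^sub>0\<^esub> = \<zero>\<^bsub>F d'\<^esub>" if "i < 6" for i q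
      using T_linear[OF kl[OF that]] x6 y2 by auto
    have v12: "entry 14 null_exp d\<^sub>0 k i 12 (ppow d\<^sub>0 q x) = \<zero>\<^bsub>F d'\<^esub>" if "i < 6" "tot_exp i \<le> q + 2" for i q
      by (rule T_linear_vanish[OF kl _ x(1)]) (use that n in \<open>auto simp: null_exp_def\<close>)
    have kx: "ppow d\<^sub>0 q x = \<zero>\<^bsub>F d\<^sub>0\<^esub>" if "4 \<le> q" for q using x that ppow_mono by (auto simp: T_iff)
    have ky: "ppow d\<^sub>0 q y = \<zero>\<^bsub>F d\<^sub>0\<^esub>" if "2 \<le> q" for q using y that ppow_mono by (auto simp: T_iff)
    note U = sub_images(2)[OF W[OF x(1)]]
    \<comment> \<open>The relation for coordinate 5, multiplied by \<open>p\<close>. The terms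
      coming from \<open>P 6\<close> vanish because \<open>x\<close> is divisible by
      \<open>p^2\<close> there, and those of coordinates 1 and 3 coming from \<open>P 2\<close>
      because they carry at least \<open>p^3\<close>; what survives is the entry that has to be
      zero.\<close>
    have "ppow d' 1 (k (probe d\<^sub>0 x) 5)
      = ppow d' 1 (ppow d' 3 (k (probe d\<^sub>0 x) 1) \<oplus>\<^bsub>F d'\<^esub> ppow d' 2 (k (probe d\<^sub>0 x) 3))" using U by simp
    moreover have "ppow d' 1 (entry 14 null_exp d\<^sub>0 k 5 12 x) = \<zero>\<^bsub>F d'\<^esub>"
      "ppow d' 4 (entry 14 null_exp d\<^sub>0 k 1 12 x) = \<zero>\<^bsub>F d'\<^esub>" "ppow d' 4 (entry 14 null_exp d\<^sub>0 k 1 13 y) = \<zero>\<^bsub>F d'\<^esub>"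
      "ppow d' 3 (entry 14 null_exp d\<^sub>0 k 3 12 x) = \<zero>\<^bsub>F d'\<^esub>" "ppow d' 3 (entry 14 null_exp d\<^sub>0 k 3 13 y) = \<zero>\<^bsub>F d'\<^esub>"
      by (simp_all add: c(3-6) v12 kx ky del: One_nat_def)
    ultimately have "ppow d' 1 (entry 14 null_exp d\<^sub>0 k 5 13 y) = \<zero>\<^bsub>F d'\<^esub>"
      using c(1,2) by (simp add: kp del: One_nat_def)
    then show ?thesis using c(4)[of 5 1] by (simp del: One_nat_def)
  qed
  interpret T5: module R "T d' (tot_exp 5)" by (rule module_T)
  let ?w = "\<lambda>j\<in>{..<14}. ppow d\<^sub>0 1 (?z j)"
  have wz: "?w = p [^] (1::nat) \<odot>\<^bsub>TP 14 null_exp d\<^sub>0\<^esub> ?z" by (auto simp: ppow_def)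
  have w: "?w \<in> carrier (TP 14 null_exp d\<^sub>0)" unfolding wz by (intro module.smult_closed[OF module_TP] z) simp
  have "k ?w = p [^] (1::nat) \<odot>\<^bsub>tot d'\<^esub> k ?z" unfolding wz by (rule linear_mapsD(4)[OF k _ z]) simp
  then have "ppow d' 1 (k ?z 5) = k ?w 5" by (simp add: ppow_def)
  also have "\<dots> = finsum (T d' (tot_exp 5)) (\<lambda>j. entry 14 null_exp d\<^sub>0 k 5 j (?w j)) {..<14}"
    by (rule entry_sum[OF k _ w]) simp
  also have "\<dots> = finsum (T d' (tot_exp 5)) (\<lambda>j. \<zero>\<^bsub>F d'\<^esub>) {..<14::nat}"
  proof (rule T5.M.finsum_cong')
    fix j assume j: "j \<in> {..<14::nat}"
    show "entry 14 null_exp d\<^sub>0 k 5 j (?w j) = \<zero>\<^bsub>F d'\<^esub>"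
      using j v[OF _ zT[of j]] last[OF zT[of j]] by (cases "j = 13") auto
  qed auto
  also have "\<dots> = \<zero>\<^bsub>F d'\<^esub>" using T5.M.finsum_zero[of "{..<14::nat}"] by simp
  finally show ?thesis using e by simp
qed

text \<open>The summand through which the entry in row \<open>i\<close> and column \<open>c\<close>
  is sent. Each column of \<open>tot\<close> has its own copy of \<open>P 6\<close> and of
  \<open>P 4\<close>, so that entries of one column can take different routes without interfering
  with other columns. Column 6 is fictitious: it stands for the component of the second factor that
  starts at summand 12.\<close>

definition block :: "nat \<Rightarrow> nat \<Rightarrow> nat" where
  "block i c = (if c = 6 then 12 else if c = 5 \<and> 4 \<le> i then 13
     else if c < 2 \<or> c < 4 \<and> i < 2 then c else c + 6)"

lemma block_less: "c < 7 \<Longrightarrow> block i c < 14"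
  by (simp add: block_def)

text \<open>An entry of a morphism that induces zero kills the \<open>p\<^sup>j\<close>-torsion for \<open>j = depth i c\<close>; the
  case \<open>tot_exp c - tot_exp i\<close> holds for every linear map.\<close>

definition depth :: "nat \<Rightarrow> nat \<Rightarrow> nat" where
  "depth i c = (if c < 2 \<and> i < 2 \<or> 2 \<le> c \<and> c < 4 \<and> 2 \<le> i \<and> i < 4 \<or> c = 4 \<and> i = 4 then 1
      else if c = 4 \<and> i = 5 then 2 else tot_exp c - tot_exp i)"

text \<open>Entries from \<open>P 2\<close> to \<open>P 3\<close> and \<open>P 2\<close> keep
  summand 13 unchanged. For every other entry \<open>linear_map_factors\<close> applies, and its
  inequalities are checked case by case. Several hold with equality: from \<open>P 3\<close> to
  \<open>P 2\<close> through \<open>P 4\<close> the condition reads 4 at most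
  \<open>2 + depth\<close>, which is why vanishing on the whole \<open>p^2\<close>-torsion was
  established for that entry.\<close>

lemma kernel_entries_factor:
  assumes n: "7 \<le> n" and rep: "is_rep V X Y d \<sigma>" and rep': "is_rep V' X' Y' d' \<sigma>'"
    and f: "f \<in> linear_maps R (tot d) (tot d')" and fU: "f ` sub V X Y d \<sigma> \<subseteq> sub V' X' Y' d' \<sigma>'"
    and ker: "\<And>s. s \<in> carrier (T d 1) \<Longrightarrow> ent d f 5 5 s = \<zero>\<^bsub>F d'\<^esub>"
    and i: "i < 6" and c: "c < 6"
  shows "\<exists>g\<in>linear_maps R (T d (null_exp (block i c))) (T d' (tot_exp i)).
     \<forall>x\<in>carrier (T d (tot_exp c)). ent d f i c x = g (ppow d (tot_exp c - null_exp (block i c)) x)"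
proof (cases "c = 5 \<and> 4 \<le> i")
  case True
  then have b: "null_exp (block i c) = 2" "tot_exp c = 2" by (simp_all add: block_def null_exp_def)
  show ?thesis using entry_linear[OF f i c] b by (intro bexI[of _ "ent d f i c"]) (auto simp: T_iff)
next
  case False
  note E = entries_of_morphism[OF n rep rep' f fU]
  define j where "j = depth i c"
  have kill: "ent d f i c x = \<zero>\<^bsub>F d'\<^esub>" if x: "x \<in> carrier (T d j)" for x
  proof -
    have "\<forall>i<6. \<forall>c<6. i = c \<and> i < 5 \<and> depth i c = 1
      \<or> (i = 0 \<and> c = 1 \<or> i = 1 \<and> c = 0 \<or> i = 2 \<and> c = 3 \<or> i = 3 \<and> c = 2) \<and> depth i c = 1
      \<or> i = 5 \<and> c = 4 \<and> depth i c = 2 \<or> depth i c = tot_exp c - tot_exp i"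
      unfolding all_less_6 by (simp add: depth_def)
    then consider "i = c" "i < 5" "j = 1" | "i = 0 \<and> c = 1 \<or> i = 1 \<and> c = 0 \<or> i = 2 \<and> c = 3 \<or> i = 3 \<and> c = 2" "j = 1"
      | "i = 5" "c = 4" "j = 2" | "j = tot_exp c - tot_exp i"
      using i c unfolding j_def by blast
    then show ?thesis
    proof cases
      case 1
      then show ?thesis using E(1)[of x i] ker[of x] x i by simp
    next
      case 2
      then show ?thesis using E(2)[of x] x by auto
    next
      case 3
      then show ?thesis using E(3)[of x] x by simp
    next
      case 4
      show ?thesis
      proof (cases "tot_exp i \<le> tot_exp c")
        case True
        then show ?thesis
          using T_linear_vanish[OF entry_linear[OF f i c] _ x, of 0] x 4 n tot_exp_le[of c] by (simp add: T_iff)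
      next
        case False
        then have "x = \<zero>\<^bsub>F d\<^esub>" using x 4 by (auto simp: T_iff)
        then show ?thesis using T_linear(4)[OF entry_linear[OF f i c]] by simp
      qed
    qed
  qed
  let ?m = "null_exp (block i c)"
  \<comment> \<open>These are the three numerical hypotheses of \<open>linear_map_factors\<close>
    for the 34 remaining positions, decided by evaluation.\<close>
  have "\<forall>i<6. \<forall>c<6. \<not> (c = 5 \<and> 4 \<le> i) \<longrightarrow> depth i c \<le> tot_exp c \<and>
     tot_exp c - null_exp (block i c) \<le> depth i c \<and> null_exp (block i c) \<le> tot_exp i + (depth i c - (tot_exp c - null_exp (block i c)))"
    unfolding all_less_6 by (simp add: depth_def null_exp_def block_def)
  then have num: "j \<le> tot_exp c" "tot_exp c - ?m \<le> j" "?m \<le> tot_exp i + (j - (tot_exp c - ?m))"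
    using i c False unfolding j_def by blast+
  show ?thesis
    using linear_map_factors[OF _ entry_linear[OF f i c] num(1) kill num(2,3)] tot_exp_le[of c] n
    by (simp add: ppow_def)
qed

text \<open>\<alpha> distributes the columns over the summands and \<beta> adds up the second
  factors of the entries. The component of \<beta> on summand 12 is free, because \<alpha> is zero
  there. It is used to send the probes into the submodule: it supplies a vector \<open>u\<close>
  divisible by \<open>p\<close> that, with \<open>w = 0\<close>, matches what summand 13 contributes
  to coordinates 4 and 5.\<close>

lemma kernel_factors:
  assumes n: "7 \<le> n" and rep: "is_rep V X Y d \<sigma>" and rep': "is_rep V' X' Y' d' \<sigma>'"
    and f: "f \<in> linear_maps R (tot d) (tot d')" and fU: "f ` sub V X Y d \<sigma> \<subseteq> sub V' X' Y' d' \<sigma>'"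
    and ker: "\<And>s. s \<in> carrier (T d 1) \<Longrightarrow> ent d f 5 5 s = \<zero>\<^bsub>F d'\<^esub>"
  shows "\<exists>\<alpha>\<in>linear_maps R (tot d) (TP 14 null_exp d). \<exists>\<beta>\<in>linear_maps R (TP 14 null_exp d) (tot d').
     (\<forall>m\<in>carrier (tot d). f m = \<beta> (\<alpha> m)) \<and> (\<forall>x\<in>carrier (T d 4). \<beta> (probe d x) \<in> sub V' X' Y' d' \<sigma>')"
proof -
  note el = entry_linear[OF f]
  have l5: "ent d f i 5 \<in> linear_maps R (T d 2) (T d' (tot_exp i))" if "i < 6" for i using el[OF that, of 5] by simp
  \<comment> \<open>\<open>b\<close> extends the component from \<open>P 2\<close> to
    \<open>P 3\<close>, and \<open>p H\<close> extends that from \<open>P 2\<close> to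
    \<open>P 2\<close>, which is divisible by \<open>p\<close> since it kills the socle. Both serve
    as maps from \<open>P 6\<close> to \<open>P 7\<close>.\<close>
  obtain b where b: "b \<in> linear_maps R (F d) (F d')" "\<And>x. x \<in> carrier (T d 2) \<Longrightarrow> ent d f 4 5 x = b x"
    using linear_map_extends[OF _ l5, of 4] n by auto
  obtain H where H: "H \<in> linear_maps R (F d) (F d')" "\<And>x. x \<in> carrier (T d 2) \<Longrightarrow> ent d f 5 5 x = ppow d' 1 (H x)"
    using linear_map_extends_dvd[OF _ l5, of 5 1] n ker by (auto simp: ppow_def)
  have "\<exists>g. g \<in> linear_maps R (T d (null_exp (block i c))) (T d' (tot_exp i)) \<and>
      (c < 6 \<longrightarrow> (\<forall>x\<in>carrier (T d (tot_exp c)). ent d f i c x = g (ppow d (tot_exp c - null_exp (block i c)) x))) \<and>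
      (c = 6 \<longrightarrow> (\<forall>x\<in>carrier (T d 6). g x = (if i = 0 then b x else if i = 1 then H x else \<zero>\<^bsub>F d'\<^esub>)))"
    if i: "i < 6" and c: "c < 7" for i c
  proof (cases "c = 6")
    case False
    then show ?thesis using kernel_entries_factor[OF n rep rep' f fU ker i, of c] c by auto
  next
    case True
    then have b6: "null_exp (block i c) = 6" by (simp add: block_def null_exp_def)
    have "\<exists>g\<in>linear_maps R (T d 6) (T d' (tot_exp i)).
      \<forall>x\<in>carrier (T d 6). g x = (if i = 0 then b x else if i = 1 then H x else \<zero>\<^bsub>F d'\<^esub>)"
    proof -
      consider "i = 0" | "i = 1" | "2 \<le> i" by linarith
      then show ?thesis
      proof cases
        case 1
        then show ?thesis using restrict_F_linear[OF b(1), of 6 7] by (intro bexI) auto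
      next
        case 2
        then show ?thesis using restrict_F_linear[OF H(1), of 6 7] by (intro bexI) auto
      next
        case 3
        have "(\<lambda>x\<in>carrier (T d 6). \<zero>\<^bsub>T d' (tot_exp i)\<^esub>) \<in> linear_maps R (T d 6) (T d' (tot_exp i))"
          by (rule linear_maps_zero[OF left_module_T left_module_T])
        then show ?thesis using 3 by (intro bexI) auto
      qed
    qed
    then show ?thesis using True b6 by auto
  qed
  then have "\<exists>g. \<forall>i c. i < 6 \<longrightarrow> c < 7 \<longrightarrow> g i c \<in> linear_maps R (T d (null_exp (block i c))) (T d' (tot_exp i)) \<and>
      (c < 6 \<longrightarrow> (\<forall>x\<in>carrier (T d (tot_exp c)). ent d f i c x = g i c (ppow d (tot_exp c - null_exp (block i c)) x))) \<and>
      (c = 6 \<longrightarrow> (\<forall>x\<in>carrier (T d 6). g i c x = (if i = 0 then b x else if i = 1 then H x else \<zero>\<^bsub>F d'\<^esub>)))"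
    by (intro choice allI) (metis (no_types, lifting))
  then obtain g where g0: "\<forall>i c. i < 6 \<longrightarrow> c < 7 \<longrightarrow> g i c \<in> linear_maps R (T d (null_exp (block i c))) (T d' (tot_exp i)) \<and>
      (c < 6 \<longrightarrow> (\<forall>x\<in>carrier (T d (tot_exp c)). ent d f i c x = g i c (ppow d (tot_exp c - null_exp (block i c)) x))) \<and>
      (c = 6 \<longrightarrow> (\<forall>x\<in>carrier (T d 6). g i c x = (if i = 0 then b x else if i = 1 then H x else \<zero>\<^bsub>F d'\<^esub>)))"
    by (rule exE)
  have g: "g i c \<in> linear_maps R (T d (null_exp (block i c))) (T d' (tot_exp i))" if "i < 6" "c < 7" for i c
    using g0 that by blast
  have gf: "ent d f i c x = g i c (ppow d (tot_exp c - null_exp (block i c)) x)"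
    if "i < 6" "c < 6" "x \<in> carrier (T d (tot_exp c))" for i c x
    using g0[rule_format, OF that(1), of c] that by simp
  have g6: "g i 6 x = (if i = 0 then b x else if i = 1 then H x else \<zero>\<^bsub>F d'\<^esub>)"
    if "i < 6" "x \<in> carrier (T d 6)" for i x
    using g0[rule_format, OF that(1), of 6] that by simp
  have comp: "(\<lambda>z\<in>carrier (TP 14 null_exp d). h (z j)) \<in> linear_maps R (TP 14 null_exp d) (T d' q)"
    if "h \<in> linear_maps R (T d (null_exp j)) (T d' q)" "j < 14" for h j q
    by (rule restrict_linear_mapsI[OF left_module_TP])
      (use linear_mapsD(2-)[OF that(1)] that(2) in auto)
  \<comment> \<open>All six columns appear twice, multiplied down to exponent 6 and to exponent 4;
    for smaller exponents truncated subtraction makes this the inclusion. Coordinate 12 stays zero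
    and coordinate 13 repeats the last column.\<close>
  define A where "A m = (\<lambda>j\<in>{..<14}. if j < 6 then ppow d (tot_exp j - 6) (m j)
     else if j < 12 then ppow d (tot_exp (j - 6) - 4) (m (j - 6)) else if j = 12 then \<zero>\<^bsub>F d\<^esub> else m 5)" for m
  define \<alpha> where "\<alpha> = (\<lambda>m\<in>carrier (tot d). A m)"
  have \<alpha>: "\<alpha> \<in> linear_maps R (tot d) (TP 14 null_exp d)"
    unfolding \<alpha>_def
  proof (rule restrict_linear_mapsI[OF left_module_TP])
    fix m assume m: "m \<in> carrier (tot d)"
    have "ppow d (tot_exp c - q) (m c) \<in> carrier (T d q)" if "c < 6" for c q
      using tot_comp[OF m that] ppow_mono[of d "tot_exp c" "m c" "q + (tot_exp c - q)"] by (simp add: T_iff)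
    moreover have "m 5 \<in> carrier (T d (tot_exp 5))" using m less_6(7) unfolding TP_simps by blast
    then have "m 5 \<in> carrier (T d 2)" by simp
    ultimately show "A m \<in> carrier (TP 14 null_exp d)"
      by (auto simp: A_def null_exp_def)
  next
    fix x y assume "x \<in> carrier (tot d)" "y \<in> carrier (tot d)"
    then have xy: "x c \<in> carrier (F d)" "y c \<in> carrier (F d)" if "c < 6" for c using tot_comp that by blast+
    show "A (x \<oplus>\<^bsub>tot d\<^esub> y) = A x \<oplus>\<^bsub>TP 14 null_exp d\<^esub> A y"
      unfolding A_def using xy by (auto intro!: restrict_ext)
  next
    fix a x assume "x \<in> carrier (tot d)" and a: "a \<in> carrier R"
    then have x: "x c \<in> carrier (F d)" if "c < 6" for c using tot_comp that by blast
    show "A (a \<odot>\<^bsub>tot d\<^esub> x) = a \<odot>\<^bsub>TP 14 null_exp d\<^esub> A x"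
      unfolding A_def using x a by (auto intro!: restrict_ext simp: ppow_smult)
  qed
  have \<alpha>b: "\<alpha> m (block i c) = ppow d (tot_exp c - null_exp (block i c)) (m c)"
    if m: "m \<in> carrier (tot d)" and "i < 6" "c < 6" for m i c
  proof -
    have "ppow d 0 (m c) = m c" using tot_comp[OF m \<open>c < 6\<close>] by simp
    moreover have "tot_exp 5 - null_exp 13 = 0" by (simp add: null_exp_def)
    ultimately show ?thesis using m that by (auto simp: \<alpha>_def A_def block_def null_exp_def simp del: TP_simps)
  qed
  have \<alpha>12: "\<alpha> m (block i 6) = \<zero>\<^bsub>F d\<^esub>" if m: "m \<in> carrier (tot d)" for m i
    using m by (simp add: \<alpha>_def A_def block_def del: TP_simps)
  let ?G = "\<lambda>i c. \<lambda>z\<in>carrier (TP 14 null_exp d). g i c (z (block i c))"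
  have G: "?G i c \<in> linear_maps R (TP 14 null_exp d) (T d' (tot_exp i))" if "i < 6" "c < 7" for i c
    using that by (intro comp g block_less)
  let ?\<phi> = "\<lambda>i. \<lambda>z\<in>carrier (TP 14 null_exp d). finsum (T d' (tot_exp i)) (\<lambda>c. ?G i c z) {..<7}"
  define \<beta> where "\<beta> = (\<lambda>z\<in>carrier (TP 14 null_exp d). \<lambda>i\<in>{..<6}. ?\<phi> i z)"
  have \<beta>: "\<beta> \<in> linear_maps R (TP 14 null_exp d) (tot d')"
    unfolding \<beta>_def TP_def[of 6 tot_exp d']
    by (intro tuple_linear left_module_TP linear_maps_finsum left_module_T G) auto
  have \<beta>i: "\<beta> z i = finsum (T d' (tot_exp i)) (\<lambda>c. g i c (z (block i c))) {..<7}"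
    if z: "z \<in> carrier (TP 14 null_exp d)" and i: "i < 6" for z i
  proof -
    interpret Ti: module R "T d' (tot_exp i)" by (rule module_T)
    show ?thesis
      using z i by (simp add: \<beta>_def del: TP_simps)
  qed
  have fac: "f m = \<beta> (\<alpha> m)" if m: "m \<in> carrier (tot d)" for m
  proof (rule extensionalityI[where A = "{..<6}"])
    have am: "\<alpha> m \<in> carrier (TP 14 null_exp d)" by (rule linear_mapsD(2)[OF \<alpha> m])
    show "f m \<in> extensional {..<6}" "\<beta> (\<alpha> m) \<in> extensional {..<6}"
      using linear_mapsD(2)[OF f m] linear_mapsD(2)[OF \<beta> am] by auto
    fix i :: nat assume "i \<in> {..<6}"
    then have i: "i < 6" by simp
    interpret Ti: module R "T d' (tot_exp i)" by (rule module_T)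
    have hc: "ent d f i c (m c) \<in> carrier (T d' (tot_exp i))" if "c < 6" for c
      using linear_mapsD(2)[OF el[OF i that]] m that by simp
    have e: "g i c (\<alpha> m (block i c)) = ent d f i c (m c)" if "c < 6" for c
      using gf[OF i that] \<alpha>b[OF m i that] m that by simp
    have g0: "g i 6 (\<alpha> m (block i 6)) = \<zero>\<^bsub>F d'\<^esub>"
      using \<alpha>12[OF m] T_linear(4)[OF g[OF i, of 6]] by simp
    have "\<beta> (\<alpha> m) i = finsum (T d' (tot_exp i)) (\<lambda>c. g i c (\<alpha> m (block i c))) (insert 6 {..<6})"
      unfolding \<beta>i[OF am i] by (simp add: lessThan_Suc[symmetric] eval_nat_numeral)
    also have "\<dots> = g i 6 (\<alpha> m (block i 6)) \<oplus>\<^bsub>T d' (tot_exp i)\<^esub> finsum (T d' (tot_exp i)) (\<lambda>c. g i c (\<alpha> m (block i c))) {..<6}"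
      using e hc g0 by (intro Ti.M.finsum_insert) auto
    also have "finsum (T d' (tot_exp i)) (\<lambda>c. g i c (\<alpha> m (block i c))) {..<6} = finsum (T d' (tot_exp i)) (\<lambda>c. ent d f i c (m c)) {..<6}"
      using e hc by (intro Ti.M.finsum_cong') auto
    also have "\<dots> = f m i" by (rule entry_sum[OF f i m, symmetric])
    finally have "\<beta> (\<alpha> m) i = \<zero>\<^bsub>T d' (tot_exp i)\<^esub> \<oplus>\<^bsub>T d' (tot_exp i)\<^esub> f m i" using g0 by simp
    moreover have "f m i \<in> carrier (T d' (tot_exp i))" using linear_mapsD(2)[OF f m] i by simp
    ultimately show "f m i = \<beta> (\<alpha> m) i" using Ti.M.l_zero by metis
  qed
  have pr: "\<beta> (probe d x) \<in> sub V' X' Y' d' \<sigma>'" if x: "x \<in> carrier (T d 4)" for x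
  proof -
    have xF[simp]: "x \<in> carrier (F d)" using x by (simp add: T_iff)
    have x6: "x \<in> carrier (T d 6)" using T_subset[OF x, of 6] by simp
    have x2: "ppow d 2 x \<in> carrier (T d 2)" using x by (simp add: T_iff)
    have pc: "probe d x \<in> carrier (TP 14 null_exp d)" using x6 x2 by (simp add: probe_def null_exp_def)
    have val: "\<beta> (probe d x) i = (if 4 \<le> i then ent d f i 5 (ppow d 2 x) else \<zero>\<^bsub>F d'\<^esub>) \<oplus>\<^bsub>F d'\<^esub> g i 6 x"
      if i: "i < 6" for i
    proof -
      interpret Ti: module R "T d' (tot_exp i)" by (rule module_T)
      let ?t = "\<lambda>c. g i c (probe d x (block i c))"
      have t: "?t c \<in> carrier (T d' (tot_exp i))" if "c < 7" for c
        using linear_mapsD(2)[OF g[OF i that]] pc block_less[OF that] by simp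
      have t6: "?t 6 = g i 6 x" by (simp add: block_def probe_def)
      have t5: "?t 5 = (if 4 \<le> i then ent d f i 5 (ppow d 2 x) else \<zero>\<^bsub>F d'\<^esub>)"
        using gf[OF i, of 5 "ppow d 2 x"] x2 T_linear(4)[OF g[OF i, of 5]]
        by (auto simp: block_def probe_def null_exp_def numeral_2_eq_2[symmetric])
      have t0: "?t c = \<zero>\<^bsub>F d'\<^esub>" if "c < 5" for c
        using T_linear(4)[OF g[OF i, of c]] that by (auto simp: block_def probe_def)
      have set: "{..<7::nat} = insert 6 (insert 5 {..<5})" by auto
      have "\<beta> (probe d x) i = ?t 6 \<oplus>\<^bsub>T d' (tot_exp i)\<^esub> (?t 5 \<oplus>\<^bsub>T d' (tot_exp i)\<^esub> finsum (T d' (tot_exp i)) ?t {..<5})"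
        unfolding \<beta>i[OF pc i] set using t by (subst Ti.M.finsum_insert; simp add: Pi_iff)+
      also have "finsum (T d' (tot_exp i)) ?t {..<5} = finsum (T d' (tot_exp i)) (\<lambda>_. \<zero>\<^bsub>T d' (tot_exp i)\<^esub>) {..<5::nat}"
        using t0 by (intro Ti.M.finsum_cong') auto
      also have "\<dots> = \<zero>\<^bsub>T d' (tot_exp i)\<^esub>" by (rule Ti.M.finsum_zero)
      also have "?t 6 \<oplus>\<^bsub>T d' (tot_exp i)\<^esub> (?t 5 \<oplus>\<^bsub>T d' (tot_exp i)\<^esub> \<zero>\<^bsub>T d' (tot_exp i)\<^esub>) = ?t 5 \<oplus>\<^bsub>T d' (tot_exp i)\<^esub> ?t 6"
        using Ti.M.r_zero[OF t[of 5]] Ti.M.a_comm[OF t[of 6] t[of 5]] by simp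
      finally show ?thesis unfolding t5 t6 by simp
    qed
    note bF = F_linear[OF b(1)] and HF = F_linear[OF H(1)]
    have e: "ent d f 4 5 (ppow d 2 x) = ppow d' 2 (b x)" "ent d f 5 5 (ppow d 2 x) = ppow d' 3 (H x)"
      using b(2)[OF x2] H(2)[OF x2] bF HF by (simp_all del: One_nat_def)
    have bx: "b x \<in> carrier (T d' 4)" "H x \<in> carrier (T d' 4)"
      using x bF HF by (simp_all add: T_iff)
    note bx' = bx[unfolded T_iff]
    have z4: "ppow d' 4 (b x) = \<zero>\<^bsub>F d'\<^esub>" "ppow d' 4 (H x) = \<zero>\<^bsub>F d'\<^esub>" using bx' by auto
    \<comment> \<open>Coordinates 0 and 1 come from summand 12, coordinates 4 and 5 from summand 13.
      As \<open>b x\<close> and \<open>H x\<close> are killed by \<open>p^4\<close>, one power more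
      than membership asks for, the congruence holds with \<open>w = 0\<close>.\<close>
    have eq: "\<beta> (probe d x) = tup (b x) (H x) \<zero>\<^bsub>F d'\<^esub> \<zero>\<^bsub>F d'\<^esub> (ppow d' 2 (b x)) (ppow d' 3 (H x))"
    proof (rule extensionalityI[where A = "{..<6}"])
      show "\<beta> (probe d x) \<in> extensional {..<6}" using linear_mapsD(2)[OF \<beta> pc] by simp
      have "\<forall>i<6. \<beta> (probe d x) i = tup (b x) (H x) \<zero>\<^bsub>F d'\<^esub> \<zero>\<^bsub>F d'\<^esub> (ppow d' 2 (b x)) (ppow d' 3 (H x)) i"
        unfolding all_less_6 using bx' by (simp add: val g6[OF _ x6] e)
      then show "\<beta> (probe d x) i = tup (b x) (H x) \<zero>\<^bsub>F d'\<^esub> \<zero>\<^bsub>F d'\<^esub> (ppow d' 2 (b x)) (ppow d' 3 (H x)) i"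
        if "i \<in> {..<6}" for i using that by simp
    qed simp
    interpret V': module R V' by (rule repD(1)[OF rep'])
    note rD' = repD[OF rep']
    show ?thesis
      unfolding eq using bx' z4 T_subset[OF bx(1), of 5] T_subset[OF bx(2), of 5]
      by (intro tup_mem_sub[OF rep']) (simp_all add: rD')
  qed
  show ?thesis using \<alpha> \<beta> fac pr by blast
qed

end

section \<open>Modules over the free algebra\<close>

lemma free_algebra_simps [simp]:
  "q \<in> carrier (free_algebra K) \<longleftrightarrow> (\<forall>w. q w \<in> carrier K) \<and> finite {w. q w \<noteq> \<zero>\<^bsub>K\<^esub>}"
  "\<zero>\<^bsub>free_algebra K\<^esub> = (\<lambda>w. \<zero>\<^bsub>K\<^esub>)"
  "\<one>\<^bsub>free_algebra K\<^esub> = free_algebra_const K \<one>\<^bsub>K\<^esub>"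
  "q \<oplus>\<^bsub>free_algebra K\<^esub> r = (\<lambda>w. q w \<oplus>\<^bsub>K\<^esub> r w)"
  by (simp_all add: free_algebra_def free_algebra_const_def)

definition monomial :: "('k, 'c) ring_scheme \<Rightarrow> 'g list \<Rightarrow> 'k \<Rightarrow> 'g list \<Rightarrow> 'k" where
  "monomial K u k = (\<lambda>w. if w = u then k else \<zero>\<^bsub>K\<^esub>)"

lemma monomial_Nil: "monomial K [] = free_algebra_const K"
  by (simp add: monomial_def free_algebra_const_def fun_eq_iff)

context ring
begin

lemma monomial_closed: "k \<in> carrier R \<Longrightarrow> monomial R u k \<in> carrier (free_algebra R)"
  by (auto simp: monomial_def)

text \<open>A constant is supported on the empty word, so of all factorisations only the one with
  empty prefix contributes.\<close>

lemma const_mult: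
  assumes q: "q \<in> carrier (free_algebra R)" and k: "k \<in> carrier R"
  shows "free_algebra_const R k \<otimes>\<^bsub>free_algebra R\<^esub> q = (\<lambda>w. k \<otimes> q w)"
proof
  fix w
  have "(free_algebra_const R k \<otimes>\<^bsub>free_algebra R\<^esub> q) w
      = (\<Oplus>i\<in>{..length w}. free_algebra_const R k (take i w) \<otimes> q (drop i w))"
    by (simp add: free_algebra_def)
  also have "\<dots> = (\<Oplus>i\<in>{..length w}. if 0 = i then k \<otimes> q w else \<zero>)"
    using q k by (intro finsum_cong') (auto simp: free_algebra_const_def)
  also have "\<dots> = k \<otimes> q w"
    using q k by (intro add.finprod_singleton[where f = "\<lambda>_. k \<otimes> q w"]) auto
  finally show "(free_algebra_const R k \<otimes>\<^bsub>free_algebra R\<^esub> q) w = k \<otimes> q w" .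
qed

text \<open>Only the prefix of length one can equal \<open>[b]\<close>; for the empty word there is
  no such prefix and the product is zero.\<close>

lemma generator_mult:
  assumes q: "q \<in> carrier (free_algebra R)"
  shows "monomial R [b] \<one> \<otimes>\<^bsub>free_algebra R\<^esub> q = (\<lambda>w. if w \<noteq> [] \<and> hd w = b then q (tl w) else \<zero>)"
proof
  fix w
  have "(monomial R [b] \<one> \<otimes>\<^bsub>free_algebra R\<^esub> q) w
      = (\<Oplus>i\<in>{..length w}. monomial R [b] \<one> (take i w) \<otimes> q (drop i w))"
    by (simp add: free_algebra_def)
  also have "\<dots> = (\<Oplus>i\<in>{..length w}. if 1 = i then (if hd w = b then q (tl w) else \<zero>) else \<zero>)"
  proof (intro finsum_cong')
    fix i assume i: "i \<in> {..length w}"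
    show "monomial R [b] \<one> (take i w) \<otimes> q (drop i w) = (if 1 = i then (if hd w = b then q (tl w) else \<zero>) else \<zero>)"
    proof (cases "i = 1")
      case True
      then obtain x xs where "w = x # xs" using i by (cases w) auto
      then show ?thesis using True q by (auto simp: monomial_def)
    next
      case False
      then have "length (take i w) \<noteq> length [b]" using i by auto
      then have "take i w \<noteq> [b]" by metis
      then show ?thesis using False q by (simp add: monomial_def)
    qed
  qed (use q in auto)
  also have "\<dots> = (if w \<noteq> [] \<and> hd w = b then q (tl w) else \<zero>)"
  proof (cases w)
    case Nil
    then show ?thesis by simp
  next
    case (Cons x xs)
    then show ?thesis
      using q by (subst add.finprod_singleton[where f = "\<lambda>_. if hd w = b then q (tl w) else \<zero>"]) auto
  qed
  finally show "(monomial R [b] \<one> \<otimes>\<^bsub>free_algebra R\<^esub> q) w = (if w \<noteq> [] \<and> hd w = b then q (tl w) else \<zero>)" .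
qed

lemma monomial_Cons:
  assumes "k \<in> carrier R"
  shows "monomial R (b # u) k = monomial R [b] \<one> \<otimes>\<^bsub>free_algebra R\<^esub> monomial R u k"
  unfolding generator_mult[OF monomial_closed[OF assms]]
  by (auto simp: monomial_def fun_eq_iff neq_Nil_conv)

lemma generator_const_commute:
  assumes k: "k \<in> carrier R"
  shows "monomial R [b] \<one> \<otimes>\<^bsub>free_algebra R\<^esub> free_algebra_const R k
       = free_algebra_const R k \<otimes>\<^bsub>free_algebra R\<^esub> monomial R [b] \<one>"
proof -
  have "monomial R [b] \<one> \<otimes>\<^bsub>free_algebra R\<^esub> free_algebra_const R k = monomial R [b] k"
    using monomial_Cons[OF k, of b "[]"] by (simp add: monomial_Nil)
  also have "\<dots> = (\<lambda>w. k \<otimes> monomial R [b] \<one> w)" using k by (auto simp: monomial_def)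
  also have "\<dots> = free_algebra_const R k \<otimes>\<^bsub>free_algebra R\<^esub> monomial R [b] \<one>"
    by (rule const_mult[OF monomial_closed[OF one_closed] k, symmetric])
  finally show ?thesis .
qed

text \<open>Constants and generators generate the free algebra. Monomials follow by induction on the
  word, arbitrary elements by induction on a finite set containing the support, where one
  coefficient is cleared at a time.\<close>

lemma linear_maps_free_algebraI:
  assumes V: "left_module (free_algebra R) V" and W: "left_module (free_algebra R) W"
    and f: "f \<in> extensional (carrier V)" "\<And>v. v \<in> carrier V \<Longrightarrow> f v \<in> carrier W"
      "\<And>v w. v \<in> carrier V \<Longrightarrow> w \<in> carrier V \<Longrightarrow> f (v \<oplus>\<^bsub>V\<^esub> w) = f v \<oplus>\<^bsub>W\<^esub> f w"
    and const: "\<And>k v. k \<in> carrier R \<Longrightarrow> v \<in> carrier V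
      \<Longrightarrow> f (free_algebra_const R k \<odot>\<^bsub>V\<^esub> v) = free_algebra_const R k \<odot>\<^bsub>W\<^esub> f v"
    and gen: "\<And>b v. v \<in> carrier V \<Longrightarrow> f (monomial R [b] \<one> \<odot>\<^bsub>V\<^esub> v) = monomial R [b] \<one> \<odot>\<^bsub>W\<^esub> f v"
  shows "f \<in> linear_maps (free_algebra R) V W"
proof (rule linear_mapsI[OF f])
  interpret V: left_module "free_algebra R" V by fact
  interpret W: left_module "free_algebra R" W by fact
  note mc = monomial_closed
  have mono: "f (monomial R u k \<odot>\<^bsub>V\<^esub> v) = monomial R u k \<odot>\<^bsub>W\<^esub> f v"
    if "k \<in> carrier R" "v \<in> carrier V" for u k v
    using that(2)
  proof (induction u arbitrary: v)
    case Nil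
    then show ?case using const[OF that(1)] by (simp add: monomial_Nil)
  next
    case (Cons b u)
    note k = that(1)
    have "f (monomial R (b # u) k \<odot>\<^bsub>V\<^esub> v) = f (monomial R [b] \<one> \<odot>\<^bsub>V\<^esub> (monomial R u k \<odot>\<^bsub>V\<^esub> v))"
      unfolding monomial_Cons[OF k] using Cons.prems mc k by (subst V.smult_assoc) auto
    also have "\<dots> = monomial R [b] \<one> \<odot>\<^bsub>W\<^esub> (monomial R u k \<odot>\<^bsub>W\<^esub> f v)"
      using gen V.smult_closed[OF mc[OF k] Cons.prems] Cons by simp
    also have "\<dots> = monomial R (b # u) k \<odot>\<^bsub>W\<^esub> f v"
      unfolding monomial_Cons[OF k] using f(2)[OF Cons.prems] mc k by (subst W.smult_assoc) auto
    finally show ?case .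
  qed
  have fin: "f (q \<odot>\<^bsub>V\<^esub> v) = q \<odot>\<^bsub>W\<^esub> f v"
    if "finite S" "q \<in> carrier (free_algebra R)" "{w. q w \<noteq> \<zero>} \<subseteq> S" "v \<in> carrier V" for S q v
    using that
  proof (induction S arbitrary: q rule: finite_induct)
    case empty
    then have q: "q = monomial R [] \<zero>" by (auto simp: monomial_def)
    show ?case unfolding q by (rule mono) (use empty in auto)
  next
    case (insert u S)
    define r where "r = q(u := \<zero>)"
    have r: "r \<in> carrier (free_algebra R)"
      using insert.prems(1) by (auto simp: r_def intro: finite_subset[rotated])
    have qr: "q = r \<oplus>\<^bsub>free_algebra R\<^esub> monomial R u (q u)"
      using insert.prems(1) by (auto simp: r_def monomial_def fun_eq_iff)
    have qu: "q u \<in> carrier R" using insert.prems(1) by simp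
    have IH: "f (r \<odot>\<^bsub>V\<^esub> v) = r \<odot>\<^bsub>W\<^esub> f v"
      using insert.prems by (intro insert.IH r) (auto simp: r_def)
    note vc = insert.prems(3)
    have "f (q \<odot>\<^bsub>V\<^esub> v) = f (r \<odot>\<^bsub>V\<^esub> v \<oplus>\<^bsub>V\<^esub> monomial R u (q u) \<odot>\<^bsub>V\<^esub> v)"
      by (subst qr, subst V.smult_l_distr[OF r mc[OF qu] vc]) (rule refl)
    also have "\<dots> = r \<odot>\<^bsub>W\<^esub> f v \<oplus>\<^bsub>W\<^esub> monomial R u (q u) \<odot>\<^bsub>W\<^esub> f v"
      using f(3)[OF V.smult_closed[OF r vc] V.smult_closed[OF mc[OF qu] vc]] IH mono[OF qu vc] by simp
    also have "\<dots> = q \<odot>\<^bsub>W\<^esub> f v"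
      by (subst (2) qr, subst W.smult_l_distr[OF r mc[OF qu] f(2)[OF vc]]) (rule refl)
    finally show ?case .
  qed
  show "f (q \<odot>\<^bsub>V\<^esub> v) = q \<odot>\<^bsub>W\<^esub> f v" if "q \<in> carrier (free_algebra R)" "v \<in> carrier V" for q v
    using fin[of "{w. q w \<noteq> \<zero>}" q v] that by simp
qed

end

context uniserial_ring
begin

section \<open>Modules over the free algebra as modules over the uniserial ring\<close>

abbreviation K :: "'a set ring" where "K \<equiv> radical_factor R"

definition const :: "'a \<Rightarrow> bool list \<Rightarrow> 'a set" where
  "const c = free_algebra_const K (jacobson_radical R +> c)"

text \<open>Restriction of scalars along the map from \<open>R\<close> to the residue field and on
  to the constants of the free algebra. It puts representations and torsion modules over the same
  ring.\<close>

definition restricted :: "(bool list \<Rightarrow> 'a set, 'v) module \<Rightarrow> ('a, 'v) module" where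
  "restricted V = \<lparr>carrier = carrier V, mult = undefined, one = undefined, zero = zero V, add = add V,
     smult = (\<lambda>c. smult V (const c))\<rparr>"

definition act :: "bool \<Rightarrow> (bool list \<Rightarrow> 'a set, 'v) module \<Rightarrow> 'v \<Rightarrow> 'v" where
  "act b V = (\<lambda>v\<in>carrier V. monomial K [b] \<one>\<^bsub>K\<^esub> \<odot>\<^bsub>V\<^esub> v)"

lemma restricted_simps [simp]:
  "carrier (restricted V) = carrier V" "\<zero>\<^bsub>restricted V\<^esub> = \<zero>\<^bsub>V\<^esub>"
  "v \<oplus>\<^bsub>restricted V\<^esub> w = v \<oplus>\<^bsub>V\<^esub> w" "c \<odot>\<^bsub>restricted V\<^esub> v = const c \<odot>\<^bsub>V\<^esub> v"
  by (simp_all add: restricted_def)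

lemma ideal_radical: "ideal (jacobson_radical R) R"
proof -
  have "jacobson_radical R = PIdl p" unfolding radical cgenideal_def using m_comm by auto
  then show ?thesis using cgenideal_ideal[OF p_closed] by simp
qed

lemma ring_K: "ring K"
  unfolding radical_factor_def by (rule ideal.quotient_is_ring[OF ideal_radical])

sublocale K: ring K by (rule ring_K)

lemma residue_hom: "(+>) (jacobson_radical R) \<in> ring_hom R K"
  unfolding radical_factor_def by (rule ideal.rcos_ring_hom[OF ideal_radical])

lemma carrier_K: "k \<in> carrier K \<longleftrightarrow> (\<exists>c\<in>carrier R. k = jacobson_radical R +> c)"
  by (auto simp: radical_factor_def FactRing_def A_RCOSETS_def')

lemma const_closed: "c \<in> carrier R \<Longrightarrow> const c \<in> carrier (free_algebra K)"
  unfolding const_def monomial_Nil[symmetric] using K.monomial_closed ring_hom_closed[OF residue_hom] by blast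

lemma const_hom:
  assumes "a \<in> carrier R" "b \<in> carrier R"
  shows "const (a \<oplus> b) = const a \<oplus>\<^bsub>free_algebra K\<^esub> const b"
    "const (a \<otimes> b) = const a \<otimes>\<^bsub>free_algebra K\<^esub> const b"
    "const \<one> = \<one>\<^bsub>free_algebra K\<^esub>" "const p = \<zero>\<^bsub>free_algebra K\<^esub>"
proof -
  note h = ring_hom_closed[OF residue_hom] ring_hom_add[OF residue_hom] ring_hom_mult[OF residue_hom]
    ring_hom_one[OF residue_hom]
  show "const (a \<oplus> b) = const a \<oplus>\<^bsub>free_algebra K\<^esub> const b"
    using assms by (auto simp: const_def h free_algebra_const_def fun_eq_iff)
  have "const a \<otimes>\<^bsub>free_algebra K\<^esub> const b = (\<lambda>w. (jacobson_radical R +> a) \<otimes>\<^bsub>K\<^esub> const b w)"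
    unfolding const_def[of a] using assms h(1) const_closed by (intro K.const_mult) auto
  then show "const (a \<otimes> b) = const a \<otimes>\<^bsub>free_algebra K\<^esub> const b"
    using assms h(1) by (auto simp: const_def h free_algebra_const_def fun_eq_iff)
  show "const \<one> = \<one>\<^bsub>free_algebra K\<^esub>" by (simp add: const_def h)
  have "p \<in> jacobson_radical R" unfolding radical by (intro CollectI exI[of _ \<one>]) simp
  then have "jacobson_radical R +> p = \<zero>\<^bsub>K\<^esub>"
    using abelian_subgroup.a_rcos_const[OF abelian_subgroupI3[OF ideal.axioms(1)[OF ideal_radical]
          abelian_group_axioms]]
    by (simp add: radical_factor_def FactRing_def)
  then show "const p = \<zero>\<^bsub>free_algebra K\<^esub>" by (simp add: const_def free_algebra_const_def fun_eq_iff)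
qed

end

locale free_algebra_module = uniserial_ring R p n for R (structure) and p n +
  fixes V :: "(bool list \<Rightarrow> 'a set, 'v) module"
  assumes left_module: "left_module (free_algebra K) V"
    and fin_gen: "fin_gen K (underlying_space K V)"
begin

sublocale FV: left_module "free_algebra K" V by (rule left_module)

lemma smult_zero_left: "v \<in> carrier V \<Longrightarrow> \<zero>\<^bsub>free_algebra K\<^esub> \<odot>\<^bsub>V\<^esub> v = \<zero>\<^bsub>V\<^esub>"
proof -
  assume v: "v \<in> carrier V"
  have z: "\<zero>\<^bsub>free_algebra K\<^esub> \<in> carrier (free_algebra K)" by simp
  have "\<zero>\<^bsub>free_algebra K\<^esub> \<oplus>\<^bsub>free_algebra K\<^esub> \<zero>\<^bsub>free_algebra K\<^esub> = \<zero>\<^bsub>free_algebra K\<^esub>" by simp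
  then have "\<zero>\<^bsub>free_algebra K\<^esub> \<odot>\<^bsub>V\<^esub> v = \<zero>\<^bsub>free_algebra K\<^esub> \<odot>\<^bsub>V\<^esub> v \<oplus>\<^bsub>V\<^esub> \<zero>\<^bsub>free_algebra K\<^esub> \<odot>\<^bsub>V\<^esub> v"
    using FV.smult_l_distr[OF z z v] by metis
  then show ?thesis using FV.smult_closed[OF z v] FV.M.add.l_cancel_one' by metis
qed

lemma module_restricted: "module R (restricted V)"
proof (rule moduleI)
  show "cring R" by (rule ring_cring)
  show "abelian_group (restricted V)"
    by (rule abelian_groupI) (auto simp: FV.M.add.m_ac intro: FV.M.l_neg FV.M.a_inv_closed)
  fix a b v assume a: "a \<in> carrier R" and b: "b \<in> carrier R" and v: "v \<in> carrier (restricted V)"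
  show "(a \<oplus> b) \<odot>\<^bsub>restricted V\<^esub> v = a \<odot>\<^bsub>restricted V\<^esub> v \<oplus>\<^bsub>restricted V\<^esub> b \<odot>\<^bsub>restricted V\<^esub> v"
    using FV.smult_l_distr[OF const_closed[OF a] const_closed[OF b]] const_hom(1)[OF a b] v
    by (simp del: free_algebra_simps)
  show "a \<otimes> b \<odot>\<^bsub>restricted V\<^esub> v = a \<odot>\<^bsub>restricted V\<^esub> (b \<odot>\<^bsub>restricted V\<^esub> v)"
    using FV.smult_assoc[OF const_closed[OF a] const_closed[OF b]] const_hom(2)[OF a b] v
    by (simp del: free_algebra_simps)
qed (use FV.smult_closed[OF const_closed] FV.smult_r_distr[OF const_closed] FV.smult_one const_hom(3)[OF p_closed p_closed]
      in \<open>auto simp del: free_algebra_simps\<close>)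

lemma p_smult: "v \<in> carrier (restricted V) \<Longrightarrow> p \<odot>\<^bsub>restricted V\<^esub> v = \<zero>\<^bsub>restricted V\<^esub>"
  using smult_zero_left const_hom(4)[OF p_closed p_closed] by (simp del: free_algebra_simps)

text \<open>Every element of \<open>K\<close> is the residue class of an element of
  \<open>R\<close>, so a submodule over \<open>R\<close> is closed under the constants as well, and
  the same finite set generates.\<close>

lemma fin_gen_restricted: "fin_gen R (restricted V)"
proof -
  obtain S where S: "finite S" "S \<subseteq> carrier (underlying_space K V)"
    and gen: "\<forall>L. submodule L K (underlying_space K V) \<longrightarrow> S \<subseteq> L \<longrightarrow> L = carrier (underlying_space K V)"
    using fin_gen unfolding fin_gen_def by blast
  show ?thesis
    unfolding fin_gen_def
  proof (intro exI[of _ S] conjI allI impI)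
    fix L assume L: "submodule L R (restricted V)" "S \<subseteq> L"
    have "submodule L K (underlying_space K V)"
    proof (intro submodule.intro submodule_axioms.intro)
      show "subgroup L (add_monoid (underlying_space K V))"
        using submodule.axioms(1)[OF L(1)] FV.M.add.group_l_invI
        by (simp add: subgroup_def underlying_space_def restricted_def a_inv_def m_inv_def)
      show "k \<odot>\<^bsub>underlying_space K V\<^esub> v \<in> L" if "k \<in> carrier K" "v \<in> L" for k v
        using that submodule_closed(5)[OF L(1)] by (auto simp: carrier_K underlying_space_def const_def)
    qed
    then have "L = carrier (underlying_space K V)" using gen L(2) by blast
    then show "L = carrier (restricted V)" by (simp add: underlying_space_def)
  qed (use S in \<open>auto simp: underlying_space_def\<close>)
qed

lemma generator_closed: "monomial K [b] \<one>\<^bsub>K\<^esub> \<in> carrier (free_algebra K)"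
  by (rule K.monomial_closed) simp

lemma act_linear: "act b V \<in> linear_maps R (restricted V) (restricted V)"
proof -
  note g = generator_closed[of b]
  have "monomial K [b] \<one>\<^bsub>K\<^esub> \<odot>\<^bsub>V\<^esub> (const c \<odot>\<^bsub>V\<^esub> v) = const c \<odot>\<^bsub>V\<^esub> (monomial K [b] \<one>\<^bsub>K\<^esub> \<odot>\<^bsub>V\<^esub> v)"
    if c: "c \<in> carrier R" and v: "v \<in> carrier V" for c v
  proof -
    have "monomial K [b] \<one>\<^bsub>K\<^esub> \<otimes>\<^bsub>free_algebra K\<^esub> const c = const c \<otimes>\<^bsub>free_algebra K\<^esub> monomial K [b] \<one>\<^bsub>K\<^esub>"
      unfolding const_def using c carrier_K by (intro K.generator_const_commute) blast
    then show ?thesis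
      using FV.smult_assoc[OF g const_closed[OF c] v] FV.smult_assoc[OF const_closed[OF c] g v] by simp
  qed
  then show ?thesis
    using FV.smult_closed[OF g] FV.smult_r_distr[OF g] FV.smult_closed[OF const_closed]
    by (intro linear_mapsI) (auto simp: act_def)
qed

end

context uniserial_ring
begin

text \<open>This translates linearity over the free algebra into what the matrix computations
  deliver and consume: an \<open>R\<close>-linear map commuting with two endomorphisms.\<close>

lemma linear_maps_free_algebra_iff:
  assumes V: "free_algebra_module R p n V" and W: "free_algebra_module R p n W"
  shows "f \<in> linear_maps (free_algebra K) V W \<longleftrightarrow> f \<in> linear_maps R (restricted V) (restricted W)
     \<and> (\<forall>b. \<forall>v\<in>carrier V. f (act b V v) = act b W (f v))" (is "?l \<longleftrightarrow> ?r")
proof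
  interpret V: free_algebra_module R p n V by fact
  interpret W: free_algebra_module R p n W by fact
  {
    assume f: ?l
    note fD = linear_mapsD[OF f]
    have "f \<in> linear_maps R (restricted V) (restricted W)"
      using fD(1-3) fD(4)[OF const_closed] by (intro linear_mapsI) auto
    moreover have "f (act b V v) = act b W (f v)" if "v \<in> carrier V" for b v
      using fD(2)[OF that] fD(4)[OF V.generator_closed that] that by (simp add: act_def)
    ultimately show ?r by blast
  next
    assume f: ?r
    then have fl: "f \<in> linear_maps R (restricted V) (restricted W)" by blast
    note fD = linear_mapsD[OF fl]
    show ?l
    proof (rule K.linear_maps_free_algebraI[OF V.left_module W.left_module])
      show "f (free_algebra_const K k \<odot>\<^bsub>V\<^esub> v) = free_algebra_const K k \<odot>\<^bsub>W\<^esub> f v"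
        if k: "k \<in> carrier K" and v: "v \<in> carrier V" for k v
      proof -
        obtain c where "c \<in> carrier R" "k = jacobson_radical R +> c" using k carrier_K by blast
        then show ?thesis using fD(4)[of c v] v by (simp add: const_def)
      qed
      show "f (monomial K [b] \<one>\<^bsub>K\<^esub> \<odot>\<^bsub>V\<^esub> v) = monomial K [b] \<one>\<^bsub>K\<^esub> \<odot>\<^bsub>W\<^esub> f v" if v: "v \<in> carrier V" for b v
        using f v fD(2)[of v] by (auto simp: act_def)
    qed (use fD in auto)
  }
qed

text \<open>The identification of \<open>V\<close> with a socle is fixed once per module, so that
  the object assigned to \<open>V\<close> and the maps induced on \<open>V\<close> refer to the same
  one.\<close>

definition layer :: "(bool list \<Rightarrow> 'a set, 'v) module \<Rightarrow> nat \<times> ((nat \<Rightarrow> 'a) \<Rightarrow> 'v)" where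
  "layer V = (SOME (d, \<sigma>). is_rep (restricted V) (act False V) (act True V) d \<sigma>)"

lemma is_rep_layer:
  assumes V: "free_algebra_module R p n V" and n: "1 \<le> n"
  shows "is_rep (restricted V) (act False V) (act True V) (fst (layer V)) (snd (layer V))"
proof -
  interpret V: free_algebra_module R p n V by fact
  have "\<exists>d \<sigma>. \<sigma> \<in> linear_maps R (T d 1) (restricted V) \<and> bij_betw \<sigma> (carrier (T d 1)) (carrier (restricted V))"
    by (rule socle_iso_exists[OF V.module_restricted V.fin_gen_restricted V.p_smult n])
  then obtain d \<sigma> where "is_rep (restricted V) (act False V) (act True V) d \<sigma>"
    unfolding is_rep_def using V.module_restricted V.act_linear by blast
  then have "case (d, \<sigma>) of (d, \<sigma>) \<Rightarrow> is_rep (restricted V) (act False V) (act True V) d \<sigma>" by simp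
  then have "case layer V of (d, \<sigma>) \<Rightarrow> is_rep (restricted V) (act False V) (act True V) d \<sigma>"
    unfolding layer_def by (rule someI)
  then show ?thesis by (simp add: case_prod_beta)
qed

section \<open>The controlled embedding\<close>

definition emb_obj :: "(bool list \<Rightarrow> 'a set, 'v) module \<Rightarrow> ('a, nat \<Rightarrow> nat \<Rightarrow> 'a) module \<times> (nat \<Rightarrow> nat \<Rightarrow> 'a) set" where
  "emb_obj V = (tot (fst (layer V)),
     sub (restricted V) (act False V) (act True V) (fst (layer V)) (snd (layer V)))"

text \<open>The last diagonal entry, restricted to the socle and conjugated by the identifications
  of the socles. On the socle all diagonal entries of a morphism agree; the last one is taken
  because \<open>layer_map\<close> makes it functorial for all linear maps, not only for those
  respecting the submodules.\<close>

definition layer_mor :: "(bool list \<Rightarrow> 'a set, 'v) module \<Rightarrow> (bool list \<Rightarrow> 'a set, 'v) module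
    \<Rightarrow> ((nat \<Rightarrow> nat \<Rightarrow> 'a) \<Rightarrow> nat \<Rightarrow> nat \<Rightarrow> 'a) \<Rightarrow> 'v \<Rightarrow> 'v" where
  "layer_mor V W f = (\<lambda>v\<in>carrier V. snd (layer W) (ent (fst (layer V)) f 5 5
      (inv_into (carrier (T (fst (layer V)) 1)) (snd (layer V)) v)))"

lemma layer_mor_eq:
  assumes V: "free_algebra_module R p n V" and n: "1 \<le> n" and s: "s \<in> carrier (T (fst (layer V)) 1)"
  shows "layer_mor V W f (snd (layer V) s) = snd (layer W) (ent (fst (layer V)) f 5 5 s)"
proof -
  note rep = is_rep_layer[OF V n]
  have "bij_betw (snd (layer V)) (carrier (T (fst (layer V)) 1)) (carrier V)" using rep by (simp add: is_rep_def)
  then have "inv_into (carrier (T (fst (layer V)) 1)) (snd (layer V)) (snd (layer V) s) = s"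
    "snd (layer V) s \<in> carrier V"
    using s by (auto simp: bij_betw_def inv_into_f_f simp del: T_iff)
  then show ?thesis by (simp add: layer_mor_def)
qed

lemma ent_socle:
  assumes f: "f \<in> linear_maps R (tot d) (tot d')" and s: "s \<in> carrier (T d 1)"
  shows "ent d f 5 5 s \<in> carrier (T d' 1)"
proof -
  note L = T_linear[OF entry_linear[OF f less_6(7) less_6(7)]]
  have s2: "s \<in> carrier (T d (tot_exp 5))" using T_subset[OF s, of 2] by simp
  have "ppow d' 1 (ent d f 5 5 s) = ent d f 5 5 \<zero>\<^bsub>F d\<^esub>" using L(3)[OF s2, of 1] s by (simp add: T_iff)
  then show ?thesis using L(1)[OF s2] L(4) by (simp add: T_iff)
qed

text \<open>The conditions have separate sources: \<open>entries_of_morphism\<close> shows that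
  induced maps are linear over the free algebra, \<open>morphism_exists\<close> gives surjectivity,
  \<open>layer_map\<close> compatibility with composition, and \<open>kernel_factors\<close> with
  \<open>probed_object_null\<close> the factorisation of the kernel through a null object.\<close>

lemma controlled_embedding_emb:
  assumes n: "7 \<le> n"
  shows "controlled_embedding (submodule_category R :: (('a, nat \<Rightarrow> nat \<Rightarrow> 'a) module \<times> (nat \<Rightarrow> nat \<Rightarrow> 'a) set, _) category)
     (fd_free_modules K) emb_obj (layer_mor :: (bool list \<Rightarrow> 'a set, 'v) module \<Rightarrow> _)"
proof -
  let ?A = "submodule_category R :: (('a, nat \<Rightarrow> nat \<Rightarrow> 'a) module \<times> (nat \<Rightarrow> nat \<Rightarrow> 'a) set, _) category"
  let ?P = "fd_free_modules K :: ((bool list \<Rightarrow> 'a set, 'v) module, 'v \<Rightarrow> 'v) category"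
  have n1: "1 \<le> n" using n by simp
  have fam: "free_algebra_module R p n V" if "V \<in> Obj ?P" for V
    using that uniserial_ring_axioms
    by (simp add: free_algebra_module_def free_algebra_module_axioms_def)
  define D where "D V = fst (layer V)" for V :: "(bool list \<Rightarrow> 'a set, 'v) module"
  define S where "S V = snd (layer V)" for V :: "(bool list \<Rightarrow> 'a set, 'v) module"
  define U where "U V = sub (restricted V) (act False V) (act True V) (D V) (S V)" for V :: "(bool list \<Rightarrow> 'a set, 'v) module"
  have emb: "emb_obj V = (tot (D V), U V)" for V :: "(bool list \<Rightarrow> 'a set, 'v) module"
    by (simp add: emb_obj_def D_def S_def U_def)
  have rep: "is_rep (restricted V) (act False V) (act True V) (D V) (S V)" if "V \<in> Obj ?P" for V
    unfolding D_def S_def by (rule is_rep_layer[OF fam[OF that] n1])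
  have eq: "layer_mor V W f (S V s) = S W (ent (D V) f 5 5 s)" if "V \<in> Obj ?P" "s \<in> carrier (T (D V) 1)" for V W f s
    using layer_mor_eq[OF fam[OF that(1)] n1, of s W f] that(2) unfolding D_def S_def by simp
  have onto: "\<exists>s\<in>carrier (T (D V) 1). S V s = v" if "V \<in> Obj ?P" "v \<in> carrier V" for V v
    using repD(10)[OF rep[OF that(1)]] that(2) by simp
  have SV: "S V s \<in> carrier V" if "V \<in> Obj ?P" "s \<in> carrier (T (D V) 1)" for V s
    using repD(4)[OF rep[OF that(1)]] that(2) by (simp add: T_iff)
  have Mor: "f \<in> Mor ?A (emb_obj V) (emb_obj W) \<longleftrightarrow> f \<in> linear_maps R (tot (D V)) (tot (D W)) \<and> f ` U V \<subseteq> U W" for V W f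
    by (simp add: emb)
  have extV: "layer_mor V W f \<in> extensional (carrier V)" for V W f by (simp add: layer_mor_def)
  have ext: "a = b" if "V \<in> Obj ?P" "a \<in> extensional (carrier V)" "b \<in> extensional (carrier V)"
    "\<And>s. s \<in> carrier (T (D V) 1) \<Longrightarrow> a (S V s) = b (S V s)" for V and a b :: "'v \<Rightarrow> 'v"
    using that(2,3) by (rule extensionalityI) (use onto[OF that(1)] that(4) in blast)
  have ec: "ent (D V) f 5 5 s \<in> carrier (T (D W) 1)"
    if "f \<in> Mor ?A (emb_obj V) (emb_obj W)" "s \<in> carrier (T (D V) 1)" for V W f s
    using ent_socle that unfolding Mor by blast
  have closed: "layer_mor V W f \<in> Mor ?P V W"
    if V: "V \<in> Obj ?P" and W: "W \<in> Obj ?P" and f: "f \<in> Mor ?A (emb_obj V) (emb_obj W)" for V W f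
  proof -
    note rV = repD[OF rep[OF V]] and rW = repD[OF rep[OF W]]
    have fl: "f \<in> linear_maps R (tot (D V)) (tot (D W))" and fU: "f ` U V \<subseteq> U W" using f unfolding Mor by auto
    note E = entries_of_morphism[OF n rep[OF V] rep[OF W] fl fU[unfolded U_def]]
    note eD = linear_mapsD[OF entry_linear[OF fl less_6(7) less_6(7)], simplified]
    have s2: "s \<in> carrier (T (D V) 2)" if "s \<in> carrier (T (D V) 1)" for s using T_subset[OF that] by simp
    interpret RV: module R "restricted V" by (rule rV(1))
    have "layer_mor V W f \<in> linear_maps R (restricted V) (restricted W)"
    proof (rule linear_mapsI)
      show "layer_mor V W f \<in> extensional (carrier (restricted V))" using extV by simp
      fix v assume "v \<in> carrier (restricted V)"
      then obtain s where s: "s \<in> carrier (T (D V) 1)" "v = S V s" using onto[OF V] by auto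
      show "layer_mor V W f v \<in> carrier (restricted W)"
        using SV[OF W ec[OF f s(1)]] eq[OF V s(1)] s(2) by simp
      {
        fix w assume "w \<in> carrier (restricted V)"
        then obtain t where t: "t \<in> carrier (T (D V) 1)" "w = S V t" using onto[OF V] by auto
        have st: "s \<oplus>\<^bsub>F (D V)\<^esub> t \<in> carrier (T (D V) 1)" using s t by (simp add: T_iff)
        have "S V (s \<oplus>\<^bsub>F (D V)\<^esub> t) = v \<oplus>\<^bsub>V\<^esub> w" using s t rV(5) by (simp add: T_iff)
        then show "layer_mor V W f (v \<oplus>\<^bsub>restricted V\<^esub> w) = layer_mor V W f v \<oplus>\<^bsub>restricted W\<^esub> layer_mor V W f w"
          using eq[OF V st, of W f] eq[OF V s(1), of W f] eq[OF V t(1), of W f] s t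
            eD(3)[OF s2[OF s(1)] s2[OF t(1)]] rW(5) ec[OF f s(1)] ec[OF f t(1)]
          by (simp add: T_iff)
      next
        fix c assume c: "c \<in> carrier R"
        have cs: "c \<odot>\<^bsub>F (D V)\<^esub> s \<in> carrier (T (D V) 1)" using s c by (simp add: T_iff ppow_smult)
        have "S V (c \<odot>\<^bsub>F (D V)\<^esub> s) = c \<odot>\<^bsub>restricted V\<^esub> v" using s c rV(6) by (simp add: T_iff)
        then show "layer_mor V W f (c \<odot>\<^bsub>restricted V\<^esub> v) = c \<odot>\<^bsub>restricted W\<^esub> layer_mor V W f v"
          using eq[OF V cs, of W f] eq[OF V s(1), of W f] s c eD(4)[OF c s2[OF s(1)]] rW(6) ec[OF f s(1)]
          by (simp add: T_iff)
      }
    qed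
    moreover have "layer_mor V W f (act b V v) = act b W (layer_mor V W f v)" if "v \<in> carrier V" for b v
    proof -
      obtain s where s: "s \<in> carrier (T (D V) 1)" "S V s = v" using onto[OF V \<open>v \<in> carrier V\<close>] by blast
      have "act b V v \<in> carrier V" using rV(2,3) \<open>v \<in> carrier V\<close> by (cases b) auto
      then obtain t where t: "t \<in> carrier (T (D V) 1)" "S V t = act b V v" using onto[OF V] by blast
      have "S W (ent (D V) f 5 5 t) = act b W (S W (ent (D V) f 5 5 s))"
        using E(4,5)[OF s(1) t(1)] s t by (cases b) auto
      then show ?thesis using eq[OF V s(1), of W f] eq[OF V t(1), of W f] s t by simp
    qed
    ultimately show ?thesis using linear_maps_free_algebra_iff[OF fam[OF V] fam[OF W]] by simp
  qed
  have zeroD: "ent (D V) f 5 5 s = \<zero>\<^bsub>F (D W)\<^esub>"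
    if V: "V \<in> Obj ?P" "W \<in> Obj ?P" and f: "f \<in> Mor ?A (emb_obj V) (emb_obj W)"
      and z: "layer_mor V W f = \<one>\<^bsub>Hom ?P V W\<^esub>" and s: "s \<in> carrier (T (D V) 1)" for V W f s
  proof -
    have "S W (ent (D V) f 5 5 s) = S W \<zero>\<^bsub>F (D W)\<^esub>"
      using eq[OF V(1) s, of W f] z SV[OF V(1) s] repD(7)[OF rep[OF V(2)]] by simp
    then show ?thesis using repD(11)[OF rep[OF V(2)] ec[OF f s] zero_T] by blast
  qed
  have zeroI: "layer_mor V W f = \<one>\<^bsub>Hom ?P V W\<^esub>"
    if V: "V \<in> Obj ?P" "W \<in> Obj ?P"
      and z: "\<And>s. s \<in> carrier (T (D V) 1) \<Longrightarrow> ent (D V) f 5 5 s = \<zero>\<^bsub>F (D W)\<^esub>" for V W f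
    by (rule ext[OF V(1) extV])
      (use z eq[OF V(1)] SV[OF V(1)] repD(7)[OF rep[OF V(2)]] in auto)
  interpret A: preadditive_category ?A by (rule preadditive_submodule_category)
  interpret P: preadditive_category ?P by (rule preadditive_fd_free_modules)
  show ?thesis
  proof (intro controlled_embedding.intro controlled_embedding_axioms.intro)
    show "preadditive_category ?A" "preadditive_category ?P"
      by (rule preadditive_submodule_category preadditive_fd_free_modules)+
  next
    fix V assume V: "V \<in> Obj ?P"
    show "emb_obj V \<in> Obj ?A"
      unfolding emb using submodule_sub[OF rep[OF V]] module_TP fin_gen_TP[OF le_trans[OF tot_exp_le n]]
      by (simp add: U_def)
    show "layer_mor V V (Ident ?A (emb_obj V)) = Ident ?P V"
    proof (rule ext[OF V extV])
      fix s assume s: "s \<in> carrier (T (D V) 1)"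
      have s2: "s \<in> carrier (T (D V) (tot_exp 5))" using T_subset[OF s, of 2] by simp
      have c: "single_TP 6 (D V) 5 s \<in> carrier (tot (D V))" using s2 by (intro single_TP_closed) auto
      then have "(\<lambda>x\<in>carrier (tot (D V)). x) (single_TP 6 (D V) 5 s) 5 = s"
        by (simp only: restrict_apply') (simp add: single_TP_def)
      then have "ent (D V) (\<lambda>x\<in>carrier (tot (D V)). x) 5 5 s = s"
        unfolding entry_def using s2 by (simp only: restrict_apply')
      then show "layer_mor V V (Ident ?A (emb_obj V)) (S V s) = Ident ?P V (S V s)"
        using eq[OF V s, of V] SV[OF V s] by (simp add: emb)
    qed simp
  next
    fix V W assume V: "V \<in> Obj ?P" "W \<in> Obj ?P"
    show "layer_mor V W \<in> hom (Hom ?A (emb_obj V) (emb_obj W)) (Hom ?P V W)"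
    proof (rule homI)
      fix f assume f: "f \<in> Mor ?A (emb_obj V) (emb_obj W)"
      then show "layer_mor V W f \<in> Mor ?P V W" by (rule closed[OF V])
      fix g assume g: "g \<in> Mor ?A (emb_obj V) (emb_obj W)"
      show "layer_mor V W (f \<otimes>\<^bsub>Hom ?A (emb_obj V) (emb_obj W)\<^esub> g) = layer_mor V W f \<otimes>\<^bsub>Hom ?P V W\<^esub> layer_mor V W g"
      proof (rule ext[OF V(1) extV])
        fix s assume s: "s \<in> carrier (T (D V) 1)"
        have s2: "s \<in> carrier (T (D V) (tot_exp 5))" using T_subset[OF s, of 2] by simp
        have c: "single_TP 6 (D V) 5 s \<in> carrier (tot (D V))" using s2 by (intro single_TP_closed) auto
        have "ent (D V) (\<lambda>x\<in>carrier (tot (D V)). f x \<oplus>\<^bsub>tot (D W)\<^esub> g x) 5 5 s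
           = ent (D V) f 5 5 s \<oplus>\<^bsub>F (D W)\<^esub> ent (D V) g 5 5 s"
          unfolding entry_def using s2 c by (simp only: restrict_apply' TP_simps(3) lessThan_iff less_6)
        then show "layer_mor V W (f \<otimes>\<^bsub>Hom ?A (emb_obj V) (emb_obj W)\<^esub> g) (S V s)
          = (layer_mor V W f \<otimes>\<^bsub>Hom ?P V W\<^esub> layer_mor V W g) (S V s)"
          using eq[OF V(1) s, of W] SV[OF V(1) s] ec[OF f s] ec[OF g s] repD(5)[OF rep[OF V(2)]]
          by (simp add: emb T_iff del: TP_simps)
      qed simp
    qed
    show "Mor ?P V W \<subseteq> layer_mor V W ` Mor ?A (emb_obj V) (emb_obj W)"
    proof
      fix a assume a: "a \<in> Mor ?P V W"
      then have al: "a \<in> linear_maps R (restricted V) (restricted W)"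
        and ac: "\<And>b v. v \<in> carrier V \<Longrightarrow> a (act b V v) = act b W (a v)"
        using linear_maps_free_algebra_iff[OF fam[OF V(1)] fam[OF V(2)]] by auto
      obtain f where f: "f \<in> linear_maps R (tot (D V)) (tot (D W))" "f ` U V \<subseteq> U W"
        and fa: "\<And>s. s \<in> carrier (T (D V) 1) \<Longrightarrow> S W (ent (D V) f 5 5 s) = a (S V s)"
        using morphism_exists[OF n rep[OF V(1)] rep[OF V(2)] al] ac unfolding U_def by auto
      have "layer_mor V W f = a"
        by (rule ext[OF V(1) extV]) (use linear_mapsD(1)[OF al] fa eq[OF V(1)] in auto)
      then show "a \<in> layer_mor V W ` Mor ?A (emb_obj V) (emb_obj W)" using f unfolding image_iff Bex_def Mor by blast
    qed
  next
    fix V W X f g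
    assume O: "V \<in> Obj ?P" "W \<in> Obj ?P" "X \<in> Obj ?P"
      and f: "f \<in> Mor ?A (emb_obj V) (emb_obj W)" and g: "g \<in> Mor ?A (emb_obj W) (emb_obj X)"
    have fl: "f \<in> linear_maps R (tot (D V)) (tot (D W))" and gl: "g \<in> linear_maps R (tot (D W)) (tot (D X))"
      using f g unfolding Mor by auto
    have gfl: "compose (carrier (tot (D V))) g f \<in> linear_maps R (tot (D V)) (tot (D X))"
      by (rule compose_linear_maps[OF left_module_TP fl gl])
    show "layer_mor V X (Comp ?A (emb_obj V) (emb_obj W) (emb_obj X) g f)
       = Comp ?P V W X (layer_mor W X g) (layer_mor V W f)"
    proof (rule ext[OF O(1) extV])
      fix s assume s: "s \<in> carrier (T (D V) 1)"
      \<comment> \<open>Dividing \<open>s\<close> by \<open>p\<close> moves the computation to the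
        \<open>p^2\<close>-torsion of \<open>tot\<close>, which \<open>f\<close> preserves. There
        \<open>layer_map\<close> applies to \<open>f\<close>, \<open>g\<close> and the composite, so
        the matrices need not be multiplied.\<close>
      obtain t where t: "t \<in> carrier (T (D V) 2)" "s = ppow (D V) 1 t" using T_dvd[OF s, of 2] n by auto
      let ?m = "single_TP 6 (D V) 5 t"
      have m: "?m \<in> carrier (tot (D V))" using t by (intro single_TP_closed) auto
      have m2: "ppow (D V) 2 (?m c) = \<zero>\<^bsub>F (D V)\<^esub>" if "c < 6" for c
        using t that by (simp add: single_TP_def T_iff)
      have m5: "?m 5 = t" by (simp add: single_TP_def)
      have fm: "f ?m \<in> carrier (tot (D W))" by (rule linear_mapsD(2)[OF fl m])
      have fm2: "ppow (D W) 2 (f ?m c) = \<zero>\<^bsub>F (D W)\<^esub>" if c: "c < 6" for c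
      proof -
        have z: "p [^] (2::nat) \<odot>\<^bsub>tot (D V)\<^esub> ?m = \<zero>\<^bsub>tot (D V)\<^esub>"
          using m2 by (auto simp: ppow_def[symmetric] intro!: restrict_ext)
        then have "p [^] (2::nat) \<odot>\<^bsub>tot (D W)\<^esub> f ?m = \<zero>\<^bsub>tot (D W)\<^esub>"
          using linear_mapsD(4)[OF fl pow_closed m, of 2] linear_map_zero[OF fl] module.axioms(2)[OF module_TP] by metis
        then have "(p [^] (2::nat) \<odot>\<^bsub>tot (D W)\<^esub> f ?m) c = \<zero>\<^bsub>tot (D W)\<^esub> c" by simp
        then show ?thesis using c by (simp add: ppow_def)
      qed
      have "ent (D V) (compose (carrier (tot (D V))) g f) 5 5 s = ppow (D X) 1 (compose (carrier (tot (D V))) g f ?m 5)"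
        using layer_map[OF n gfl m m2] t(2) m5 by simp
      also have "compose (carrier (tot (D V))) g f ?m = g (f ?m)" using m by (simp add: compose_def)
      also have "ppow (D X) 1 (g (f ?m) 5) = ent (D W) g 5 5 (ppow (D W) 1 (f ?m 5))"
        by (rule layer_map[OF n gl fm fm2])
      also have "ppow (D W) 1 (f ?m 5) = ent (D V) f 5 5 s"
        using layer_map[OF n fl m m2] t(2) m5 by simp
      finally have e: "ent (D V) (compose (carrier (tot (D V))) g f) 5 5 s = ent (D W) g 5 5 (ent (D V) f 5 5 s)" .
      show "layer_mor V X (Comp ?A (emb_obj V) (emb_obj W) (emb_obj X) g f) (S V s)
         = Comp ?P V W X (layer_mor W X g) (layer_mor V W f) (S V s)"
        using eq[OF O(1) s, of X] eq[OF O(1) s, of W f] eq[OF O(2) ec[OF f s], of X g] SV[OF O(1) s] e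
        by (simp add: emb compose_def del: TP_simps)
    qed (simp add: compose_def)
  next
    fix V W f
    assume V: "V \<in> Obj ?P" "W \<in> Obj ?P" and f: "f \<in> Mor ?A (emb_obj V) (emb_obj W)"
      and z: "layer_mor V W f = \<one>\<^bsub>Hom ?P V W\<^esub>"
    have fl: "f \<in> linear_maps R (tot (D V)) (tot (D W))" and fU: "f ` U V \<subseteq> U W" using f unfolding Mor by auto
    obtain \<alpha> \<beta> where \<alpha>: "\<alpha> \<in> linear_maps R (tot (D V)) (TP 14 null_exp (D V))"
      and \<beta>: "\<beta> \<in> linear_maps R (TP 14 null_exp (D V)) (tot (D W))"
      and fac: "\<And>m. m \<in> carrier (tot (D V)) \<Longrightarrow> f m = \<beta> (\<alpha> m)"
      and pr: "\<And>x. x \<in> carrier (T (D V) 4) \<Longrightarrow> \<beta> (probe (D V) x) \<in> U W"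
      using kernel_factors[OF n rep[OF V(1)] rep[OF V(2)] fl fU[unfolded U_def] zeroD[OF V f z]]
      unfolding U_def by blast
    \<comment> \<open>The largest submodule for which \<beta> is a morphism. It contains the image
      of the submodule under \<alpha> because \<open>f\<close> respects the submodules, and it
      contains the probes.\<close>
    define Q where "Q = {z \<in> carrier (TP 14 null_exp (D V)). \<beta> z \<in> U W}"
    let ?Z = "(TP 14 null_exp (D V), Q)"
    have ezn: "null_exp j \<le> n" for j using n by (simp add: null_exp_def)
    have "submodule Q R (TP 14 null_exp (D V))"
      unfolding Q_def by (rule submodule_vimage[OF module_TP module_TP \<beta>])
        (use submodule_sub[OF rep[OF V(2)]] in \<open>simp add: U_def\<close>)
    then have ZO: "?Z \<in> Obj ?A" using module_TP fin_gen_TP[OF ezn] by simp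
    have prQ: "probe (D V) x \<in> Q" if x: "x \<in> carrier (T (D V) 4)" for x
    proof -
      have "x \<in> carrier (T (D V) 6)" "ppow (D V) 2 x \<in> carrier (T (D V) 2)"
        using x T_subset[OF x, of 6] by (auto simp: T_iff)
      then have "probe (D V) x \<in> carrier (TP 14 null_exp (D V))" by (simp add: probe_def null_exp_def)
      then show ?thesis using pr[OF x] by (simp add: Q_def del: TP_simps)
    qed
    have "?Z \<in> null_objects ?A ?P emb_obj layer_mor"
      unfolding null_objects_def mem_Collect_eq
    proof (intro conjI ballI)
      show "?Z \<in> Obj ?A" by (rule ZO)
      fix V' W' g k
      assume O: "V' \<in> Obj ?P" "W' \<in> Obj ?P" and g: "g \<in> Mor ?A (emb_obj V') ?Z" and k: "k \<in> Mor ?A ?Z (emb_obj W')"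
      have gl: "g \<in> linear_maps R (tot (D V')) (TP 14 null_exp (D V))"
        and kl: "k \<in> linear_maps R (TP 14 null_exp (D V)) (tot (D W'))" and kQ: "k ` Q \<subseteq> U W'"
        using g k by (auto simp: emb simp del: TP_simps)
      have "Comp ?A (emb_obj V') ?Z (emb_obj W') k g = compose (carrier (tot (D V'))) k g" by (simp add: emb)
      moreover have "k (probe (D V) x) \<in> sub (restricted W') (act False W') (act True W') (D W') (S W')"
        if "x \<in> carrier (T (D V) 4)" for x using prQ[OF that] kQ unfolding U_def by blast
      then have "ent (D V') (compose (carrier (tot (D V'))) k g) 5 5 s = \<zero>\<^bsub>F (D W')\<^esub>"
        if "s \<in> carrier (T (D V') 1)" for s
        by (rule probed_object_null[OF n gl kl _ that])
      ultimately show "layer_mor V' W' (Comp ?A (emb_obj V') ?Z (emb_obj W') k g) = \<one>\<^bsub>Hom ?P V' W'\<^esub>"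
        using zeroI[OF O] by (simp only:)
    qed
    moreover have "\<alpha> \<in> Mor ?A (emb_obj V) ?Z"
    proof -
      have "\<alpha> m \<in> Q" if m: "m \<in> U V" for m
      proof -
        have mc: "m \<in> carrier (tot (D V))" using m by (simp add: U_def sub_def)
        show ?thesis using fac[OF mc] fU m linear_mapsD(2)[OF \<alpha> mc] by (auto simp: Q_def simp del: TP_simps)
      qed
      then show ?thesis using \<alpha> by (auto simp: emb)
    qed
    moreover have "\<beta> \<in> Mor ?A ?Z (emb_obj W)" using \<beta> by (auto simp: emb Q_def)
    moreover have "f = Comp ?A (emb_obj V) ?Z (emb_obj W) \<beta> \<alpha>"
    proof -
      have "f = compose (carrier (tot (D V))) \<beta> \<alpha>"
        using linear_mapsD(1)[OF fl] fac
        by (intro extensionalityI[where A = "carrier (tot (D V))"]) (auto simp: compose_def simp del: TP_simps)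
      then show ?thesis by (simp add: emb)
    qed
    ultimately show "\<exists>Z\<in>null_objects ?A ?P emb_obj layer_mor.
       \<exists>h\<in>Mor ?A (emb_obj V) Z. \<exists>g\<in>Mor ?A Z (emb_obj W). f = Comp ?A (emb_obj V) Z (emb_obj W) g h"
      by blast
  qed
qed

end

section \<open>Passage to the prescribed carrier type and conclusion\<close>

lemma zero_module_exists:
  assumes "ring A"
  shows "\<exists>V0 :: ('r, 'v) module. left_module A V0 \<and> carrier V0 = {\<zero>\<^bsub>V0\<^esub>}"
proof -
  define V0 :: "('r, 'v) module" where
    "V0 = \<lparr>carrier = {undefined}, mult = undefined, one = undefined, zero = undefined,
       add = (\<lambda>_ _. undefined), smult = (\<lambda>_ _. undefined)\<rparr>"
  have "abelian_group V0" by (rule abelian_groupI) (auto simp: V0_def)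
  then have "left_module A V0"
    using assms by (intro left_module.intro left_module_axioms.intro) (auto simp: V0_def)
  then show ?thesis by (intro exI[of _ V0]) (simp add: V0_def)
qed

lemma equivalent_categories_empty:
  "Obj A = {} \<Longrightarrow> Obj B = {} \<Longrightarrow> equivalent_categories A B"
  by (simp add: equivalent_categories_def is_functor_def is_natural_iso_def)

lemma controlled_wild_submodule_category:
  fixes R :: "('a, 'c) ring_scheme"
  assumes u: "uniserial_ring R p n" and n: "7 \<le> n"
  shows "controlled_wild (radical_factor R) (submodule_category R :: 'a submodule_category)"
proof -
  let ?A = "submodule_category R :: 'a submodule_category"
  let ?P = "fd_free_modules (radical_factor R) :: 'a set fd_free_module_category"
  interpret uniserial_ring R p n by fact
  have sums: "\<exists>D. direct_sum ?A m F D" if "\<And>i. i < m \<Longrightarrow> F i \<in> Obj ?A" for m F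
    using that by (rule submodule_category_direct_sums[OF ring_cring])
  have "\<exists>C B. C \<subseteq> B \<and> B \<subseteq> Obj ?A \<and> equivalent_categories (full_subcategory (factor_category ?A C) B) ?P"
  \<comment> \<open>The case distinction stands in for verifying the ring axioms of the free
    algebra: an object of the module category entails them, and without objects the empty
    subcategories give the equivalence.\<close>
  proof (cases "Obj ?P = {}")
    case True
    then have "equivalent_categories (full_subcategory (factor_category ?A {}) {}) ?P"
      by (intro equivalent_categories_empty) (simp_all add: full_subcategory_def)
    then show ?thesis by blast
  next
    case False
    \<comment> \<open>A module over the free algebra witnesses that the free algebra is a ring.\<close>
    then obtain V :: "(bool list \<Rightarrow> 'a set, nat \<Rightarrow> 'a set) module" where "left_module (free_algebra K) V" by auto
    then have "ring (free_algebra K :: (bool list \<Rightarrow> 'a set) ring)" by (rule left_module.axioms(1))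
    from zero_module_exists[OF this] obtain V0 :: "(bool list \<Rightarrow> 'a set, nat \<Rightarrow> 'a set) module"
      where V0: "left_module (free_algebra K) V0 \<and> carrier V0 = {\<zero>\<^bsub>V0\<^esub>}" by (rule exE)
    have "fin_gen K (underlying_space K V0)"
      unfolding fin_gen_def
    proof (intro exI[of _ "{}"] conjI allI impI)
      fix L assume "submodule L K (underlying_space K V0)"
      then show "L = carrier (underlying_space K V0)"
        using submodule_closed(1,2)[of L K "underlying_space K V0"] V0 by (auto simp: underlying_space_def)
    qed auto
    then have V0P: "V0 \<in> Obj ?P" using V0 by simp
    have "(\<lambda>x\<in>carrier V0. x) = (\<lambda>x\<in>carrier V0. \<zero>\<^bsub>V0\<^esub>)" using V0 by (auto intro!: restrict_ext)
    then have V0I: "Ident ?P V0 = \<one>\<^bsub>Hom ?P V0 V0\<^esub>" by simp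
    interpret E: controlled_embedding ?A ?P "\<lambda>V. encode_obj (emb_obj V)"
      "\<lambda>V W f. layer_mor V W (inv_into (Mor (submodule_category R) (emb_obj V) (emb_obj W))
          (encode_mor (emb_obj V) (emb_obj W)) f)"
      by (rule controlled_embedding_transport[OF controlled_embedding_emb[OF n] preadditive_submodule_category
            encode_functor(1)]) (rule encode_functor(2,3); assumption)+
    show ?thesis by (rule E.factor_category_equivalent[OF sums V0P V0I])
  qed
  moreover have "additive_category ?A"
    unfolding additive_category_iff using sums preadditive_submodule_category by blast
  ultimately show ?thesis unfolding controlled_wild_def by blast
qed

theorem theorem2:
  fixes R :: "('a, 'c) ring_scheme" and n :: nat
  assumes "cring R"
    and "local_ring R"
    and "uniserial R"
    and "has_length R (regular_module R) n"
    and "7 \<le> n"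
  shows "controlled_wild (radical_factor R) (submodule_category R :: 'a submodule_category)"
proof -
  have "2 \<le> n" using assms(5) by simp
  then obtain p where "uniserial_ring R p n"
    using uniserial_ring_exists[OF assms(1-4)] by blast
  then show ?thesis using assms(5) by (rule controlled_wild_submodule_category)
qed

end
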